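(* Assume Condition 1. Let $I\subseteq(0,\infty)$ be compact and fix $\alpha_0\in\mathbb R$. Then there exists a constant $C>0$ such that \[ \|r^{\alpha_0}\phi\|\le C\|r^{-3/4}\phi\| \] for every generalized eigenfunction $\phi\in\mathcal B^*_0$ of $H$ with eigenvalue $\lambda\in I$. In particular, every generalized eigenfunction $\phi\in\mathcal B_0^*$ with positive eigenvalue is a genuine ($L^2$) eigenfunction and satisfies $\phi\in H^2_s:=r^{-s}H^2(\mathbb R^d)$ for all $s\in\mathbb R$. Moreover, the set $\mathcal E_+$ of positive eigenvalues of $H$ is discrete in $(0,\infty)$ (it can accumulate only at $0$), and each eigenvalue in $\mathcal E_+$ has finite multiplicity.
   Context: Setting: $d\ge 1$, $L^2=L^2(\mathbb R^d)$, $\|\cdot\|$ the $L^2$ norm. $p=-i\nabla$, $H_0=p^*p=-\Delta$, $r=r(x)=(1+|x|^2)^{1/2}$, $\omega=\nabla r=x/r$. Big-O and small-o notation refer to $|x|\to\infty$ and include a local boundedness assumption. A function depending only on $r$ is called radial; for radial functions primes denote derivatives in $r$. Condition 1: there is a radial function $W_0=W_0(r)\ge 0$ and a splitting $V=V^{sr}+V^{lr}$ into real bounded functions such that (i) $W_0=o(r^{-1})$ and $W_0\in L^1([1,\infty),dr)$; (ii) $V^{lr}$ has first-order distributional derivatives in $L^1_{loc}$, $V^{lr}=o(1)$, and $\omega\cdot\nabla V^{lr}\le W_0$; (iii) $|V^{sr}|\le W_0$. $H=H_0+V$ is self-adjoint on $L^2$ with domain $H^2(\mathbb R^d)$. Besov-type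 spaces: with $F_k=1_{\{2^{k-1}\le r<2^k\}}$ ($k\ge1$), $\mathcal B^*=\{\psi\in L^2_{loc}:\sup_{k\ge1}2^{-k/2}\|F_k\psi\|<\infty\}$ and $\mathcal B^*_0=\{\psi\in L^2_{loc}:\lim_{k\to\infty}2^{-k/2}\|F_k\psi\|=0\}$. A generalized eigenfunction with eigenvalue $\lambda$ is a $\phi\in H^2_{loc}$ with $(H-\lambda)\phi=0$ in the distributional sense. $\mathcal E_+$ denotes the set of positive eigenvalues of $H$ (with $L^2$ eigenfunctions). *)

theory Defs
  imports "HOL-Analysis.Analysis"
begin

definition rr :: "'a::euclidean_space \<Rightarrow> real" where
  "rr x = sqrt (1 + (norm x)\<^sup>2)"

definition pd :: "'a::euclidean_space \<Rightarrow> ('a \<Rightarrow> real) \<Rightarrow> 'a \<Rightarrow> real" where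
  "pd u \<psi> = (\<lambda>x. frechet_derivative \<psi> (at x) u)"

fun iter_pd :: "'a::euclidean_space list \<Rightarrow> ('a \<Rightarrow> real) \<Rightarrow> 'a \<Rightarrow> real" where
  "iter_pd [] \<psi> = \<psi>"
| "iter_pd (u # us) \<psi> = pd u (iter_pd us \<psi>)"

definition smooth_fun :: "('a::euclidean_space \<Rightarrow> real) \<Rightarrow> bool" where
  "smooth_fun \<psi> \<longleftrightarrow> (\<forall>us. set us \<subseteq> Basis \<longrightarrow> (\<forall>x. iter_pd us \<psi> differentiable (at x)))"

definition test_fun :: "('a::euclidean_space \<Rightarrow> real) \<Rightarrow> bool" where
  "test_fun \<psi> \<longleftrightarrow> smooth_fun \<psi> \<and> compact (closure {x. \<psi> x \<noteq> 0})"

definition laplacian :: "('a::euclidean_space \<Rightarrow> real) \<Rightarrow> 'a \<Rightarrow> real" where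
  "laplacian \<psi> = (\<lambda>x. \<Sum>i\<in>Basis. pd i (pd i \<psi>) x)"

definition l2sq :: "('a::euclidean_space \<Rightarrow> complex) \<Rightarrow> ennreal" where
  "l2sq f = (\<integral>\<^sup>+x. ennreal ((cmod (f x))\<^sup>2) \<partial>lborel)"

definition L2 :: "('a::euclidean_space \<Rightarrow> complex) \<Rightarrow> bool" where
  "L2 f \<longleftrightarrow> f \<in> borel_measurable lborel \<and> l2sq f < \<infinity>"

definition L2loc :: "('a::euclidean_space \<Rightarrow> complex) \<Rightarrow> bool" where
  "L2loc f \<longleftrightarrow> f \<in> borel_measurable lborel \<and>
     (\<forall>K. compact K \<longrightarrow> (\<integral>\<^sup>+x\<in>K. ennreal ((cmod (f x))\<^sup>2) \<partial>lborel) < \<infinity>)"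

definition L1loc_real :: "('a::euclidean_space \<Rightarrow> real) \<Rightarrow> bool" where
  "L1loc_real f \<longleftrightarrow> f \<in> borel_measurable lborel \<and>
     (\<forall>K. compact K \<longrightarrow> (\<integral>\<^sup>+x\<in>K. ennreal \<bar>f x\<bar> \<partial>lborel) < \<infinity>)"

definition weak_deriv :: "('a::euclidean_space \<Rightarrow> complex) \<Rightarrow> 'a \<Rightarrow> ('a \<Rightarrow> complex) \<Rightarrow> bool" where
  "weak_deriv f u g \<longleftrightarrow> (\<forall>\<psi>. test_fun \<psi> \<longrightarrow>
     (\<integral>x. f x * complex_of_real (pd u \<psi> x) \<partial>lborel) = - (\<integral>x. g x * complex_of_real (\<psi> x) \<partial>lborel))"

definition H2loc :: "('a::euclidean_space \<Rightarrow> complex) \<Rightarrow> bool" where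
  "H2loc f \<longleftrightarrow> L2loc f \<and> (\<forall>i\<in>Basis. \<exists>g. L2loc g \<and> weak_deriv f i g \<and>
      (\<forall>j\<in>Basis. \<exists>h. L2loc h \<and> weak_deriv g j h))"

definition H2 :: "('a::euclidean_space \<Rightarrow> complex) \<Rightarrow> bool" where
  "H2 f \<longleftrightarrow> L2 f \<and> (\<forall>i\<in>Basis. \<exists>g. L2 g \<and> weak_deriv f i g \<and>
      (\<forall>j\<in>Basis. \<exists>h. L2 h \<and> weak_deriv g j h))"

definition shell :: "nat \<Rightarrow> 'a::euclidean_space set" where
  "shell k = {x. 2 powr (real k - 1) \<le> rr x \<and> rr x < 2 powr (real k)}"

text \<open>B*_0: 2^(-k/2) ||F_k f|| -> 0, written with squared norms.\<close>
definition Bstar0 :: "('a::euclidean_space \<Rightarrow> complex) \<Rightarrow> bool" where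
  "Bstar0 f \<longleftrightarrow> L2loc f \<and>
     ((\<lambda>k. ennreal (2 powr (- real k)) * (\<integral>\<^sup>+x\<in>shell k. ennreal ((cmod (f x))\<^sup>2) \<partial>lborel))
        \<longlonglongrightarrow> 0)"

definition gen_eigenfun :: "('a::euclidean_space \<Rightarrow> real) \<Rightarrow> real \<Rightarrow> ('a \<Rightarrow> complex) \<Rightarrow> bool" where
  "gen_eigenfun V E \<phi> \<longleftrightarrow> H2loc \<phi> \<and> (\<forall>\<psi>. test_fun \<psi> \<longrightarrow>
     (\<integral>x. \<phi> x * complex_of_real (- laplacian \<psi> x)
          + complex_of_real (V x - E) * \<phi> x * complex_of_real (\<psi> x) \<partial>lborel) = 0)"

text \<open>Genuine eigenfunction: in the operator domain H^2 and solving the equation.\<close>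
definition eigenfun :: "('a::euclidean_space \<Rightarrow> real) \<Rightarrow> real \<Rightarrow> ('a \<Rightarrow> complex) \<Rightarrow> bool" where
  "eigenfun V E \<phi> \<longleftrightarrow> H2 \<phi> \<and> gen_eigenfun V E \<phi>"

definition pos_eigenvalues :: "('a::euclidean_space \<Rightarrow> real) \<Rightarrow> real set" where
  "pos_eigenvalues V = {E. 0 < E \<and> (\<exists>\<phi>. eigenfun V E \<phi> \<and> \<not> (AE x in lborel. \<phi> x = 0))}"

definition condition1 :: "('a::euclidean_space \<Rightarrow> real) \<Rightarrow> bool" where
  "condition1 V \<longleftrightarrow> (\<exists>(w0::real \<Rightarrow> real) Vsr Vlr (G::'a \<Rightarrow> 'a \<Rightarrow> real).
     (\<forall>t\<ge>1. 0 \<le> w0 t) \<and>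
     ((\<lambda>t. t * w0 t) \<longlongrightarrow> 0) at_top \<and>
     (\<forall>b. bounded (w0 ` {1..b})) \<and>
     set_integrable lborel {1..} w0 \<and>
     Vsr \<in> borel_measurable lborel \<and> bounded (range Vsr) \<and>
     Vlr \<in> borel_measurable lborel \<and> bounded (range Vlr) \<and>
     (\<forall>x. V x = Vsr x + Vlr x) \<and>
     (\<forall>i\<in>Basis. L1loc_real (G i) \<and>
        weak_deriv (\<lambda>x. complex_of_real (Vlr x)) i (\<lambda>x. complex_of_real (G i x))) \<and>
     (Vlr \<longlongrightarrow> 0) at_infinity \<and>
     (AE x in lborel. (\<Sum>i\<in>Basis. (x \<bullet> i / rr x) * G i x) \<le> w0 (rr x)) \<and>
     (\<forall>x. \<bar>Vsr x\<bar> \<le> w0 (rr x)))"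

end

theory Submission
  imports Defs
begin

text \<open>The real and imaginary parts \<open>u\<close> of an eigenfunction solve \<open>\<Delta>u = (V - E) u\<close>. Testing this equation
  with \<open>f(r) \<omega> \<bullet> \<nabla>u + g(r) u\<close> and integrating gives an inequality in which only the radial derivative of the
  long-range part enters. For \<open>f = r\<^sup>m \<eta> exp (K \<integral>(w0 + r\<^sup>-\<^sup>2))\<close> the exponential is bounded because \<open>w0\<close> is
  integrable, yet its derivative gains \<open>K (w0 + r\<^sup>-\<^sup>2) f\<close>, which for large \<open>K\<close> beats every error term and leaves
  \<open>\<integral> r\<^sup>m\<^sup>-\<^sup>2 (|\<nabla>u|\<^sup>2 + u\<^sup>2)\<close> bounded by the mass of \<open>u\<close> on a fixed ball, uniformly for \<open>E\<close> in a compact set; the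
  \<open>B\<^sup>*\<^sub>0\<close> condition removes the cutoff at infinity. Hence normalised eigenfunctions are uniformly
  concentrated on a ball with bounded gradients, and Bessel's inequality for a mollifier kernel bounds how
  many of them can be orthonormal.\<close>

subsection \<open>Mollifiers\<close>

text \<open>Several choices behind this plan are not visible in it. The term 1/r^2 accompanies
  \<open>w0\<close> in the exponent because \<open>x / rr x\<close> is not a unit vector: its
  squared length is 1 - 1/r^2, and the multiplier terms carry corrections of that relative order,
  which the same exponential must dominate. The weight is not r^m itself but a power of tL/(t+L),
  comparable to t below L and never above L. An outer cutoff at radius rho then costs L^m/rho times
  an energy, which vanishes as rho grows with L fixed; L grows last, so any power of decay is
  reached in one pass, without improving a rate step by step. The obstacle is regularity:
  \<open>w0\<close> is merely measurable, the radial bound on the long-range part concerns a weak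
  gradient that is only locally integrable, and eigenfunctions need not have classical derivatives.
  Identities are therefore proved for mollified functions and C^1 weights and then passed to the
  limit. Since eigenfunctions for distinct eigenvalues are orthogonal, finite multiplicity and
  absence of accumulation both follow from a single bound on orthonormal families.\<close>

lemma pd_eq:
  assumes "(f has_derivative D) (at x)" shows "pd u f x = D u"
  using frechet_derivative_at[OF assms] by (simp add: pd_def)

text \<open>A recursion on the number of derivatives replaces the quantifier over lists of
  directions. Closure under sums, products and convolution becomes an induction on \<open>n\<close>;
  \<open>smooth_fun_iff\<close> shows that all orders together give
  \<open>smooth_fun\<close>.\<close>

primrec sm :: "nat \<Rightarrow> ('a::euclidean_space \<Rightarrow> real) \<Rightarrow> bool" where
  "sm 0 f = True"
| "sm (Suc n) f = ((\<forall>x. f differentiable (at x)) \<and> (\<forall>i\<in>Basis. sm n (pd i f)))"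

lemma sm_Suc_imp: "sm (Suc n) f \<Longrightarrow> sm n f"
  by (induction n arbitrary: f) auto

lemma sm_const: "sm n (\<lambda>x. c)"
proof (induction n arbitrary: c)
  case (Suc n)
  have "pd i (\<lambda>x. c) = (\<lambda>x. 0)" for i :: 'a
    by (intro ext pd_eq[of _ "\<lambda>x. 0", simplified]) simp
  then show ?case using Suc by simp
qed simp

lemma sm_linear: "sm n (\<lambda>x. x \<bullet> a)"
proof (cases n)
  case (Suc m)
  have "pd i (\<lambda>x. x \<bullet> a) = (\<lambda>x. i \<bullet> a)" for i :: 'a
    by (intro ext pd_eq[of _ "\<lambda>h. h \<bullet> a"]) (auto intro!: derivative_eq_intros)
  then show ?thesis using Suc sm_const by (auto intro!: derivative_intros)
qed simp

lemma sm_add: "sm n f \<Longrightarrow> sm n g \<Longrightarrow> sm n (\<lambda>x. f x + g x)"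
proof (induction n arbitrary: f g)
  case (Suc n)
  have "pd i (\<lambda>x. f x + g x) = (\<lambda>x. pd i f x + pd i g x)" for i
  proof (intro ext)
    fix x
    have "(f has_derivative frechet_derivative f (at x)) (at x)" "(g has_derivative frechet_derivative g (at x)) (at x)"
      using Suc.prems by (auto simp: frechet_derivative_works)
    from has_derivative_add[OF this]
    show "pd i (\<lambda>x. f x + g x) x = pd i f x + pd i g x" by (subst pd_eq) (auto simp: pd_def)
  qed
  then show ?case using Suc by auto
qed simp

lemma sm_mult: "sm n f \<Longrightarrow> sm n g \<Longrightarrow> sm n (\<lambda>x. f x * g x)"
proof (induction n arbitrary: f g)
  case (Suc n)
  have *: "pd i (\<lambda>x. f x * g x) = (\<lambda>x. f x * pd i g x + pd i f x * g x)" for i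
  proof (intro ext)
    fix x
    have "(f has_derivative frechet_derivative f (at x)) (at x)" "(g has_derivative frechet_derivative g (at x)) (at x)"
      using Suc.prems by (auto simp: frechet_derivative_works)
    from has_derivative_mult[OF this]
    show "pd i (\<lambda>x. f x * g x) x = f x * pd i g x + pd i f x * g x" by (subst pd_eq) (auto simp: pd_def)
  qed
  have "sm n (pd i (\<lambda>x. f x * g x))" if "i \<in> Basis" for i
    unfolding * using Suc.prems that by (intro sm_add Suc.IH) (auto simp del: sm.simps simp: sm_Suc_imp, auto)
  then show ?case using Suc.prems by auto
qed simp

lemma iter_pd_snoc: "iter_pd (us @ [i]) f = iter_pd us (pd i f)"
  by (induction us) auto

lemma smooth_fun_pd:
  assumes "smooth_fun f" "i \<in> Basis" shows "smooth_fun (pd i f)"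
  unfolding smooth_fun_def
proof (intro allI impI)
  fix us :: "'a list" and x assume "set us \<subseteq> Basis"
  then show "iter_pd us (pd i f) differentiable at x"
    using assms unfolding smooth_fun_def iter_pd_snoc[symmetric] by simp
qed

lemma smooth_fun_differentiable: "smooth_fun f \<Longrightarrow> f differentiable (at x)"
  unfolding smooth_fun_def by (metis iter_pd.simps(1) list.set(1) empty_subsetI)

text \<open>\<open>iter_pd\<close> applies the head of its list last, whereas \<open>sm\<close>
  strips off the innermost derivative first. Hence the induction from the right end of the list,
  driven by \<open>iter_pd_snoc\<close>.\<close>

lemma smooth_fun_iff: "smooth_fun f \<longleftrightarrow> (\<forall>n. sm n f)"
proof
  show "smooth_fun f \<Longrightarrow> \<forall>n. sm n f"
  proof
    fix n assume "smooth_fun f" then show "sm n f"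
      by (induction n arbitrary: f) (auto simp: smooth_fun_pd smooth_fun_differentiable)
  qed
  assume a: "\<forall>n. sm n f"
  show "smooth_fun f" unfolding smooth_fun_def
  proof (intro allI impI)
    fix us :: "'a list" and x assume "set us \<subseteq> Basis"
    then show "iter_pd us f differentiable at x" using a
    proof (induction us arbitrary: f rule: rev_induct)
      case Nil then show ?case using sm.simps(2) by (metis iter_pd.simps(1))
    next
      case (snoc i us)
      have "sm n (pd i f)" for n using snoc.prems(1) spec[OF snoc.prems(2), of "Suc n"] by simp
      then show ?case unfolding iter_pd_snoc using snoc by simp
    qed
  qed
qed

section \<open>Explicit smooth bump functions\<close>

definition eb :: "real poly \<Rightarrow> real \<Rightarrow> real" where
  "eb p t = (if t > 0 then poly p (1 / t) * exp (- 1 / t) else 0)"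

lemma poly_exp_tendsto: "((\<lambda>s::real. poly p s * exp (- s)) \<longlongrightarrow> 0) at_top"
proof -
  have "((\<lambda>s. \<Sum>i\<le>degree p. coeff p i * (s ^ i / exp s)) \<longlongrightarrow> (\<Sum>i\<le>degree p. coeff p i * 0)) at_top"
    by (intro tendsto_intros tendsto_power_div_exp_0)
  then show ?thesis
    by (simp add: poly_altdef sum_distrib_right exp_minus divide_inverse mult.assoc)
qed

text \<open>With s = 1/t the function is p(s) exp(-s), and differentiation in t replaces p by s^2 (p
  - p'); \<open>[:0,0,1:]\<close> is s^2. The family is closed under differentiation, so every
  derivative of a bump is explicit. To the right of the origin the difference quotient is again a
  polynomial in s times exp(-s), with s tending to infinity.\<close>

lemma eb_deriv: "(eb p has_real_derivative eb ([:0,0,1:] * (p - pderiv p)) t) (at t)"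
proof -
  consider "t > 0" | "t < 0" | "t = 0" by linarith
  then show ?thesis
  proof cases
    case 1
    have "((\<lambda>t. poly p (1 / t) * exp (- 1 / t)) has_real_derivative eb ([:0,0,1:] * (p - pderiv p)) t) (at t)"
      using 1 by (auto intro!: derivative_eq_intros poly_DERIV[THEN DERIV_chain2] simp: eb_def field_simps power2_eq_square)
    then show ?thesis
      by (rule has_field_derivative_transform_within_open[of _ _ _ "{0<..}"]) (use 1 in \<open>auto simp: eb_def\<close>)
  next
    case 2
    have "((\<lambda>t. 0) has_real_derivative eb ([:0,0,1:] * (p - pderiv p)) t) (at t)"
      using 2 by (auto simp: eb_def)
    then show ?thesis
      by (rule has_field_derivative_transform_within_open[of _ _ _ "{..<0}"]) (use 2 in \<open>auto simp: eb_def\<close>)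
  next
    case 3
    have "((\<lambda>h. poly ([:0,1:] * p) (inverse h) * exp (- inverse h)) \<longlongrightarrow> 0) (at_right 0)"
      by (rule filterlim_compose[OF poly_exp_tendsto filterlim_inverse_at_top_right])
    then have r: "((\<lambda>h. eb p h / h) \<longlongrightarrow> 0) (at_right 0)"
      by (rule Lim_transform_eventually) (auto simp: eb_def eventually_at_right_less field_simps intro!: eventually_mono[OF eventually_at_right_less])
    have l: "((\<lambda>h. eb p h / h) \<longlongrightarrow> 0) (at_left 0)"
      by (rule Lim_transform_eventually[OF tendsto_const]) (auto simp: eb_def eventually_at_filter)
    have "((\<lambda>h. eb p h / h) \<longlongrightarrow> 0) (at 0)"
      using r l by (simp add: filterlim_at_split)
    then show ?thesis using 3 by (simp add: has_field_derivative_iff eb_def)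
  qed
qed

definition bump :: "real \<Rightarrow> real poly \<Rightarrow> 'a::euclidean_space \<Rightarrow> real" where
  "bump c p x = eb p (1 - c * (x \<bullet> x))"

lemma bump_has_derivative:
  "(bump c p has_derivative (\<lambda>h. - 2 * c * (x \<bullet> h) * bump c ([:0,0,1:] * (p - pderiv p)) x)) (at x)"
proof -
  have "((\<lambda>x. 1 - c * (x \<bullet> x)) has_derivative (\<lambda>h. - 2 * c * (x \<bullet> h))) (at x)"
    by (auto intro!: derivative_eq_intros simp: inner_commute)
  from has_derivative_compose[OF this eb_deriv[unfolded has_field_derivative_def]]
  show ?thesis unfolding bump_def[abs_def] by (simp add: mult.commute)
qed

lemma pd_bump: "pd i (bump c p) = (\<lambda>x. (- 2 * c) * (x \<bullet> i) * bump c ([:0,0,1:] * (p - pderiv p)) x)"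
  by (intro ext) (simp add: pd_eq[OF bump_has_derivative])

text \<open>Read off from the closed form, which is symmetric in the two directions. This symmetry
  of the kernel is what later makes the Hessian of a mollified function symmetric.\<close>

lemma pd_bump_commute: "pd j (pd i (bump c p)) = pd i (pd j (bump c p))"
proof (intro ext)
  fix x :: 'a
  have "pd j (pd i (bump c p)) x = (- 2 * c) * (j \<bullet> i) * bump c ([:0,0,1:] * (p - pderiv p)) x
     + (- 2 * c) * (x \<bullet> i) * (- 2 * c * (x \<bullet> j) * bump c ([:0,0,1:] * ([:0,0,1:] * (p - pderiv p) - pderiv ([:0,0,1:] * (p - pderiv p)))) x)" for i j
    unfolding pd_bump[of i c p]
    by (rule pd_eq[THEN trans]) (rule derivative_eq_intros bump_has_derivative refl | simp add: algebra_simps)+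
  then show "pd j (pd i (bump c p)) x = pd i (pd j (bump c p)) x" by (simp add: inner_commute)
qed

lemma sm_bump: "sm n (bump c p)"
proof (induction n arbitrary: p)
  case (Suc n)
  have "sm n (pd i (bump c p))" for i :: 'a
    unfolding pd_bump by (intro sm_mult sm_const sm_linear Suc)
  moreover have "bump c p differentiable (at x)" for x :: 'a
    using bump_has_derivative differentiable_def by blast
  ultimately show ?case by simp
qed simp

lemma test_funI:
  assumes "smooth_fun f" "\<And>x. norm x > R \<Longrightarrow> f x = 0" shows "test_fun f"
proof -
  have "closure {x. f x \<noteq> 0} \<subseteq> cball 0 R"
    using assms(2) by (intro closure_minimal) (auto, meson not_le)
  then have "compact (closure {x. f x \<noteq> 0})"
    by (meson bounded_cball bounded_subset closed_closure compact_eq_bounded_closed)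
  then show ?thesis using assms(1) by (simp add: test_fun_def)
qed

lemma test_fun_support:
  assumes "test_fun f" obtains R where "R > 0" "\<And>x. norm x > R \<Longrightarrow> f x = 0"
proof -
  have "bounded {x. f x \<noteq> 0}"
    using assms unfolding test_fun_def by (meson bounded_subset closure_subset compact_imp_bounded)
  then obtain R where "R > 0" "\<forall>x\<in>{x. f x \<noteq> 0}. norm x \<le> R" by (auto simp: bounded_pos)
  then show ?thesis by (intro that[of R]) force+
qed

lemma pd_zero_outside:
  fixes f :: "'a::euclidean_space \<Rightarrow> real"
  assumes "\<And>x. norm x > R \<Longrightarrow> f x = 0" "norm x > R" shows "pd i f x = 0"
proof -
  have "open {x::'a. norm x > R}" by (intro open_Collect_less continuous_intros)
  then have "(f has_derivative (\<lambda>h. 0)) (at x)"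
    by (rule has_derivative_transform_within_open[OF has_derivative_const[of 0]]) (use assms in auto)
  then show ?thesis by (rule pd_eq)
qed

lemma test_fun_pd:
  assumes "test_fun f" "i \<in> Basis" shows "test_fun (pd i f)"
proof -
  obtain R where R: "\<And>x. norm x > R \<Longrightarrow> f x = 0" using test_fun_support[OF assms(1)] by metis
  show ?thesis
    by (rule test_funI[of _ R]) (use assms R in \<open>auto simp: test_fun_def smooth_fun_pd intro: pd_zero_outside[of R]\<close>)
qed

lemma smooth_fun_has_derivative:
  fixes f :: "'a::euclidean_space \<Rightarrow> real"
  assumes "smooth_fun f"
  shows "(f has_derivative (\<lambda>h. \<Sum>i\<in>Basis. (h \<bullet> i) * pd i f x)) (at x)"
proof -
  let ?D = "frechet_derivative f (at x)"
  have D: "(f has_derivative ?D) (at x)"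
    using smooth_fun_differentiable[OF assms] by (simp add: frechet_derivative_works)
  then interpret linear ?D by (rule has_derivative_linear)
  have "?D h = (\<Sum>i\<in>Basis. (h \<bullet> i) * pd i f x)" for h
    by (subst euclidean_representation[of h, symmetric]) (simp add: sum scale pd_def del: euclidean_representation)
  then have "?D = (\<lambda>h. \<Sum>i\<in>Basis. (h \<bullet> i) * pd i f x)" by (rule ext)
  with D show ?thesis by simp
qed

lemma test_fun_has_derivative:
  "test_fun f \<Longrightarrow> (f has_derivative (\<lambda>h. \<Sum>i\<in>Basis. (h \<bullet> i) * pd i f x)) (at x)"
  by (simp add: test_fun_def smooth_fun_has_derivative)

lemma test_fun_continuous: "test_fun f \<Longrightarrow> continuous_on S f"
  by (meson differentiable_imp_continuous_within differentiable_at_withinI continuous_on_eq_continuous_within smooth_fun_differentiable test_fun_def)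

lemma test_fun_measurable [measurable_dest]: "test_fun f \<Longrightarrow> f \<in> borel_measurable borel"
  by (simp add: borel_measurable_continuous_onI test_fun_continuous)

lemma test_fun_bounded:
  fixes f :: "'a::euclidean_space \<Rightarrow> real"
  assumes "test_fun f" obtains C where "C > 0" "\<And>x. \<bar>f x\<bar> \<le> C"
proof -
  obtain R where R: "\<And>x. norm x > R \<Longrightarrow> f x = 0" using test_fun_support[OF assms] by metis
  have "compact (f ` cball 0 R)"
    using test_fun_continuous[OF assms] by (intro compact_continuous_image) auto
  then obtain C where C: "C > 0" "\<forall>y\<in>f ` cball 0 R. norm y \<le> C" by (metis bounded_pos compact_imp_bounded)
  have "\<bar>f x\<bar> \<le> C" for x
    using C R[of x] by (cases "norm x \<le> R") auto
  then show ?thesis using C that by blast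
qed

lemma test_fun_lipschitz:
  fixes f :: "'a::euclidean_space \<Rightarrow> real"
  assumes f: "test_fun f" obtains L where "L > 0" "\<And>x y. \<bar>f x - f y\<bar> \<le> L * norm (x - y)"
proof -
  have "\<forall>i\<in>Basis. \<exists>C. C > 0 \<and> (\<forall>x. \<bar>pd i f x\<bar> \<le> C)"
    using test_fun_bounded[OF test_fun_pd[OF f]] by metis
  then obtain C where C: "\<And>i. i \<in> Basis \<Longrightarrow> C i > 0 \<and> (\<forall>x. \<bar>pd i f x\<bar> \<le> C i)" by metis
  define L where "L = (\<Sum>i\<in>Basis. C i)"
  have L: "L > 0" unfolding L_def using C by (intro sum_pos) auto
  have "norm (f x - f y) \<le> L * norm (x - y)" for x y
  proof (rule differentiable_bound[of UNIV])
    fix x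
    show "(f has_derivative (\<lambda>h. \<Sum>i\<in>Basis. (h \<bullet> i) * pd i f x)) (at x within UNIV)"
      using test_fun_has_derivative[OF f] by simp
    have "\<bar>\<Sum>i\<in>Basis. (h \<bullet> i) * pd i f x\<bar> \<le> L * norm h" for h
    proof -
      have "\<bar>\<Sum>i\<in>Basis. (h \<bullet> i) * pd i f x\<bar> \<le> (\<Sum>i\<in>Basis. \<bar>(h \<bullet> i) * pd i f x\<bar>)" by (rule sum_abs)
      also have "\<dots> \<le> (\<Sum>i\<in>Basis. norm h * C i)"
        unfolding abs_mult using C by (intro sum_mono mult_mono) (auto simp: Basis_le_norm)
      finally show ?thesis by (simp add: L_def sum_distrib_left mult.commute)
    qed
    then show "onorm (\<lambda>h. \<Sum>i\<in>Basis. (h \<bullet> i) * pd i f x) \<le> L"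
      by (intro onorm_le) auto
  qed auto
  then show ?thesis using that L by simp
qed

text \<open>The remainder as a function of the increment has gradient equal to the increment of the
  gradient of \<open>f\<close>, which is Lipschitz; the mean value inequality on the ball of radius
  \<open>norm h\<close> then gives the square. Uniformity in the base point is what permits
  differentiation under a convolution integral.\<close>

lemma test_fun_taylor:
  fixes f :: "'a::euclidean_space \<Rightarrow> real"
  assumes f: "test_fun f"
  obtains C where "C > 0" "\<And>x h. \<bar>f (x + h) - f x - (\<Sum>i\<in>Basis. (h \<bullet> i) * pd i f x)\<bar> \<le> C * (norm h)\<^sup>2"
proof -
  have "\<forall>i\<in>Basis. \<exists>L. L > 0 \<and> (\<forall>x y. \<bar>pd i f x - pd i f y\<bar> \<le> L * norm (x - y))"
    using test_fun_lipschitz[OF test_fun_pd[OF f]] by metis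
  then obtain L where L: "\<And>i. i \<in> Basis \<Longrightarrow> L i > 0 \<and> (\<forall>x y. \<bar>pd i f x - pd i f y\<bar> \<le> L i * norm (x - y))" by metis
  define C where "C = (\<Sum>i\<in>Basis. L i)"
  have C: "C > 0" unfolding C_def using L by (intro sum_pos) auto
  have "\<bar>f (x + h) - f x - (\<Sum>i\<in>Basis. (h \<bullet> i) * pd i f x)\<bar> \<le> C * (norm h)\<^sup>2" for x h
  proof -
    define F where "F = (\<lambda>y. f (x + y) - (\<Sum>i\<in>Basis. (y \<bullet> i) * pd i f x))"
    have "norm (F h - F 0) \<le> (C * norm h) * norm (h - 0)"
    proof (rule differentiable_bound[of "cball (0::'a) (norm h)"])
      fix y :: 'a assume y: "y \<in> cball 0 (norm h)"
      let ?D = "\<lambda>k::'a. \<Sum>i\<in>Basis. (k \<bullet> i) * (pd i f (x + y) - pd i f x)"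
      have "((\<lambda>y. f (x + y)) has_derivative (\<lambda>k. \<Sum>i\<in>Basis. (k \<bullet> i) * pd i f (x + y))) (at y)"
      proof -
        have "((\<lambda>y. x + y) has_derivative (\<lambda>k. k)) (at y)" by (auto intro!: derivative_eq_intros)
        from has_derivative_compose[OF this test_fun_has_derivative[OF f]] show ?thesis .
      qed
      then have "(F has_derivative ?D) (at y)" unfolding F_def
        by (rule derivative_eq_intros) (auto intro!: derivative_eq_intros simp: sum_subtractf right_diff_distrib)
      then show "(F has_derivative ?D) (at y within cball 0 (norm h))" by (rule has_derivative_at_withinI)
      have "\<bar>?D k\<bar> \<le> C * norm h * norm k" for k
      proof -
        have "\<bar>?D k\<bar> \<le> (\<Sum>i\<in>Basis. \<bar>(k \<bullet> i) * (pd i f (x + y) - pd i f x)\<bar>)" by (rule sum_abs)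
        also have "\<dots> \<le> (\<Sum>i\<in>Basis. norm k * (L i * norm h))"
          unfolding abs_mult
        proof (intro sum_mono mult_mono)
          fix i :: 'a assume i: "i \<in> Basis"
          have "\<bar>pd i f (x + y) - pd i f x\<bar> \<le> L i * norm (x + y - x)" using L[OF i] by blast
          also have "\<dots> \<le> L i * norm h" using y L[OF i] by (intro mult_left_mono) auto
          finally show "\<bar>pd i f (x + y) - pd i f x\<bar> \<le> L i * norm h" .
        qed (auto simp: Basis_le_norm)
        finally show ?thesis by (simp add: C_def sum_distrib_left sum_distrib_right mult_ac)
      qed
      then show "onorm ?D \<le> C * norm h" by (intro onorm_le) auto
    qed auto
    then show ?thesis by (simp add: F_def power2_eq_square mult.assoc)
  qed
  then show ?thesis using that C by blast
qed

lemma pd_reflect: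
  assumes "smooth_fun f" shows "pd i (\<lambda>y. f (x - y)) = (\<lambda>y. - pd i f (x - y))"
proof (intro ext)
  fix y
  let ?D = "frechet_derivative f (at (x - y))"
  have D: "(f has_derivative ?D) (at (x - y))"
    using smooth_fun_differentiable[OF assms] by (simp add: frechet_derivative_works)
  have "((\<lambda>y. x - y) has_derivative (\<lambda>h. - h)) (at y)" by (auto intro!: derivative_eq_intros)
  from has_derivative_compose[OF this D]
  have "pd i (\<lambda>y. f (x - y)) y = ?D (- i)" by (rule pd_eq)
  also have "\<dots> = - ?D i" using has_derivative_linear[OF D] by (simp add: linear_neg)
  finally show "pd i (\<lambda>y. f (x - y)) y = - pd i f (x - y)" by (simp add: pd_def)
qed

lemma sm_reflect:
  assumes "smooth_fun f" shows "sm n (\<lambda>y. c * f (x - y))"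
  using assms
proof (induction n arbitrary: f c)
  case (Suc n)
  have d: "(\<lambda>y. f (x - y)) differentiable (at y)" for y
    using differentiable_compose[of f "\<lambda>y. x - y" y UNIV] smooth_fun_differentiable[OF Suc.prems] by simp
  have e: "pd i (\<lambda>y. c * f (x - y)) = (\<lambda>y. (- c) * pd i f (x - y))" for i
  proof (intro ext)
    fix y
    have "((\<lambda>y. f (x - y)) has_derivative frechet_derivative (\<lambda>y. f (x - y)) (at y)) (at y)"
      using d by (simp add: frechet_derivative_works)
    then have "((\<lambda>y. c * f (x - y)) has_derivative (\<lambda>h. c * frechet_derivative (\<lambda>y. f (x - y)) (at y) h)) (at y)"
      by (auto intro!: derivative_eq_intros)
    from pd_eq[OF this, of i] have "pd i (\<lambda>y. c * f (x - y)) y = c * pd i (\<lambda>y. f (x - y)) y"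
      by (simp add: pd_def)
    then show "pd i (\<lambda>y. c * f (x - y)) y = (- c) * pd i f (x - y)" by (simp add: pd_reflect[OF Suc.prems])
  qed
  have "sm n (pd i (\<lambda>y. c * f (x - y)))" if "i \<in> Basis" for i
    unfolding e by (rule Suc.IH[OF smooth_fun_pd[OF Suc.prems that]])
  then show ?case using d by simp
qed simp

lemma test_fun_reflect:
  assumes "test_fun f" shows "test_fun (\<lambda>y. f (x - y))"
proof -
  obtain R where R: "\<And>x. norm x > R \<Longrightarrow> f x = 0" using test_fun_support[OF assms] by metis
  show ?thesis
  proof (rule test_funI)
    show "smooth_fun (\<lambda>y. f (x - y))"
      using sm_reflect[of f _ 1 x] assms by (auto simp: smooth_fun_iff[of "\<lambda>y. f (x - y)"] test_fun_def)
    fix y :: 'a assume "norm y > R + norm x"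
    then have "norm (x - y) > R" using norm_triangle_ineq2[of y x] by (simp add: norm_minus_commute)
    then show "f (x - y) = 0" by (rule R)
  qed
qed

lemma test_fun_integrable:
  assumes "test_fun f" shows "integrable lborel f"
proof -
  obtain R where R: "\<And>x. norm x > R \<Longrightarrow> f x = 0" using test_fun_support[OF assms] by metis
  obtain C where C: "\<And>x. \<bar>f x\<bar> \<le> C" using test_fun_bounded[OF assms] by metis
  have fin: "emeasure lborel (cball (0::'a) R) < \<infinity>" by (rule emeasure_lborel_cball_finite)
  show ?thesis
    by (rule integrableI_bounded_set[of "cball 0 R" _ _ C]) (use assms R C fin in \<open>auto simp: not_le[symmetric]\<close>)
qed

definition mol_const :: "'a::euclidean_space itself \<Rightarrow> nat \<Rightarrow> real" where
  "mol_const _ n = (LBINT x. bump ((real n + 1)\<^sup>2) 1 (x::'a))"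

text \<open>The parameter (n+1)^2 confines the bump to the ball of radius 1/(n+1), hence to the unit
  ball for every \<open>n\<close>; the divisor normalises the mass to one.\<close>

definition moll :: "nat \<Rightarrow> 'a::euclidean_space \<Rightarrow> real" where
  "moll n x = bump ((real n + 1)\<^sup>2) 1 x / mol_const TYPE('a) n"

lemma bump_zero:
  assumes "norm (x::'a::euclidean_space) \<ge> 1 / (real n + 1)" shows "bump ((real n + 1)\<^sup>2) p x = 0"
proof -
  have "1 \<le> norm x * (real n + 1)" using assms by (simp add: field_simps)
  then have "1\<^sup>2 \<le> (norm x * (real n + 1))\<^sup>2" by (intro power_mono) auto
  then show ?thesis by (simp add: bump_def eb_def dot_square_norm power_mult_distrib mult.commute)
qed

lemma bump_nonneg: "bump c 1 x \<ge> 0" by (simp add: bump_def eb_def)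

lemma test_fun_bump: "test_fun (bump ((real n + 1)\<^sup>2) p)"
  by (rule test_funI[of _ "1 / (real n + 1)"]) (auto simp: smooth_fun_iff sm_bump bump_zero)

text \<open>A vanishing integral would make the nonnegative bump zero almost everywhere, but it is
  positive on an open ball, which is not a null set.\<close>

lemma mol_const_pos: "mol_const TYPE('a::euclidean_space) n > 0"
proof -
  let ?b = "bump ((real n + 1)\<^sup>2) 1 :: 'a \<Rightarrow> real"
  have "mol_const TYPE('a) n \<noteq> 0"
  proof
    assume "mol_const TYPE('a) n = 0"
    then have "AE x in lborel. ?b x = 0"
      unfolding mol_const_def
      by (subst (asm) integral_nonneg_eq_0_iff_AE) (auto simp: bump_nonneg test_fun_integrable test_fun_bump)
    then have "AE x in lborel. x \<notin> ball (0::'a) (1 / (real n + 1))"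
    proof (rule AE_mp, intro AE_I2 impI notI)
      fix x :: 'a assume z: "?b x = 0" and "x \<in> ball 0 (1 / (real n + 1))"
      then have "norm x * (real n + 1) < 1" by (simp add: field_simps)
      then have "(norm x * (real n + 1))\<^sup>2 < 1\<^sup>2" by (intro power_strict_mono) auto
      then have "?b x > 0" by (simp add: bump_def eb_def dot_square_norm power_mult_distrib mult.commute)
      with z show False by simp
    qed
    then have "ball (0::'a) (1 / (real n + 1)) \<in> null_sets lborel"
      by (subst (asm) AE_iff_null_sets[symmetric]) auto
    then show False
      using open_not_negligible[of "ball (0::'a) (1 / (real n + 1))"]
      by (simp add: negligible_iff_null_sets null_sets_completionI)
  qed
  moreover have "mol_const TYPE('a) n \<ge> 0" unfolding mol_const_def by (simp add: bump_nonneg)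
  ultimately show ?thesis by simp
qed

lemma test_fun_scale: assumes "test_fun f" shows "test_fun (\<lambda>x. c * f x)"
proof -
  obtain R where R: "\<And>x. norm x > R \<Longrightarrow> f x = 0" using test_fun_support[OF assms] by metis
  show ?thesis
    by (rule test_funI[of _ R]) (use assms in \<open>auto simp: R smooth_fun_iff test_fun_def intro!: sm_mult sm_const\<close>)
qed

lemma moll_eq: "moll n = (\<lambda>x::'a::euclidean_space. (1 / mol_const TYPE('a) n) * bump ((real n + 1)\<^sup>2) 1 x)"
  by (intro ext) (simp add: moll_def)

lemma test_fun_moll: "test_fun (moll n)"
  unfolding moll_eq by (rule test_fun_scale[OF test_fun_bump])

lemma moll_nonneg: "moll n (x::'a::euclidean_space) \<ge> 0"
  using mol_const_pos[of n, where 'a='a] by (simp add: moll_def bump_nonneg)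

lemma moll_zero: "norm (x::'a::euclidean_space) \<ge> 1 / (real n + 1) \<Longrightarrow> moll n x = 0"
  by (simp add: moll_def bump_zero)

lemma moll_integral: "(LBINT x. moll n (x::'a::euclidean_space)) = 1"
  using mol_const_pos[of n, where 'a='a] by (simp add: moll_def mol_const_def)

lemma pd_scale: assumes "test_fun f" shows "pd i (\<lambda>x. c * f x) = (\<lambda>x. c * pd i f x)"
proof (intro ext)
  fix x
  have "(f has_derivative frechet_derivative f (at x)) (at x)"
    using assms smooth_fun_differentiable by (auto simp: frechet_derivative_works test_fun_def)
  then have "((\<lambda>x. c * f x) has_derivative (\<lambda>h. c * frechet_derivative f (at x) h)) (at x)"
    by (auto intro!: derivative_eq_intros)
  from pd_eq[OF this] show "pd i (\<lambda>x. c * f x) x = c * pd i f x" by (simp add: pd_def)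
qed

lemma pd_moll_commute:
  assumes "i \<in> Basis" "j \<in> Basis"
  shows "pd i (pd j (moll n)) = pd j (pd i (moll n))"
  unfolding moll_eq using assms
  by (simp only: pd_scale test_fun_bump test_fun_pd pd_bump_commute[of i j])

section \<open>Local integrability classes and domination\<close>

definition l1loc :: "('a::euclidean_space \<Rightarrow> 'b::euclidean_space) \<Rightarrow> bool" where
  "l1loc w \<longleftrightarrow> w \<in> borel_measurable borel \<and> (\<forall>R. set_integrable lborel (cball 0 R) w)"

text \<open>Balls around the origin stand in for general compact sets and Bochner integrability for
  finiteness of an extended integral. The Euclidean codomain lets one notion serve real functions,
  complex functions and gradients.\<close>

definition l2loc :: "('a::euclidean_space \<Rightarrow> 'b::euclidean_space) \<Rightarrow> bool" where
  "l2loc w \<longleftrightarrow> w \<in> borel_measurable borel \<and> (\<forall>R. set_integrable lborel (cball 0 R) (\<lambda>x. (norm (w x))\<^sup>2))"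

lemma l1loc_measurable [measurable_dest]: "l1loc w \<Longrightarrow> w \<in> borel_measurable borel"
  by (simp add: l1loc_def)
lemma l2loc_measurable [measurable_dest]: "l2loc w \<Longrightarrow> w \<in> borel_measurable borel"
  by (simp add: l2loc_def)

lemma cball_borel [measurable]: "cball (a::'a::euclidean_space) R \<in> sets borel"
  by (simp add: borel_closed)

lemma abs_inner_le: "\<bar>a \<bullet> e\<bar> \<le> norm e * norm a"
  using Cauchy_Schwarz_ineq2[of a e] by (simp add: mult.commute)

lemma integrable_const_cball [simp]: "integrable lborel (\<lambda>x. indicator (cball (0::'a::euclidean_space) R) x *\<^sub>R (c::real))"
proof -
  have "integrable lborel (indicat_real (cball (0::'a) R))"
    using emeasure_lborel_cball_finite[of "0::'a" R] by (intro integrable_real_indicator) auto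
  then show ?thesis by (intro integrable_scaleR_left)
qed

lemma set_integrable_const_cball [simp]: "set_integrable lborel (cball (0::'a::euclidean_space) R) (\<lambda>x. c::real)"
  unfolding set_integrable_def by (rule integrable_const_cball)

lemma integrable_l1:
  fixes u :: "'a::euclidean_space \<Rightarrow> 'b::euclidean_space" and h :: "'a \<Rightarrow> 'c::euclidean_space"
  assumes u: "l1loc u" and h: "h \<in> borel_measurable borel"
    and b: "\<And>x. norm x \<le> R \<Longrightarrow> norm (h x) \<le> M * norm (u x)" and z: "\<And>x. norm x > R \<Longrightarrow> h x = 0"
  shows "integrable lborel h"
proof (rule Bochner_Integration.integrable_bound)
  have "integrable lborel (\<lambda>x. M *\<^sub>R norm (indicator (cball 0 R) x *\<^sub>R u x))"
    using u unfolding l1loc_def set_integrable_def by (intro integrable_scaleR_right integrable_norm) auto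
  then show "integrable lborel (\<lambda>x. M *\<^sub>R norm (indicator (cball 0 R) x *\<^sub>R u x))" .
  show "h \<in> borel_measurable lborel" using h by simp
  show "AE x in lborel. norm (h x) \<le> norm (M *\<^sub>R norm (indicator (cball 0 R) x *\<^sub>R u x))"
  proof (intro AE_I2)
    fix x
    show "norm (h x) \<le> norm (M *\<^sub>R norm (indicator (cball 0 R) x *\<^sub>R u x))"
      using order_trans[OF b[of x] abs_ge_self] z[of x] by (cases "norm x \<le> R") (auto simp: abs_mult)
  qed
qed

text \<open>Domination by ab \<le> a^2 + b^2. Most integrands below are products of two locally
  square integrable functions (the solution, its gradient, the right-hand side) with a bounded
  coefficient of bounded support, and their integrability is an instance of this rule.\<close>

lemma l2loc_prod_integrable:
  fixes u :: "'a::euclidean_space \<Rightarrow> 'b::euclidean_space" and v :: "'a \<Rightarrow> 'c::euclidean_space" and h :: "'a \<Rightarrow> 'd::euclidean_space"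
  assumes u: "l2loc u" and v: "l2loc v" and h: "h \<in> borel_measurable borel"
    and b: "\<And>x. norm x \<le> R \<Longrightarrow> norm (h x) \<le> M * (norm (u x) * norm (v x))" and z: "\<And>x. norm x > R \<Longrightarrow> h x = 0"
  shows "integrable lborel h"
proof (rule Bochner_Integration.integrable_bound)
  show "integrable lborel (\<lambda>x. \<bar>M\<bar> *\<^sub>R (indicator (cball 0 R) x *\<^sub>R ((norm (u x))\<^sup>2) + indicator (cball 0 R) x *\<^sub>R ((norm (v x))\<^sup>2)))"
    using u v unfolding l2loc_def set_integrable_def by (intro integrable_scaleR_right Bochner_Integration.integrable_add) auto
  show "h \<in> borel_measurable lborel" using h by simp
  show "AE x in lborel. norm (h x) \<le> norm (\<bar>M\<bar> *\<^sub>R (indicator (cball 0 R) x *\<^sub>R ((norm (u x))\<^sup>2) + indicator (cball 0 R) x *\<^sub>R ((norm (v x))\<^sup>2)))"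
  proof (intro AE_I2)
    fix x
    show "norm (h x) \<le> norm (\<bar>M\<bar> *\<^sub>R (indicator (cball 0 R) x *\<^sub>R ((norm (u x))\<^sup>2) + indicator (cball 0 R) x *\<^sub>R ((norm (v x))\<^sup>2)))"
    proof (cases "norm x \<le> R")
      case True
      have "norm (h x) \<le> M * (norm (u x) * norm (v x))" by (rule b[OF True])
      also have "\<dots> \<le> \<bar>M\<bar> * (norm (u x) * norm (v x))" by (intro mult_right_mono) auto
      also have "\<dots> \<le> \<bar>M\<bar> * ((norm (u x))\<^sup>2 + (norm (v x))\<^sup>2)"
      proof (intro mult_left_mono)
        have "2 * (norm (u x) * norm (v x)) \<le> (norm (u x))\<^sup>2 + (norm (v x))\<^sup>2"
          using sum_squares_bound[of "norm (u x)" "norm (v x)"] by simp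
        moreover have "0 \<le> norm (u x) * norm (v x)" by simp
        ultimately show "norm (u x) * norm (v x) \<le> (norm (u x))\<^sup>2 + (norm (v x))\<^sup>2" by linarith
      qed auto
      finally show ?thesis using True by simp
    qed (use z[of x] in auto)
  qed
qed

lemma l2loc_bound:
  assumes u: "l2loc u" and h: "h \<in> borel_measurable borel"
    and b: "\<And>R. \<exists>M. \<forall>x. norm x \<le> R \<longrightarrow> norm (h x) \<le> M * norm (u x)"
  shows "l2loc h"
  unfolding l2loc_def set_integrable_def
proof (intro conjI allI)
  fix R
  obtain M where M: "\<forall>x. norm x \<le> R \<longrightarrow> norm (h x) \<le> M * norm (u x)" using b by blast
  note [measurable] = h
  show "integrable lborel (\<lambda>x. indicator (cball 0 R) x *\<^sub>R (norm (h x))\<^sup>2)"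
  proof (rule l2loc_prod_integrable[OF u u, of _ R "M\<^sup>2"])
    fix x :: 'a assume x: "norm x \<le> R"
    have "(norm (h x))\<^sup>2 \<le> (M * norm (u x))\<^sup>2" using M x by (intro power_mono) auto
    then show "norm (indicator (cball 0 R) x *\<^sub>R (norm (h x))\<^sup>2) \<le> M\<^sup>2 * (norm (u x) * norm (u x))"
      using x by (simp add: power2_eq_square mult_ac)
  qed (use h in auto)
qed (use h in auto)

lemma l2loc_const: "l2loc (\<lambda>x. c)"
  unfolding l2loc_def by auto

lemma l2loc_locally_bounded:
  fixes h :: "'a::euclidean_space \<Rightarrow> 'b::euclidean_space"
  assumes h: "h \<in> borel_measurable borel" and b: "\<And>R. \<exists>M. \<forall>x. norm x \<le> R \<longrightarrow> norm (h x) \<le> M"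
  shows "l2loc h"
  by (rule l2loc_bound[OF l2loc_const[of "1::real"] h]) (use b in simp)

lemma continuous_bounded_cball:
  fixes h :: "'a::euclidean_space \<Rightarrow> 'b::real_normed_vector"
  assumes "continuous_on UNIV h" shows "\<exists>M. \<forall>x. norm x \<le> R \<longrightarrow> norm (h x) \<le> M"
proof -
  have "compact (h ` cball 0 R)" by (intro compact_continuous_image continuous_on_subset[OF assms]) auto
  then obtain M where "\<forall>y\<in>h ` cball 0 R. norm y \<le> M" by (metis bounded_pos compact_imp_bounded)
  then show ?thesis by (intro exI[of _ M]) auto
qed

lemma l2loc_continuous: "continuous_on UNIV h \<Longrightarrow> l2loc h"
  by (intro l2loc_locally_bounded continuous_bounded_cball borel_measurable_continuous_onI)

lemma l2loc_add:
  assumes u: "l2loc u" and v: "l2loc v" shows "l2loc (\<lambda>x. u x + v x)"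
  unfolding l2loc_def set_integrable_def
proof (intro conjI allI)
  note [measurable] = u v
  show "(\<lambda>x. u x + v x) \<in> borel_measurable borel" by measurable
  fix R
  show "integrable lborel (\<lambda>x. indicator (cball 0 R) x *\<^sub>R (norm (u x + v x))\<^sup>2)"
  proof (rule Bochner_Integration.integrable_bound)
    show "integrable lborel (\<lambda>x. 2 *\<^sub>R (indicator (cball 0 R) x *\<^sub>R ((norm (u x))\<^sup>2) + indicator (cball 0 R) x *\<^sub>R ((norm (v x))\<^sup>2)))"
      using u v unfolding l2loc_def set_integrable_def by (intro integrable_scaleR_right Bochner_Integration.integrable_add) auto
    show "AE x in lborel. norm (indicator (cball 0 R) x *\<^sub>R (norm (u x + v x))\<^sup>2)
       \<le> norm (2 *\<^sub>R (indicator (cball 0 R) x *\<^sub>R ((norm (u x))\<^sup>2) + indicator (cball 0 R) x *\<^sub>R ((norm (v x))\<^sup>2)))"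
    proof (intro AE_I2)
      fix x
      have "(norm (u x + v x))\<^sup>2 \<le> (norm (u x) + norm (v x))\<^sup>2" by (intro power_mono norm_triangle_ineq) auto
      also have "\<dots> \<le> 2 * ((norm (u x))\<^sup>2 + (norm (v x))\<^sup>2)"
        using sum_squares_bound[of "norm (u x)" "norm (v x)"] by (simp add: power2_sum)
      finally show "norm (indicator (cball 0 R) x *\<^sub>R (norm (u x + v x))\<^sup>2)
       \<le> norm (2 *\<^sub>R (indicator (cball 0 R) x *\<^sub>R ((norm (u x))\<^sup>2) + indicator (cball 0 R) x *\<^sub>R ((norm (v x))\<^sup>2)))"
        by (auto simp: indicator_def)
    qed
  qed measurable
qed

lemma l2loc_imp_l1loc: assumes "l2loc u" shows "l1loc u"
  unfolding l1loc_def set_integrable_def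
proof (intro conjI allI)
  fix R
  note [measurable] = assms
  show "integrable lborel (\<lambda>x. indicator (cball 0 R) x *\<^sub>R u x)"
    by (rule l2loc_prod_integrable[OF assms l2loc_const[of "1::real"], of _ R 1]) (use assms in auto)
qed (use assms in measurable)

lemma l2loc_inner: "l2loc u \<Longrightarrow> l2loc (\<lambda>x. u x \<bullet> e)"
  by (rule l2loc_bound[of u]) (auto intro!: exI[of _ "norm e"] simp: abs_inner_le)

lemma l2loc_cmult: "l2loc (u :: _ \<Rightarrow> real) \<Longrightarrow> l2loc (\<lambda>x. c * u x)"
  by (rule l2loc_bound[of u]) (auto intro!: exI[of _ "\<bar>c\<bar>"] simp: abs_mult)

lemma l1loc_inner: assumes "l1loc u" shows "l1loc (\<lambda>x. u x \<bullet> e)"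
  unfolding l1loc_def set_integrable_def
proof (intro conjI allI)
  fix R
  note [measurable] = assms
  show "integrable lborel (\<lambda>x. indicator (cball 0 R) x *\<^sub>R (u x \<bullet> e))"
    by (rule integrable_l1[OF assms, of _ R "norm e"]) (auto simp: abs_inner_le)
qed (use assms in measurable)

subsection \<open>Convolution\<close>

lemma distr_reflect: "distr lborel borel (\<lambda>y. x - y) = (lborel :: 'a::euclidean_space measure)"
  using lborel_affine[of "-1" x] by (simp add: density_1)

lemma integral_reflect:
  fixes f :: "'a::euclidean_space \<Rightarrow> 'b::euclidean_space"
  assumes [measurable]: "f \<in> borel_measurable borel"
  shows "(LBINT y. f (x - y)) = (LBINT y. f y)"
  by (subst (2) distr_reflect[of x, symmetric]) (simp add: integral_distr)

lemma nn_integral_translate: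
  fixes f :: "'a::euclidean_space \<Rightarrow> ennreal"
  assumes [measurable]: "f \<in> borel_measurable borel"
  shows "(\<integral>\<^sup>+y. f (y - x) \<partial>lborel) = (\<integral>\<^sup>+y. f y \<partial>lborel)"
  by (subst (2) lborel_distr_plus[of "-x", symmetric]) (simp add: nn_integral_distr)

lemma integral_translate:
  fixes f :: "'a::euclidean_space \<Rightarrow> 'b::euclidean_space"
  assumes [measurable]: "f \<in> borel_measurable borel"
  shows "(LBINT y. f (y + x)) = (LBINT y. f y)"
  by (subst (2) lborel_distr_plus[of x, symmetric]) (simp add: integral_distr add.commute)

definition conv :: "('a::euclidean_space \<Rightarrow> real) \<Rightarrow> ('a \<Rightarrow> 'b::euclidean_space) \<Rightarrow> 'a \<Rightarrow> 'b" where
  "conv k w x = (LBINT y. k (x - y) *\<^sub>R w y)"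

lemma conv_integrable:
  assumes k: "test_fun k" and w: "l1loc w"
  shows "integrable lborel (\<lambda>y. k (x - y) *\<^sub>R w y)"
proof -
  obtain R where R: "\<And>x. norm x > R \<Longrightarrow> k x = 0" using test_fun_support[OF k] by metis
  obtain C where C: "\<And>x. \<bar>k x\<bar> \<le> C" using test_fun_bounded[OF k] by metis
  note [measurable] = test_fun_measurable[OF k] l1loc_measurable[OF w]
  show ?thesis
  proof (rule integrable_l1[OF w, of _ "R + norm x" C])
    show "(\<lambda>y. k (x - y) *\<^sub>R w y) \<in> borel_measurable borel" by measurable
    fix y
    show "norm (k (x - y) *\<^sub>R w y) \<le> C * norm (w y)" using C by (auto intro: mult_right_mono)
    assume "norm y > R + norm x"
    then have "norm (x - y) > R" using norm_triangle_ineq2[of y x] by (simp add: norm_minus_commute)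
    then show "k (x - y) *\<^sub>R w y = 0" by (simp add: R)
  qed
qed

lemma conv_inner:
  assumes "test_fun k" "l1loc w" shows "conv k w x \<bullet> e = conv k (\<lambda>x. w x \<bullet> e) x"
  unfolding conv_def by (subst integral_inner_left[symmetric]) (auto simp: conv_integrable assms)

lemma conv_alt:
  assumes "test_fun k" "l1loc w" shows "conv k w x = (LBINT y. k y *\<^sub>R w (x - y))"
proof -
  note [measurable] = test_fun_measurable[OF assms(1)] l1loc_measurable[OF assms(2)]
  have "(\<lambda>y. k (x - y) *\<^sub>R w y) \<in> borel_measurable borel" by measurable
  from integral_reflect[OF this, of x] show ?thesis by (simp add: conv_def)
qed

lemma conv_cong_cball:
  assumes "\<And>x. norm x > R \<Longrightarrow> k x = 0" "\<And>y. norm y \<le> norm x + R \<Longrightarrow> w y = w' y"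
  shows "conv k w x = conv k w' x"
  unfolding conv_def
proof (intro Bochner_Integration.integral_cong refl)
  fix y
  show "k (x - y) *\<^sub>R w y = k (x - y) *\<^sub>R w' y"
  proof (cases "norm (x - y) > R")
    case False
    then have "norm y \<le> norm x + R" using norm_triangle_ineq2[of y x] by (simp add: norm_minus_commute)
    then show ?thesis using assms(2) by simp
  qed (simp add: assms(1))
qed

text \<open>Differentiation under the integral for a merely locally integrable \<open>w\<close>: the
  kernel's second-order remainder is bounded uniformly in the base point, so the remainder of the
  convolution is at most a constant times |h|^2 times the mass of \<open>w\<close> on a fixed
  ball.\<close>

lemma conv_has_derivative:
  fixes w :: "'a::euclidean_space \<Rightarrow> 'b::euclidean_space"
  assumes k: "test_fun k" and w: "l1loc w"
  shows "(conv k w has_derivative (\<lambda>h. \<Sum>i\<in>Basis. (h \<bullet> i) *\<^sub>R conv (pd i k) w x)) (at x)"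
proof -
  obtain R where R: "R > 0" "\<And>x. norm x > R \<Longrightarrow> k x = 0" using test_fun_support[OF k] by metis
  obtain C where C: "C > 0" "\<And>x h. \<bar>k (x + h) - k x - (\<Sum>i\<in>Basis. (h \<bullet> i) * pd i k x)\<bar> \<le> C * (norm h)\<^sup>2"
    using test_fun_taylor[OF k] by metis
  \<comment> \<open>For increments of norm at most 1 the ball of this radius contains the supports
    of both y -> k(x - y) and y -> k(x + h - y).\<close>
  define r where "r = R + norm x + 1"
  define I where "I = (LBINT y. indicator (cball 0 r) y * norm (w y))"
  note [measurable] = test_fun_measurable[OF k] l1loc_measurable[OF w]
  have wi: "integrable lborel (\<lambda>y. indicator (cball 0 r) y * norm (w y))"
    by (rule integrable_l1[OF w, of _ r 1]) (use w in auto)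
  let ?D = "\<lambda>h. \<Sum>i\<in>Basis. (h \<bullet> i) *\<^sub>R conv (pd i k) w x"
  have bd: "norm (conv k w (x + h) - conv k w x - ?D h) \<le> C * I * (norm h)\<^sup>2" if h: "norm h \<le> 1" for h
  proof -
    let ?g = "\<lambda>y. k (x + h - y) - k (x - y) - (\<Sum>i\<in>Basis. (h \<bullet> i) * pd i k (x - y))"
    have "conv k w (x + h) - conv k w x - ?D h = (LBINT y. ?g y *\<^sub>R w y)"
      unfolding conv_def using conv_integrable[OF k w] conv_integrable[OF test_fun_pd[OF k] w]
      by (simp add: scaleR_diff_left scaleR_sum_left flip: scaleR_scaleR integral_scaleR_right)
    also have "norm \<dots> \<le> (LBINT y. C * (norm h)\<^sup>2 * (indicator (cball 0 r) y * norm (w y)))"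
    proof (rule Bochner_Integration.integral_norm_bound_integral)
      show "integrable lborel (\<lambda>y. ?g y *\<^sub>R w y)"
        using conv_integrable[OF k w] conv_integrable[OF test_fun_pd[OF k] w]
        by (simp add: scaleR_diff_left scaleR_sum_left flip: scaleR_scaleR)
      show "integrable lborel (\<lambda>y. C * (norm h)\<^sup>2 * (indicator (cball 0 r) y * norm (w y)))"
        using wi by simp
      fix y
      show "norm (?g y *\<^sub>R w y) \<le> C * (norm h)\<^sup>2 * (indicator (cball 0 r) y * norm (w y))"
      proof (cases "norm y \<le> r")
        case True
        have "\<bar>?g y\<bar> \<le> C * (norm h)\<^sup>2" using C(2)[of "x - y" h] by (simp add: algebra_simps)
        then show ?thesis using True by (simp add: mult_right_mono)
      next
        case False
        have "norm (x - y) > R" using False norm_triangle_ineq2[of y x] h by (simp add: r_def norm_minus_commute)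
        moreover have "norm (x + h - y) > R"
          using False norm_triangle_ineq2[of y "x + h"] norm_triangle_ineq[of x h] h by (simp add: r_def norm_minus_commute)
        ultimately have "?g y = 0" using R by (simp add: pd_zero_outside[of R k])
        then show ?thesis using False by simp
      qed
    qed
    also have "\<dots> = C * I * (norm h)\<^sup>2" unfolding I_def by simp
    finally show ?thesis .
  qed
  show ?thesis
    unfolding has_derivative_at
  proof (intro conjI)
    show "bounded_linear ?D"
      by (intro bounded_linear_sum bounded_linear_scaleR_const bounded_linear_inner_left)
    have lim: "((\<lambda>h. C * I * norm h) \<longlongrightarrow> C * I * norm (0::'a)) (at (0::'a))" by (intro tendsto_intros)
    show "(\<lambda>h. norm (conv k w (x + h) - conv k w x - ?D h) / norm h) \<midarrow>0\<rightarrow> 0"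
    proof (rule Lim_null_comparison)
      have "eventually (\<lambda>h. h \<in> ball (0::'a) 1 \<and> h \<noteq> 0) (at 0)"
        by (auto simp: eventually_at_filter intro!: eventually_nhds_in_open[THEN eventually_mono, of "ball 0 1"])
      then show "\<forall>\<^sub>F h in at 0. norm (norm (conv k w (x + h) - conv k w x - ?D h) / norm h) \<le> C * I * norm h"
      proof eventually_elim
        case (elim h)
        then show ?case using bd[of h] by (simp add: field_simps power2_eq_square)
      qed
      show "((\<lambda>h. C * I * norm h) \<longlongrightarrow> 0) (at (0::'a))" using lim by simp
    qed
  qed
qed

lemma conv_continuous:
  assumes "test_fun k" "l1loc w" shows "continuous_on UNIV (conv k w)"
  using has_derivative_continuous[OF conv_has_derivative[OF assms]] by (simp add: continuous_on_eq_continuous_within)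

lemma conv_measurable:
  assumes "test_fun k" "l1loc w" shows "conv k w \<in> borel_measurable borel"
  using conv_continuous[OF assms] by (rule borel_measurable_continuous_onI)

lemma conv_l2loc: "test_fun k \<Longrightarrow> l1loc w \<Longrightarrow> l2loc (conv k w)"
  by (intro l2loc_continuous conv_continuous)

lemma pd_conv:
  fixes w :: "'a::euclidean_space \<Rightarrow> real"
  assumes "test_fun k" "l1loc w" "i \<in> Basis" shows "pd i (conv k w) = conv (pd i k) w"
proof (intro ext)
  fix x
  have "pd i (conv k w) x = (\<Sum>j\<in>Basis. (i \<bullet> j) *\<^sub>R conv (pd j k) w x)"
    by (rule pd_eq[OF conv_has_derivative[OF assms(1,2)]])
  also have "\<dots> = (\<Sum>j\<in>Basis. if j = i then conv (pd j k) w x else 0)"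
    by (intro sum.cong refl) (use assms(3) in \<open>auto simp: inner_Basis\<close>)
  finally show "pd i (conv k w) x = conv (pd i k) w x" using assms(3) by simp
qed

text \<open>Every derivative falls on the kernel, which remains a test function, so the induction
  generalises over \<open>k\<close> and never differentiates \<open>w\<close>.\<close>

lemma conv_smooth:
  fixes w :: "'a::euclidean_space \<Rightarrow> real"
  assumes "test_fun k" and w: "l1loc w" shows "smooth_fun (conv k w)"
proof -
  have "sm n (conv k w)" if "test_fun k" for n k
    using that
  proof (induction n arbitrary: k)
    case (Suc n)
    then show ?case
      using conv_has_derivative[OF _ w, THEN differentiableI] by (auto simp: pd_conv w test_fun_pd)
  qed simp
  then show ?thesis using assms(1) by (simp add: smooth_fun_iff)
qed

lemma conv_zero_outside:
  assumes "\<And>x. norm x > R \<Longrightarrow> k x = 0" "\<And>x. norm x > S \<Longrightarrow> w x = 0" "norm x > R + S"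
  shows "conv k w x = 0"
proof -
  have "k (x - y) *\<^sub>R w y = 0" for y
    using assms(1)[of "x - y"] assms(2)[of y] assms(3) norm_triangle_ineq2[of x y] by (cases "norm y > S") auto
  then have "(\<lambda>y. k (x - y) *\<^sub>R w y) = (\<lambda>y. 0)" by blast
  then show ?thesis by (simp add: conv_def)
qed

subsection \<open>Integration by parts and weak derivatives\<close>

lemma has_derivative_continuous_on_UNIV:
  assumes "\<And>x. (\<psi> has_derivative D x) (at x)" shows "continuous_on UNIV \<psi>"
  unfolding continuous_on_eq_continuous_within
  using has_derivative_continuous[OF assms] by simp

text \<open>Translation invariance makes the integral of \<psi>(x + e) - \<psi>(x) vanish. Along the
  segment from x to x + e this difference is the integral of the derivative, and Fubini followed by
  translation invariance turns the double integral into the single integral of the derivative over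
  the whole space.\<close>

lemma integral_directional_derivative_zero:
  fixes \<psi> :: "'a::euclidean_space \<Rightarrow> real"
  assumes D: "\<And>x. (\<psi> has_derivative D x) (at x)" and c: "continuous_on UNIV (\<lambda>x. D x e)"
    and z: "\<And>x. norm x > R \<Longrightarrow> \<psi> x = 0"
  shows "(LBINT x. D x e) = 0"
proof -
  define h where "h = (\<lambda>x. D x e)"
  have hm [measurable]: "h \<in> borel_measurable borel"
    unfolding h_def by (rule borel_measurable_continuous_onI[OF c])
  have h0: "h x = 0" if "norm x > R" for x
    unfolding h_def using pd_zero_outside[of R \<psi> x e] pd_eq[OF D] z that by metis
  obtain M where M: "\<And>x. norm x \<le> R \<Longrightarrow> \<bar>h x\<bar> \<le> M" using continuous_bounded_cball[OF c, of R] by (auto simp: h_def)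
  have psic: "continuous_on UNIV \<psi>" by (rule has_derivative_continuous_on_UNIV[OF D])
  note pm [measurable] = borel_measurable_continuous_onI[OF psic]
  have pint: "integrable lborel \<psi>"
    by (rule integrable_l1[OF l2loc_imp_l1loc[OF l2loc_continuous[OF psic]], of _ R 1]) (auto simp: z)
  have ftc: "(LBINT t. indicator {0..1} t *\<^sub>R h (x + t *\<^sub>R e)) = \<psi> (x + e) - \<psi> x" for x
  proof -
    have "(LBINT t. indicator {0..1} t *\<^sub>R h (x + t *\<^sub>R e)) = \<psi> (x + 1 *\<^sub>R e) - \<psi> (x + 0 *\<^sub>R e)"
    proof (rule integral_FTC_atLeastAtMost)
      fix t :: real
      have "((\<lambda>t. x + t *\<^sub>R e) has_derivative (\<lambda>s. s *\<^sub>R e)) (at t)" by (auto intro!: derivative_eq_intros)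
      from has_derivative_compose[OF this D]
      have "((\<lambda>t. \<psi> (x + t *\<^sub>R e)) has_derivative (\<lambda>s. D (x + t *\<^sub>R e) (s *\<^sub>R e))) (at t)" .
      then have "((\<lambda>t. \<psi> (x + t *\<^sub>R e)) has_derivative (\<lambda>s. s *\<^sub>R h (x + t *\<^sub>R e))) (at t)"
        using linear_scale[OF has_derivative_linear[OF D]] by (simp add: h_def)
      then show "((\<lambda>t. \<psi> (x + t *\<^sub>R e)) has_vector_derivative h (x + t *\<^sub>R e)) (at t within {0..1})"
        by (simp add: has_vector_derivative_def has_derivative_at_withinI)
    qed (auto simp: h_def intro!: continuous_intros continuous_on_compose2[OF c])
    then show ?thesis by simp
  qed
  let ?F = "\<lambda>x t. indicator {0..1::real} t *\<^sub>R h (x + t *\<^sub>R e)"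
  have int: "integrable (lborel \<Otimes>\<^sub>M lborel) (case_prod ?F)"
  proof (rule integrableI_bounded_set[of "cball 0 (R + norm e) \<times> {0..1}" _ _ "max M 0"])
    show "case_prod ?F \<in> borel_measurable (lborel \<Otimes>\<^sub>M lborel)" by measurable
    have "emeasure (lborel \<Otimes>\<^sub>M lborel) (cball (0::'a) (R + norm e) \<times> {0..1::real}) = emeasure lborel (cball (0::'a) (R + norm e)) * emeasure lborel {0..1::real}"
      by (intro lborel.emeasure_pair_measure_Times) auto
    also have "\<dots> < \<infinity>" using emeasure_lborel_cball_finite[of "0::'a" "R + norm e"] by (simp add: ennreal_mult_less_top)
    finally show "emeasure (lborel \<Otimes>\<^sub>M lborel) (cball (0::'a) (R + norm e) \<times> {0..1::real}) < \<infinity>" .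
    have 1: "norm (case_prod ?F p) \<le> max M 0" for p
      using M[of "fst p + snd p *\<^sub>R e"] h0[of "fst p + snd p *\<^sub>R e"]
      by (cases p; cases "norm (fst p + snd p *\<^sub>R e) \<le> R") (auto simp: indicator_def)
    show "AE p in lborel \<Otimes>\<^sub>M lborel. p \<in> cball 0 (R + norm e) \<times> {0..1} \<longrightarrow> norm (case_prod ?F p) \<le> max M 0"
      using 1 by auto
    have 2: "case_prod ?F p = 0" if p: "p \<notin> cball 0 (R + norm e) \<times> {0..1}" for p :: "'a \<times> real"
    proof (cases "snd p \<in> {0..1}")
      case True
      then have "norm (fst p) > R + norm e" using p by (cases p) auto
      moreover have "norm (snd p *\<^sub>R e) \<le> 1 * norm e"
        unfolding norm_scaleR using True by (intro mult_right_mono) auto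
      ultimately have "norm (fst p + snd p *\<^sub>R e) > R"
        using norm_triangle_ineq2[of "fst p" "- (snd p *\<^sub>R e)"] by simp
      then show ?thesis by (cases p) (simp add: h0)
    qed (cases p, auto)
    show "AE p in lborel \<Otimes>\<^sub>M lborel. p \<notin> cball 0 (R + norm e) \<times> {0..1} \<longrightarrow> case_prod ?F p = 0"
      using 2 by (intro AE_I2 impI)
  qed simp
  have "0 = (LBINT x. \<psi> (x + e)) - (LBINT x. \<psi> x)" by (simp add: integral_translate)
  also have "\<dots> = (LBINT x. \<psi> (x + e) - \<psi> x)"
  proof (rule Bochner_Integration.integral_diff[symmetric])
    show "integrable lborel (\<lambda>x. \<psi> (x + e))"
    proof -
      have "(\<lambda>x. x + e) = (+) e" by (simp add: fun_eq_iff add.commute)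
      then have "distr lborel borel (\<lambda>x. x + e) = (lborel :: 'a measure)" using lborel_distr_plus[of e] by simp
      then show ?thesis by (intro integrable_distr[of "\<lambda>x. x + e" lborel borel \<psi>]) (auto simp: pint)
    qed
  qed (rule pint)
  also have "\<dots> = (LBINT x. (LBINT t. ?F x t))" by (simp only: ftc)
  also have "\<dots> = (LBINT t. (LBINT x. ?F x t))"
    by (rule lborel_pair.Fubini_integral[OF int, symmetric])
  also have "\<dots> = (LBINT t. indicator {0..1::real} t *\<^sub>R (LBINT x. h x))"
    by (simp only: integral_scaleR_right integral_translate[OF hm])
  also have "\<dots> = (LBINT x. h x)" by simp
  finally show ?thesis by (simp add: h_def)
qed

text \<open>The weak derivative with scalar multiplication by the test function, so that it makes
  sense for any Euclidean codomain; \<open>weak_deriv_iff\<close> identifies it with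
  \<open>weak_deriv\<close> in the complex case.\<close>

definition wd :: "('a::euclidean_space \<Rightarrow> 'b::euclidean_space) \<Rightarrow> 'a \<Rightarrow> ('a \<Rightarrow> 'b) \<Rightarrow> bool" where
  "wd f i g \<longleftrightarrow> (\<forall>\<psi>. test_fun \<psi> \<longrightarrow> (LBINT x. pd i \<psi> x *\<^sub>R f x) = - (LBINT x. \<psi> x *\<^sub>R g x))"

lemma continuous_integrable:
  fixes h :: "'a::euclidean_space \<Rightarrow> real"
  assumes "continuous_on UNIV h" "\<And>x. norm x > R \<Longrightarrow> h x = 0" shows "integrable lborel h"
  by (rule integrable_l1[OF l2loc_imp_l1loc[OF l2loc_continuous[OF assms(1)]], of _ R 1])
     (auto simp: assms borel_measurable_continuous_onI)

lemma wd_of_has_derivative: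
  fixes \<psi> :: "'a::euclidean_space \<Rightarrow> real"
  assumes D: "\<And>x. (\<psi> has_derivative D x) (at x)" and c: "continuous_on UNIV (\<lambda>x. D x i)" and i: "i \<in> Basis"
  shows "wd \<psi> i (\<lambda>x. D x i)"
  unfolding wd_def
proof (intro allI impI)
  fix k :: "'a \<Rightarrow> real" assume k: "test_fun k"
  obtain R where R: "\<And>x. norm x > R \<Longrightarrow> k x = 0" using test_fun_support[OF k] by metis
  have k': "(k has_derivative (\<lambda>h. \<Sum>i\<in>Basis. (h \<bullet> i) * pd i k x)) (at x)" for x by (rule test_fun_has_derivative[OF k])
  have pdi: "(\<Sum>j\<in>Basis. (i \<bullet> j) * pd j k x) = pd i k x" for x
    using pd_eq[OF k', of i x] by simp
  have psic: "continuous_on UNIV \<psi>" by (rule has_derivative_continuous_on_UNIV[OF D])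
  have c1: "continuous_on UNIV (\<lambda>x. k x * D x i)" by (intro continuous_on_mult test_fun_continuous[OF k] c)
  have c2: "continuous_on UNIV (\<lambda>x. pd i k x * \<psi> x)"
    by (intro continuous_on_mult test_fun_continuous[OF test_fun_pd[OF k i]] psic)
  have z1: "k x * D x i = 0" "pd i k x * \<psi> x = 0" if "norm x > R" for x
    using R[OF that] pd_zero_outside[OF R that, where i = i] by simp_all
  have "((\<lambda>x. k x * \<psi> x) has_derivative (\<lambda>h. k x * D x h + (\<Sum>i\<in>Basis. (h \<bullet> i) * pd i k x) * \<psi> x)) (at x)" for x
    by (rule has_derivative_mult[OF k' D])
  from integral_directional_derivative_zero[OF this, of i R]
  have "(LBINT x. k x * D x i + pd i k x * \<psi> x) = 0"
    using R by (simp add: pdi continuous_on_add c1 c2)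
  also have "(LBINT x. k x * D x i + pd i k x * \<psi> x) = (LBINT x. k x * D x i) + (LBINT x. pd i k x * \<psi> x)"
    by (intro Bochner_Integration.integral_add continuous_integrable[OF c1] continuous_integrable[OF c2] z1)
  finally show "(LBINT x. pd i k x *\<^sub>R \<psi> x) = - (LBINT x. k x *\<^sub>R D x i)" by simp
qed

text \<open>The test function is the reflected kernel y -> k(x - y); the sign produced by the
  reflection cancels the sign in the definition of a weak derivative. In this way a derivative moves
  from the kernel onto the function.\<close>

lemma conv_pd_wd:
  assumes k: "test_fun k" and w: "wd f i g"
  shows "conv (pd i k) f x = conv k g x"
proof -
  have "(LBINT y. - pd i k (x - y) *\<^sub>R f y) = - (LBINT y. k (x - y) *\<^sub>R g y)"
    using w[unfolded wd_def, rule_format, OF test_fun_reflect[OF k, of x]] pd_reflect[of k i x] k by (simp add: test_fun_def)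
  then show ?thesis by (simp add: conv_def)
qed

text \<open>Mollification is an average with nonnegative weights of total mass one over a ball of
  radius 1/(n+1). Taking \<open>z = w x\<close> gives convergence at points of continuity, taking
  \<open>z = 0\<close> gives bounds by the supremum.\<close>

lemma moll_conv_diff_le:
  fixes w :: "'a::euclidean_space \<Rightarrow> 'b::euclidean_space"
  assumes w: "l1loc w" and b: "\<And>y. norm y \<le> 1 / (real n + 1) \<Longrightarrow> norm (w (x - y) - z) \<le> M"
  shows "norm (conv (moll n) w x - z) \<le> M"
proof -
  note [measurable] = test_fun_measurable[OF test_fun_moll] l1loc_measurable[OF w]
  have i1: "integrable lborel (\<lambda>y. moll n y *\<^sub>R w (x - y))"
  proof -
    have "integrable (distr lborel borel (\<lambda>y. x - y)) (\<lambda>y. moll n (x - y) *\<^sub>R w y)"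
      using conv_integrable[OF test_fun_moll w, of n x] by (simp add: distr_reflect)
    then show ?thesis by (subst (asm) integrable_distr_eq) auto
  qed
  have i2: "integrable lborel (\<lambda>y::'a. moll n y *\<^sub>R z)" by (intro integrable_scaleR_left test_fun_integrable test_fun_moll)
  have "conv (moll n) w x - z = (LBINT y. moll n y *\<^sub>R w (x - y)) - (\<integral>y. moll n y *\<^sub>R z \<partial>(lborel::'a measure))"
    by (simp add: conv_alt[OF test_fun_moll w] moll_integral test_fun_integrable[OF test_fun_moll])
  also have "\<dots> = (LBINT y. moll n y *\<^sub>R (w (x - y) - z))"
    by (subst Bochner_Integration.integral_diff[OF i1 i2, symmetric]) (simp add: scaleR_diff_right)
  also have "norm \<dots> \<le> (\<integral>y. moll n y * M \<partial>(lborel :: 'a measure))"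
  proof (rule Bochner_Integration.integral_norm_bound_integral)
    show "integrable lborel (\<lambda>y. moll n y *\<^sub>R (w (x - y) - z))"
      using Bochner_Integration.integrable_diff[OF i1 i2] by (simp add: scaleR_diff_right)
    show "integrable lborel (\<lambda>y::'a. moll n y * M)" by (intro integrable_mult_left test_fun_integrable test_fun_moll)
    fix y
    show "norm (moll n y *\<^sub>R (w (x - y) - z)) \<le> moll n y * M"
      using b[of y] moll_zero[of n y] moll_nonneg[of n y]
      by (cases "norm y \<le> 1 / (real n + 1)") (auto intro: mult_left_mono)
  qed
  also have "\<dots> = M" by (simp add: moll_integral)
  finally show ?thesis .
qed

lemma moll_conv_tendsto:
  fixes w :: "'a::euclidean_space \<Rightarrow> 'b::euclidean_space"
  assumes c: "continuous_on UNIV w" shows "(\<lambda>n. conv (moll n) w x) \<longlonglongrightarrow> w x"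
proof (rule LIMSEQ_I)
  fix e :: real assume e: "e > 0"
  have "isCont w x" using c by (simp add: continuous_on_eq_continuous_within)
  then obtain d where d: "d > 0" "\<And>y. dist y x < d \<Longrightarrow> dist (w y) (w x) < e / 2"
    unfolding continuous_at_eps_delta using half_gt_zero[OF e] by blast
  obtain N where N: "1 / real (Suc N) < d" using d(1) nat_approx_posE by metis
  have "norm (conv (moll n) w x - w x) < e" if "n \<ge> N" for n
  proof -
    have "1 / (real n + 1) \<le> 1 / real (Suc N)" using that by (intro divide_left_mono) auto
    then have "1 / (real n + 1) < d" using N by linarith
    then have "norm (conv (moll n) w x - w x) \<le> e / 2"
      by (intro moll_conv_diff_le l2loc_imp_l1loc l2loc_continuous c less_imp_le[OF d(2)[unfolded dist_norm]]) auto
    then show ?thesis using e by simp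
  qed
  then show "\<exists>no. \<forall>n\<ge>no. norm (conv (moll n) w x - w x) < e" by blast
qed

lemma continuous_bounded_support:
  fixes h :: "'a::euclidean_space \<Rightarrow> real"
  assumes "continuous_on UNIV h" "\<And>x. norm x > R \<Longrightarrow> h x = 0"
  obtains M where "M \<ge> 0" "\<And>x. \<bar>h x\<bar> \<le> M"
proof -
  obtain M where "\<forall>x. norm x \<le> R \<longrightarrow> norm (h x) \<le> M" using continuous_bounded_cball[OF assms(1)] by blast
  then have "\<bar>h x\<bar> \<le> max M 0" for x using assms(2)[of x] by (cases "norm x \<le> R") auto
  then show ?thesis using that[of "max M 0"] by auto
qed

lemma moll_conv_integral_tendsto:
  fixes f :: "'a::euclidean_space \<Rightarrow> 'b::euclidean_space"
  assumes h: "continuous_on UNIV h" "\<And>x. norm x > R \<Longrightarrow> h x = 0" and f: "l1loc f"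
  shows "(\<lambda>n. \<integral>x. conv (moll n) h x *\<^sub>R f x \<partial>lborel) \<longlonglongrightarrow> (LBINT x. (h x :: real) *\<^sub>R f x)"
proof -
  obtain M where M: "M \<ge> 0" "\<And>x. \<bar>h x\<bar> \<le> M" using continuous_bounded_support[OF h] by metis
  have h1: "l1loc h" by (intro l2loc_imp_l1loc l2loc_continuous h)
  note [measurable] = conv_measurable[OF test_fun_moll h1] l1loc_measurable[OF h1] l1loc_measurable[OF f]
  show ?thesis
  proof (rule integral_dominated_convergence[where w = "\<lambda>x. M * (indicator (cball 0 (R + 1)) x * norm (f x))"])
    show "integrable lborel (\<lambda>x. M * (indicator (cball 0 (R + 1)) x * norm (f x)))"
      by (intro integrable_mult_right integrable_l1[OF f, of _ "R + 1" 1]) auto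
    show "AE x in lborel. (\<lambda>n. conv (moll n) h x *\<^sub>R f x) \<longlonglongrightarrow> h x *\<^sub>R f x"
      by (intro AE_I2 tendsto_scaleR tendsto_const moll_conv_tendsto h)
    fix n
    show "AE x in lborel. norm (conv (moll n) h x *\<^sub>R f x) \<le> M * (indicator (cball 0 (R + 1)) x * norm (f x))"
    proof (intro AE_I2)
      fix x
      show "norm (conv (moll n) h x *\<^sub>R f x) \<le> M * (indicator (cball 0 (R + 1)) x * norm (f x))"
      proof (cases "norm x \<le> R + 1")
        case True
        have "norm (conv (moll n) h x - 0) \<le> M" by (rule moll_conv_diff_le[OF h1]) (use M in auto)
        then show ?thesis using True by (simp add: mult_right_mono)
      next
        case False
        have "moll n y = 0" if "norm y > 1" for y :: 'a
        proof (rule moll_zero)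
          have "1 / (real n + 1) \<le> 1" by simp
          then show "1 / (real n + 1) \<le> norm y" using that by linarith
        qed
        then have "conv (moll n) h x = 0" using False h(2) by (intro conv_zero_outside[of 1 _ R]) auto
        then show ?thesis using False by simp
      qed
    qed
  qed measurable
qed

text \<open>Radial weights and cutoffs are only once differentiable and so are no test functions.
  Their mollifications are, and the derivative of a mollification is the mollification of the
  classical derivative; both sides then converge because these converge pointwise, boundedly and
  with supports in one ball.\<close>

lemma wd_C1:
  fixes f g :: "'a::euclidean_space \<Rightarrow> 'b::euclidean_space"
  assumes f: "l1loc f" and g: "l1loc g" and w: "wd f i g" and i: "i \<in> Basis"
    and D: "\<And>x. (\<psi> has_derivative D x) (at x)" and c: "continuous_on UNIV (\<lambda>x. D x i)"
    and z: "\<And>x. norm x > R \<Longrightarrow> \<psi> x = (0::real)"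
  shows "(LBINT x. D x i *\<^sub>R f x) = - (LBINT x. \<psi> x *\<^sub>R g x)"
proof -
  have psic: "continuous_on UNIV \<psi>" by (rule has_derivative_continuous_on_UNIV[OF D])
  have p1: "l1loc \<psi>" by (intro l2loc_imp_l1loc l2loc_continuous psic)
  have z': "D x i = 0" if "norm x > R" for x
    using pd_zero_outside[of R \<psi> x i] pd_eq[OF D] z that by metis
  have t: "test_fun (conv (moll n) \<psi>)" for n
  proof (rule test_funI[OF conv_smooth[OF test_fun_moll p1]])
    fix x :: 'a assume "norm x > 1 / (real n + 1) + R"
    then show "conv (moll n) \<psi> x = 0" by (intro conv_zero_outside[of "1 / (real n + 1)" _ R] moll_zero z) auto
  qed
  have "pd i (conv (moll n) \<psi>) x = conv (moll n) (\<lambda>x. D x i) x" for n x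
    by (simp add: pd_conv[OF test_fun_moll p1 i] conv_pd_wd[OF test_fun_moll wd_of_has_derivative[OF D c i]])
  then have "(LBINT x. conv (moll n) (\<lambda>x. D x i) x *\<^sub>R f x) = - (LBINT x. conv (moll n) \<psi> x *\<^sub>R g x)" for n
    using w[unfolded wd_def, rule_format, OF t[of n]] by simp
  moreover have "(\<lambda>n. \<integral>x. conv (moll n) (\<lambda>x. D x i) x *\<^sub>R f x \<partial>lborel) \<longlonglongrightarrow> (LBINT x. D x i *\<^sub>R f x)"
    by (rule moll_conv_integral_tendsto[OF c z' f])
  moreover have "(\<lambda>n. - (LBINT x. conv (moll n) \<psi> x *\<^sub>R g x)) \<longlonglongrightarrow> - (LBINT x. \<psi> x *\<^sub>R g x)"
    by (intro tendsto_minus moll_conv_integral_tendsto[OF psic z g])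
  ultimately show ?thesis using LIMSEQ_unique by simp
qed

subsection \<open>Mollifiers converge in the mean square\<close>

text \<open>Squared L^2 norm with values in the extended nonnegative reals, so that norm
  inequalities can be chained without integrability side conditions.\<close>

definition N2 :: "('a::euclidean_space \<Rightarrow> 'b::euclidean_space) \<Rightarrow> ennreal" where
  "N2 w = (\<integral>\<^sup>+x. ennreal ((norm (w x))\<^sup>2) \<partial>lborel)"

lemma norm_add_sq_le: "(norm (a + b))\<^sup>2 \<le> 2 * (norm a)\<^sup>2 + 2 * (norm (b :: 'b::real_normed_vector))\<^sup>2"
proof -
  have "(norm (a + b))\<^sup>2 \<le> (norm a + norm b)\<^sup>2" by (intro power_mono norm_triangle_ineq) auto
  also have "\<dots> \<le> 2 * (norm a)\<^sup>2 + 2 * (norm b)\<^sup>2"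
    using sum_squares_bound[of "norm a" "norm b"] by (simp add: power2_sum)
  finally show ?thesis .
qed

lemma N2_add_le:
  assumes [measurable]: "u \<in> borel_measurable borel" "v \<in> borel_measurable borel"
  shows "N2 (\<lambda>x. u x + v x) \<le> 2 * N2 u + 2 * N2 v"
proof -
  have "N2 (\<lambda>x. u x + v x) \<le> (\<integral>\<^sup>+x. 2 * ennreal ((norm (u x))\<^sup>2) + 2 * ennreal ((norm (v x))\<^sup>2) \<partial>lborel)"
    unfolding N2_def
    by (intro nn_integral_mono) (simp add: norm_add_sq_le ennreal_mult'[symmetric] ennreal_plus[symmetric] del: ennreal_plus flip: ennreal_numeral)
  also have "\<dots> = 2 * N2 u + 2 * N2 v" unfolding N2_def by (simp add: nn_integral_add nn_integral_cmult)
  finally show ?thesis .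
qed

text \<open>The kernel is a probability density, so the variance of the norm of \<open>z\<close> is
  nonnegative: the square of its mean \<open>c\<close> is at most the mean of the squares. An
  infinite right-hand side is trivial and split off.\<close>

lemma moll_jensen:
  fixes z :: "'a::euclidean_space \<Rightarrow> 'b::euclidean_space"
  assumes [measurable]: "z \<in> borel_measurable borel"
  shows "ennreal ((norm (LBINT y. moll n y *\<^sub>R z y))\<^sup>2) \<le> (\<integral>\<^sup>+y. ennreal (moll n y) * ennreal ((norm (z y))\<^sup>2) \<partial>lborel)"
proof (cases "(\<integral>\<^sup>+y. ennreal (moll n y) * ennreal ((norm (z y))\<^sup>2) \<partial>lborel) < \<infinity>")
  case True
  note [measurable] = test_fun_measurable[OF test_fun_moll[of n, where 'a='a]]
  have mi: "integrable lborel (moll n :: 'a \<Rightarrow> real)" by (rule test_fun_integrable[OF test_fun_moll])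
  have i2: "integrable lborel (\<lambda>y. moll n y * (norm (z y))\<^sup>2)"
    using True by (intro integrableI_bounded) (auto simp: moll_nonneg ennreal_mult)
  have i1: "integrable lborel (\<lambda>y. moll n y * norm (z y))"
  proof (rule Bochner_Integration.integrable_bound)
    show "integrable lborel (\<lambda>y. moll n y * (norm (z y))\<^sup>2 + moll n y)" using i2 mi by simp
    show "AE y in lborel. norm (moll n y * norm (z y)) \<le> norm (moll n y * (norm (z y))\<^sup>2 + moll n y)"
    proof (intro AE_I2)
      fix y :: 'a
      have "2 * norm (z y) \<le> (norm (z y))\<^sup>2 + 1" using sum_squares_bound[of "norm (z y)" 1] by simp
      moreover have "0 \<le> norm (z y)" by simp
      ultimately have "norm (z y) \<le> (norm (z y))\<^sup>2 + 1" by linarith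
      then have "moll n y * norm (z y) \<le> moll n y * ((norm (z y))\<^sup>2 + 1)" by (intro mult_left_mono moll_nonneg)
      then show "norm (moll n y * norm (z y)) \<le> norm (moll n y * (norm (z y))\<^sup>2 + moll n y)"
        by (simp add: moll_nonneg algebra_simps)
    qed
  qed measurable
  define c where "c = (LBINT y. moll n y * norm (z y))"
  have "0 \<le> (LBINT y. moll n y * (norm (z y) - c)\<^sup>2)" by (intro Bochner_Integration.integral_nonneg) (auto simp: moll_nonneg)
  also have "\<dots> = (LBINT y. moll n y * (norm (z y))\<^sup>2 - 2 * c * (moll n y * norm (z y)) + c\<^sup>2 * moll n y)"
    by (intro Bochner_Integration.integral_cong) (auto simp: power2_eq_square algebra_simps)
  also have "\<dots> = (LBINT y. moll n y * (norm (z y))\<^sup>2) - 2 * c * c + c\<^sup>2 * 1"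
    using i1 i2 mi by (simp add: c_def moll_integral)
  finally have "c\<^sup>2 \<le> (LBINT y. moll n y * (norm (z y))\<^sup>2)" by (simp add: power2_eq_square)
  moreover have "norm (LBINT y. moll n y *\<^sub>R z y) \<le> c"
    unfolding c_def using integral_norm_bound[of lborel "\<lambda>y. moll n y *\<^sub>R z y"] by (simp add: moll_nonneg)
  then have "(norm (LBINT y. moll n y *\<^sub>R z y))\<^sup>2 \<le> c\<^sup>2" by (intro power_mono) auto
  ultimately have "(norm (LBINT y. moll n y *\<^sub>R z y))\<^sup>2 \<le> (LBINT y. moll n y * (norm (z y))\<^sup>2)" by linarith
  then have "ennreal ((norm (LBINT y. moll n y *\<^sub>R z y))\<^sup>2) \<le> ennreal (LBINT y. moll n y * (norm (z y))\<^sup>2)"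
    by (rule ennreal_leI)
  also have "\<dots> = (\<integral>\<^sup>+y. ennreal (moll n y * (norm (z y))\<^sup>2) \<partial>lborel)"
    by (rule nn_integral_eq_integral[symmetric, OF i2]) (auto simp: moll_nonneg)
  finally show ?thesis by (simp add: ennreal_mult moll_nonneg)
qed (simp add: not_less top_unique)

text \<open>Jensen pointwise, then exchanging the integrals: each translate of \<open>w\<close> has
  the same norm and the kernel has mass one. Contractivity is what reduces convergence for general
  \<open>w\<close> to a dense class.\<close>

lemma N2_conv_le:
  fixes w :: "'a::euclidean_space \<Rightarrow> 'b::euclidean_space"
  assumes w: "l1loc w" shows "N2 (conv (moll n) w) \<le> N2 w"
proof -
  note [measurable] = test_fun_measurable[OF test_fun_moll[of n, where 'a='a]] l1loc_measurable[OF w]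
  have "N2 (conv (moll n) w) \<le> (\<integral>\<^sup>+x. (\<integral>\<^sup>+y. ennreal (moll n y) * ennreal ((norm (w (x - y)))\<^sup>2) \<partial>lborel) \<partial>lborel)"
    unfolding N2_def conv_alt[OF test_fun_moll w] by (intro nn_integral_mono moll_jensen) measurable
  also have "\<dots> = (\<integral>\<^sup>+y. (\<integral>\<^sup>+x. ennreal (moll n y) * ennreal ((norm (w (x - y)))\<^sup>2) \<partial>lborel) \<partial>lborel)"
    by (rule lborel_pair.Fubini') measurable
  also have "\<dots> = (\<integral>\<^sup>+y. ennreal (moll n y) * N2 w \<partial>(lborel::'a measure))"
    unfolding N2_def by (simp add: nn_integral_cmult nn_integral_translate[of "\<lambda>x. ennreal ((norm (w x))\<^sup>2)"])
  also have "\<dots> = N2 w"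
    by (simp add: nn_integral_multc nn_integral_eq_integral[OF test_fun_integrable[OF test_fun_moll]] moll_nonneg moll_integral)
  finally show ?thesis .
qed

lemma N2_tendsto_dominated:
  fixes w :: "'a::euclidean_space \<Rightarrow> 'b::euclidean_space"
  assumes "\<And>n. u n \<in> borel_measurable borel" "w \<in> borel_measurable borel" "v \<in> borel_measurable borel"
    and "\<And>n x. (norm (u n x - w x))\<^sup>2 \<le> v x" "(\<integral>\<^sup>+x. ennreal (v x) \<partial>lborel) < \<infinity>"
    and "AE x in lborel. (\<lambda>n. u n x) \<longlonglongrightarrow> w x"
  shows "(\<lambda>n. N2 (\<lambda>x. u n x - w x)) \<longlonglongrightarrow> 0"
proof -
  note [measurable] = assms(1-3)
  have "(\<lambda>n. \<integral>\<^sup>+x. ennreal ((norm (u n x - w x))\<^sup>2) \<partial>lborel) \<longlonglongrightarrow> (\<integral>\<^sup>+x. 0 \<partial>(lborel::'a measure))"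
  proof (rule nn_integral_dominated_convergence[where w = "\<lambda>x. ennreal (v x)"])
    show "AE x in lborel. (\<lambda>n. ennreal ((norm (u n x - w x))\<^sup>2)) \<longlonglongrightarrow> 0"
      using assms(6)
    proof eventually_elim
      case (elim x)
      then have "(\<lambda>n. (norm (u n x - w x))\<^sup>2) \<longlonglongrightarrow> (norm (w x - w x))\<^sup>2" by (intro tendsto_intros)
      then have "(\<lambda>n. ennreal ((norm (u n x - w x))\<^sup>2)) \<longlonglongrightarrow> ennreal 0" by (intro tendsto_ennrealI) simp
      then show ?case by simp
    qed
  qed (use assms in \<open>auto intro!: ennreal_leI\<close>)
  then show ?thesis by (simp add: N2_def)
qed

lemma ex_small_of_tendsto_0: "f \<longlonglongrightarrow> (0::ennreal) \<Longrightarrow> e > 0 \<Longrightarrow> \<exists>n::nat. f n < e"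
  using order_tendstoD(2)[of f 0 sequentially e] by (auto simp: eventually_sequentially)

text \<open>Two reductions by dominated convergence: from \<open>w\<close> to its truncation in
  space and in size, then from the truncation to continuous functions converging to it off a
  negligible set, modified so as to share one bound and one support.\<close>

lemma N2_dense:
  fixes w :: "'a::euclidean_space \<Rightarrow> 'b::euclidean_space"
  assumes w: "w \<in> borel_measurable borel" "N2 w < \<infinity>" and e: "e > 0"
  obtains g R where "continuous_on UNIV g" "\<And>x. norm x > R \<Longrightarrow> g x = 0" "N2 (\<lambda>x. w x - g x) < e"
proof -
  note [measurable] = w(1)
  define u where "u = (\<lambda>(n::nat) x. indicator {x. norm x \<le> real n \<and> norm (w x) \<le> real n} x *\<^sub>R w x)"
  have um [measurable]: "u n \<in> borel_measurable borel" for n unfolding u_def by measurable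
  have "(\<lambda>n. N2 (\<lambda>x. u n x - w x)) \<longlonglongrightarrow> 0"
  proof (rule N2_tendsto_dominated[where v = "\<lambda>x. (norm (w x))\<^sup>2"])
    show "(norm (u n x - w x))\<^sup>2 \<le> (norm (w x))\<^sup>2" for n x by (auto simp: u_def indicator_def)
    have "(\<lambda>n. u n x) \<longlonglongrightarrow> w x" for x
    proof (rule tendsto_eventually)
      obtain N :: nat where N: "max (norm x) (norm (w x)) \<le> real N" using real_arch_simple by blast
      show "\<forall>\<^sub>F n in sequentially. u n x = w x"
        by (rule eventually_sequentiallyI[of N]) (use N in \<open>auto simp: u_def indicator_def\<close>)
    qed
    then show "AE x in lborel. (\<lambda>n. u n x) \<longlonglongrightarrow> w x" by simp
  qed (use w in \<open>auto simp: N2_def\<close>)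
  moreover have e4: "e / 4 > 0" using e by (simp add: ennreal_zero_less_divide)
  ultimately obtain n where n: "N2 (\<lambda>x. u n x - w x) < e / 4" by (meson ex_small_of_tendsto_0)
  have "u n measurable_on UNIV"
    by (rule lebesgue_measurable_imp_measurable_on) (auto intro: measurable_completion)
  then obtain N g where N: "negligible N" "\<And>k. continuous_on UNIV (g k)" "\<And>x. x \<notin> N \<Longrightarrow> (\<lambda>k. g k x) \<longlonglongrightarrow> u n x"
    unfolding measurable_on_def by auto
  define B where "B = real n + 1"
  have B: "B > 0" by (simp add: B_def)
  \<comment> \<open>The numerator is 1 where |x| is at most n and 0 beyond B = n + 1; the
    denominator caps the norm at B and leaves smaller values alone. Neither changes the limit
    \<open>u n\<close>.\<close>
  define h where "h = (\<lambda>k x. (max 0 (min 1 (B - norm x)) / max 1 (norm (g k x) / B)) *\<^sub>R g k x)"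
  have hc: "continuous_on UNIV (h k)" for k
    unfolding h_def using B by (intro continuous_intros N(2)) (auto simp: max_def)
  have hm [measurable]: "h k \<in> borel_measurable borel" for k by (rule borel_measurable_continuous_onI[OF hc])
  have h0: "h k x = 0" if "norm x > B" for k x using that by (simp add: h_def)
  have hb: "norm (h k x) \<le> B" for k x
  proof -
    have "norm (h k x) = max 0 (min 1 (B - norm x)) * (norm (g k x) / max 1 (norm (g k x) / B))" by (simp add: h_def)
    also have "\<dots> \<le> 1 * (norm (g k x) / max 1 (norm (g k x) / B))" by (intro mult_right_mono) auto
    also have "\<dots> \<le> B" using B by (auto simp: max_def field_simps)
    finally show ?thesis .
  qed
  have ub: "norm (u n x) \<le> B" "norm x > real n \<Longrightarrow> u n x = 0" for x by (auto simp: u_def indicator_def B_def)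
  have "(\<lambda>k. N2 (\<lambda>x. h k x - u n x)) \<longlonglongrightarrow> 0"
  proof (rule N2_tendsto_dominated[where v = "\<lambda>x. 4 * B\<^sup>2 * indicator (cball 0 B) x"])
    fix k x
    have "norm (h k x - u n x) \<le> 2 * B * indicator (cball 0 B) x"
    proof (cases "norm x \<le> B")
      case True then show ?thesis using norm_triangle_ineq4[of "h k x" "u n x"] hb[of k x] ub(1)[of x] by simp
    next
      case False then show ?thesis using h0[of x k] ub(2)[of x] by (simp add: B_def)
    qed
    then have "(norm (h k x - u n x))\<^sup>2 \<le> (2 * B * indicator (cball 0 B) x)\<^sup>2" by (intro power_mono) auto
    then show "(norm (h k x - u n x))\<^sup>2 \<le> 4 * B\<^sup>2 * indicator (cball 0 B) x"
      by (auto simp: indicator_def power_mult_distrib split: if_splits)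
  next
    have "(\<integral>\<^sup>+x. ennreal (4 * B\<^sup>2 * indicator (cball (0::'a) B) x) \<partial>lborel) = ennreal (4 * B\<^sup>2) * emeasure lborel (cball (0::'a) B)"
      by (simp add: ennreal_mult' ennreal_indicator nn_integral_cmult_indicator)
    also have "\<dots> < \<infinity>" using emeasure_lborel_cball_finite[of "0::'a" B] by (simp add: ennreal_mult_less_top)
    finally show "(\<integral>\<^sup>+x. ennreal (4 * B\<^sup>2 * indicator (cball (0::'a) B) x) \<partial>lborel) < \<infinity>" .
  next
    have "AE x in lebesgue. x \<notin> N" using N(1) by (simp add: negligible_iff_null_sets AE_not_in)
    then have "AE x in lborel. x \<notin> N" by (simp add: AE_completion_iff)
    then show "AE x in lborel. (\<lambda>k. h k x) \<longlonglongrightarrow> u n x"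
    proof eventually_elim
      case (elim x)
      have "(\<lambda>k. h k x) \<longlonglongrightarrow> (max 0 (min 1 (B - norm x)) / max 1 (norm (u n x) / B)) *\<^sub>R u n x"
        unfolding h_def using B by (intro tendsto_intros N(3)[OF elim]) (auto simp: max_def)
      also have "(max 0 (min 1 (B - norm x)) / max 1 (norm (u n x) / B)) *\<^sub>R u n x = u n x"
      proof (cases "norm x \<le> real n")
        case True
        then have "max 0 (min 1 (B - norm x)) = 1" by (simp add: B_def)
        moreover have "max 1 (norm (u n x) / B) = 1" using ub(1)[of x] B by (simp add: field_simps)
        ultimately show ?thesis by simp
      qed (simp add: ub(2))
      finally show ?case .
    qed
  qed measurable
  then obtain k where k: "N2 (\<lambda>x. h k x - u n x) < e / 4" using e4 by (meson ex_small_of_tendsto_0)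
  have sw: "N2 (\<lambda>x. a x - b x) = N2 (\<lambda>x. b x - a x)" for a b :: "'a \<Rightarrow> 'b"
    by (simp add: N2_def norm_minus_commute)
  have n': "N2 (\<lambda>x. w x - u n x) < e / 4" unfolding sw[of w "u n"] by (rule n)
  have k': "N2 (\<lambda>x. u n x - h k x) < e / 4" unfolding sw[of "u n" "h k"] by (rule k)
  have "N2 (\<lambda>x. w x - h k x) = N2 (\<lambda>x. (w x - u n x) + (u n x - h k x))" by simp
  also have "\<dots> \<le> 2 * N2 (\<lambda>x. w x - u n x) + 2 * N2 (\<lambda>x. u n x - h k x)" by (rule N2_add_le) measurable
  also have "\<dots> < e"
  proof (cases "e = \<infinity>")
    case True
    have "N2 (\<lambda>x. w x - u n x) < \<infinity>" "N2 (\<lambda>x. u n x - h k x) < \<infinity>"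
      using order_less_le_trans[OF n' top_greatest] order_less_le_trans[OF k' top_greatest] by simp_all
    then show ?thesis using True by (simp add: ennreal_mult_less_top)
  next
    case False
    then obtain r where r: "e = ennreal r" "r > 0" using e by (cases e) (auto simp: ennreal_less_zero_iff)
    have q: "e / 4 = ennreal (r / 4)" unfolding r(1) using r(2) by (simp add: divide_ennreal[symmetric])
    have "N2 (\<lambda>x. w x - u n x) < ennreal (r / 4)" "N2 (\<lambda>x. u n x - h k x) < ennreal (r / 4)"
      using n' k' unfolding q by auto
    then have "2 * N2 (\<lambda>x. w x - u n x) + 2 * N2 (\<lambda>x. u n x - h k x) < 2 * ennreal (r / 4) + 2 * ennreal (r / 4)"
      by (intro add_strict_mono) (auto simp: ennreal_mult_strict_left_mono)
    also have "\<dots> = e" using r by (simp add: ennreal_mult'[symmetric] ennreal_plus[symmetric] del: ennreal_plus flip: ennreal_numeral)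
    finally show ?thesis .
  qed
  finally have small: "N2 (\<lambda>x. w x - h k x) < e" .
  show ?thesis by (rule that[of "h k" B, OF hc h0 small])
qed

lemma N2_finite_imp_l2loc:
  assumes [measurable]: "w \<in> borel_measurable borel" and f: "N2 w < \<infinity>" shows "l2loc w"
  unfolding l2loc_def set_integrable_def
proof (intro conjI allI)
  fix R
  have "integrable lborel (\<lambda>x. (norm (w x))\<^sup>2)" using f by (intro integrableI_bounded) (auto simp: N2_def)
  then show "integrable lborel (\<lambda>x. indicator (cball 0 R) x *\<^sub>R (norm (w x))\<^sup>2)"
    by (intro integrable_mult_indicator) auto
qed (rule assms(1))

lemma conv_diff:
  assumes "test_fun k" "l1loc v" "l1loc w"
  shows "conv k (\<lambda>x. v x - w x) x = conv k v x - conv k w x"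
  unfolding conv_def scaleR_diff_right
  by (intro Bochner_Integration.integral_diff conv_integrable assms)

lemma moll_support: "norm (y::'a::euclidean_space) > 1 \<Longrightarrow> moll n y = 0"
proof (rule moll_zero)
  assume "norm y > 1"
  moreover have "1 / (real n + 1) \<le> 1" by simp
  ultimately show "1 / (real n + 1) \<le> norm y" by linarith
qed

lemma moll_conv_N2_continuous:
  fixes g :: "'a::euclidean_space \<Rightarrow> 'b::euclidean_space"
  assumes g: "continuous_on UNIV g" "\<And>x. norm x > R \<Longrightarrow> g x = 0"
  shows "(\<lambda>n. N2 (\<lambda>x. conv (moll n) g x - g x)) \<longlonglongrightarrow> 0"
proof -
  have g1: "l1loc g" by (intro l2loc_imp_l1loc l2loc_continuous g)
  obtain M where M: "\<And>x. norm x \<le> R \<Longrightarrow> norm (g x) \<le> M" using continuous_bounded_cball[OF g(1), of R] by auto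
  define B where "B = max M 0"
  have B: "norm (g x) \<le> B" "B \<ge> 0" for x using M[of x] g(2)[of x] by (cases "norm x \<le> R"; auto simp: B_def)+
  show ?thesis
  proof (rule N2_tendsto_dominated[where v = "\<lambda>x. 4 * B\<^sup>2 * indicator (cball 0 (max (R + 1) 0)) x"])
    fix n and x :: 'a
    have cb: "norm (conv (moll n) g x) \<le> B" using moll_conv_diff_le[OF g1, of n x 0 B] B by simp
    have "norm (conv (moll n) g x - g x) \<le> 2 * B * indicator (cball 0 (max (R + 1) 0)) x"
    proof (cases "norm x \<le> R + 1")
      case True then show ?thesis using norm_triangle_ineq4[of "conv (moll n) g x" "g x"] cb B(1)[of x] by simp
    next
      case False
      have "conv (moll n) g x = 0" using False g(2) by (intro conv_zero_outside[of 1 _ R] moll_support) auto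
      then show ?thesis using False g(2)[of x] B by simp
    qed
    then have "(norm (conv (moll n) g x - g x))\<^sup>2 \<le> (2 * B * indicator (cball 0 (max (R + 1) 0)) x)\<^sup>2" by (intro power_mono) auto
    then show "(norm (conv (moll n) g x - g x))\<^sup>2 \<le> 4 * B\<^sup>2 * indicator (cball 0 (max (R + 1) 0)) x"
      by (auto simp: indicator_def power_mult_distrib split: if_splits)
  next
    let ?S = "max (R + 1) 0"
    have "(\<integral>\<^sup>+x. ennreal (4 * B\<^sup>2 * indicator (cball (0::'a) ?S) x) \<partial>lborel) = ennreal (4 * B\<^sup>2) * emeasure lborel (cball (0::'a) ?S)"
      by (simp add: ennreal_mult' ennreal_indicator nn_integral_cmult_indicator)
    also have "\<dots> < \<infinity>" using emeasure_lborel_cball_finite[of "0::'a" ?S] by (simp add: ennreal_mult_less_top)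
    finally show "(\<integral>\<^sup>+x. ennreal (4 * B\<^sup>2 * indicator (cball (0::'a) ?S) x) \<partial>lborel) < \<infinity>" .
  qed (auto intro!: conv_measurable conv_continuous test_fun_moll g1 moll_conv_tendsto g borel_measurable_continuous_onI)
qed

lemma moll_conv_N2:
  fixes w :: "'a::euclidean_space \<Rightarrow> 'b::euclidean_space"
  assumes w: "w \<in> borel_measurable borel" "N2 w < \<infinity>"
  shows "(\<lambda>n. N2 (\<lambda>x. conv (moll n) w x - w x)) \<longlonglongrightarrow> 0"
proof (rule order_tendstoI)
  show "\<forall>\<^sub>F n in sequentially. a < N2 (\<lambda>x. conv (moll n) w x - w x)" if "a < 0" for a
    using that by simp
  fix e :: ennreal assume e: "0 < e"
  \<comment> \<open>The three-term splitting in the proof uses \<open>N2_add_le\<close> twice and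
    costs 2d + 2(2d + 2d) = 10d; a sixteenth of \<open>e\<close> leaves room for a strict
    inequality.\<close>
  define d where "d = (if e = \<infinity> then 1 else enn2real e / 16)"
  have d: "d > 0" "10 * ennreal d < e"
  proof -
    show "d > 0" using e by (auto simp: d_def enn2real_positive_iff top.not_eq_extremum)
    show "10 * ennreal d < e"
    proof (cases "e = \<infinity>")
      case False
      then obtain r where r: "e = ennreal r" "r > 0" using e by (cases e) (auto simp: ennreal_less_zero_iff)
      have "10 * ennreal (r / 16) = ennreal 10 * ennreal (r / 16)" by simp
      also have "\<dots> = ennreal (10 * (r / 16))" using r by (intro ennreal_mult[symmetric]) auto
      also have "\<dots> < e" unfolding r(1) using r(2) by (intro ennreal_lessI) auto
      finally show ?thesis using r by (simp add: d_def)
    qed (simp add: d_def ennreal_mult_less_top)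
  qed
  obtain g R where g: "continuous_on UNIV g" "\<And>x. norm x > R \<Longrightarrow> g x = 0" "N2 (\<lambda>x. w x - g x) < ennreal d"
    using N2_dense[OF w, of "ennreal d"] d by auto
  have w1: "l1loc w" and g1: "l1loc g" by (intro l2loc_imp_l1loc N2_finite_imp_l2loc w l2loc_continuous g)+
  note [measurable] = l1loc_measurable[OF w1] l1loc_measurable[OF g1] conv_measurable[OF test_fun_moll w1] conv_measurable[OF test_fun_moll g1]
  have wg1: "l1loc (\<lambda>x. w x - g x)"
    using g(3) by (intro l2loc_imp_l1loc N2_finite_imp_l2loc) (auto intro: order_less_le_trans)
  have "eventually (\<lambda>n. N2 (\<lambda>x. conv (moll n) g x - g x) < ennreal d) sequentially"
    using moll_conv_N2_continuous[OF g(1,2)] d by (intro order_tendstoD(2)[of _ 0]) auto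
  then show "\<forall>\<^sub>F n in sequentially. N2 (\<lambda>x. conv (moll n) w x - w x) < e"
  proof eventually_elim
    case (elim n)
    have "N2 (\<lambda>x. conv (moll n) w x - w x) = N2 (\<lambda>x. conv (moll n) (\<lambda>x. w x - g x) x + ((conv (moll n) g x - g x) + (g x - w x)))"
      by (simp add: conv_diff[OF test_fun_moll w1 g1] algebra_simps)
    also have "\<dots> \<le> 2 * N2 (conv (moll n) (\<lambda>x. w x - g x)) + 2 * N2 (\<lambda>x. (conv (moll n) g x - g x) + (g x - w x))"
      by (rule N2_add_le) (auto intro: conv_measurable test_fun_moll wg1)
    also have "\<dots> \<le> 2 * N2 (\<lambda>x. w x - g x) + 2 * (2 * N2 (\<lambda>x. conv (moll n) g x - g x) + 2 * N2 (\<lambda>x. g x - w x))"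
      by (intro add_mono mult_left_mono N2_conv_le wg1 N2_add_le) auto
    also have "N2 (\<lambda>x. g x - w x) = N2 (\<lambda>x. w x - g x)" by (simp add: N2_def norm_minus_commute)
    also have "2 * N2 (\<lambda>x. w x - g x) + 2 * (2 * N2 (\<lambda>x. conv (moll n) g x - g x) + 2 * N2 (\<lambda>x. w x - g x))
      \<le> 2 * ennreal d + 2 * (2 * ennreal d + 2 * ennreal d)"
      using elim g(3) by (intro add_mono mult_left_mono) auto
    also have "\<dots> = 10 * ennreal d" by (simp add: mult.assoc[symmetric] distrib_right[symmetric])
    also have "\<dots> < e" by (rule d)
    finally show ?case .
  qed
qed

section \<open>Mean-square convergence on balls and limits of bilinear integrals\<close>

definition l2conv :: "(nat \<Rightarrow> 'a::euclidean_space \<Rightarrow> 'b::euclidean_space) \<Rightarrow> ('a \<Rightarrow> 'b) \<Rightarrow> bool" where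
  "l2conv u w \<longleftrightarrow> (\<forall>n. l2loc (u n)) \<and> l2loc w \<and>
     (\<forall>R. (\<lambda>n. LINT x:cball 0 R|lborel. (norm (u n x - w x))\<^sup>2) \<longlonglongrightarrow> 0)"

lemma l2loc_minus: assumes "l2loc v" shows "l2loc (\<lambda>x. - v x)"
  using l2loc_measurable[OF assms] by (intro l2loc_bound[OF assms]) (auto intro!: exI[of _ 1])

lemma l2loc_diff: "l2loc u \<Longrightarrow> l2loc v \<Longrightarrow> l2loc (\<lambda>x. u x - v x)"
  using l2loc_add[of u "\<lambda>x. - v x"] l2loc_minus[of v] by simp

text \<open>The kernels live in the unit ball, so on the ball of radius R nothing changes if
  \<open>w\<close> is cut off at radius R + 1. The cut function is globally square integrable and
  the global statement applies.\<close>

lemma l2conv_moll: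
  fixes w :: "'a::euclidean_space \<Rightarrow> 'b::euclidean_space"
  assumes w: "l2loc w" shows "l2conv (\<lambda>n. conv (moll n) w) w"
  unfolding l2conv_def
proof (intro conjI allI)
  show cl: "l2loc (conv (moll n) w)" for n by (intro conv_l2loc test_fun_moll l2loc_imp_l1loc w)
  fix R :: real
  define w' where "w' = (\<lambda>x. indicator (cball 0 (R + 1)) x *\<^sub>R w x)"
  note [measurable] = l2loc_measurable[OF w]
  have w'm [measurable]: "w' \<in> borel_measurable borel" unfolding w'_def by measurable
  have fin: "N2 w' < \<infinity>"
  proof -
    have "integrable lborel (\<lambda>x. (norm (w' x))\<^sup>2)"
      by (rule l2loc_prod_integrable[OF w w, of _ "R + 1" 1]) (auto simp: w'_def power2_eq_square)
    then have "(\<integral>\<^sup>+x. ennreal ((norm (w' x))\<^sup>2) \<partial>lborel) = ennreal (LBINT x. (norm (w' x))\<^sup>2)"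
      by (intro nn_integral_eq_integral) auto
    then show ?thesis by (simp add: N2_def)
  qed
  note [measurable] = conv_measurable[OF test_fun_moll l2loc_imp_l1loc[OF N2_finite_imp_l2loc[OF w'm fin]]]
     l2loc_measurable[OF cl]
  have le: "ennreal (LINT x:cball 0 R|lborel. (norm (conv (moll n) w x - w x))\<^sup>2) \<le> N2 (\<lambda>x. conv (moll n) w' x - w' x)" for n
  proof -
    have "set_integrable lborel (cball 0 R) (\<lambda>x. (norm (conv (moll n) w x - w x))\<^sup>2)"
      using l2loc_diff[OF cl w] by (simp add: l2loc_def)
    then have "ennreal (LINT x:cball 0 R|lborel. (norm (conv (moll n) w x - w x))\<^sup>2) = (\<integral>\<^sup>+x. ennreal (indicator (cball 0 R) x *\<^sub>R (norm (conv (moll n) w x - w x))\<^sup>2) \<partial>lborel)"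
      unfolding set_integrable_def set_lebesgue_integral_def
      by (intro nn_integral_eq_integral[symmetric]) auto
    also have "\<dots> \<le> N2 (\<lambda>x. conv (moll n) w' x - w' x)"
      unfolding N2_def
    proof (intro nn_integral_mono ennreal_leI)
      fix x :: 'a
      have "conv (moll n) w x = conv (moll n) w' x" if "norm x \<le> R"
        by (rule conv_cong_cball[of 1]) (use that in \<open>auto simp: w'_def moll_support\<close>)
      then show "indicator (cball 0 R) x *\<^sub>R (norm (conv (moll n) w x - w x))\<^sup>2 \<le> (norm (conv (moll n) w' x - w' x))\<^sup>2"
        by (cases "norm x \<le> R") (auto simp: w'_def)
    qed
    finally show ?thesis .
  qed
  have "(\<lambda>n. ennreal (LINT x:cball 0 R|lborel. (norm (conv (moll n) w x - w x))\<^sup>2)) \<longlonglongrightarrow> 0"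
    by (rule tendsto_sandwich[OF _ _ tendsto_const moll_conv_N2[OF w'm fin]]) (use le in auto)
  then have "(\<lambda>n. ennreal (LINT x:cball 0 R|lborel. (norm (conv (moll n) w x - w x))\<^sup>2)) \<longlonglongrightarrow> ennreal 0" by simp
  then show "(\<lambda>n. LINT x:cball 0 R|lborel. (norm (conv (moll n) w x - w x))\<^sup>2) \<longlonglongrightarrow> 0"
    by (rule tendsto_ennrealD) (auto simp: set_lebesgue_integral_def intro!: Bochner_Integration.integral_nonneg)
qed (rule w)

text \<open>The integral of (f - t g)^2 is a nonnegative quadratic in t. Its value at t = C/B gives
  the claim; if B = 0 it is affine in t and can stay nonnegative only when C = 0.\<close>

lemma integral_cauchy_schwarz:
  fixes f g :: "'a \<Rightarrow> real"
  assumes f: "integrable M (\<lambda>x. (f x)\<^sup>2)" and g: "integrable M (\<lambda>x. (g x)\<^sup>2)" and fg: "integrable M (\<lambda>x. f x * g x)"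
  shows "\<bar>\<integral>x. f x * g x \<partial>M\<bar> \<le> sqrt (\<integral>x. (f x)\<^sup>2 \<partial>M) * sqrt (\<integral>x. (g x)\<^sup>2 \<partial>M)"
proof -
  define A B C where "A = (\<integral>x. (f x)\<^sup>2 \<partial>M)" and "B = (\<integral>x. (g x)\<^sup>2 \<partial>M)" and "C = (\<integral>x. f x * g x \<partial>M)"
  have pos: "0 \<le> A - 2 * t * C + t\<^sup>2 * B" for t
  proof -
    have "0 \<le> (\<integral>x. (f x - t * g x)\<^sup>2 \<partial>M)" by simp
    also have "\<dots> = (\<integral>x. (f x)\<^sup>2 - 2 * t * (f x * g x) + t\<^sup>2 * (g x)\<^sup>2 \<partial>M)"
      by (intro Bochner_Integration.integral_cong) (auto simp: power2_eq_square algebra_simps)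
    also have "\<dots> = A - 2 * t * C + t\<^sup>2 * B" using f g fg by (simp add: A_def B_def C_def)
    finally show ?thesis .
  qed
  have B0: "B \<ge> 0" by (simp add: B_def)
  have "C\<^sup>2 \<le> A * B"
  proof (cases "B = 0")
    case True
    have "C = 0"
    proof (rule ccontr)
      assume "C \<noteq> 0"
      then show False using pos[of "(A + 1) / (2 * C)"] True by (simp add: field_simps)
    qed
    then show ?thesis using True by simp
  next
    case False
    then have "B > 0" using B0 by simp
    then have "0 \<le> A - C\<^sup>2 / B" using pos[of "C / B"] by (simp add: power2_eq_square field_simps)
    then show ?thesis using \<open>B > 0\<close> by (simp add: field_simps)
  qed
  then have "sqrt (C\<^sup>2) \<le> sqrt (A * B)" by (rule real_sqrt_le_mono)
  then show ?thesis by (simp add: A_def B_def C_def real_sqrt_mult)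
qed

lemma l2loc_cauchy_schwarz:
  fixes u :: "'a::euclidean_space \<Rightarrow> 'b::euclidean_space" and v :: "'a \<Rightarrow> 'c::euclidean_space"
  assumes u: "l2loc u" and v: "l2loc v" and h: "(h::'a \<Rightarrow> real) \<in> borel_measurable borel"
    and M: "M \<ge> 0" "\<And>x. norm x \<le> R \<Longrightarrow> norm (h x) \<le> M * (norm (u x) * norm (v x))" and z: "\<And>x. norm x > R \<Longrightarrow> h x = 0"
  shows "\<bar>\<integral>x. h x \<partial>lborel\<bar> \<le> M * (sqrt (LINT x:cball 0 R|lborel. (norm (u x))\<^sup>2) * sqrt (LINT x:cball 0 R|lborel. (norm (v x))\<^sup>2))"
proof -
  let ?i = "\<lambda>x. indicator (cball 0 R) x :: real"
  note [measurable] = l2loc_measurable[OF u] l2loc_measurable[OF v] h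
  have i: "integrable lborel (\<lambda>x. (?i x * norm (u x)) * (?i x * norm (v x)))"
    by (rule l2loc_prod_integrable[OF u v, of _ R 1]) auto
  have "integrable lborel h" by (rule l2loc_prod_integrable[OF u v h M(2) z])
  then have "\<bar>\<integral>x. h x \<partial>lborel\<bar> \<le> (LBINT x. \<bar>h x\<bar>)" using integral_norm_bound[of lborel h] by simp
  also have "\<dots> \<le> (LBINT x. M * ((?i x * norm (u x)) * (?i x * norm (v x))))"
  proof (rule integral_mono)
    show "integrable lborel (\<lambda>x. \<bar>h x\<bar>)" using \<open>integrable lborel h\<close> by simp
    show "integrable lborel (\<lambda>x. M * ((?i x * norm (u x)) * (?i x * norm (v x))))" using i by simp
    fix x
    show "\<bar>h x\<bar> \<le> M * ((?i x * norm (u x)) * (?i x * norm (v x)))"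
      using M(2)[of x] z[of x] by (cases "norm x \<le> R") auto
  qed
  also have "\<dots> = M * (LBINT x. (?i x * norm (u x)) * (?i x * norm (v x)))" by simp
  also have "\<dots> \<le> M * (sqrt (LBINT x. (?i x * norm (u x))\<^sup>2) * sqrt (LBINT x. (?i x * norm (v x))\<^sup>2))"
  proof (intro mult_left_mono M(1) order_trans[OF abs_ge_self integral_cauchy_schwarz] i)
    show "integrable lborel (\<lambda>x. (?i x * norm (u x))\<^sup>2)"
      by (rule l2loc_prod_integrable[OF u u, of _ R 1]) (auto simp: power2_eq_square)
    show "integrable lborel (\<lambda>x. (?i x * norm (v x))\<^sup>2)"
      by (rule l2loc_prod_integrable[OF v v, of _ R 1]) (auto simp: power2_eq_square)
  qed
  also have "(\<lambda>x. (?i x * norm (u x))\<^sup>2) = (\<lambda>x. ?i x * (norm (u x))\<^sup>2)" by (auto simp: indicator_def)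
  also have "(\<lambda>x. (?i x * norm (v x))\<^sup>2) = (\<lambda>x. ?i x * (norm (v x))\<^sup>2)" by (auto simp: indicator_def)
  finally show ?thesis by (simp add: set_lebesgue_integral_def)
qed

text \<open>The one device that carries identities from mollified functions to weak solutions: terms
  in those identities are pointwise bilinear forms with bounded coefficients of bounded support,
  evaluated at locally square integrable functions, so Cauchy-Schwarz on a ball suffices.\<close>

lemma l2conv_bilinear:
  fixes u :: "'a::euclidean_space \<Rightarrow> 'b::euclidean_space" and v :: "'a \<Rightarrow> 'c::euclidean_space" and B :: "'a \<Rightarrow> 'b \<Rightarrow> 'c \<Rightarrow> real"
  assumes U: "l2conv U u" and W: "l2conv W v" and B: "\<And>x. bilinear (B x)"
    and m: "\<And>f g. f \<in> borel_measurable borel \<Longrightarrow> g \<in> borel_measurable borel \<Longrightarrow> (\<lambda>x. B x (f x) (g x)) \<in> borel_measurable borel"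
    and b: "\<And>x a c. norm x \<le> R \<Longrightarrow> \<bar>B x a c\<bar> \<le> M * (norm a * norm c)" and z: "\<And>x a c. norm x > R \<Longrightarrow> B x a c = 0"
  shows "(\<lambda>n. \<integral>x. B x (U n x) (W n x) \<partial>lborel) \<longlonglongrightarrow> (LBINT x. B x (u x) (v x))"
proof -
  have l: "l2loc (U n)" "l2loc u" "l2loc (W n)" "l2loc v" for n using U W by (auto simp: l2conv_def)
  let ?s = "\<lambda>(w :: 'a \<Rightarrow> 'b). sqrt (LINT x:cball 0 R|lborel. (norm (w x))\<^sup>2)"
  let ?t = "\<lambda>(w :: 'a \<Rightarrow> 'c). sqrt (LINT x:cball 0 R|lborel. (norm (w x))\<^sup>2)"
  let ?M = "max M 0"
  have int: "integrable lborel (\<lambda>x. B x (f x) (g x))" if "l2loc f" "l2loc g" for f g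
    by (rule l2loc_prod_integrable[OF that m[OF that[THEN l2loc_measurable]], where R = R and M = M]) (use b z in auto)
  have cs: "\<bar>\<integral>x. B x (f x) (g x) \<partial>lborel\<bar> \<le> ?M * (?s f * ?t g)" if "l2loc f" "l2loc g" for f g
  proof (rule l2loc_cauchy_schwarz[OF that m[OF that[THEN l2loc_measurable]] _ _ z])
    fix x :: 'a assume "norm x \<le> R"
    then have "\<bar>B x (f x) (g x)\<bar> \<le> M * (norm (f x) * norm (g x))" by (rule b)
    also have "\<dots> \<le> ?M * (norm (f x) * norm (g x))" by (intro mult_right_mono) auto
    finally show "norm (B x (f x) (g x)) \<le> ?M * (norm (f x) * norm (g x))" by simp
  qed auto
  let ?e = "\<lambda>n. ?M * (?s (\<lambda>x. U n x - u x) * ?t v) + (?M * (?s u * ?t (\<lambda>x. W n x - v x)) + ?M * (?s (\<lambda>x. U n x - u x) * ?t (\<lambda>x. W n x - v x)))"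
  have bd: "norm ((LBINT x. B x (U n x) (W n x)) - (LBINT x. B x (u x) (v x))) \<le> ?e n" for n
  proof -
    note du = l2loc_diff[OF l(1)[of n] l(2)] and dv = l2loc_diff[OF l(3)[of n] l(4)]
    \<comment> \<open>Each of the three summands contains a difference that tends to zero, paired
      with a fixed function or with another such difference; no separate bound on the approximating
      sequences is required.\<close>
    have "B x (U n x) (W n x) - B x (u x) (v x) = B x (U n x - u x) (v x) + (B x (u x) (W n x - v x) + B x (U n x - u x) (W n x - v x))" for x
      using B[of x] by (simp add: bilinear_lsub bilinear_rsub)
    then have "(LBINT x. B x (U n x) (W n x)) - (LBINT x. B x (u x) (v x))
      = (LBINT x. B x (U n x - u x) (v x)) + ((LBINT x. B x (u x) (W n x - v x)) + (LBINT x. B x (U n x - u x) (W n x - v x)))"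
      using int[OF l(1,3)[of n]] int[OF l(2,4)] int[OF du l(4)] int[OF l(2) dv] int[OF du dv]
      by (simp flip: Bochner_Integration.integral_diff Bochner_Integration.integral_add)
    then show ?thesis
      unfolding real_norm_def
      by (simp only: order_trans[OF abs_triangle_ineq add_mono[OF cs[OF du l(4)] order_trans[OF abs_triangle_ineq add_mono[OF cs[OF l(2) dv] cs[OF du dv]]]]])
  qed
  have su: "(\<lambda>n. ?s (\<lambda>x. U n x - u x)) \<longlonglongrightarrow> sqrt 0"
    by (rule tendsto_real_sqrt) (use U[unfolded l2conv_def] in blast)
  have sv: "(\<lambda>n. ?t (\<lambda>x. W n x - v x)) \<longlonglongrightarrow> sqrt 0"
    by (rule tendsto_real_sqrt) (use W[unfolded l2conv_def] in blast)
  have "?e \<longlonglongrightarrow> ?M * (sqrt 0 * ?t v) + (?M * (?s u * sqrt 0) + ?M * (sqrt 0 * sqrt 0))"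
    by (intro tendsto_intros su sv)
  then have "?e \<longlonglongrightarrow> 0" by simp
  then have "(\<lambda>n. (LBINT x. B x (U n x) (W n x)) - (LBINT x. B x (u x) (v x))) \<longlonglongrightarrow> 0"
    by (rule Lim_null_comparison[rotated]) (use bd in auto)
  then show ?thesis by (simp add: LIM_zero_iff)
qed

subsection \<open>Weak solutions of the Poisson equation\<close>

text \<open>The Laplacian is imposed only in the distributional sense, while the weak gradient is
  carried as explicit data: it is determined only up to null sets, and the multiplier identities are
  quadratic in it.\<close>

definition wsol :: "('a::euclidean_space \<Rightarrow> real) \<Rightarrow> ('a \<Rightarrow> 'a) \<Rightarrow> ('a \<Rightarrow> real) \<Rightarrow> bool" where
  "wsol u Du F \<longleftrightarrow> l2loc u \<and> l2loc Du \<and> l2loc F \<and> (\<forall>i\<in>Basis. wd u i (\<lambda>x. Du x \<bullet> i)) \<and>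
     (\<forall>\<psi>. test_fun \<psi> \<longrightarrow> (LBINT x. u x * laplacian \<psi> x) = (LBINT x. F x * \<psi> x))"

text \<open>\<open>A x\<close> is the Jacobian at \<open>x\<close>, with continuity required
  direction by direction; \<open>tr (A x)\<close> is then the divergence.\<close>

definition C1vf :: "('a::euclidean_space \<Rightarrow> 'a) \<Rightarrow> ('a \<Rightarrow> 'a \<Rightarrow> 'a) \<Rightarrow> bool" where
  "C1vf X A \<longleftrightarrow> (\<forall>x. (X has_derivative A x) (at x)) \<and> (\<forall>e. continuous_on UNIV (\<lambda>x. A x e))"

definition tr :: "('a::euclidean_space \<Rightarrow> 'a) \<Rightarrow> real" where
  "tr A = (\<Sum>i\<in>Basis. A i \<bullet> i)"

lemma div_integral_zero:
  assumes Y: "C1vf Y A" and z: "\<And>x. norm x > R \<Longrightarrow> Y x = 0"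
  shows "(LBINT x. tr (A x)) = 0"
proof -
  have d: "((\<lambda>x. Y x \<bullet> i) has_derivative (\<lambda>h. A x h \<bullet> i)) (at x)" for i x
    using Y by (auto simp: C1vf_def intro!: derivative_eq_intros)
  have c: "continuous_on UNIV (\<lambda>x. A x i \<bullet> i)" for i
    using Y by (auto simp: C1vf_def intro!: continuous_intros)
  have z': "A x i \<bullet> i = 0" if "norm x > R" for x i
    using pd_zero_outside[of R "\<lambda>x. Y x \<bullet> i" x i] pd_eq[OF d, of i i x] z that by simp
  have "(LBINT x. A x i \<bullet> i) = 0" for i
    by (rule integral_directional_derivative_zero[OF d c, of R]) (simp add: z)
  moreover have "integrable lborel (\<lambda>x. A x i \<bullet> i)" for i by (rule continuous_integrable[OF c z'])
  ultimately show ?thesis by (simp add: tr_def)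
qed

lemma C1vf_linear: "C1vf X A \<Longrightarrow> linear (A x)"
  by (auto simp: C1vf_def intro: has_derivative_linear)

lemma C1vf_continuous: "C1vf X A \<Longrightarrow> continuous_on UNIV X"
  by (rule has_derivative_continuous_on_UNIV[of X A]) (auto simp: C1vf_def)

lemma linear_expand:
  assumes "linear L" shows "L h = (\<Sum>i\<in>Basis. (h \<bullet> i) *\<^sub>R L i)"
  by (subst euclidean_representation[of h, symmetric])
     (simp add: linear_sum[OF assms] linear_scale[OF assms] del: euclidean_representation)

context
  fixes u :: "'a::euclidean_space \<Rightarrow> real" and Du :: "'a \<Rightarrow> 'a" and F k :: "'a \<Rightarrow> real"
  assumes sol: "wsol u Du F" and k: "test_fun k"
begin

lemma wsol_l1loc: "l1loc u" "l1loc Du" "l1loc F"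
  using sol by (auto simp: wsol_def intro: l2loc_imp_l1loc)

text \<open>The Hessian of the mollified solution, written as the Jacobian of its mollified
  gradient. One derivative sits on the kernel, so no second derivatives of \<open>u\<close> are
  involved.\<close>

definition hess :: "'a \<Rightarrow> 'a \<Rightarrow> 'a" where
  "hess x h = (\<Sum>i\<in>Basis. (h \<bullet> i) *\<^sub>R conv (pd i k) Du x)"

lemma C1vf_hess: "C1vf (conv k Du) hess"
  unfolding C1vf_def
proof (intro conjI allI)
  show "(conv k Du has_derivative hess x) (at x)" for x
    unfolding hess_def[abs_def] by (rule conv_has_derivative[OF k wsol_l1loc(2)])
  show "continuous_on UNIV (\<lambda>x. hess x e)" for e
    unfolding hess_def by (intro continuous_intros conv_continuous wsol_l1loc test_fun_pd k)
qed

lemma conv_pd_Du: 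
  assumes "i \<in> Basis" "j \<in> Basis" shows "conv (pd i k) Du x \<bullet> j = conv (pd j (pd i k)) u x"
  using conv_pd_wd[OF test_fun_pd[OF k assms(1)], of u j "\<lambda>x. Du x \<bullet> j" x] sol assms
  by (simp add: wsol_def conv_inner[OF test_fun_pd[OF k] wsol_l1loc(2)])

text \<open>Mollification commutes with the equation: testing it with the reflected kernel y -> k(x
  - y) produces two sign changes in each second derivative, hence none in the Laplacian.\<close>

lemma tr_hess: "tr (hess x) = conv k F x"
proof -
  have "hess x i = conv (pd i k) Du x" if "i \<in> Basis" for i
  proof -
    have "hess x i = (\<Sum>j\<in>Basis. if j = i then conv (pd j k) Du x else 0)"
      unfolding hess_def by (intro sum.cong refl) (use that in \<open>auto simp: inner_Basis\<close>)
    then show ?thesis using that by simp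
  qed
  then have "tr (hess x) = (\<Sum>i\<in>Basis. conv (pd i (pd i k)) u x)"
    unfolding tr_def by (intro sum.cong refl) (simp add: conv_pd_Du)
  also have "\<dots> = (LBINT y. (\<Sum>i\<in>Basis. pd i (pd i k) (x - y) * u y))"
    unfolding conv_def using conv_integrable[OF test_fun_pd[OF test_fun_pd[OF k]] wsol_l1loc(1), of _ _ x] by simp
  also have "\<dots> = (LBINT y. u y * laplacian (\<lambda>y. k (x - y)) y)"
  proof (intro Bochner_Integration.integral_cong refl)
    fix y
    have "pd i (pd i (\<lambda>y. k (x - y))) y = pd i (pd i k) (x - y)" if i: "i \<in> Basis" for i
    proof -
      note t = test_fun_pd[OF k i]
      have "pd i (\<lambda>y. k (x - y)) = (\<lambda>y. (-1) * pd i k (x - y))"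
        using pd_reflect[of k i x] k by (simp add: test_fun_def)
      then have "pd i (pd i (\<lambda>y. k (x - y))) = (\<lambda>y. (-1) * pd i (\<lambda>y. pd i k (x - y)) y)"
        using pd_scale[OF test_fun_reflect[OF t, of x], of i "-1"] by simp
      then show ?thesis using pd_reflect[of "pd i k" i x] t by (simp add: test_fun_def)
    qed
    then show "(\<Sum>i\<in>Basis. pd i (pd i k) (x - y) * u y) = u y * laplacian (\<lambda>y. k (x - y)) y"
      by (simp add: laplacian_def sum_distrib_left mult.commute)
  qed
  also have "\<dots> = conv k F x"
    using sol test_fun_reflect[OF k, of x] by (simp add: wsol_def conv_def mult.commute)
  finally show ?thesis .
qed

text \<open>All derivatives can be placed on the kernel by \<open>conv_pd_Du\<close>, so symmetry of
  the Hessian reduces to that of the second derivatives of \<open>k\<close>.\<close>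

lemma hess_symmetric:
  assumes "\<And>i j. i \<in> Basis \<Longrightarrow> j \<in> Basis \<Longrightarrow> pd i (pd j k) = pd j (pd i k)"
  shows "hess x h \<bullet> l = hess x l \<bullet> h"
proof -
  have e: "hess x h \<bullet> l = (\<Sum>i\<in>Basis. \<Sum>j\<in>Basis. (h \<bullet> i) * (l \<bullet> j) * conv (pd j (pd i k)) u x)" for h l
    unfolding hess_def
    by (simp add: inner_sum_left euclidean_inner[of "conv _ _ _" l] sum_distrib_left mult_ac conv_pd_Du)
  show ?thesis
    unfolding e[of h l] e[of l h]
    by (subst sum.swap) (intro sum.cong refl, simp add: assms mult_ac)
qed

end

lemma bilinear_via:
  assumes "\<And>a. linear (f a)" "\<And>b. linear (\<lambda>a. f a b)" shows "bilinear f"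
  using assms by (simp add: bilinear_def)

text \<open>The multiplier identity is the integrated divergence of \<open>(X \<bullet> p) p - |p|\<^sup>2 X / 2\<close> with \<open>p = \<nabla>v\<close>;
  the two Hessian terms cancel because the Hessian is symmetric.\<close>

lemma multiplier_identity_smooth:
  fixes X :: "'a::euclidean_space \<Rightarrow> 'a"
  assumes X: "C1vf X A" and p: "C1vf p P" and sym: "\<And>x h l. P x h \<bullet> l = P x l \<bullet> h"
    and z: "\<And>x. norm x > R \<Longrightarrow> X x = 0"
  shows "(LBINT x. (X x \<bullet> p x) * tr (P x) + A x (p x) \<bullet> p x - tr (A x) * (p x \<bullet> p x) / 2) = 0"
proof -
  define Y where "Y = (\<lambda>x. (X x \<bullet> p x) *\<^sub>R p x - ((p x \<bullet> p x) / 2) *\<^sub>R X x)"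
  define B where "B = (\<lambda>x h. (X x \<bullet> p x) *\<^sub>R P x h + (A x h \<bullet> p x + X x \<bullet> P x h) *\<^sub>R p x
     - (((p x \<bullet> p x) / 2) *\<^sub>R A x h + (p x \<bullet> P x h) *\<^sub>R X x))"
  note Xd = X[unfolded C1vf_def, THEN conjunct1, rule_format] and pd' = p[unfolded C1vf_def, THEN conjunct1, rule_format]
  have "C1vf Y B"
    unfolding C1vf_def
  proof (intro conjI allI)
    fix x
    show "(Y has_derivative B x) (at x)"
      unfolding Y_def B_def by (rule Xd pd' derivative_eq_intros refl)+ (auto simp: Xd pd' inner_commute algebra_simps)
    show "continuous_on UNIV (\<lambda>x. B x e)" for e
      unfolding B_def using X p C1vf_continuous[OF X] C1vf_continuous[OF p]
      by (auto simp: C1vf_def intro!: continuous_intros)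
  qed
  moreover have "tr (B x) = (X x \<bullet> p x) * tr (P x) + A x (p x) \<bullet> p x - tr (A x) * (p x \<bullet> p x) / 2" for x
  proof -
    have 1: "(\<Sum>i\<in>Basis. (A x i \<bullet> p x) * (p x \<bullet> i)) = A x (p x) \<bullet> p x"
      by (subst linear_expand[OF C1vf_linear[OF X], of x "p x"]) (simp add: inner_sum_left mult.commute)
    have 2: "(\<Sum>i\<in>Basis. (v \<bullet> P x i) * (w \<bullet> i)) = v \<bullet> P x w" for v w
      by (subst linear_expand[OF C1vf_linear[OF p], of x w]) (simp add: inner_sum_right mult.commute)
    have "tr (B x) = (X x \<bullet> p x) * tr (P x) + (\<Sum>i\<in>Basis. (A x i \<bullet> p x) * (p x \<bullet> i)) + (\<Sum>i\<in>Basis. (X x \<bullet> P x i) * (p x \<bullet> i))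
       - (p x \<bullet> p x) / 2 * tr (A x) - (\<Sum>i\<in>Basis. (p x \<bullet> P x i) * (X x \<bullet> i))"
      unfolding tr_def B_def
      by (simp add: inner_diff_left inner_add_left distrib_right sum.distrib sum_subtractf sum_distrib_left)
    then show ?thesis using sym[of x "p x" "X x"] unfolding 1 2 by (simp add: inner_commute)
  qed
  ultimately show ?thesis using div_integral_zero[of Y B R] z by (simp add: Y_def)
qed

lemma C1vf_bound:
  assumes X: "C1vf X A" obtains M where "M \<ge> 0" "\<And>x h. norm x \<le> R \<Longrightarrow> norm (A x h) \<le> M * norm h"
proof -
  have "\<forall>i. \<exists>M. \<forall>x. norm x \<le> R \<longrightarrow> norm (A x i) \<le> M"
    using X continuous_bounded_cball[of "\<lambda>x. A x _" R] by (auto simp: C1vf_def)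
  then obtain M where M: "\<And>i x. norm x \<le> R \<Longrightarrow> norm (A x i) \<le> M i" by metis
  show ?thesis
  proof (rule that[of "\<Sum>i\<in>Basis. \<bar>M i\<bar>"])
    fix x h :: 'a assume x: "norm x \<le> R"
    have "norm (A x h) \<le> (\<Sum>i\<in>Basis. norm ((h \<bullet> i) *\<^sub>R A x i))"
      by (subst linear_expand[OF C1vf_linear[OF X]]) (rule norm_sum)
    also have "\<dots> \<le> (\<Sum>i\<in>Basis. norm h * \<bar>M i\<bar>)"
      unfolding norm_scaleR by (intro sum_mono mult_mono) (auto simp: Basis_le_norm intro: order_trans[OF M[OF x] abs_ge_self])
    finally show "norm (A x h) \<le> (\<Sum>i\<in>Basis. \<bar>M i\<bar>) * norm h" by (simp add: sum_distrib_left mult.commute)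
  qed (auto intro: sum_nonneg)
qed

lemma C1vf_zero_outside:
  assumes X: "C1vf X A" and z: "\<And>x. norm x > R \<Longrightarrow> X x = 0" and x: "norm x > R" shows "A x h = 0"
proof -
  have d: "((\<lambda>x. X x \<bullet> i) has_derivative (\<lambda>h. A x h \<bullet> i)) (at x)" for i x
    using X by (auto simp: C1vf_def intro!: derivative_eq_intros)
  have "A x h \<bullet> i = 0" for i
    using pd_zero_outside[of R "\<lambda>x. X x \<bullet> i" x h] pd_eq[OF d, of h i x] z x by simp
  then show ?thesis by (metis inner_eq_zero_iff)
qed

lemma C1vf_tr_continuous: "C1vf X A \<Longrightarrow> continuous_on UNIV (\<lambda>x. tr (A x))"
  unfolding tr_def by (auto simp: C1vf_def intro!: continuous_intros)

lemma C1vf_apply_measurable: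
  assumes X: "C1vf X A" and [measurable]: "f \<in> borel_measurable borel"
  shows "(\<lambda>x. A x (f x)) \<in> borel_measurable borel"
proof -
  have [measurable]: "(\<lambda>x. A x i) \<in> borel_measurable borel" for i
    using X by (auto simp: C1vf_def intro: borel_measurable_continuous_onI)
  have "(\<lambda>x. A x (f x)) = (\<lambda>x. \<Sum>i\<in>Basis. (f x \<bullet> i) *\<^sub>R A x i)"
    by (intro ext linear_expand C1vf_linear[OF X])
  then show ?thesis by simp
qed

text \<open>The mollified gradient is a C^1 field with symmetric Jacobian and trace
  \<open>conv (moll n) F\<close>, so the smooth identity applies to it. Its three terms are bilinear
  in the mollified gradient and right-hand side with coefficients from \<open>X\<close> and
  \<open>A\<close>, and pass to the limit one by one.\<close>

lemma multiplier_identity: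
  fixes X :: "'a::euclidean_space \<Rightarrow> 'a"
  assumes sol: "wsol u Du F" and X: "C1vf X A" and z: "\<And>x. norm x > R \<Longrightarrow> X x = 0"
  shows "(LBINT x. (X x \<bullet> Du x) * F x) + (LBINT x. A x (Du x) \<bullet> Du x) - (LBINT x. tr (A x) * (Du x \<bullet> Du x)) / 2 = 0"
proof -
  have l: "l2loc Du" "l2loc F" using sol by (auto simp: wsol_def)
  note c = l2conv_moll[OF l(1)] l2conv_moll[OF l(2)]
  obtain M1 where M1: "\<And>x. norm x \<le> R \<Longrightarrow> norm (X x) \<le> M1"
    using continuous_bounded_cball[OF C1vf_continuous[OF X], of R] by auto
  obtain M2 where M2: "M2 \<ge> 0" "\<And>x h. norm x \<le> R \<Longrightarrow> norm (A x h) \<le> M2 * norm h" using C1vf_bound[OF X] by metis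
  obtain M3 where M3: "\<And>x. norm x \<le> R \<Longrightarrow> \<bar>tr (A x)\<bar> \<le> M3"
    using continuous_bounded_cball[OF C1vf_tr_continuous[OF X], of R] by auto
  have tz: "tr (A x) = 0" if "norm x > R" for x using C1vf_zero_outside[OF X z that] by (simp add: tr_def)
  note [measurable] = borel_measurable_continuous_onI[OF C1vf_continuous[OF X]]
     borel_measurable_continuous_onI[OF C1vf_tr_continuous[OF X]] C1vf_apply_measurable[OF X]
  have lin: "linear (A x)" for x by (rule C1vf_linear[OF X])
  have b1: "norm ((X x \<bullet> a) * c) \<le> M1 * (norm a * norm c)" if "norm x \<le> R" for x a and c :: real
  proof -
    have "\<bar>X x \<bullet> a\<bar> \<le> norm (X x) * norm a" by (rule Cauchy_Schwarz_ineq2)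
    also have "\<dots> \<le> M1 * norm a" by (intro mult_right_mono M1 that) auto
    finally show ?thesis by (simp add: abs_mult mult_right_mono flip: mult.assoc)
  qed
  have b2: "norm (A x a \<bullet> c) \<le> M2 * (norm a * norm c)" if "norm x \<le> R" for x a c
  proof -
    have "\<bar>A x a \<bullet> c\<bar> \<le> norm (A x a) * norm c" by (rule Cauchy_Schwarz_ineq2)
    also have "\<dots> \<le> M2 * norm a * norm c" by (intro mult_right_mono M2 that) auto
    finally show ?thesis by simp
  qed
  have b3: "norm (tr (A x) * (a \<bullet> c)) \<le> M3 * (norm a * norm c)" if "norm x \<le> R" for x and a c :: 'a
    unfolding norm_mult by (intro mult_mono) (use M3[OF that] in \<open>auto simp: Cauchy_Schwarz_ineq2 intro: order_trans[OF abs_ge_zero]\<close>)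
  let ?p = "\<lambda>n. conv (moll n) Du" and ?f = "\<lambda>n. conv (moll n) F"
  have t1: "(\<lambda>n. \<integral>x. (X x \<bullet> ?p n x) * ?f n x \<partial>lborel) \<longlonglongrightarrow> (LBINT x. (X x \<bullet> Du x) * F x)"
    by (rule l2conv_bilinear[OF c(1) c(2), where B = "\<lambda>x a c. (X x \<bullet> a) * c" and R = R and M = M1])
       (use b1 z in \<open>auto intro!: bilinear_via linearI simp: algebra_simps\<close>)
  have t2: "(\<lambda>n. \<integral>x. A x (?p n x) \<bullet> ?p n x \<partial>lborel) \<longlonglongrightarrow> (LBINT x. A x (Du x) \<bullet> Du x)"
    by (rule l2conv_bilinear[OF c(1) c(1), where B = "\<lambda>x a c. A x a \<bullet> c" and R = R and M = M2])
       (use b2 C1vf_zero_outside[OF X z] in \<open>auto intro!: bilinear_via linearI simp: algebra_simps linear_add[OF lin] linear_scale[OF lin]\<close>)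
  have t3: "(\<lambda>n. \<integral>x. tr (A x) * (?p n x \<bullet> ?p n x) \<partial>lborel) \<longlonglongrightarrow> (LBINT x. tr (A x) * (Du x \<bullet> Du x))"
    by (rule l2conv_bilinear[OF c(1) c(1), where B = "\<lambda>x a c. tr (A x) * (a \<bullet> c)" and R = R and M = M3])
       (use b3 tz in \<open>auto intro!: bilinear_via linearI simp: algebra_simps\<close>)
  have "(LBINT x. (X x \<bullet> ?p n x) * ?f n x) + (LBINT x. A x (?p n x) \<bullet> ?p n x) - (LBINT x. tr (A x) * (?p n x \<bullet> ?p n x)) / 2 = 0" (is "?S n = 0") for n
  proof -
    have lp: "l2loc (?p n)" "l2loc (?f n)" using c by (auto simp: l2conv_def)
    note [measurable] = l2loc_measurable[OF lp(1)] l2loc_measurable[OF lp(2)]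
    have i1: "integrable lborel (\<lambda>x. (X x \<bullet> ?p n x) * ?f n x)"
      by (rule l2loc_prod_integrable[OF lp(1) lp(2) _ b1]) (use z in auto)
    have i2: "integrable lborel (\<lambda>x. A x (?p n x) \<bullet> ?p n x)"
      by (rule l2loc_prod_integrable[OF lp(1) lp(1) _ b2]) (use C1vf_zero_outside[OF X z] in auto)
    have i3: "integrable lborel (\<lambda>x. tr (A x) * (?p n x \<bullet> ?p n x))"
      by (rule l2loc_prod_integrable[OF lp(1) lp(1) _ b3]) (use tz in auto)
    have "(LBINT x. (X x \<bullet> ?p n x) * ?f n x + A x (?p n x) \<bullet> ?p n x - tr (A x) * (?p n x \<bullet> ?p n x) / 2) = 0"
      using multiplier_identity_smooth[OF X C1vf_hess[OF sol test_fun_moll] hess_symmetric[OF sol test_fun_moll pd_moll_commute] z]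
      by (simp add: tr_hess[OF sol test_fun_moll])
    then show ?thesis using i1 i2 i3 by simp
  qed
  then have e: "?S = (\<lambda>n. 0)" by (rule ext)
  have t: "?S \<longlonglongrightarrow> (LBINT x. (X x \<bullet> Du x) * F x) + (LBINT x. A x (Du x) \<bullet> Du x) - (LBINT x. tr (A x) * (Du x \<bullet> Du x)) / 2"
    by (intro tendsto_intros t1 t2 t3) simp
  show ?thesis by (rule LIMSEQ_unique[OF t]) (unfold e, rule tendsto_const)
qed

lemma wd_gradient_conv:
  assumes u: "l1loc u" "l1loc Du" and w: "\<And>i. i \<in> Basis \<Longrightarrow> wd u i (\<lambda>x. Du x \<bullet> i)" and k: "test_fun k"
  shows "(conv k u has_derivative (\<lambda>h. conv k Du x \<bullet> h)) (at x)"
proof -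
  have "(\<Sum>i\<in>Basis. (h \<bullet> i) *\<^sub>R conv (pd i k) u x) = conv k Du x \<bullet> h" for h
    by (simp add: conv_pd_wd[OF k w] conv_inner[OF k u(2), symmetric] euclidean_inner[of "conv k Du x" h] mult.commute)
  then show ?thesis using conv_has_derivative[OF k u(1), of x] by simp
qed

text \<open>Integrated divergence of \<open>\<theta> v \<nabla>u\<close>.\<close>

lemma energy_identity:
  fixes u v \<theta> :: "'a::euclidean_space \<Rightarrow> real"
  assumes sol: "wsol u Du F" and v: "l2loc v" "l2loc Dv" "\<And>i. i \<in> Basis \<Longrightarrow> wd v i (\<lambda>x. Dv x \<bullet> i)"
    and th: "\<And>x. (\<theta> has_derivative (\<lambda>h. T x \<bullet> h)) (at x)" "continuous_on UNIV T" and z: "\<And>x. norm x > R \<Longrightarrow> \<theta> x = 0"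
  shows "(LBINT x. \<theta> x * (Du x \<bullet> Dv x)) + (LBINT x. v x * (T x \<bullet> Du x)) + (LBINT x. \<theta> x * v x * F x) = 0"
proof -
  have l: "l2loc Du" "l2loc F" using sol by (auto simp: wsol_def)
  note c = l2conv_moll[OF l(1)] l2conv_moll[OF l(2)] l2conv_moll[OF v(1)] l2conv_moll[OF v(2)]
  have thc: "continuous_on UNIV \<theta>" by (rule has_derivative_continuous_on_UNIV[OF th(1)])
  obtain M1 where M1: "\<And>x. norm x \<le> R \<Longrightarrow> \<bar>\<theta> x\<bar> \<le> M1" using continuous_bounded_cball[OF thc, of R] by auto
  obtain M2 where M2: "\<And>x. norm x \<le> R \<Longrightarrow> norm (T x) \<le> M2" using continuous_bounded_cball[OF th(2), of R] by auto
  have Tz: "T x = 0" if "norm x > R" for x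
  proof -
    have "T x \<bullet> T x = 0" using pd_zero_outside[of R \<theta> x "T x"] pd_eq[OF th(1), of "T x" x] z that by simp
    then show ?thesis by simp
  qed
  note [measurable] = borel_measurable_continuous_onI[OF thc] borel_measurable_continuous_onI[OF th(2)]
  have b1: "norm (\<theta> x * (a \<bullet> c)) \<le> M1 * (norm a * norm c)" if "norm x \<le> R" for x and a c :: 'a
    unfolding norm_mult by (intro mult_mono) (use M1[OF that] in \<open>auto simp: Cauchy_Schwarz_ineq2 intro: order_trans[OF abs_ge_zero]\<close>)
  have b2: "norm (a * (T x \<bullet> c)) \<le> M2 * (norm a * norm c)" if "norm x \<le> R" for x and a :: real and c :: 'a
  proof -
    have "\<bar>T x \<bullet> c\<bar> \<le> norm (T x) * norm c" by (rule Cauchy_Schwarz_ineq2)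
    also have "\<dots> \<le> M2 * norm c" by (intro mult_right_mono M2 that) auto
    finally have "\<bar>a\<bar> * \<bar>T x \<bullet> c\<bar> \<le> \<bar>a\<bar> * (M2 * norm c)" by (intro mult_left_mono) auto
    then show ?thesis by (simp add: abs_mult mult_ac)
  qed
  have b3: "norm (\<theta> x * a * c) \<le> M1 * (norm a * norm c)" if "norm x \<le> R" for x and a c :: real
    unfolding norm_mult mult.assoc using M1[OF that] by (intro mult_right_mono) auto
  let ?p = "\<lambda>n. conv (moll n) Du" and ?f = "\<lambda>n. conv (moll n) F" and ?v = "\<lambda>n. conv (moll n) v" and ?q = "\<lambda>n. conv (moll n) Dv"
  have t1: "(\<lambda>n. \<integral>x. \<theta> x * (?p n x \<bullet> ?q n x) \<partial>lborel) \<longlonglongrightarrow> (LBINT x. \<theta> x * (Du x \<bullet> Dv x))"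
    by (rule l2conv_bilinear[OF c(1) c(4), where B = "\<lambda>x a c. \<theta> x * (a \<bullet> c)" and R = R and M = M1])
       (use b1 z in \<open>auto intro!: bilinear_via linearI simp: algebra_simps\<close>)
  have t2: "(\<lambda>n. \<integral>x. ?v n x * (T x \<bullet> ?p n x) \<partial>lborel) \<longlonglongrightarrow> (LBINT x. v x * (T x \<bullet> Du x))"
    by (rule l2conv_bilinear[OF c(3) c(1), where B = "\<lambda>x a c. a * (T x \<bullet> c)" and R = R and M = M2])
       (use b2 Tz in \<open>auto intro!: bilinear_via linearI simp: algebra_simps\<close>)
  have t3: "(\<lambda>n. \<integral>x. \<theta> x * ?v n x * ?f n x \<partial>lborel) \<longlonglongrightarrow> (LBINT x. \<theta> x * v x * F x)"
    by (rule l2conv_bilinear[OF c(3) c(2), where B = "\<lambda>x a c. \<theta> x * a * c" and R = R and M = M1])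
       (use b3 z in \<open>auto intro!: bilinear_via linearI simp: algebra_simps\<close>)
  have "(LBINT x. \<theta> x * (?p n x \<bullet> ?q n x)) + (LBINT x. ?v n x * (T x \<bullet> ?p n x)) + (LBINT x. \<theta> x * ?v n x * ?f n x) = 0" (is "?S n = 0") for n
  proof -
    have lp: "l2loc (?p n)" "l2loc (?f n)" "l2loc (?v n)" "l2loc (?q n)" using c by (auto simp: l2conv_def)
    note [measurable] = lp[THEN l2loc_measurable]
    have i1: "integrable lborel (\<lambda>x. \<theta> x * (?p n x \<bullet> ?q n x))"
      by (rule l2loc_prod_integrable[OF lp(1) lp(4) _ b1]) (use z in auto)
    have i2: "integrable lborel (\<lambda>x. ?v n x * (T x \<bullet> ?p n x))"
      by (rule l2loc_prod_integrable[OF lp(3) lp(1) _ b2]) (use Tz in auto)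
    have i3: "integrable lborel (\<lambda>x. \<theta> x * ?v n x * ?f n x)"
      by (rule l2loc_prod_integrable[OF lp(3) lp(2) _ b3]) (use z in auto)
    have p: "C1vf (?p n) (hess Du (moll n))" by (rule C1vf_hess[OF sol test_fun_moll])
    note pD = p[unfolded C1vf_def, THEN conjunct1, rule_format]
    note vD = wd_gradient_conv[OF v(1,2)[THEN l2loc_imp_l1loc] v(3) test_fun_moll]
    define Y where "Y = (\<lambda>x. (\<theta> x * ?v n x) *\<^sub>R ?p n x)"
    define B where "B = (\<lambda>x h. (\<theta> x * ?v n x) *\<^sub>R hess Du (moll n) x h + (\<theta> x * (?q n x \<bullet> h) + (T x \<bullet> h) * ?v n x) *\<^sub>R ?p n x)"
    have "C1vf Y B"
      unfolding C1vf_def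
    proof (intro conjI allI)
      fix x
      have "((\<lambda>x. \<theta> x * ?v n x) has_derivative (\<lambda>h. \<theta> x * (?q n x \<bullet> h) + (T x \<bullet> h) * ?v n x)) (at x)"
        by (rule has_derivative_mult[OF th(1) vD])
      from has_derivative_scaleR[OF this pD]
      show "(Y has_derivative B x) (at x)" unfolding Y_def B_def .
      show "continuous_on UNIV (\<lambda>x. B x e)" for e
        unfolding B_def using p C1vf_continuous[OF p] thc th(2) conv_continuous[OF test_fun_moll v(2)[THEN l2loc_imp_l1loc]]
          has_derivative_continuous_on_UNIV[OF vD]
        by (auto simp: C1vf_def intro!: continuous_intros)
    qed
    then have "(LBINT x. tr (B x)) = 0" by (rule div_integral_zero[of _ _ R]) (simp add: Y_def z)
    moreover have "tr (B x) = \<theta> x * (?p n x \<bullet> ?q n x) + ?v n x * (T x \<bullet> ?p n x) + \<theta> x * ?v n x * ?f n x" for x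
    proof -
      have "tr (B x) = (\<theta> x * ?v n x) * tr (hess Du (moll n) x) + (\<theta> x * (\<Sum>i\<in>Basis. (?q n x \<bullet> i) * (?p n x \<bullet> i)) + ?v n x * (\<Sum>i\<in>Basis. (T x \<bullet> i) * (?p n x \<bullet> i)))"
        unfolding tr_def B_def
        by (simp add: inner_add_left distrib_right distrib_left sum.distrib sum_distrib_left mult_ac)
      then show ?thesis
        by (simp add: tr_hess[OF sol test_fun_moll] euclidean_inner[of "?q n x" "?p n x"] euclidean_inner[of "T x" "?p n x"]
            euclidean_inner[of "?p n x" "?q n x"] mult.commute)
    qed
    ultimately show ?thesis using i1 i2 i3 by simp
  qed
  then have e: "?S = (\<lambda>n. 0)" by (rule ext)
  have t: "?S \<longlonglongrightarrow> (LBINT x. \<theta> x * (Du x \<bullet> Dv x)) + (LBINT x. v x * (T x \<bullet> Du x)) + (LBINT x. \<theta> x * v x * F x)"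
    by (intro tendsto_intros t1 t2 t3)
  show ?thesis by (rule LIMSEQ_unique[OF t]) (unfold e, rule tendsto_const)
qed

text \<open>Only an upper bound on \<open>X \<bullet> G\<close> is available, so the term with the weak gradient \<open>G\<close> of the
  potential \<open>c\<close> survives as an inequality; it is tested against the mollified \<open>u\<close>, which is bounded.\<close>

lemma potential_inequality:
  fixes u c :: "'a::euclidean_space \<Rightarrow> real" and X :: "'a \<Rightarrow> 'a"
  assumes u: "l2loc u" "l2loc Du" "\<And>i. i \<in> Basis \<Longrightarrow> wd u i (\<lambda>x. Du x \<bullet> i)"
    and X: "C1vf X A" and z: "\<And>x. norm x > R \<Longrightarrow> X x = 0"
    and c: "c \<in> borel_measurable borel" "\<And>x. \<bar>c x\<bar> \<le> Q" and G: "l1loc G" "\<And>i. i \<in> Basis \<Longrightarrow> wd c i (\<lambda>x. G x \<bullet> i)"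
    and m: "m \<in> borel_measurable borel" "\<And>x. \<bar>m x\<bar> \<le> N" "\<And>x. norm x > R \<Longrightarrow> m x = 0"
    and XG: "AE x in lborel. X x \<bullet> G x \<le> m x"
  shows "(LBINT x. (tr (A x) * c x) * u x * u x) + 2 * (LBINT x. u x * ((c x *\<^sub>R X x) \<bullet> Du x)) \<ge> - (LBINT x. m x * u x * u x)"
proof -
  note cv = l2conv_moll[OF u(1)] l2conv_moll[OF u(2)]
  have cl: "l1loc c" using c by (intro l2loc_imp_l1loc l2loc_locally_bounded) auto
  obtain M1 where M1: "\<And>x. norm x \<le> R \<Longrightarrow> norm (X x) \<le> M1"
    using continuous_bounded_cball[OF C1vf_continuous[OF X], of R] by auto
  obtain M3 where M3: "\<And>x. norm x \<le> R \<Longrightarrow> \<bar>tr (A x)\<bar> \<le> M3"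
    using continuous_bounded_cball[OF C1vf_tr_continuous[OF X], of R] by auto
  have Az: "A x h = 0" if "norm x > R" for x h using C1vf_zero_outside[OF X z that] .
  then have tz: "tr (A x) = 0" if "norm x > R" for x using that by (simp add: tr_def)
  note [measurable] = borel_measurable_continuous_onI[OF C1vf_continuous[OF X]]
     borel_measurable_continuous_onI[OF C1vf_tr_continuous[OF X]] c(1) m(1) l1loc_measurable[OF G(1)]
  have Q: "Q \<ge> 0" using c(2)[of 0] by simp
  have b1: "norm ((tr (A x) * c x) * a * b) \<le> (M3 * Q) * (norm a * norm b)" if "norm x \<le> R" for x and a b :: real
  proof -
    have "\<bar>tr (A x) * c x\<bar> \<le> M3 * Q" unfolding abs_mult
      using M3[OF that] c(2)[of x] order_trans[OF abs_ge_zero M3[OF that]] by (intro mult_mono) auto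
    then have "\<bar>tr (A x) * c x\<bar> * (\<bar>a\<bar> * \<bar>b\<bar>) \<le> (M3 * Q) * (\<bar>a\<bar> * \<bar>b\<bar>)" by (intro mult_right_mono) auto
    then show ?thesis by (simp add: abs_mult mult_ac)
  qed
  have b2: "norm (a * ((c x *\<^sub>R X x) \<bullet> b)) \<le> (Q * M1) * (norm a * norm b)" if "norm x \<le> R" for x and a :: real and b :: 'a
  proof -
    have "\<bar>(c x *\<^sub>R X x) \<bullet> b\<bar> \<le> norm (c x *\<^sub>R X x) * norm b" by (rule Cauchy_Schwarz_ineq2)
    also have "\<dots> \<le> (Q * M1) * norm b" unfolding norm_scaleR real_norm_def
      using M1[OF that] c(2)[of x] Q by (intro mult_right_mono mult_mono) auto
    finally have "\<bar>a\<bar> * \<bar>(c x *\<^sub>R X x) \<bullet> b\<bar> \<le> \<bar>a\<bar> * ((Q * M1) * norm b)" by (intro mult_left_mono) auto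
    then show ?thesis by (simp add: abs_mult mult_ac)
  qed
  have b3: "norm (m x * a * b) \<le> N * (norm a * norm b)" for x and a b :: real
    unfolding norm_mult mult.assoc using m(2)[of x] by (intro mult_right_mono) auto
  let ?v = "\<lambda>n. conv (moll n) u" and ?p = "\<lambda>n. conv (moll n) Du"
  have t1: "(\<lambda>n. \<integral>x. (tr (A x) * c x) * ?v n x * ?v n x \<partial>lborel) \<longlonglongrightarrow> (LBINT x. (tr (A x) * c x) * u x * u x)"
    by (rule l2conv_bilinear[OF cv(1) cv(1), where B = "\<lambda>x a b. (tr (A x) * c x) * a * b" and R = R and M = "M3 * Q"])
       (use b1 tz in \<open>auto intro!: bilinear_via linearI simp: algebra_simps\<close>)
  have t2: "(\<lambda>n. \<integral>x. ?v n x * ((c x *\<^sub>R X x) \<bullet> ?p n x) \<partial>lborel) \<longlonglongrightarrow> (LBINT x. u x * ((c x *\<^sub>R X x) \<bullet> Du x))"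
    by (rule l2conv_bilinear[OF cv(1) cv(2), where B = "\<lambda>x a b. a * ((c x *\<^sub>R X x) \<bullet> b)" and R = R and M = "Q * M1"])
       (use b2 z in \<open>auto intro!: bilinear_via linearI simp: algebra_simps\<close>)
  have t3: "(\<lambda>n. \<integral>x. m x * ?v n x * ?v n x \<partial>lborel) \<longlonglongrightarrow> (LBINT x. m x * u x * u x)"
    by (rule l2conv_bilinear[OF cv(1) cv(1), where B = "\<lambda>x a b. m x * a * b" and R = R and M = N])
       (use b3 m in \<open>auto intro!: bilinear_via linearI simp: algebra_simps\<close>)
  have le: "(LBINT x. (tr (A x) * c x) * ?v n x * ?v n x) + 2 * (LBINT x. ?v n x * ((c x *\<^sub>R X x) \<bullet> ?p n x)) \<ge> - (LBINT x. m x * ?v n x * ?v n x)" for n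
  proof -
    have lp: "l2loc (?v n)" "l2loc (?p n)" using cv by (auto simp: l2conv_def)
    note [measurable] = lp[THEN l2loc_measurable]
    note vD = wd_gradient_conv[OF u(1,2)[THEN l2loc_imp_l1loc] u(3) test_fun_moll]
    have vc: "continuous_on UNIV (?v n)" by (rule has_derivative_continuous_on_UNIV[OF vD])
    have pc: "continuous_on UNIV (?p n)" by (rule conv_continuous[OF test_fun_moll u(2)[THEN l2loc_imp_l1loc]])
    obtain Mv where Mv: "\<And>x. norm x \<le> R \<Longrightarrow> \<bar>?v n x\<bar> \<le> Mv" using continuous_bounded_cball[OF vc, of R] by auto
    have i1: "integrable lborel (\<lambda>x. (tr (A x) * c x) * ?v n x * ?v n x)"
      by (rule l2loc_prod_integrable[OF lp(1) lp(1) _ b1]) (use tz in auto)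
    have i2: "integrable lborel (\<lambda>x. ?v n x * ((c x *\<^sub>R X x) \<bullet> ?p n x))"
      by (rule l2loc_prod_integrable[OF lp(1) lp(2) _ b2]) (use z in auto)
    have i3: "integrable lborel (\<lambda>x. m x * ?v n x * ?v n x)"
      by (rule l2loc_prod_integrable[OF lp(1) lp(1) _ b3]) (use m in auto)
    define D where "D = (\<lambda>i x h. (X x \<bullet> i) * (?v n x * (?p n x \<bullet> h) + (?p n x \<bullet> h) * ?v n x) + (A x h \<bullet> i) * (?v n x * ?v n x))"
    \<comment> \<open>The components of v^2 X, with v the mollified \<open>u\<close>: C^1 functions
      of bounded support, hence admissible against the weak gradient of \<open>c\<close> by
      \<open>wd_C1\<close>. Summing their derivatives gives the divergence of v^2 X.\<close>
    define \<psi> where "\<psi> = (\<lambda>i x. (X x \<bullet> i) * (?v n x * ?v n x))"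
    have psiD: "(\<psi> i has_derivative D i x) (at x)" for i x
    proof -
      have "((\<lambda>x. X x \<bullet> i) has_derivative (\<lambda>h. A x h \<bullet> i)) (at x)"
        using X by (auto simp: C1vf_def intro!: derivative_eq_intros)
      from has_derivative_mult[OF this has_derivative_mult[OF vD vD]] show ?thesis unfolding \<psi>_def D_def .
    qed
    have Dc: "continuous_on UNIV (\<lambda>x. D i x i)" for i
      unfolding D_def using X C1vf_continuous[OF X] vc pc by (auto simp: C1vf_def intro!: continuous_intros)
    have Dz: "D i x i = 0" if "norm x > R" for i x using z[OF that] Az[OF that] by (simp add: D_def)
    have ig: "integrable lborel (\<lambda>x. \<psi> i x * (G x \<bullet> i))" if i: "i \<in> Basis" for i
    proof (rule integrable_l1[OF G(1), of _ R "M1 * (Mv * Mv)"])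
      fix x :: 'a assume x: "norm x \<le> R"
      have "\<bar>X x \<bullet> i\<bar> \<le> M1" using Basis_le_norm[OF i, of "X x"] M1[OF x] by linarith
      then have "norm (\<psi> i x) \<le> M1 * (Mv * Mv)" unfolding \<psi>_def real_norm_def abs_mult
        using Mv[OF x] order_trans[OF abs_ge_zero Mv[OF x]] by (intro mult_mono) auto
      then show "norm (\<psi> i x * (G x \<bullet> i)) \<le> (M1 * (Mv * Mv)) * norm (G x)"
        unfolding real_norm_def abs_mult using Basis_le_norm[OF i, of "G x"] by (intro mult_mono) (auto intro: order_trans[OF abs_ge_zero])
    qed (auto simp: \<psi>_def z)
    have id: "integrable lborel (\<lambda>x. D i x i * c x)" if i: "i \<in> Basis" for i
    proof -
      obtain MD where MD: "\<And>x. norm x \<le> R \<Longrightarrow> \<bar>D i x i\<bar> \<le> MD" using continuous_bounded_cball[OF Dc, of R i] by auto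
      note [measurable] = borel_measurable_continuous_onI[OF Dc]
      show ?thesis
        by (rule integrable_l1[OF cl, of _ R MD]) (use MD Dz in \<open>auto simp: abs_mult intro: mult_right_mono\<close>)
    qed
    have eq: "(LBINT x. D i x i * c x) = - (LBINT x. \<psi> i x * (G x \<bullet> i))" if i: "i \<in> Basis" for i
      using wd_C1[OF cl l1loc_inner[OF G(1)] G(2)[OF i] i psiD Dc, of R] by (simp add: \<psi>_def z)
    have trD: "(\<Sum>i\<in>Basis. D i x i) = tr (A x) * ?v n x * ?v n x + 2 * ?v n x * (X x \<bullet> ?p n x)" for x
      unfolding D_def tr_def euclidean_inner[of "X x" "?p n x"]
      by (simp add: sum.distrib sum_distrib_left sum_distrib_right algebra_simps)
    have "(LBINT x. (tr (A x) * c x) * ?v n x * ?v n x) + 2 * (LBINT x. ?v n x * ((c x *\<^sub>R X x) \<bullet> ?p n x))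
       = (LBINT x. (\<Sum>i\<in>Basis. D i x i) * c x)"
    proof -
      have "(\<Sum>i\<in>Basis. D i x i) * c x = (tr (A x) * c x) * ?v n x * ?v n x + 2 * (?v n x * ((c x *\<^sub>R X x) \<bullet> ?p n x))" for x
        unfolding trD by (simp add: algebra_simps)
      then show ?thesis using i1 i2 by simp
    qed
    also have "\<dots> = (\<Sum>i\<in>Basis. (LBINT x. D i x i * c x))" using id by (simp add: sum_distrib_right)
    also have "\<dots> = - (\<Sum>i\<in>Basis. (LBINT x. \<psi> i x * (G x \<bullet> i)))" by (simp add: eq sum_negf)
    also have "\<dots> = - (LBINT x. (\<Sum>i\<in>Basis. \<psi> i x * (G x \<bullet> i)))" using ig by simp
    also have "(\<lambda>x. \<Sum>i\<in>Basis. \<psi> i x * (G x \<bullet> i)) = (\<lambda>x. (X x \<bullet> G x) * (?v n x * ?v n x))"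
      by (simp add: \<psi>_def euclidean_inner[of "X _" "G _"] sum_distrib_right sum_distrib_left mult_ac)
    finally have *: "(LBINT x. (tr (A x) * c x) * ?v n x * ?v n x) + 2 * (LBINT x. ?v n x * ((c x *\<^sub>R X x) \<bullet> ?p n x))
       = - (LBINT x. (X x \<bullet> G x) * (?v n x * ?v n x))" .
    have "integrable lborel (\<lambda>x. \<Sum>i\<in>Basis. \<psi> i x * (G x \<bullet> i))" using ig by simp
    also have "(\<lambda>x. \<Sum>i\<in>Basis. \<psi> i x * (G x \<bullet> i)) = (\<lambda>x. (X x \<bullet> G x) * (?v n x * ?v n x))"
      by (simp add: \<psi>_def euclidean_inner[of "X _" "G _"] sum_distrib_right sum_distrib_left mult_ac)
    finally have "(LBINT x. (X x \<bullet> G x) * (?v n x * ?v n x)) \<le> (LBINT x. m x * ?v n x * ?v n x)"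
      using i3 XG by (intro integral_mono_AE) (auto simp: mult.assoc intro!: mult_right_mono elim!: eventually_mono)
    then show ?thesis unfolding * by simp
  qed
  show ?thesis
    by (rule LIMSEQ_le[OF tendsto_minus[OF t3] tendsto_add[OF t1 tendsto_mult[OF tendsto_const t2]]]) (use le in auto)
qed

subsection \<open>Radial multipliers\<close>

lemma rr_ge_1: "rr x \<ge> 1" and rr_pos: "rr x > 0" and rr_sq: "(rr x)\<^sup>2 = 1 + (norm x)\<^sup>2" and norm_le_rr: "norm x \<le> rr x"
proof -
  show 1: "rr x \<ge> 1" by (simp add: rr_def)
  then show "rr x > 0" by linarith
  show "(rr x)\<^sup>2 = 1 + (norm x)\<^sup>2" by (simp add: rr_def add_nonneg_nonneg)
  show "norm x \<le> rr x" unfolding rr_def by (rule real_le_rsqrt) simp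
qed

lemma rr_neq_0 [simp]: "rr x \<noteq> 0" using rr_pos[of x] by simp

lemma rr_has_derivative: "(rr has_derivative (\<lambda>h. (x \<bullet> h) / rr x)) (at (x::'a::euclidean_space))"
proof -
  have "1 + x \<bullet> x > 0" by (simp add: add_pos_nonneg)
  then have "((\<lambda>x. sqrt (1 + x \<bullet> x)) has_derivative (\<lambda>h. (x \<bullet> h) / rr x)) (at x)"
    by (auto intro!: derivative_eq_intros simp: inner_commute field_simps rr_def dot_square_norm)
  moreover have "(rr :: 'a \<Rightarrow> real) = (\<lambda>x. sqrt (1 + x \<bullet> x))" by (simp add: rr_def fun_eq_iff dot_square_norm)
  ultimately show ?thesis by (metis (no_types))
qed

lemma rr_continuous: "continuous_on S rr"
  by (rule continuous_on_subset[OF has_derivative_continuous_on_UNIV[OF rr_has_derivative]]) auto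

lemma rr_measurable [measurable]: "rr \<in> borel_measurable borel"
  by (rule borel_measurable_continuous_onI[OF rr_continuous])

lemma radial_has_derivative:
  assumes "\<And>t. t > 0 \<Longrightarrow> (f has_real_derivative f' t) (at t)"
  shows "((\<lambda>x. f (rr x)) has_derivative (\<lambda>h. f' (rr x) * ((x \<bullet> h) / rr x))) (at x)"
  using has_derivative_compose[OF rr_has_derivative assms[OF rr_pos, unfolded has_field_derivative_def]] .

lemma radial_continuous:
  assumes "continuous_on {0<..} f" shows "continuous_on UNIV (\<lambda>x::'a::euclidean_space. f (rr x))"
  by (rule continuous_on_compose2[OF assms rr_continuous]) (auto simp: rr_pos)

text \<open>The field f(r) \<omega> with \<omega> = x/r, the gradient of r. The regularised radius r
  \<ge> 1 keeps it differentiable at the origin.\<close>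

definition rad :: "(real \<Rightarrow> real) \<Rightarrow> 'a::euclidean_space \<Rightarrow> 'a" where
  "rad f x = (f (rr x) / rr x) *\<^sub>R x"

text \<open>Jacobian of f(r) x/r, namely (f/r) times the identity plus (f' - f/r) times the rank-one
  map in the direction of x.\<close>

definition rad_deriv :: "(real \<Rightarrow> real) \<Rightarrow> (real \<Rightarrow> real) \<Rightarrow> 'a::euclidean_space \<Rightarrow> 'a \<Rightarrow> 'a" where
  "rad_deriv f f' x h = (f (rr x) / rr x) *\<^sub>R h + ((f' (rr x) - f (rr x) / rr x) * ((x \<bullet> h) / (rr x)\<^sup>2)) *\<^sub>R x"

lemma C1vf_rad:
  assumes f: "\<And>t. t > 0 \<Longrightarrow> (f has_real_derivative f' t) (at t)" and c: "continuous_on {0<..} f'"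
  shows "C1vf (rad f :: 'a::euclidean_space \<Rightarrow> 'a) (rad_deriv f f')"
  unfolding C1vf_def
proof (intro conjI allI)
  have fc: "continuous_on {0<..} f"
    using f by (auto intro!: DERIV_isCont continuous_at_imp_continuous_on)
  fix x :: 'a
  have "((\<lambda>x. f (rr x) / rr x) has_derivative (\<lambda>h. (f' (rr x) * ((x \<bullet> h) / rr x) * rr x - f (rr x) * ((x \<bullet> h) / rr x)) / (rr x * rr x))) (at x)"
    by (rule has_derivative_divide'[OF radial_has_derivative[OF f] rr_has_derivative]) (use rr_pos[of x] in auto)
  from has_derivative_scaleR[OF this has_derivative_ident]
  have "(rad f has_derivative (\<lambda>h. (f (rr x) / rr x) *\<^sub>R h + ((f' (rr x) * ((x \<bullet> h) / rr x) * rr x - f (rr x) * ((x \<bullet> h) / rr x)) / (rr x * rr x)) *\<^sub>R x)) (at x)"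
    unfolding rad_def[abs_def] .
  moreover have "(f' (rr x) * ((x \<bullet> h) / rr x) * rr x - f (rr x) * ((x \<bullet> h) / rr x)) / (rr x * rr x) = (f' (rr x) - f (rr x) / rr x) * ((x \<bullet> h) / (rr x)\<^sup>2)" for h
    using rr_pos[of x] by (simp add: field_simps power2_eq_square)
  ultimately show "(rad f has_derivative rad_deriv f f' x) (at x)" unfolding rad_deriv_def[abs_def] by simp
  show "continuous_on UNIV (\<lambda>x. rad_deriv f f' x e)" for e :: 'a
    unfolding rad_deriv_def using radial_continuous[OF fc] radial_continuous[OF c] rr_pos
    by (auto intro!: continuous_intros rr_continuous simp: less_imp_neq[symmetric])
qed

text \<open>The rank-one part has trace |x|^2/r^2 = 1 - 1/r^2. This is the origin of the inverse
  square corrections that recur below.\<close>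

lemma tr_rad_deriv:
  "tr (rad_deriv f f' (x::'a::euclidean_space)) = f' (rr x) * (1 - 1 / (rr x)\<^sup>2) + f (rr x) / rr x * (DIM('a) - 1 + 1 / (rr x)\<^sup>2)"
proof -
  have "tr (rad_deriv f f' x) = (f (rr x) / rr x) * DIM('a) + (f' (rr x) - f (rr x) / rr x) / (rr x)\<^sup>2 * (\<Sum>i\<in>Basis. (x \<bullet> i) * (x \<bullet> i))"
    unfolding tr_def rad_deriv_def
    by (simp add: inner_add_left sum.distrib sum_distrib_left sum_divide_distrib mult_ac)
  also have "(\<Sum>i\<in>Basis. (x \<bullet> i) * (x \<bullet> i)) = (rr x)\<^sup>2 - 1" by (simp add: rr_sq dot_square_norm flip: euclidean_inner)
  also have "(f' (rr x) - f (rr x) / rr x) / (rr x)\<^sup>2 * ((rr x)\<^sup>2 - 1) = (f' (rr x) - f (rr x) / rr x) * (1 - 1 / (rr x)\<^sup>2)"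
  proof -
    have "a / b * (b - 1) = a * (1 - 1 / b)" if "b \<noteq> 0" for a b :: real using that by (simp add: field_simps)
    then show ?thesis by simp
  qed
  finally show ?thesis by (simp add: algebra_simps)
qed

text \<open>The quadratic form splits into a radial part with coefficient f' and an angular part
  with coefficient f/r. The angular part is the reserve from which wrong signs are paid
  later.\<close>

lemma rad_deriv_inner:
  "rad_deriv f f' x y \<bullet> y = f' (rr x) * ((x \<bullet> y) / rr x)\<^sup>2 + f (rr x) / rr x * (y \<bullet> y - ((x \<bullet> y) / rr x)\<^sup>2)"
  by (simp add: rad_deriv_def inner_add_left power2_eq_square algebra_simps)

lemma rad_inner: "rad f x \<bullet> y = f (rr x) * ((x \<bullet> y) / rr x)"
  by (simp add: rad_def)

lemma abs_radial_le: "\<bar>(x \<bullet> y) / rr x\<bar> \<le> norm y"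
proof -
  have "\<bar>x \<bullet> y\<bar> \<le> rr x * norm y"
    by (rule order_trans[OF Cauchy_Schwarz_ineq2]) (intro mult_right_mono norm_le_rr, simp)
  then show ?thesis using rr_pos[of x] by (simp add: abs_divide divide_le_eq mult.commute)
qed

text \<open>Null sets of radii pull back to null sets: by Fubini in dilation parameter and point.\<close>

lemma AE_radial_notin:
  assumes N: "negligible (N :: real set)"
  shows "AE x in (lborel :: 'a::euclidean_space measure). rr x \<notin> N"
proof -
  have "AE t in lebesgue. t \<notin> N" using N by (simp add: negligible_iff_null_sets AE_not_in)
  then have "AE t in lborel. t \<notin> N" by (simp add: AE_completion_iff)
  then obtain N' where N': "N \<subseteq> N'" "N' \<in> null_sets lborel" by (auto elim!: AE_E simp: null_sets_def)
  have [measurable]: "N' \<in> sets borel" using N' by (auto simp: null_sets_def)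
  have negN': "negligible N'" using N'(2) by (simp add: negligible_iff_null_sets null_sets_completionI)
  let ?I = "\<lambda>t (x::'a). indicator {1..2::real} t * indicator N' (rr (t *\<^sub>R x)) :: ennreal"
  have inner0: "(\<integral>\<^sup>+t. ?I t x \<partial>lborel) = 0" if x: "x \<noteq> 0" for x
  proof -
    \<comment> \<open>Inverts t -> \<open>rr (t *\<^sub>R x)\<close>: the radius s is reached at t =
      sqrt(s^2 - 1)/|x|. This is differentiable for s > 1, so null sets of radii give null sets of
      dilations.\<close>
    define f where "f = (\<lambda>s. sqrt (s\<^sup>2 - 1) / norm x)"
    have "f differentiable_on (N' \<inter> {1<..})"
      unfolding differentiable_on_def
    proof
      fix s assume "s \<in> N' \<inter> {1<..}"
      then have s: "s > 1" by simp
      then have "s\<^sup>2 - 1 > 0" using one_less_power[of s 2] by simp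
      then have "(f has_real_derivative (inverse (sqrt (s\<^sup>2 - 1)) / 2 * (2 * s)) / norm x) (at s)"
        unfolding f_def using x by (auto intro!: derivative_eq_intros)
      then show "f differentiable at s within N' \<inter> {1<..}"
        by (meson real_differentiable_def differentiable_at_withinI)
    qed
    then have "negligible (f ` (N' \<inter> {1<..}))"
      by (intro negligible_differentiable_image_negligible negligible_subset[OF negN']) auto
    moreover have "{t \<in> {1..2}. rr (t *\<^sub>R x) \<in> N'} \<subseteq> f ` (N' \<inter> {1<..})"
    proof
      fix t assume t: "t \<in> {t \<in> {1..2}. rr (t *\<^sub>R x) \<in> N'}"
      have "(rr (t *\<^sub>R x))\<^sup>2 > 1\<^sup>2" using t x by (auto simp: rr_sq)
      then have gt: "rr (t *\<^sub>R x) > 1" using rr_pos[of "t *\<^sub>R x"] by (rule power2_less_imp_less[OF _ less_imp_le])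
      have "f (rr (t *\<^sub>R x)) = t" unfolding f_def rr_sq using t x by simp
      then show "t \<in> f ` (N' \<inter> {1<..})" using gt t by (metis (no_types, lifting) IntI greaterThan_iff imageI mem_Collect_eq)
    qed
    ultimately have neg: "negligible {t \<in> {1..2}. rr (t *\<^sub>R x) \<in> N'}" by (rule negligible_subset)
    have m: "{t \<in> {1..2}. rr (t *\<^sub>R x) \<in> N'} \<in> sets borel" by measurable
    have "{t \<in> {1..2}. rr (t *\<^sub>R x) \<in> N'} \<in> null_sets lborel"
      using neg m by (auto simp: negligible_iff_null_sets null_sets_def)
    then have "AE t in lborel. t \<notin> {t \<in> {1..2}. rr (t *\<^sub>R x) \<in> N'}" by (rule AE_not_in)
    then have "(\<integral>\<^sup>+t. ?I t x \<partial>lborel) = (\<integral>\<^sup>+t. 0 \<partial>(lborel::real measure))"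
      by (intro nn_integral_cong_AE) (auto simp: indicator_def elim!: eventually_mono)
    then show ?thesis by simp
  qed
  have "(\<integral>\<^sup>+t. (\<integral>\<^sup>+x. ?I t x \<partial>lborel) \<partial>lborel) = (\<integral>\<^sup>+x. (\<integral>\<^sup>+t. ?I t x \<partial>lborel) \<partial>lborel)"
    by (rule lborel_pair.Fubini') measurable
  also have "\<dots> = (\<integral>\<^sup>+x. 0 \<partial>(lborel::'a measure))"
  proof (intro nn_integral_cong_AE)
    have "AE x in lborel. x \<notin> {0::'a}" by (intro AE_not_in) (simp add: null_sets_def)
    then show "AE x in lborel. (\<integral>\<^sup>+t. ?I t x \<partial>lborel) = 0" using inner0 by (auto elim!: eventually_mono)
  qed
  finally have z: "(\<integral>\<^sup>+t. (\<integral>\<^sup>+x. ?I t x \<partial>lborel) \<partial>lborel) = 0" by simp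
  have "AE t in lborel. (\<integral>\<^sup>+x. ?I t x \<partial>lborel) = 0"
    by (subst nn_integral_0_iff_AE[symmetric]) (measurable, rule z)
  \<comment> \<open>Since [1,2] has positive measure, one dilation is good; scaling by this single t
    transfers the null set statement back to the undilated radius.\<close>
  then have "\<exists>t\<in>{1..2}. (\<integral>\<^sup>+x. ?I t x \<partial>lborel) = 0"
  proof (rule contrapos_pp)
    assume "\<not> (\<exists>t\<in>{1..2}. (\<integral>\<^sup>+x. ?I t x \<partial>lborel) = 0)"
    then have a: "\<forall>t\<in>{1..2}. (\<integral>\<^sup>+x. ?I t x \<partial>lborel) \<noteq> 0" by blast
    show "\<not> (AE t in lborel. (\<integral>\<^sup>+x. ?I t x \<partial>lborel) = 0)"
    proof
      assume "AE t in lborel. (\<integral>\<^sup>+x. ?I t x \<partial>lborel) = 0"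
      then have "AE t in lborel. t \<notin> {1..2::real}" using a by (auto elim!: eventually_mono)
      then have "{1..2::real} \<in> null_sets lborel" by (subst (asm) AE_iff_null_sets[symmetric]) auto
      then show False by (simp add: null_sets_def)
    qed
  qed
  then obtain t where t: "t \<in> {1..2}" "(\<integral>\<^sup>+x. ?I t x \<partial>lborel) = 0" by blast
  have "AE x in lborel. ?I t x = 0"
    using t(2) by (subst (asm) nn_integral_0_iff_AE) auto
  then have "AE x in lborel. rr (t *\<^sub>R (x::'a)) \<notin> N'"
    using t(1) by (auto simp: indicator_def elim!: eventually_mono split: if_splits)
  then have "AE x in lborel. rr (x::'a) \<notin> N'"
    using t(1) by (subst lborel_affine[of t 0]) (auto simp: AE_density AE_distr_iff)
  then show ?thesis using N'(1) by (auto elim!: eventually_mono)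
qed

text \<open>Working form of the hypotheses: \<open>w0\<close> is nonnegative and integrable on the
  whole line, the components of the weak gradient are assembled into one field \<open>G\<close>, and
  a single constant \<open>Q\<close> bounds both parts of the potential. Global nonnegativity makes
  the primitive of \<open>w0\<close> monotone.\<close>

locale potential =
  fixes V Vsr Vlr :: "'a::euclidean_space \<Rightarrow> real" and G :: "'a \<Rightarrow> 'a" and w0 :: "real \<Rightarrow> real" and Q :: real
  assumes w0_meas [measurable]: "w0 \<in> borel_measurable borel"
    and w0_nonneg: "0 \<le> w0 t" and w0_lim: "((\<lambda>t. t * w0 t) \<longlongrightarrow> 0) at_top"
    and w0_bdd: "\<exists>B. \<forall>t\<le>b. w0 t \<le> B" and w0_int: "integrable lborel w0"
    and Vsr_meas [measurable]: "Vsr \<in> borel_measurable borel" and Vlr_meas [measurable]: "Vlr \<in> borel_measurable borel"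
    and Vsr_Q: "\<bar>Vsr x\<bar> \<le> Q" and Vlr_Q: "\<bar>Vlr x\<bar> \<le> Q" and V_eq: "V x = Vsr x + Vlr x"
    and G_l1loc: "l1loc G" and G_wd: "i \<in> Basis \<Longrightarrow> wd Vlr i (\<lambda>x. G x \<bullet> i)"
    and Vlr_lim: "(Vlr \<longlongrightarrow> 0) at_infinity"
    and G_le: "AE x in lborel. (x \<bullet> G x) / rr x \<le> w0 (rr x)"
    and Vsr_le: "\<bar>Vsr x\<bar> \<le> w0 (rr x)"
begin

lemma Q_nonneg: "Q \<ge> 0" using Vsr_Q[of 0] by simp

definition esol :: "real \<Rightarrow> ('a \<Rightarrow> real) \<Rightarrow> ('a \<Rightarrow> 'a) \<Rightarrow> bool" where
  "esol E u Du \<longleftrightarrow> wsol u Du (\<lambda>x. (V x - E) * u x)"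

text \<open>A constant has zero weak gradient because the derivative of a test function integrates
  to zero. It allows the energy to be merged with the long-range part before integrating by
  parts.\<close>

lemma wd_shift:
  assumes "i \<in> Basis" shows "wd (\<lambda>x. Vlr x - E) i (\<lambda>x. G x \<bullet> i)"
  unfolding wd_def
proof (intro allI impI)
  fix k :: "'a \<Rightarrow> real" assume k: "test_fun k"
  note t = test_fun_pd[OF k assms]
  obtain R where R: "\<And>x. norm x > R \<Longrightarrow> k x = 0" using test_fun_support[OF k] by metis
  have pdi: "(\<Sum>j\<in>Basis. (i \<bullet> j) * pd j k x) = pd i k x" for x
    using pd_eq[OF test_fun_has_derivative[OF k], of i x] by simp
  have "(LBINT x. pd i k x) = 0"
    using integral_directional_derivative_zero[OF test_fun_has_derivative[OF k], of i R] R test_fun_continuous[OF t]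
    by (simp add: pdi)
  moreover have "integrable lborel (\<lambda>x. pd i k x * Vlr x)"
  proof (rule Bochner_Integration.integrable_bound[of _ "\<lambda>x. Q * pd i k x"])
    show "AE x in lborel. norm (pd i k x * Vlr x) \<le> norm (Q * pd i k x)"
      using Vlr_Q Q_nonneg by (auto simp: abs_mult mult.commute intro!: AE_I2 mult_right_mono)
    show "(\<lambda>x. pd i k x * Vlr x) \<in> borel_measurable lborel" using test_fun_measurable[OF t] by simp
  qed (use test_fun_integrable[OF t] in simp)
  ultimately show "(LBINT x. pd i k x *\<^sub>R (Vlr x - E)) = - (LBINT x. k x *\<^sub>R (G x \<bullet> i))"
    using G_wd[OF assms] k test_fun_integrable[OF t] by (simp add: wd_def right_diff_distrib)
qed

section \<open>The integrand of the combined multiplier inequality\<close>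

definition cD :: "('a \<Rightarrow> 'a) \<Rightarrow> 'a \<Rightarrow> real" where "cD Du x = Du x \<bullet> Du x"
definition cs :: "('a \<Rightarrow> 'a) \<Rightarrow> 'a \<Rightarrow> real" where "cs Du x = (x \<bullet> Du x) / rr x"

text \<open>\<open>a1\<close> to \<open>a4\<close> are the coefficients of f', f, g and g' after the
  multiplier identity, half of the potential inequality and the energy identity have been added up.
  \<open>cs\<close> is the component of the gradient along x/r. The last term of \<open>a2\<close>
  is the price for knowing only an upper bound on the radial derivative of
  \<open>Vlr\<close>.\<close>

definition a1 where "a1 E u Du x = (cs Du x)\<^sup>2 - (1 - 1 / (rr x)\<^sup>2) / 2 * (cD Du x - (E - Vlr x) * (u x)\<^sup>2)"
definition a2 where "a2 E u Du x = (cD Du x - (cs Du x)\<^sup>2) / rr x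
   - (real DIM('a) - 1 + 1 / (rr x)\<^sup>2) / rr x / 2 * (cD Du x - (E - Vlr x) * (u x)\<^sup>2)
   + Vsr x * u x * cs Du x - w0 (rr x) * (u x)\<^sup>2 / 2"
definition a3 where "a3 E u Du x = cD Du x - (E - Vlr x) * (u x)\<^sup>2 + Vsr x * (u x)\<^sup>2"
definition a4 where "a4 u Du x = u x * cs Du x"

definition Sf where
  "Sf E u Du f f' g g' x = f' (rr x) * a1 E u Du x + f (rr x) * a2 E u Du x + g (rr x) * a3 E u Du x + g' (rr x) * a4 u Du x"

text \<open>Three ingredients are added: the multiplier identity for \<open>rad f\<close>, half of
  the potential inequality with bound f \<open>w0\<close>, and the energy identity with weight g(r)
  and v = u. The term pairing \<open>(Vlr x - E) * u x\<close> with the radial derivative occurs in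
  the first two and is eliminated between them. Nonnegativity of \<open>f\<close> keeps the
  direction of the bound on the radial derivative of \<open>Vlr\<close>.\<close>

lemma multiplier_inequality_smooth:
  assumes sol: "esol E u Du"
    and f: "\<And>t. t > 0 \<Longrightarrow> (f has_real_derivative f' t) (at t)" "continuous_on {0<..} f'" "\<And>t. t > 0 \<Longrightarrow> f t \<ge> 0" "\<And>t. t \<ge> M \<Longrightarrow> f t = 0"
    and g: "\<And>t. t > 0 \<Longrightarrow> (g has_real_derivative g' t) (at t)" "continuous_on {0<..} g'" "\<And>t. t \<ge> M \<Longrightarrow> g t = 0"
  shows "(LBINT x. Sf E u Du f f' g g' x) \<le> 0"
proof -
  have l: "l2loc u" "l2loc Du" "\<And>i. i \<in> Basis \<Longrightarrow> wd u i (\<lambda>x. Du x \<bullet> i)" using sol by (auto simp: esol_def wsol_def)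
  note X = C1vf_rad[OF f(1,2), where 'a = 'a]
  have out: "rr x \<ge> M" if "norm x > M" for x :: 'a using that norm_le_rr[of x] by linarith
  have Xz: "rad f x = 0" if "norm x > M" for x :: 'a using f(4)[OF out[OF that]] by (simp add: rad_def)
  have fc: "continuous_on {0<..} f" and gc: "continuous_on {0<..} g"
    using f(1) g(1) by (auto intro!: DERIV_isCont continuous_at_imp_continuous_on)
  note fcu = radial_continuous[OF fc, where 'a='a] and gcu = radial_continuous[OF gc, where 'a='a]
    and g'cu = radial_continuous[OF g(2), where 'a='a]
  note [measurable] = borel_measurable_continuous_onI[OF fcu] borel_measurable_continuous_onI[OF gcu]
    borel_measurable_continuous_onI[OF g'cu] l2loc_measurable[OF l(1)] l2loc_measurable[OF l(2)]
    borel_measurable_continuous_onI[OF C1vf_continuous[OF X]] borel_measurable_continuous_onI[OF C1vf_tr_continuous[OF X]]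
    C1vf_apply_measurable[OF X]
  obtain Bf where Bf: "\<And>x::'a. norm x \<le> M \<Longrightarrow> \<bar>f (rr x)\<bar> \<le> Bf" using continuous_bounded_cball[OF fcu, of M] by auto
  obtain Bg where Bg: "\<And>x::'a. norm x \<le> M \<Longrightarrow> \<bar>g (rr x)\<bar> \<le> Bg" using continuous_bounded_cball[OF gcu, of M] by auto
  obtain Bg' where Bg': "\<And>x::'a. norm x \<le> M \<Longrightarrow> \<bar>g' (rr x)\<bar> \<le> Bg'" using continuous_bounded_cball[OF g'cu, of M] by auto
  obtain Bt where Bt: "\<And>x::'a. norm x \<le> M \<Longrightarrow> \<bar>tr (rad_deriv f f' x)\<bar> \<le> Bt" using continuous_bounded_cball[OF C1vf_tr_continuous[OF X], of M] by auto
  obtain BA where BA: "BA \<ge> 0" "\<And>(x::'a) h. norm x \<le> M \<Longrightarrow> norm (rad_deriv f f' x h) \<le> BA * norm h" using C1vf_bound[OF X] by metis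
  obtain Bw where Bw: "\<And>t. t \<le> \<bar>M\<bar> + 1 \<Longrightarrow> w0 t \<le> Bw" using w0_bdd by blast
  have rb: "rr x \<le> \<bar>M\<bar> + 1" if "norm x \<le> M" for x :: 'a
    unfolding rr_def by (rule real_le_lsqrt) (use that power_mono[OF that, of 2] in \<open>auto simp: power2_eq_square algebra_simps abs_if\<close>)
  have Tz: "g' (rr x) = 0" if "norm x > M" for x :: 'a
  proof -
    have r: "rr x > M" using that norm_le_rr[of x] by linarith
    have "(g has_real_derivative 0) (at (rr x))"
      by (rule has_field_derivative_transform_within_open[of "\<lambda>_. 0" _ _ "{M<..}"]) (use r g(3) in auto)
    then show ?thesis using DERIV_unique g(1)[OF rr_pos] by blast
  qed
  have Az: "rad_deriv f f' x h = 0" if "norm x > M" for x h :: 'a by (rule C1vf_zero_outside[OF X Xz that])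
  then have tz: "tr (rad_deriv f f' x) = 0" if "norm x > M" for x :: 'a using that by (simp add: tr_def)
  let ?r = "rr :: 'a \<Rightarrow> real" and ?d = "\<lambda>x::'a. tr (rad_deriv f f' x)"
  have n2: "norm y * norm y = y \<bullet> y" for y :: 'a by (simp add: dot_square_norm power2_eq_square)
  have ri: "rad f x \<bullet> Du x = f (rr x) * cs Du x" for x by (simp add: rad_inner cs_def)
  have csb: "\<bar>cs Du x\<bar> \<le> norm (Du x)" for x unfolding cs_def by (rule abs_radial_le)
  have i1: "integrable lborel (\<lambda>x. rad_deriv f f' x (Du x) \<bullet> Du x)"
    by (rule l2loc_prod_integrable[OF l(2) l(2), of _ M BA])
       (use Az BA in \<open>auto intro!: order_trans[OF Cauchy_Schwarz_ineq2] mult_right_mono simp: mult.assoc[symmetric]\<close>)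
  have i2: "integrable lborel (\<lambda>x. ?d x * (Du x \<bullet> Du x))"
    by (rule l2loc_prod_integrable[OF l(2) l(2), of _ M Bt])
       (use tz Bt in \<open>auto simp: abs_mult n2 intro!: mult_right_mono\<close>)
  have i3: "integrable lborel (\<lambda>x. (?d x * (Vlr x - E)) * u x * u x)"
  proof (rule l2loc_prod_integrable[OF l(1) l(1), of _ M "Bt * (Q + \<bar>E\<bar>)"])
    fix x :: 'a assume x: "norm x \<le> M"
    have "\<bar>?d x * (Vlr x - E)\<bar> \<le> Bt * (Q + \<bar>E\<bar>)" unfolding abs_mult
      using Bt[OF x] Vlr_Q[of x] order_trans[OF abs_ge_zero Bt[OF x]] by (intro mult_mono) auto
    then have "\<bar>?d x * (Vlr x - E)\<bar> * (\<bar>u x\<bar> * \<bar>u x\<bar>) \<le> (Bt * (Q + \<bar>E\<bar>)) * (\<bar>u x\<bar> * \<bar>u x\<bar>)" by (intro mult_right_mono) auto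
    then show "norm ((?d x * (Vlr x - E)) * u x * u x) \<le> (Bt * (Q + \<bar>E\<bar>)) * (norm (u x) * norm (u x))" by (simp add: abs_mult mult_ac)
  qed (use tz in auto)
  have bV: "integrable lborel (\<lambda>x. (f (rr x) * b x) * u x * cs Du x)" if b: "b \<in> borel_measurable borel" "\<And>x. \<bar>b x\<bar> \<le> Bb" for b Bb
  proof (rule l2loc_prod_integrable[OF l(1) l(2), of _ M "Bf * Bb"])
    note [measurable] = b(1)
    show "(\<lambda>x. f (rr x) * b x * u x * cs Du x) \<in> borel_measurable borel" unfolding cs_def by measurable
    fix x :: 'a assume x: "norm x \<le> M"
    have "\<bar>f (rr x) * b x\<bar> \<le> Bf * Bb" unfolding abs_mult
      using Bf[OF x] b(2)[of x] order_trans[OF abs_ge_zero Bf[OF x]] by (intro mult_mono) auto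
    then have "\<bar>f (rr x) * b x\<bar> * (\<bar>u x\<bar> * \<bar>cs Du x\<bar>) \<le> (Bf * Bb) * (\<bar>u x\<bar> * norm (Du x))"
      by (intro mult_mono csb) (auto intro: order_trans[OF abs_ge_zero])
    then show "norm (f (rr x) * b x * u x * cs Du x) \<le> Bf * Bb * (norm (u x) * norm (Du x))" by (simp add: abs_mult mult_ac)
  qed (use f(4) out in auto)
  have i4: "integrable lborel (\<lambda>x. (f (rr x) * Vsr x) * u x * cs Du x)" by (rule bV[OF Vsr_meas Vsr_Q])
  have i5: "integrable lborel (\<lambda>x. (f (rr x) * (Vlr x - E)) * u x * cs Du x)"
    by (rule bV[of _ "Q + \<bar>E\<bar>"]) (use Vlr_Q in \<open>auto intro!: order_trans[OF abs_triangle_ineq4] add_mono\<close>)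
  have i6: "integrable lborel (\<lambda>x. (f (rr x) * w0 (rr x)) * u x * u x)"
  proof (rule l2loc_prod_integrable[OF l(1) l(1), of _ M "Bf * Bw"])
    fix x :: 'a assume x: "norm x \<le> M"
    have "\<bar>f (rr x) * w0 (rr x)\<bar> \<le> Bf * Bw" unfolding abs_mult
      using Bf[OF x] Bw[OF rb[OF x]] w0_nonneg[of "rr x"] order_trans[OF abs_ge_zero Bf[OF x]] by (intro mult_mono) auto
    then have "\<bar>f (rr x) * w0 (rr x)\<bar> * (\<bar>u x\<bar> * \<bar>u x\<bar>) \<le> (Bf * Bw) * (\<bar>u x\<bar> * \<bar>u x\<bar>)" by (intro mult_right_mono) auto
    then show "norm (f (rr x) * w0 (rr x) * u x * u x) \<le> Bf * Bw * (norm (u x) * norm (u x))" by (simp add: abs_mult mult_ac)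
  qed (use f(4) out in auto)
  have i7: "integrable lborel (\<lambda>x. g (rr x) * (Du x \<bullet> Du x))"
    by (rule l2loc_prod_integrable[OF l(2) l(2), of _ M Bg])
       (use g(3) out Bg in \<open>auto simp: abs_mult n2 intro!: mult_right_mono\<close>)
  have i8: "integrable lborel (\<lambda>x. g (rr x) * u x * ((V x - E) * u x))"
  proof (rule l2loc_prod_integrable[OF l(1) l(1), of _ M "Bg * (2 * Q + \<bar>E\<bar>)"])
    have [measurable]: "V \<in> borel_measurable borel" unfolding V_eq by measurable
    show "(\<lambda>x. g (rr x) * u x * ((V x - E) * u x)) \<in> borel_measurable borel" by measurable
    fix x :: 'a assume x: "norm x \<le> M"
    have "\<bar>V x - E\<bar> \<le> 2 * Q + \<bar>E\<bar>" using Vlr_Q[of x] Vsr_Q[of x] V_eq[of x] by linarith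
    then have "\<bar>g (rr x) * (V x - E)\<bar> \<le> Bg * (2 * Q + \<bar>E\<bar>)" unfolding abs_mult
      using Bg[OF x] order_trans[OF abs_ge_zero Bg[OF x]] by (intro mult_mono) auto
    then have "\<bar>g (rr x) * (V x - E)\<bar> * (\<bar>u x\<bar> * \<bar>u x\<bar>) \<le> (Bg * (2 * Q + \<bar>E\<bar>)) * (\<bar>u x\<bar> * \<bar>u x\<bar>)" by (intro mult_right_mono) auto
    then show "norm (g (rr x) * u x * ((V x - E) * u x)) \<le> Bg * (2 * Q + \<bar>E\<bar>) * (norm (u x) * norm (u x))" by (simp add: abs_mult mult_ac)
  qed (use g(3) out in auto)
  have i9: "integrable lborel (\<lambda>x. g' (rr x) * (u x * cs Du x))"
  proof (rule l2loc_prod_integrable[OF l(1) l(2), of _ M Bg'])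
    show "(\<lambda>x. g' (rr x) * (u x * cs Du x)) \<in> borel_measurable borel" unfolding cs_def by measurable
    fix x :: 'a assume x: "norm x \<le> M"
    have "\<bar>g' (rr x)\<bar> * (\<bar>u x\<bar> * \<bar>cs Du x\<bar>) \<le> Bg' * (\<bar>u x\<bar> * norm (Du x))"
      using Bg'[OF x] by (intro mult_mono csb) (auto intro: order_trans[OF abs_ge_zero])
    then show "norm (g' (rr x) * (u x * cs Du x)) \<le> Bg' * (norm (u x) * norm (Du x))" by (simp add: abs_mult)
  qed (use Tz in auto)
  have M1: "(LBINT x. (f (rr x) * Vsr x) * u x * cs Du x) + (LBINT x. (f (rr x) * (Vlr x - E)) * u x * cs Du x)
      + (LBINT x. rad_deriv f f' x (Du x) \<bullet> Du x) - (LBINT x. ?d x * (Du x \<bullet> Du x)) / 2 = 0"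
  proof -
    have "(LBINT x. (rad f x \<bullet> Du x) * ((V x - E) * u x)) = (LBINT x. (f (rr x) * Vsr x) * u x * cs Du x + (f (rr x) * (Vlr x - E)) * u x * cs Du x)"
      by (intro Bochner_Integration.integral_cong refl) (simp add: ri V_eq algebra_simps)
    then show ?thesis using multiplier_identity[OF sol[unfolded esol_def] X Xz] i4 i5 by simp
  qed
  have P: "(LBINT x. (?d x * (Vlr x - E)) * u x * u x) + 2 * (LBINT x. (f (rr x) * (Vlr x - E)) * u x * cs Du x) \<ge> - (LBINT x. (f (rr x) * w0 (rr x)) * u x * u x)"
  proof -
    have "(LBINT x. (?d x * (Vlr x - E)) * u x * u x) + 2 * (LBINT x. u x * (((Vlr x - E) *\<^sub>R rad f x) \<bullet> Du x)) \<ge> - (LBINT x. (f (rr x) * w0 (rr x)) * u x * u x)"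
    proof (rule potential_inequality[OF l X Xz _ _ G_l1loc wd_shift])
      show "\<bar>Vlr x - E\<bar> \<le> Q + \<bar>E\<bar>" for x using Vlr_Q[of x] by linarith
      show "\<bar>f (rr x) * w0 (rr x)\<bar> \<le> \<bar>Bf\<bar> * \<bar>Bw\<bar>" for x :: 'a
      proof (cases "norm x \<le> M")
        case True
        then show ?thesis unfolding abs_mult
          using Bf[OF True] Bw[OF rb[OF True]] w0_nonneg[of "rr x"] by (intro mult_mono) auto
      qed (use f(4) out in auto)
      show "AE x in lborel. rad f x \<bullet> G x \<le> f (rr x) * w0 (rr x)"
        using G_le
      proof eventually_elim
        case (elim x) then show ?case unfolding rad_inner by (intro mult_left_mono f(3) rr_pos)
      qed
    qed (use f(4) out in auto)
    also have "(\<lambda>x. u x * (((Vlr x - E) *\<^sub>R rad f x) \<bullet> Du x)) = (\<lambda>x. (f (rr x) * (Vlr x - E)) * u x * cs Du x)"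
      by (simp add: ri fun_eq_iff mult_ac)
    finally show ?thesis by simp
  qed
  have En: "(LBINT x. g (rr x) * (Du x \<bullet> Du x)) + (LBINT x. g' (rr x) * (u x * cs Du x)) + (LBINT x. g (rr x) * u x * ((V x - E) * u x)) = 0"
  proof -
    have d: "((\<lambda>x. g (rr x)) has_derivative (\<lambda>h. ((g' (rr x) / rr x) *\<^sub>R x) \<bullet> h)) (at x)" for x :: 'a
      using radial_has_derivative[OF g(1), of x] by simp
    have c: "continuous_on UNIV (\<lambda>x::'a. (g' (rr x) / rr x) *\<^sub>R x)"
      using rr_pos by (intro continuous_intros g'cu rr_continuous) (auto simp: less_imp_neq[symmetric])
    have "(LBINT x. g (rr x) * (Du x \<bullet> Du x)) + (LBINT x. u x * (((g' (rr x) / rr x) *\<^sub>R x) \<bullet> Du x)) + (LBINT x. g (rr x) * u x * ((V x - E) * u x)) = 0"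
      by (rule energy_identity[OF sol[unfolded esol_def] l d c, of M]) (use g(3) out in auto)
    also have "(\<lambda>x. u x * (((g' (rr x) / rr x) *\<^sub>R x) \<bullet> Du x)) = (\<lambda>x. g' (rr x) * (u x * cs Du x))"
      by (simp add: cs_def fun_eq_iff)
    finally show ?thesis .
  qed
  have "Sf E u Du f f' g g' x = rad_deriv f f' x (Du x) \<bullet> Du x - ?d x * (Du x \<bullet> Du x) / 2 - (?d x * (Vlr x - E)) * u x * u x / 2
     + (f (rr x) * Vsr x) * u x * cs Du x - (f (rr x) * w0 (rr x)) * u x * u x / 2 + g (rr x) * (Du x \<bullet> Du x)
     + g (rr x) * u x * ((V x - E) * u x) + g' (rr x) * (u x * cs Du x)" for x
    unfolding Sf_def a1_def a2_def a3_def a4_def rad_deriv_inner tr_rad_deriv cD_def cs_def[of Du x, symmetric] V_eq[of x]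
    by (simp add: field_simps power2_eq_square)
  then have "(LBINT x. Sf E u Du f f' g g' x) = (LBINT x. rad_deriv f f' x (Du x) \<bullet> Du x) - (LBINT x. ?d x * (Du x \<bullet> Du x)) / 2
     - (LBINT x. (?d x * (Vlr x - E)) * u x * u x) / 2 + (LBINT x. (f (rr x) * Vsr x) * u x * cs Du x)
     - (LBINT x. (f (rr x) * w0 (rr x)) * u x * u x) / 2 + (LBINT x. g (rr x) * (Du x \<bullet> Du x))
     + (LBINT x. g (rr x) * u x * ((V x - E) * u x)) + (LBINT x. g' (rr x) * (u x * cs Du x))"
    using i1 i2 i3 i4 i6 i7 i8 i9 by simp
  then show ?thesis using M1 P En by simp
qed

end

lemma abs_mult_le_sum_sq: "\<bar>a * b\<bar> \<le> (a\<^sup>2 + (b::real)\<^sup>2) / 2"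
  using sum_squares_bound[of "\<bar>a\<bar>" "\<bar>b\<bar>"] by (simp add: abs_mult)

lemma integrable_indicator_Icc: "integrable lborel (\<lambda>s. indicator {a..b::real} s * (c::real))"
  by (intro integrable_mult_left, rule integrable_real_indicator) (auto simp: emeasure_lborel_Icc_eq)

section \<open>Energy density bounds and the exponential weight\<close>

context potential
begin

definition Zf :: "('a \<Rightarrow> real) \<Rightarrow> ('a \<Rightarrow> 'a) \<Rightarrow> 'a \<Rightarrow> real" where "Zf u Du x = cD Du x + (u x)\<^sup>2"

lemma cD_nonneg: "cD Du x \<ge> 0" and cs_sq_le: "(cs Du x)\<^sup>2 \<le> cD Du x" and Zf_nonneg: "Zf u Du x \<ge> 0"
  and u_cs_le: "\<bar>u x * cs Du x\<bar> \<le> Zf u Du x / 2"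
proof -
  show 1: "cD Du x \<ge> 0" by (simp add: cD_def)
  have "\<bar>cs Du x\<bar> \<le> norm (Du x)" unfolding cs_def by (rule abs_radial_le)
  then have "\<bar>cs Du x\<bar>\<^sup>2 \<le> (norm (Du x))\<^sup>2" by (intro power_mono) auto
  then show 2: "(cs Du x)\<^sup>2 \<le> cD Du x" by (simp add: cD_def dot_square_norm)
  show "Zf u Du x \<ge> 0" using 1 by (simp add: Zf_def)
  show "\<bar>u x * cs Du x\<bar> \<le> Zf u Du x / 2"
    using abs_mult_le_sum_sq[of "u x" "cs Du x"] 2 by (simp add: Zf_def)
qed

lemma quad_le: "\<bar>cD Du x - (E - Vlr x) * (u x)\<^sup>2\<bar> \<le> (\<bar>E\<bar> + Q + 1) * Zf u Du x"
proof -
  have "\<bar>cD Du x - (E - Vlr x) * (u x)\<^sup>2\<bar> \<le> \<bar>cD Du x\<bar> + \<bar>E - Vlr x\<bar> * (u x)\<^sup>2"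
    using abs_triangle_ineq4[of "cD Du x" "(E - Vlr x) * (u x)\<^sup>2"] by (simp add: abs_mult)
  also have "\<dots> \<le> (\<bar>E\<bar> + Q + 1) * cD Du x + (\<bar>E\<bar> + Q + 1) * (u x)\<^sup>2"
  proof (intro add_mono mult_right_mono)
    show "\<bar>cD Du x\<bar> \<le> (\<bar>E\<bar> + Q + 1) * cD Du x"
      using mult_right_mono[of 1 "\<bar>E\<bar> + Q + 1" "cD Du x"] cD_nonneg[of Du x] Q_nonneg by simp
    show "\<bar>E - Vlr x\<bar> \<le> \<bar>E\<bar> + Q + 1" using Vlr_Q[of x] by linarith
  qed simp
  finally show ?thesis by (simp add: Zf_def algebra_simps)
qed

text \<open>A deliberately crude bound by the energy density \<open>Zf\<close>, used only to supply
  an integrable majorant when the weight is approximated; its constant never enters the final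
  estimates.\<close>

lemma coeff_bound:
  assumes "w0 (rr x) \<le> Bw"
  shows "\<bar>a1 E u Du x\<bar> + \<bar>a2 E u Du x\<bar> + \<bar>a3 E u Du x\<bar> + \<bar>a4 u Du x\<bar>
    \<le> (4 + (real DIM('a) + 2) * (\<bar>E\<bar> + Q + 1) + 2 * Q + Bw) * Zf u Du x"
proof -
  let ?q = "cD Du x - (E - Vlr x) * (u x)\<^sup>2" and ?P = "\<bar>E\<bar> + Q + 1" and ?Z = "Zf u Du x" and ?d = "real DIM('a)"
  have r: "rr x \<ge> 1" by (rule rr_ge_1)
  have q: "\<bar>?q\<bar> \<le> ?P * ?Z" by (rule quad_le)
  have r2: "0 \<le> 1 / (rr x)\<^sup>2" "1 / (rr x)\<^sup>2 \<le> 1" using one_le_power[OF r, of 2] by (simp_all add: divide_le_eq)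
  have uZ: "(u x)\<^sup>2 \<le> ?Z" "cD Du x \<le> ?Z" "0 \<le> ?Z" using cD_nonneg[of Du x] Zf_nonneg by (simp_all add: Zf_def)
  have s: "0 \<le> (cs Du x)\<^sup>2" "(cs Du x)\<^sup>2 \<le> ?Z" using cs_sq_le[of Du x] uZ by simp_all
  have "\<bar>(1 - y) / 2\<bar> \<le> 1" if "0 \<le> y" "y \<le> 1" for y :: real using that by simp
  then have h: "\<bar>(1 - 1 / (rr x)\<^sup>2) / 2\<bar> \<le> 1" using r2 by blast
  have "\<bar>(1 - 1 / (rr x)\<^sup>2) / 2 * ?q\<bar> \<le> 1 * (?P * ?Z)"
    unfolding abs_mult[of _ ?q] using q by (intro mult_mono h) auto
  then have b1: "\<bar>a1 E u Du x\<bar> \<le> ?Z + ?P * ?Z" unfolding a1_def using s by linarith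
  have f: "\<bar>(cD Du x - (cs Du x)\<^sup>2) / rr x\<bar> \<le> ?Z"
  proof -
    have "\<bar>(cD Du x - (cs Du x)\<^sup>2) / rr x\<bar> \<le> \<bar>cD Du x - (cs Du x)\<^sup>2\<bar>"
      using r by (simp add: abs_divide divide_le_eq mult_le_cancel_left1)
    then show ?thesis using cs_sq_le[of Du x] s uZ by linarith
  qed
  have d1: "?d \<ge> 1" using DIM_positive[where 'a='a] by (simp add: Suc_leI)
  have c: "\<bar>(?d - 1 + 1 / (rr x)\<^sup>2) / rr x / 2\<bar> \<le> ?d"
  proof -
    have "(?d - 1 + 1 / (rr x)\<^sup>2) / rr x \<le> ?d / 1" using r r2 d1 by (intro frac_le) auto
    moreover have "0 \<le> (?d - 1 + 1 / (rr x)\<^sup>2) / rr x" using r r2 d1 by (intro divide_nonneg_nonneg) auto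
    moreover have "\<bar>y / 2\<bar> \<le> ?d" if "0 \<le> y" "y \<le> ?d" for y :: real using that by simp
    ultimately show ?thesis by (metis div_by_1)
  qed
  have dq: "\<bar>(?d - 1 + 1 / (rr x)\<^sup>2) / rr x / 2 * ?q\<bar> \<le> ?d * (?P * ?Z)"
    unfolding abs_mult using c q d1 by (intro mult_mono) auto
  have v: "\<bar>Vsr x * (u x * cs Du x)\<bar> \<le> Q * ?Z"
    unfolding abs_mult[of "Vsr x"] using Vsr_Q[of x] u_cs_le[of u x Du] uZ Q_nonneg by (intro mult_mono) auto
  have wZ: "\<bar>w0 (rr x) * (u x)\<^sup>2 / 2\<bar> \<le> Bw * ?Z"
  proof -
    have "w0 (rr x) * (u x)\<^sup>2 \<le> Bw * ?Z" using assms uZ order_trans[OF w0_nonneg assms] by (intro mult_mono) auto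
    moreover have "0 \<le> w0 (rr x) * (u x)\<^sup>2" using w0_nonneg by simp
    ultimately show ?thesis by simp
  qed
  have abs4: "\<bar>a - b + c - e\<bar> \<le> a' + b' + c' + e'" if "\<bar>a\<bar> \<le> a'" "\<bar>b\<bar> \<le> b'" "\<bar>c\<bar> \<le> c'" "\<bar>e\<bar> \<le> e'" for a b c e a' b' c' e' :: real
    using that by linarith
  have b2: "\<bar>a2 E u Du x\<bar> \<le> ?Z + ?d * (?P * ?Z) + Q * ?Z + Bw * ?Z"
    unfolding a2_def mult.assoc[of "Vsr x"] by (rule abs4[OF f dq v wZ])
  have "\<bar>Vsr x * (u x)\<^sup>2\<bar> \<le> Q * ?Z" unfolding abs_mult using Vsr_Q[of x] uZ Q_nonneg by (intro mult_mono) auto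
  then have b3: "\<bar>a3 E u Du x\<bar> \<le> ?P * ?Z + Q * ?Z" unfolding a3_def using q by linarith
  have b4: "\<bar>a4 u Du x\<bar> \<le> ?Z" unfolding a4_def using u_cs_le[of u x Du] uZ by linarith
  have "(4 + (?d + 2) * ?P + 2 * Q + Bw) * ?Z = 4 * ?Z + ?d * (?P * ?Z) + 2 * (?P * ?Z) + 2 * (Q * ?Z) + Bw * ?Z"
    by (simp add: algebra_simps)
  then show ?thesis using b1 b2 b3 b4 uZ by linarith
qed

lemma esol_l2loc: "esol E u Du \<Longrightarrow> l2loc u" "esol E u Du \<Longrightarrow> l2loc Du"
  by (auto simp: esol_def wsol_def)

lemma Zf_measurable:
  assumes "esol E u Du" shows "Zf u Du \<in> borel_measurable borel"
proof -
  note [measurable] = esol_l2loc[OF assms, THEN l2loc_measurable]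
  show ?thesis unfolding Zf_def[abs_def] cD_def by measurable
qed

lemma a_measurable:
  assumes "esol E u Du"
  shows "a1 E u Du \<in> borel_measurable borel" "a2 E u Du \<in> borel_measurable borel"
    "a3 E u Du \<in> borel_measurable borel" "a4 u Du \<in> borel_measurable borel"
proof -
  note [measurable] = esol_l2loc[OF assms, THEN l2loc_measurable]
  show "a1 E u Du \<in> borel_measurable borel" "a2 E u Du \<in> borel_measurable borel"
    "a3 E u Du \<in> borel_measurable borel" "a4 u Du \<in> borel_measurable borel"
    unfolding a1_def[abs_def] a2_def[abs_def] a3_def[abs_def] a4_def[abs_def] cD_def cs_def by measurable
qed

lemma Zf_integrable:
  assumes e: "esol E u Du" and h: "h \<in> borel_measurable borel"
    and b: "\<And>x. norm x \<le> R \<Longrightarrow> \<bar>h x\<bar> \<le> M" and z: "\<And>x. norm x > R \<Longrightarrow> h x = 0"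
  shows "integrable lborel (\<lambda>x. h x * Zf u Du x)"
proof -
  note l = esol_l2loc[OF e]
  note [measurable] = l[THEN l2loc_measurable] h
  have 1: "integrable lborel (\<lambda>x. h x * cD Du x)"
  proof (rule l2loc_prod_integrable[OF l(2) l(2), of _ R M])
    show "(\<lambda>x. h x * cD Du x) \<in> borel_measurable borel" unfolding cD_def by measurable
    fix x :: 'a assume "norm x \<le> R"
    then show "norm (h x * cD Du x) \<le> M * (norm (Du x) * norm (Du x))"
      using b[of x] by (simp add: cD_def abs_mult dot_square_norm power2_eq_square mult_right_mono)
  qed (simp add: z)
  have 2: "integrable lborel (\<lambda>x. h x * (u x)\<^sup>2)"
  proof (rule l2loc_prod_integrable[OF l(1) l(1), of _ R M])
    fix x :: 'a assume "norm x \<le> R"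
    then show "norm (h x * (u x)\<^sup>2) \<le> M * (norm (u x) * norm (u x))"
      using b[of x] by (simp add: abs_mult power2_eq_square mult_right_mono)
  qed (simp_all add: z)
  show ?thesis using Bochner_Integration.integrable_add[OF 1 2] by (simp add: Zf_def distrib_left)
qed

text \<open>\<open>Ex K\<close> is chosen to have logarithmic derivative K W almost everywhere:
  \<open>Jw\<close> is a primitive of \<open>w0\<close> and -1/t one of 1/t^2. Both are bounded for
  t \<ge> 1, so the weight stays between positive constants however large \<open>K\<close>
  is.\<close>

definition Jw :: "real \<Rightarrow> real" where "Jw t = (LBINT s. indicator {0..t} s * w0 s)"
definition W :: "real \<Rightarrow> real" where "W t = w0 t + 1 / t\<^sup>2"
definition Ex :: "real \<Rightarrow> real \<Rightarrow> real" where "Ex K t = exp (K * (Jw t - 1 / t))"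

text \<open>Clamping continuous approximants between 0 and B preserves continuity and the limit,
  since \<open>w0\<close> itself lies there on the relevant range; the common bound then serves for
  dominated convergence.\<close>

lemma w0_approx:
  assumes B: "\<And>t. t \<le> M \<Longrightarrow> w0 t \<le> B"
  obtains N w where "negligible N" "\<And>n::nat. continuous_on UNIV (w n)" "\<And>n t. 0 \<le> w n t" "\<And>n t. w n t \<le> B"
    "\<And>t. t \<notin> N \<Longrightarrow> t \<le> M \<Longrightarrow> (\<lambda>n. w n t) \<longlonglongrightarrow> w0 t"
proof -
  have "w0 measurable_on UNIV"
    by (rule lebesgue_measurable_imp_measurable_on) (auto intro: measurable_completion)
  then obtain N g where N: "negligible N" "\<And>k::nat. continuous_on UNIV (g k)" "\<And>x. x \<notin> N \<Longrightarrow> (\<lambda>k. g k x) \<longlonglongrightarrow> w0 x"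
    unfolding measurable_on_def by auto
  have B0: "0 \<le> B" using order_trans[OF w0_nonneg B[of M]] by simp
  show ?thesis
  proof (rule that[of N "\<lambda>n t. max 0 (min B (g n t))"])
    fix t assume t: "t \<notin> N" "t \<le> M"
    have "(\<lambda>n. max 0 (min B (g n t))) \<longlonglongrightarrow> max 0 (min B (w0 t))" by (intro tendsto_intros N t)
    then show "(\<lambda>n. max 0 (min B (g n t))) \<longlonglongrightarrow> w0 t" using w0_nonneg[of t] B[OF t(2)] by simp
  qed (use N B0 in \<open>auto intro!: continuous_intros\<close>)
qed

lemma primitive_deriv:
  assumes c: "continuous_on UNIV (w :: real \<Rightarrow> real)" and t: "t > 0"
  shows "((\<lambda>t. \<integral>s. indicator {0..t} s * w s \<partial>lborel) has_real_derivative w t) (at t)"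
proof -
  have eq: "(LBINT s. indicator {0..t} s * w s) = integral {0..t} w" for t
  proof -
    have "set_integrable lborel {0..t} w"
      by (intro borel_integrable_atLeastAtMost' continuous_on_subset[OF c]) auto
    from set_borel_integral_eq_integral(2)[OF this] show ?thesis by (simp add: set_lebesgue_integral_def)
  qed
  have "((\<lambda>t. integral {0..t} w) has_real_derivative w t) (at t within {0..t + 1})"
    by (rule integral_has_real_derivative) (use t in \<open>auto intro: continuous_on_subset[OF c]\<close>)
  then show ?thesis unfolding eq using t by (subst (asm) at_within_Icc_at) auto
qed

text \<open>The weight f \<open>Ex K\<close> is not C^1 when \<open>w0\<close> is discontinuous.
  With \<open>w0\<close> replaced by continuous approximants the smooth inequality applies. The
  approximants converge off a null set of radii, hence at almost every point by
  \<open>AE_radial_notin\<close>, and dominated convergence gives the limit.\<close>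

lemma multiplier_inequality:
  assumes sol: "esol E u Du" and K: "K \<ge> 0"
    and f: "\<And>t. t > 0 \<Longrightarrow> (f has_real_derivative f' t) (at t)" "continuous_on {0<..} f'" "\<And>t. t > 0 \<Longrightarrow> f t \<ge> 0"
    and g: "\<And>t. t > 0 \<Longrightarrow> (g has_real_derivative g' t) (at t)" "continuous_on {0<..} g'"
    and z: "\<And>t. t \<ge> M \<Longrightarrow> f t = 0" "\<And>t. t \<ge> M \<Longrightarrow> f' t = 0" "\<And>t. t \<ge> M \<Longrightarrow> g t = 0" "\<And>t. t \<ge> M \<Longrightarrow> g' t = 0"
  defines "S \<equiv> Sf E u Du (\<lambda>t. f t * Ex K t) (\<lambda>t. (f' t + K * W t * f t) * Ex K t) (\<lambda>t. g t * Ex K t) (\<lambda>t. (g' t + K * W t * g t) * Ex K t)"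
  shows "integrable lborel S" "(LBINT x. S x) \<le> 0"
proof -
  obtain B where B: "\<And>t. t \<le> M \<Longrightarrow> w0 t \<le> B" using w0_bdd[of M] by blast
  obtain N w where w: "negligible N" "\<And>n::nat. continuous_on UNIV (w n)" "\<And>n t. 0 \<le> w n t" "\<And>n t. w n t \<le> B"
    "\<And>t. t \<notin> N \<Longrightarrow> t \<le> M \<Longrightarrow> (\<lambda>n. w n t) \<longlonglongrightarrow> w0 t"
    using w0_approx[of M B] B by metis
  have B0: "B \<ge> 0" using order_trans[OF w(3) w(4)] .
  note wm [measurable] = borel_measurable_continuous_onI[OF w(2)]
  define J where "J = (\<lambda>n t. \<integral>s. indicator {0..t} s * w n s \<partial>lborel)"
  define e where "e = (\<lambda>n t. exp (K * (J n t - 1 / t)))"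
  have fc: "continuous_on {0<..} f" and gc: "continuous_on {0<..} g"
    using f(1) g(1) by (auto intro!: DERIV_isCont continuous_at_imp_continuous_on)
  have ed: "(e n has_real_derivative K * (w n t + 1 / t\<^sup>2) * e n t) (at t)" if "t > 0" for n t
  proof -
    have "(J n has_real_derivative w n t) (at t)" unfolding J_def by (rule primitive_deriv[OF w(2) that])
    then show ?thesis unfolding e_def using that
      by (auto intro!: derivative_eq_intros simp: power2_eq_square field_simps)
  qed
  have ec: "continuous_on {0<..} (e n)" for n
    using ed by (auto intro!: DERIV_isCont continuous_at_imp_continuous_on)
  define T where "T = (\<lambda>n. Sf E u Du (\<lambda>t. f t * e n t) (\<lambda>t. (f' t + K * (w n t + 1 / t\<^sup>2) * f t) * e n t)
      (\<lambda>t. g t * e n t) (\<lambda>t. (g' t + K * (w n t + 1 / t\<^sup>2) * g t) * e n t))"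
  have T: "(LBINT x. T n x) \<le> 0" for n
    unfolding T_def
  proof (rule multiplier_inequality_smooth[OF sol, where M = M])
    fix t :: real assume t: "t > 0"
    show "((\<lambda>t. f t * e n t) has_real_derivative (f' t + K * (w n t + 1 / t\<^sup>2) * f t) * e n t) (at t)"
      using DERIV_mult[OF f(1)[OF t] ed[OF t]] by (simp add: algebra_simps)
    show "((\<lambda>t. g t * e n t) has_real_derivative (g' t + K * (w n t + 1 / t\<^sup>2) * g t) * e n t) (at t)"
      using DERIV_mult[OF g(1)[OF t] ed[OF t]] by (simp add: algebra_simps)
    show "f t * e n t \<ge> 0" using f(3)[OF t] by (simp add: e_def)
  next
    have wc: "continuous_on {0<..} (\<lambda>t. w n t + 1 / t\<^sup>2)"
      by (intro continuous_intros continuous_on_subset[OF w(2)]) auto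
    show "continuous_on {0<..} (\<lambda>t. (f' t + K * (w n t + 1 / t\<^sup>2) * f t) * e n t)"
      by (intro continuous_intros f(2) fc ec wc)
    show "continuous_on {0<..} (\<lambda>t. (g' t + K * (w n t + 1 / t\<^sup>2) * g t) * e n t)"
      by (intro continuous_intros g(2) gc ec wc)
  qed (use z in auto)
  have bnd: "\<exists>C. \<forall>t\<in>{1..M}. \<bar>h t\<bar> \<le> C" if "continuous_on {0<..} h" for h :: "real \<Rightarrow> real"
  proof -
    have "compact (h ` {1..M})" by (intro compact_continuous_image continuous_on_subset[OF that]) auto
    then obtain C where "\<forall>y\<in>h ` {1..M}. norm y \<le> C" by (metis bounded_pos compact_imp_bounded)
    then show ?thesis by (intro exI[of _ C]) auto
  qed
  obtain C1 C2 C3 C4 where C: "\<forall>t\<in>{1..M}. \<bar>f t\<bar> \<le> C1" "\<forall>t\<in>{1..M}. \<bar>f' t\<bar> \<le> C2" "\<forall>t\<in>{1..M}. \<bar>g t\<bar> \<le> C3" "\<forall>t\<in>{1..M}. \<bar>g' t\<bar> \<le> C4"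
    using bnd[OF fc] bnd[OF f(2)] bnd[OF gc] bnd[OF g(2)] by metis
  define C where "C = \<bar>C1\<bar> + \<bar>C2\<bar> + \<bar>C3\<bar> + \<bar>C4\<bar>"
  have Cb: "\<bar>f t\<bar> \<le> C" "\<bar>f' t\<bar> \<le> C" "\<bar>g t\<bar> \<le> C" "\<bar>g' t\<bar> \<le> C" if "t \<in> {1..M}" for t
    using C[THEN bspec, OF that] unfolding C_def by linarith+
  have C0: "C \<ge> 0" by (simp add: C_def)
  define Ce where "Ce = exp (K * (M * B))"
  have Jb: "0 \<le> J n t \<and> J n t \<le> M * B" if "t \<in> {1..M}" for n t
  proof
    show "0 \<le> J n t" unfolding J_def using w(3) by (intro Bochner_Integration.integral_nonneg) auto
    have ci: "integrable lborel (\<lambda>s. indicator {0..t} s * B)"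
      by (rule integrable_indicator_Icc)
    have "J n t \<le> (LBINT s. indicator {0..t} s * B)" unfolding J_def
    proof (rule integral_mono)
      show "integrable lborel (\<lambda>s. indicator {0..t} s * w n s)"
        by (rule Bochner_Integration.integrable_bound[OF ci]) (use w B0 in \<open>auto simp: indicator_def\<close>)
    qed (use w ci in \<open>auto simp: indicator_def\<close>)
    also have "\<dots> = t * B" using that by simp
    also have "\<dots> \<le> M * B" using that B0 by (intro mult_right_mono) auto
    finally show "J n t \<le> M * B" .
  qed
  have eb: "0 \<le> e n t" "e n t \<le> Ce" if "t \<in> {1..M}" for n t
    unfolding e_def Ce_def using Jb[OF that, of n] that K by (auto intro!: mult_left_mono simp: divide_nonneg_nonneg diff_le_eq add_increasing2)
  \<comment> \<open>Bounds every radial coefficient on [1, M] uniformly in n: \<open>C\<close> for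
    the functions and derivatives supplied, K (B + 1) for the logarithmic derivative of the
    exponential, \<open>Ce\<close> for the exponential itself.\<close>
  define C' where "C' = C * (1 + K * (B + 1)) * Ce"
  have Ce: "Ce \<ge> 0" by (simp add: Ce_def)
  have KB: "0 \<le> K * (B + 1)" using K B0 by simp
  have cb1: "\<bar>a * e n t\<bar> \<le> C'" if t: "t \<in> {1..M}" and a: "\<bar>a\<bar> \<le> C" for n t a
  proof -
    have "\<bar>a * e n t\<bar> \<le> C * Ce" unfolding abs_mult using eb[OF t, of n] a by (intro mult_mono) auto
    also have "C * Ce = C * 1 * Ce" by simp
    also have "\<dots> \<le> C * (1 + K * (B + 1)) * Ce" using KB C0 Ce by (intro mult_right_mono mult_left_mono) auto
    finally show ?thesis by (simp add: C'_def)
  qed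
  have cb2: "\<bar>(a' + K * (w n t + 1 / t\<^sup>2) * a) * e n t\<bar> \<le> C'" if t: "t \<in> {1..M}" and a: "\<bar>a\<bar> \<le> C" "\<bar>a'\<bar> \<le> C" for n t a a'
  proof -
    have "1 / t\<^sup>2 \<le> 1" using t one_le_power[of t 2] by (simp add: divide_le_eq)
    then have "\<bar>K * (w n t + 1 / t\<^sup>2)\<bar> \<le> K * (B + 1)"
      unfolding abs_mult using K w(3,4)[of n t] by (intro mult_mono) auto
    then have "\<bar>K * (w n t + 1 / t\<^sup>2) * a\<bar> \<le> K * (B + 1) * C"
      unfolding abs_mult[of _ a] using a KB by (intro mult_mono) auto
    then have "\<bar>a' + K * (w n t + 1 / t\<^sup>2) * a\<bar> \<le> C * (1 + K * (B + 1))"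
      using a by (simp add: algebra_simps)
    then show ?thesis unfolding abs_mult C'_def using eb[OF t, of n] C0 KB by (intro mult_mono) auto
  qed
  have C'0: "C' \<ge> 0" unfolding C'_def using C0 KB Ce by simp
  have r1: "rr x \<in> {1..M}" if "rr x < M" for x :: 'a using that rr_ge_1[of x] by auto
  define A where "A = 4 + (real DIM('a) + 2) * (\<bar>E\<bar> + Q + 1) + 2 * Q + B"
  define H where "H = (\<lambda>x. (C' * A * indicator {x::'a. rr x < M} x) * Zf u Du x)"
  have Hi: "integrable lborel H"
    unfolding H_def
  proof (rule Zf_integrable[OF sol, of _ M "\<bar>C' * A\<bar>"])
    fix x :: 'a assume "norm x > M" then have "\<not> rr x < M" using norm_le_rr[of x] by linarith
    then show "C' * A * indicator {x. rr x < M} x = 0" by simp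
  qed (auto simp: indicator_def)
  have Tm: "T n \<in> borel_measurable lborel" for n
  proof -
    have wc: "continuous_on {0<..} (\<lambda>t. w n t + 1 / t\<^sup>2)"
      by (intro continuous_intros continuous_on_subset[OF w(2)]) auto
    have m: "(\<lambda>x::'a. h (rr x)) \<in> borel_measurable borel" if "continuous_on {0<..} h" for h :: "real \<Rightarrow> real"
      by (intro borel_measurable_continuous_onI radial_continuous that)
    note [measurable] = a_measurable[OF sol]
    note [measurable] = m[of "\<lambda>t. f t * e n t", OF continuous_on_mult[OF fc ec]]
      m[of "\<lambda>t. g t * e n t", OF continuous_on_mult[OF gc ec]]
    have [measurable]: "(\<lambda>x::'a. (f' (rr x) + K * (w n (rr x) + 1 / (rr x)\<^sup>2) * f (rr x)) * e n (rr x)) \<in> borel_measurable borel"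
      by (rule m[of "\<lambda>t. (f' t + K * (w n t + 1 / t\<^sup>2) * f t) * e n t"]) (intro continuous_intros f(2) fc ec wc)
    have [measurable]: "(\<lambda>x::'a. (g' (rr x) + K * (w n (rr x) + 1 / (rr x)\<^sup>2) * g (rr x)) * e n (rr x)) \<in> borel_measurable borel"
      by (rule m[of "\<lambda>t. (g' t + K * (w n t + 1 / t\<^sup>2) * g t) * e n t"]) (intro continuous_intros g(2) gc ec wc)
    show ?thesis unfolding T_def Sf_def[abs_def] by measurable
  qed
  have Tb: "norm (T n x) \<le> H x" for n x
  proof (cases "rr x < M")
    case True
    note t = r1[OF True]
    let ?r = "rr x"
    have "\<bar>T n x\<bar> \<le> C' * \<bar>a1 E u Du x\<bar> + C' * \<bar>a2 E u Du x\<bar> + C' * \<bar>a3 E u Du x\<bar> + C' * \<bar>a4 u Du x\<bar>"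
    proof -
      have s1: "\<bar>((f' ?r + K * (w n ?r + 1 / ?r\<^sup>2) * f ?r) * e n ?r) * a1 E u Du x\<bar> \<le> C' * \<bar>a1 E u Du x\<bar>"
        unfolding abs_mult[of _ "a1 E u Du x"] by (intro mult_right_mono cb2 t Cb) auto
      have s2: "\<bar>(f ?r * e n ?r) * a2 E u Du x\<bar> \<le> C' * \<bar>a2 E u Du x\<bar>"
        unfolding abs_mult[of _ "a2 E u Du x"] by (intro mult_right_mono cb1 t Cb) auto
      have s3: "\<bar>(g ?r * e n ?r) * a3 E u Du x\<bar> \<le> C' * \<bar>a3 E u Du x\<bar>"
        unfolding abs_mult[of _ "a3 E u Du x"] by (intro mult_right_mono cb1 t Cb) auto
      have s4: "\<bar>((g' ?r + K * (w n ?r + 1 / ?r\<^sup>2) * g ?r) * e n ?r) * a4 u Du x\<bar> \<le> C' * \<bar>a4 u Du x\<bar>"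
        unfolding abs_mult[of _ "a4 u Du x"] by (intro mult_right_mono cb2 t Cb) auto
      have abs4: "\<bar>a + b + c + d\<bar> \<le> a' + b' + c' + d'" if "\<bar>a\<bar> \<le> a'" "\<bar>b\<bar> \<le> b'" "\<bar>c\<bar> \<le> c'" "\<bar>d\<bar> \<le> d'" for a b c d a' b' c' d' :: real
        using that by linarith
      show ?thesis unfolding T_def Sf_def by (rule abs4[OF s1 s2 s3 s4])
    qed
    also have "\<dots> = C' * (\<bar>a1 E u Du x\<bar> + \<bar>a2 E u Du x\<bar> + \<bar>a3 E u Du x\<bar> + \<bar>a4 u Du x\<bar>)" by (simp add: algebra_simps)
    also have "\<dots> \<le> C' * (A * Zf u Du x)"
      unfolding A_def using B[of "rr x"] True by (intro mult_left_mono coeff_bound C'0) auto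
    finally show ?thesis using True by (simp add: H_def mult.assoc)
  qed (use z in \<open>simp add: T_def Sf_def H_def\<close>)
  have lim: "AE x in lborel. (\<lambda>n. T n x) \<longlonglongrightarrow> S x"
    using AE_radial_notin[OF w(1), where 'a='a]
  proof eventually_elim
    case (elim x)
    show ?case
    proof (cases "rr x < M")
      case True
      note t = r1[OF True]
      have wl: "(\<lambda>n. w n (rr x)) \<longlonglongrightarrow> w0 (rr x)" by (rule w(5)) (use elim True in auto)
      have Jl: "(\<lambda>n. J n (rr x)) \<longlonglongrightarrow> Jw (rr x)"
        unfolding J_def Jw_def
      proof (rule integral_dominated_convergence[where w = "\<lambda>s. indicator {0..rr x} s * B"])
        show "integrable lborel (\<lambda>s. indicator {0..rr x} s * B)"
          by (rule integrable_indicator_Icc)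
        have "AE t in lebesgue. t \<notin> N" using w(1) by (simp add: negligible_iff_null_sets AE_not_in)
        then have "AE t in lborel. t \<notin> N" by (simp add: AE_completion_iff)
        then show "AE s in lborel. (\<lambda>n. indicator {0..rr x} s * w n s) \<longlonglongrightarrow> indicator {0..rr x} s * w0 s"
        proof eventually_elim
          case (elim s)
          show ?case
          proof (cases "s \<in> {0..rr x}")
            case T: True
            then show ?thesis using True by (intro tendsto_intros w(5)[OF elim]) auto
          qed simp
        qed
        show "AE s in lborel. norm (indicator {0..rr x} s * w n s) \<le> indicator {0..rr x} s * B" for n
          using w by (auto simp: indicator_def)
      qed measurable
      have el: "(\<lambda>n. e n (rr x)) \<longlonglongrightarrow> Ex K (rr x)" unfolding e_def Ex_def by (intro tendsto_intros Jl) auto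
      show ?thesis unfolding T_def S_def Sf_def W_def
        by (intro tendsto_intros el wl)
    qed (use z in \<open>simp add: T_def Sf_def S_def\<close>)
  qed
  have Sm: "S \<in> borel_measurable lborel"
  proof -
    have m: "h \<in> borel_measurable (restrict_space borel {0<..})" if "continuous_on {0<..} h" for h :: "real \<Rightarrow> real"
      by (rule borel_measurable_continuous_on_restrict[OF that])
    have rm: "(rr :: 'a \<Rightarrow> real) \<in> measurable borel (restrict_space borel {0<..})"
      by (rule measurable_restrict_space2) (auto simp: rr_pos)
    have rad: "(\<lambda>x::'a. h (rr x)) \<in> borel_measurable borel" if "continuous_on {0<..} h" for h :: "real \<Rightarrow> real"
      by (rule measurable_compose[OF rm m[OF that]])
    \<comment> \<open>Measurability comes from monotonicity, since \<open>w0\<close> is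
      nonnegative.\<close>
    have [measurable]: "Jw \<in> borel_measurable borel"
    proof -
      have "mono Jw"
      proof (rule monoI)
        fix s t :: real assume "s \<le> t"
        then show "Jw s \<le> Jw t" unfolding Jw_def
          by (intro integral_mono) (auto simp: indicator_def w0_nonneg intro!: Bochner_Integration.integrable_bound[OF w0_int])
      qed
      then show ?thesis by (rule borel_measurable_mono)
    qed
    note [measurable] = a_measurable[OF sol] rad[OF fc] rad[OF f(2)] rad[OF gc] rad[OF g(2)]
    show ?thesis unfolding S_def Sf_def[abs_def] Ex_def W_def by measurable
  qed
  show "integrable lborel S"
    by (rule integrable_dominated_convergence[OF Sm Tm Hi lim]) (use Tb in auto)
  have "(\<lambda>n. \<integral>x. T n x \<partial>lborel) \<longlonglongrightarrow> (LBINT x. S x)"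
    by (rule integral_dominated_convergence[OF Sm Tm Hi lim]) (use Tb in auto)
  then show "(LBINT x. S x) \<le> 0" by (rule LIMSEQ_le_const2) (use T in auto)
qed

end

subsection \<open>Absorption of the error terms\<close>

text \<open>The squared positive part is continuously differentiable across 0, enough smoothness to
  assemble C^1 cutoffs.\<close>

definition sq_pos :: "real \<Rightarrow> real" where "sq_pos s = (max 0 s)\<^sup>2"

lemma sq_pos_deriv: "(sq_pos has_real_derivative 2 * max 0 s) (at s)"
proof -
  consider "s > 0" | "s < 0" | "s = 0" by linarith
  then show ?thesis
  proof cases
    case 1
    have "((\<lambda>s. s\<^sup>2) has_real_derivative 2 * max 0 s) (at s)" using 1 by (auto intro!: derivative_eq_intros)
    then show ?thesis
      by (rule has_field_derivative_transform_within_open[of _ _ _ "{0<..}"]) (use 1 in \<open>auto simp: sq_pos_def max_def\<close>)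
  next
    case 2
    have "((\<lambda>s. 0) has_real_derivative 2 * max 0 s) (at s)" using 2 by auto
    then show ?thesis
      by (rule has_field_derivative_transform_within_open[of _ _ _ "{..<0}"]) (use 2 in \<open>auto simp: sq_pos_def max_def\<close>)
  next
    case 3
    have "((\<lambda>h. sq_pos h / h) \<longlongrightarrow> 0) (at 0)"
    proof (rule Lim_null_comparison)
      have "norm (sq_pos h / h) \<le> \<bar>h\<bar>" for h
        by (cases "h > 0") (auto simp: sq_pos_def max_def power2_eq_square)
      then show "\<forall>\<^sub>F h in at 0. norm (sq_pos h / h) \<le> \<bar>h\<bar>" by simp
      have "((\<lambda>h. \<bar>h\<bar>) \<longlongrightarrow> \<bar>0::real\<bar>) (at 0)" by (intro tendsto_intros)
      then show "((\<lambda>h. \<bar>h::real\<bar>) \<longlongrightarrow> 0) (at 0)" by simp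
    qed
    then show ?thesis using 3 by (simp add: has_field_derivative_iff sq_pos_def)
  qed
qed

text \<open>The quotient of sq_pos(t - 1) by sq_pos(t - 1) + sq_pos(2 - t) climbs from 0 to 1 across
  [1,2]; the denominator never vanishes because t > 1 or t < 2 always holds. The derivative is
  continuous and lives on a compact interval, hence is bounded.\<close>

lemma cutoff_exists:
  obtains ct ct' :: "real \<Rightarrow> real" and B where "\<And>t. (ct has_real_derivative ct' t) (at t)" "continuous_on UNIV ct'"
    "\<And>t. 0 \<le> ct t" "\<And>t. ct t \<le> 1" "\<And>t. t \<le> 1 \<Longrightarrow> ct t = 0" "\<And>t. t \<ge> 2 \<Longrightarrow> ct t = 1"
    "\<And>t. \<bar>ct' t\<bar> \<le> B" "\<And>t. t \<le> 1 \<Longrightarrow> ct' t = 0" "\<And>t. t \<ge> 2 \<Longrightarrow> ct' t = 0" "B \<ge> 1"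
proof -
  define D where "D = (\<lambda>t. sq_pos (t - 1) + sq_pos (2 - t))"
  define ct where "ct = (\<lambda>t. sq_pos (t - 1) / D t)"
  define ct' where "ct' = (\<lambda>t. ((2 * max 0 (t - 1)) * D t - sq_pos (t - 1) * (2 * max 0 (t - 1) - 2 * max 0 (2 - t))) / (D t * D t))"
  have D: "D t > 0" for t
  proof (cases "t > 1")
    case True
    then have "sq_pos (t - 1) > 0" by (simp add: sq_pos_def)
    then show ?thesis by (simp add: D_def sq_pos_def add_pos_nonneg)
  next
    case False
    then have "sq_pos (2 - t) > 0" by (simp add: sq_pos_def)
    then show ?thesis by (simp add: D_def sq_pos_def add_nonneg_pos)
  qed
  have s1: "((\<lambda>t. sq_pos (t - 1)) has_real_derivative 2 * max 0 (t - 1)) (at t)" for t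
  proof -
    have "((\<lambda>t. t - 1) has_real_derivative 1) (at t)" by (auto intro!: derivative_eq_intros)
    from DERIV_chain2[OF sq_pos_deriv this] show ?thesis by simp
  qed
  have s2: "((\<lambda>t. sq_pos (2 - t)) has_real_derivative - (2 * max 0 (2 - t))) (at t)" for t
  proof -
    have "((\<lambda>t. 2 - t) has_real_derivative - 1) (at t)" by (auto intro!: derivative_eq_intros)
    from DERIV_chain2[OF sq_pos_deriv this] show ?thesis by simp
  qed
  have Dd: "(D has_real_derivative (2 * max 0 (t - 1) - 2 * max 0 (2 - t))) (at t)" for t
    using DERIV_add[OF s1 s2] unfolding D_def by simp
  have d: "(ct has_real_derivative ct' t) (at t)" for t
    unfolding ct_def ct'_def by (rule DERIV_divide[OF s1 Dd]) (use D[of t] in simp)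
  have c: "continuous_on UNIV ct'"
    unfolding ct'_def D_def sq_pos_def using D[unfolded D_def sq_pos_def]
    by (intro continuous_intros) (auto simp: less_imp_neq[symmetric])
  have z: "ct' t = 0" if "t \<le> 1 \<or> t \<ge> 2" for t
    using that by (auto simp: ct'_def D_def sq_pos_def)
  have "compact (ct' ` {1..2})" by (intro compact_continuous_image continuous_on_subset[OF c]) auto
  then obtain B where B: "\<forall>y\<in>ct' ` {1..2}. norm y \<le> B" by (metis bounded_pos compact_imp_bounded)
  have b: "\<bar>ct' t\<bar> \<le> \<bar>B\<bar> + 1" for t
  proof (cases "t \<in> {1..2}")
    case True
    then have "norm (ct' t) \<le> B" using B by blast
    then show ?thesis by simp
  qed (use z[of t] in auto)
  show ?thesis
    by (rule that[of ct ct' "\<bar>B\<bar> + 1"])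
       (use d c z b D in \<open>auto simp: ct_def D_def sq_pos_def divide_le_eq add_nonneg_pos\<close>)
qed

text \<open>With \<open>f = f1 \<eta> E\<close>, \<open>E' = K W E\<close> and \<open>2 g = (f1' \<eta> + (d - 1) f1 \<eta> / t) E\<close>, the coefficient of
  \<open>|\<nabla>u|\<^sup>2 - (E - Vlr) u\<^sup>2\<close> in the integrand reduces to lower order; \<open>K W t \<le> 1\<close> lets the angular term absorb
  the bad sign in \<open>K W f\<close>, so all remaining errors have constants independent of \<open>K\<close>.\<close>

lemma abs_le_ge: "\<bar>x\<bar> \<le> y \<Longrightarrow> - y \<le> (x::real)"
  by linarith

lemma (in potential) absorption:
  fixes f f1 f2 h h1 K m E :: real and x :: 'a and u :: "'a \<Rightarrow> real" and Du :: "'a \<Rightarrow> 'a" and c0 :: real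
  defines "d \<equiv> real DIM('a)"
  defines "F \<equiv> f * h" and "F1 \<equiv> f1 * h + f * h1"
  defines "g \<equiv> (f1 * h + (d - 1) * (f * h) / rr x) / 2"
  defines "g1 \<equiv> (f2 * h + f1 * h1 + (d - 1) * (f1 * h / rr x + f * h1 / rr x - f * h / (rr x)\<^sup>2)) / 2"
  defines "P \<equiv> \<bar>E\<bar> + Q + 1"
  assumes f: "0 \<le> f" "0 \<le> f1" "f1 \<le> m * f / rr x" "\<bar>f2\<bar> \<le> m * (m + 3) * f / (rr x)\<^sup>2" and h: "0 \<le> h" "h \<le> 1" and m: "0 \<le> m"
    and K: "0 \<le> K" "K * W (rr x) * rr x \<le> 1" and c0: "0 \<le> c0" "c0 \<le> 1" "c0 \<le> E - Vlr x"
  shows "(F1 + K * W (rr x) * F) * a1 E u Du x + F * a2 E u Du x + g * a3 E u Du x + (g1 + K * W (rr x) * g) * a4 u Du x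
    \<ge> (K * c0 / 2 - (P * (m + 2) + 1 + (m + d) + (m * (m + 3) + d * (m + 1) + m + d))) * (W (rr x) * F * Zf u Du x)
      - (2 * P + m + d) * (f * \<bar>h1\<bar> * Zf u Du x)"
proof -
  define t w Z q D s where "t = rr x" and "w = W t" and "Z = Zf u Du x" and "q = E - Vlr x" and "D = cD Du x" and "s = cs Du x"
  note defs = t_def w_def Z_def q_def D_def s_def
  have t: "t \<ge> 1" unfolding t_def by (rule rr_ge_1)
  have d1: "d \<ge> 1" unfolding d_def using DIM_positive[where 'a='a] by (simp add: Suc_leI)
  have Z: "0 \<le> Z" "D \<le> Z" "(u x)\<^sup>2 \<le> Z" "Z = D + (u x)\<^sup>2" "0 \<le> D" "s\<^sup>2 \<le> D" "\<bar>u x * s\<bar> \<le> Z / 2"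
    using cD_nonneg[of Du x] cs_sq_le[of Du x] u_cs_le[of u x Du] unfolding defs by (auto simp: Zf_def)
  have qZ: "\<bar>D - q * (u x)\<^sup>2\<bar> \<le> P * Z" using quad_le[of Du x E u] unfolding defs P_def .
  have P1: "P \<ge> 1" using Q_nonneg by (simp add: P_def)
  have it: "1 / t\<^sup>2 \<le> w" "w0 t \<le> w" "0 \<le> w" "0 \<le> 1 / t\<^sup>2" "1 / t\<^sup>2 \<le> 1" "0 \<le> 1 / t" "1 / t \<le> 1"
    using w0_nonneg[of t] t one_le_power[OF t, of 2] by (simp_all add: w_def W_def divide_le_eq)
  have F: "0 \<le> F" "F \<le> f" using f h mult_left_mono[of h 1 f] by (simp_all add: F_def)
  \<comment> \<open>Two units of account: \<open>Fw\<close> measures the gain produced by the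
    exponential, and \<open>Hz\<close> the cost of a varying cutoff. The error terms
    \<open>R1\<close> to \<open>R5\<close> are bounded below by negative multiples of these
    two.\<close>
  define Fw where "Fw = w * F * Z"
  define Hz where "Hz = f * \<bar>h1\<bar> * Z"
  have Fw: "0 \<le> Fw" unfolding Fw_def by (rule mult_nonneg_nonneg[OF mult_nonneg_nonneg[OF it(3) F(1)] Z(1)])
  have Hz: "0 \<le> Hz" unfolding Hz_def by (rule mult_nonneg_nonneg[OF mult_nonneg_nonneg[OF f(1) abs_ge_zero] Z(1)])
  have Ft2: "F / t\<^sup>2 * Z \<le> Fw"
  proof -
    have "1 / t\<^sup>2 * (F * Z) \<le> w * (F * Z)" using it F Z by (intro mult_right_mono) auto
    then show ?thesis by (simp add: Fw_def)
  qed
  have f1h: "0 \<le> f1 * h" "f1 * h \<le> m * F / t"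
  proof -
    show "0 \<le> f1 * h" using f h by simp
    have "f1 * h \<le> (m * f / t) * h" using f(3) h unfolding t_def[symmetric] by (intro mult_right_mono) auto
    then show "f1 * h \<le> m * F / t" by (simp add: F_def)
  qed
  have kw: "0 \<le> K * w" "K * w \<le> 1 / t"
  proof -
    show "0 \<le> K * w" by (rule mult_nonneg_nonneg[OF K(1) it(3)])
    show "K * w \<le> 1 / t" using K(2) t unfolding t_def[symmetric] w_def[symmetric] by (simp add: le_divide_eq)
  qed
  have KF: "0 \<le> K * w * F" "K * w * F \<le> F / t"
    using mult_nonneg_nonneg[OF kw(1) F(1)] mult_right_mono[OF kw(2) F(1)] by simp_all
  have V: "\<bar>Vsr x\<bar> \<le> w" using Vsr_le[of x] it(2) unfolding t_def by linarith
  \<comment> \<open>The source of positivity. With angular energy D - s^2 and K w F \<le> F/t, the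
    last summand turns s^2 into D, leaving K w F (D + q u^2)/2; there q \<ge> c0 makes the bracket
    at least c0 Z.\<close>
  have L: "K * w * F * (s\<^sup>2 - (D - q * (u x)\<^sup>2) / 2) + F / t * (D - s\<^sup>2) \<ge> (K * c0 / 2) * Fw"
  proof -
    have 1: "K * w * F * (D - s\<^sup>2) \<le> F / t * (D - s\<^sup>2)" using KF Z by (intro mult_right_mono) auto
    have 2: "K * w * F * (c0 * Z) \<le> K * w * F * (D + q * (u x)\<^sup>2)"
    proof (intro mult_left_mono)
      have "c0 * D \<le> 1 * D" "c0 * (u x)\<^sup>2 \<le> q * (u x)\<^sup>2" using c0 Z unfolding q_def by (intro mult_right_mono; auto)+
      then show "c0 * Z \<le> D + q * (u x)\<^sup>2" unfolding Z(4) by (simp add: algebra_simps)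
    qed (rule KF)
    have "A * (S - (D' - R) / 2) + T \<ge> C / 2" if "A * (D' - S) \<le> T" "C \<le> A * (D' + R)" for A S D' R T C :: real
      using that by (simp add: field_simps)
    from this[OF 1 2] show ?thesis by (simp add: Fw_def mult_ac)
  qed
  have R0: "f1 * h * s\<^sup>2 \<ge> 0" using f1h by simp
  have R1: "f * h1 * (s\<^sup>2 - (D - q * (u x)\<^sup>2) / 2) \<ge> - (P * Hz)"
  proof -
    have "\<bar>s\<^sup>2 - (D - q * (u x)\<^sup>2) / 2\<bar> \<le> P * Z"
    proof -
      have 1: "\<bar>q * (u x)\<^sup>2\<bar> \<le> P * (u x)\<^sup>2"
        unfolding abs_mult P_def q_def using Vlr_Q[of x] by (intro mult_mono) auto
      have 2: "P * (u x)\<^sup>2 + P * D = P * Z" unfolding Z(4) by (simp add: algebra_simps)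
      have 3: "D \<le> P * D" using P1 Z(5) mult_right_mono[of 1 P D] by simp
      have "\<bar>S - (D' - R) / 2\<bar> \<le> c" if "0 \<le> S" "S \<le> D'" "D' \<le> a" "\<bar>R\<bar> \<le> b" "b + a = c" for S D' R a b c :: real
        using that by (simp add: abs_le_iff field_simps)
      from this[OF zero_le_power2 Z(6) 3 1 2] show ?thesis .
    qed
    then have "\<bar>f * h1 * (s\<^sup>2 - (D - q * (u x)\<^sup>2) / 2)\<bar> \<le> f * \<bar>h1\<bar> * (P * Z)"
      unfolding abs_mult using f by (intro mult_mono) auto
    from abs_le_ge[OF this] show ?thesis by (simp add: Hz_def mult_ac)
  qed
  \<comment> \<open>Everything still multiplying D - q u^2 carries a factor 1/t^2 or 1/t^3 and stems
    from the defect 1 - 1/r^2 in the trace. The summand 1/t^2 of W dominates it.\<close>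
  have R2: "(F1 / t\<^sup>2 / 2 + K * w * F / t\<^sup>2 / 2 - F / t^3 / 2) * (D - q * (u x)\<^sup>2) \<ge> - (P * (m + 2) * Fw) - P * Hz"
  proof -
    have i2: "m * F / t * (1 / t\<^sup>2) \<le> m * F * (1 / t\<^sup>2)"
    proof -
      have "m * F * (1 / t) \<le> m * F * 1" using it m F by (intro mult_left_mono) auto
      then show ?thesis using it by (intro mult_right_mono) auto
    qed
    have i3: "F / t * (1 / t\<^sup>2) \<le> F * (1 / t\<^sup>2)"
    proof -
      have "F * (1 / t) \<le> F * 1" using it F by (intro mult_left_mono) auto
      then show ?thesis using it by (intro mult_right_mono) auto
    qed
    have "\<bar>F1 / t\<^sup>2 / 2 + K * w * F / t\<^sup>2 / 2 - F / t^3 / 2\<bar> \<le> (m + 2) * (F / t\<^sup>2) + f * \<bar>h1\<bar>"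
    proof -
      have 1: "\<bar>f * h1 * (1 / t\<^sup>2)\<bar> \<le> f * \<bar>h1\<bar>"
        unfolding abs_mult using mult_left_le[OF it(5), of "f * \<bar>h1\<bar>"] f it by simp
      have 2: "0 \<le> f1 * h * (1 / t\<^sup>2)" by (rule mult_nonneg_nonneg[OF f1h(1) it(4)])
      have 3: "f1 * h * (1 / t\<^sup>2) \<le> m * F * (1 / t\<^sup>2)"
        by (rule order_trans[OF mult_right_mono[OF f1h(2) it(4)] i2])
      have 4: "0 \<le> K * w * F * (1 / t\<^sup>2)" by (rule mult_nonneg_nonneg[OF KF(1) it(4)])
      have 5: "K * w * F * (1 / t\<^sup>2) \<le> F * (1 / t\<^sup>2)"
        by (rule order_trans[OF mult_right_mono[OF KF(2) it(4)] i3])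
      have 6: "0 \<le> F / t * (1 / t\<^sup>2)" using F t by simp
      have "\<bar>(a + b) / 2 + c / 2 - e / 2\<bar> \<le> A + 2 * B + C"
        if "\<bar>b\<bar> \<le> C" "0 \<le> a" "a \<le> A" "0 \<le> c" "c \<le> B" "0 \<le> e" "e \<le> B" for a b c e A B C :: real
        using that by (simp add: abs_le_iff field_simps)
      from this[OF 1 2 3 4 5 6 i3] show ?thesis
        by (simp add: F1_def add_divide_distrib power3_eq_cube power2_eq_square algebra_simps)
    qed
    then have "\<bar>(F1 / t\<^sup>2 / 2 + K * w * F / t\<^sup>2 / 2 - F / t^3 / 2) * (D - q * (u x)\<^sup>2)\<bar> \<le> ((m + 2) * (F / t\<^sup>2) + f * \<bar>h1\<bar>) * (P * Z)"
      unfolding abs_mult[of _ "D - q * (u x)\<^sup>2"] using qZ by (intro mult_mono) auto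
    also have "\<dots> = P * (m + 2) * (F / t\<^sup>2 * Z) + P * Hz" by (simp add: Hz_def algebra_simps)
    also have "\<dots> \<le> P * (m + 2) * Fw + P * Hz" using Ft2 P1 m by (intro add_right_mono mult_left_mono) auto
    finally show ?thesis using abs_le_ge by fastforce
  qed
  have R3: "F * (Vsr x * (u x * s)) - F * w0 t * (u x)\<^sup>2 / 2 \<ge> - Fw"
  proof -
    have 1: "\<bar>F * (Vsr x * (u x * s))\<bar> \<le> F * (w * (Z / 2))"
      unfolding abs_mult[of F] abs_mult[of "Vsr x"] using F V Z by (intro mult_mono) auto
    have 2: "F * w0 t * (u x)\<^sup>2 \<le> F * w * Z" using F it Z w0_nonneg[of t] by (intro mult_mono) auto
    have "a - b / 2 \<ge> - c" if "\<bar>a\<bar> \<le> c / 2" "b \<le> c" for a b c :: real using that by (simp add: abs_le_iff field_simps)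
    from this[OF _ 2] 1 show ?thesis by (simp add: Fw_def mult_ac)
  qed
  have gb: "0 \<le> g" "g \<le> (m + d) * (F / t)"
  proof -
    have "0 \<le> (d - 1) * F / t" using d1 F t by simp
    then show "0 \<le> g" using f1h(1) unfolding g_def t_def[symmetric] F_def[symmetric] by simp
    have y: "0 \<le> F / t" "0 \<le> m * (F / t)" "0 \<le> d * (F / t)" using F t m d1 by simp_all
    have "(a + (d - 1) * y) / 2 \<le> (m + d) * y" if "a \<le> m * y" "0 \<le> y" "0 \<le> m * y" "0 \<le> d * y" for a y :: real
      using that by (simp add: algebra_simps)
    from this[OF _ y, of "f1 * h"] f1h(2) show "g \<le> (m + d) * (F / t)"
      unfolding g_def t_def[symmetric] F_def[symmetric] by simp
  qed
  have R4: "g * (Vsr x * (u x)\<^sup>2) \<ge> - ((m + d) * Fw)"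
  proof -
    have "g \<le> (m + d) * F"
    proof -
      have "F * (1 / t) \<le> F * 1" using F it by (intro mult_left_mono) auto
      then have "(m + d) * (F / t) \<le> (m + d) * F" using m d1 by (intro mult_left_mono) auto
      then show ?thesis using gb by linarith
    qed
    then have "\<bar>g * (Vsr x * (u x)\<^sup>2)\<bar> \<le> (m + d) * F * (w * Z)"
      unfolding abs_mult[of g] abs_mult[of "Vsr x"] using gb V Z it by (intro mult_mono) auto
    from abs_le_ge[OF this] show ?thesis by (simp add: Fw_def mult_ac)
  qed
  have R5: "(g1 + K * w * g) * (u x * s) \<ge> - ((m * (m + 3) + d * (m + 1) + m + d) * Fw) - (m + d) * Hz"
  proof -
    have e1: "\<bar>f2 * h\<bar> \<le> m * (m + 3) * (F / t\<^sup>2)"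
    proof -
      have "\<bar>f2\<bar> * h \<le> (m * (m + 3) * f / t\<^sup>2) * h" using f(4) h unfolding t_def by (intro mult_right_mono) auto
      then show ?thesis using h by (simp add: abs_mult F_def)
    qed
    have e2: "\<bar>f1 * h1\<bar> \<le> m * (f * \<bar>h1\<bar>)"
    proof -
      have "m * f * (1 / t) \<le> m * f * 1" using m f it by (intro mult_left_mono) auto
      then have "f1 \<le> m * f" using f(3) unfolding t_def[symmetric] by simp
      then have "f1 * \<bar>h1\<bar> \<le> (m * f) * \<bar>h1\<bar>" by (intro mult_right_mono) auto
      then show ?thesis using f by (simp add: abs_mult)
    qed
    have e3: "\<bar>f1 * h / t\<bar> \<le> m * (F / t\<^sup>2)"
      using divide_right_mono[OF f1h(2), of t] f1h(1) t by (simp add: power2_eq_square)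
    have e4: "\<bar>f * h1 / t\<bar> \<le> f * \<bar>h1\<bar>"
    proof -
      have "f * \<bar>h1\<bar> * (1 / t) \<le> f * \<bar>h1\<bar> * 1" using f it by (intro mult_left_mono) auto
      then show ?thesis using f t by (simp add: abs_mult)
    qed
    have e5: "\<bar>f * h / t\<^sup>2\<bar> = F / t\<^sup>2" using F by (simp add: F_def)
    have "\<bar>f1 * h / t + f * h1 / t - f * h / t\<^sup>2\<bar> \<le> (m + 1) * (F / t\<^sup>2) + f * \<bar>h1\<bar>"
    proof -
      have "\<bar>a + b - c\<bar> \<le> (m + 1) * y + z" if "\<bar>a\<bar> \<le> m * y" "\<bar>b\<bar> \<le> z" "\<bar>c\<bar> = y" for a b c y z :: real
        using that by (simp add: distrib_right abs_if split: if_splits)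
      from this[OF e3 e4 e5] show ?thesis .
    qed
    then have e6: "\<bar>(d - 1) * (f1 * h / t + f * h1 / t - f * h / t\<^sup>2)\<bar> \<le> (d - 1) * ((m + 1) * (F / t\<^sup>2) + f * \<bar>h1\<bar>)"
      unfolding abs_mult using d1 by (intro mult_mono) auto
    have e7: "0 \<le> (m + 1) * (F / t\<^sup>2)" "0 \<le> f * \<bar>h1\<bar>" "0 \<le> m * (m + 3) * (F / t\<^sup>2)" using m F f by simp_all
    have e8: "\<bar>g1\<bar> \<le> m * (m + 3) * (F / t\<^sup>2) + m * (f * \<bar>h1\<bar>) + (d - 1) * ((m + 1) * (F / t\<^sup>2) + f * \<bar>h1\<bar>)"
    proof -
      have g1: "g1 = (f2 * h + f1 * h1 + (d - 1) * (f1 * h / t + f * h1 / t - f * h / t\<^sup>2)) / 2"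
        unfolding g1_def t_def ..
      have "\<bar>(a + b + c) / 2\<bar> \<le> a' + b' + c'" if "\<bar>a\<bar> \<le> a'" "\<bar>b\<bar> \<le> b'" "\<bar>c\<bar> \<le> c'" for a b c a' b' c' :: real
        using that by (simp add: abs_le_iff field_simps)
      from this[OF e1 e2 e6] show ?thesis unfolding g1 .
    qed
    have g0: "0 \<le> K * w * g" by (rule mult_nonneg_nonneg[OF kw(1) gb(1)])
    have "K * w * g \<le> 1 / t * ((m + d) * (F / t))" using kw gb it by (intro mult_mono) auto
    then have g2: "K * w * g \<le> (m + d) * (F / t\<^sup>2)" by (simp add: power2_eq_square)
    have "\<bar>a + b\<bar> \<le> a' + b'" if "\<bar>a\<bar> \<le> a'" "0 \<le> b" "b \<le> b'" for a b a' b' :: real using that by (simp add: abs_le_iff field_simps)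
    from this[OF e8 g0 g2] have "\<bar>g1 + K * w * g\<bar> \<le> m * (m + 3) * (F / t\<^sup>2) + m * (f * \<bar>h1\<bar>) + (d - 1) * ((m + 1) * (F / t\<^sup>2) + f * \<bar>h1\<bar>) + (m + d) * (F / t\<^sup>2)"
      .
    also have "\<dots> = (m * (m + 3) + (d - 1) * (m + 1) + m + d) * (F / t\<^sup>2) + (m + d - 1) * (f * \<bar>h1\<bar>)"
    proof -
      have "m * (m + 3) * y + m * z + (d - 1) * ((m + 1) * y + z) + (m + d) * y
        = (m * (m + 3) + (d - 1) * (m + 1) + m + d) * y + (m + d - 1) * z" for y z :: real
        by (simp add: algebra_simps)
      from this[of "F / t\<^sup>2" "f * \<bar>h1\<bar>"] show ?thesis .
    qed
    also have "\<dots> \<le> (m * (m + 3) + d * (m + 1) + m + d) * (F / t\<^sup>2) + (m + d) * (f * \<bar>h1\<bar>)"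
      using F m e7 by (intro add_mono mult_right_mono) auto
    finally have "\<bar>(g1 + K * w * g) * (u x * s)\<bar> \<le> ((m * (m + 3) + d * (m + 1) + m + d) * (F / t\<^sup>2) + (m + d) * (f * \<bar>h1\<bar>)) * Z"
      unfolding abs_mult[of _ "u x * s"] using Z by (intro mult_mono) auto
    also have "\<dots> = (m * (m + 3) + d * (m + 1) + m + d) * (F / t\<^sup>2 * Z) + (m + d) * Hz" by (simp add: Hz_def algebra_simps)
    also have "\<dots> \<le> (m * (m + 3) + d * (m + 1) + m + d) * Fw + (m + d) * Hz"
      using Ft2 m d1 by (intro add_right_mono mult_left_mono) auto
    finally have fin: "\<bar>(g1 + K * w * g) * (u x * s)\<bar> \<le> (m * (m + 3) + d * (m + 1) + m + d) * Fw + (m + d) * Hz" .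
    show ?thesis using abs_le_ge[OF fin] by simp
  qed
  have "(F1 + K * W (rr x) * F) * a1 E u Du x + F * a2 E u Du x + g * a3 E u Du x + (g1 + K * W (rr x) * g) * a4 u Du x
    = (f1 * h * s\<^sup>2) + (K * w * F * (s\<^sup>2 - (D - q * (u x)\<^sup>2) / 2) + F / t * (D - s\<^sup>2))
      + f * h1 * (s\<^sup>2 - (D - q * (u x)\<^sup>2) / 2)
      + (F1 / t\<^sup>2 / 2 + K * w * F / t\<^sup>2 / 2 - F / t^3 / 2) * (D - q * (u x)\<^sup>2)
      + (F * (Vsr x * (u x * s)) - F * w0 t * (u x)\<^sup>2 / 2) + g * (Vsr x * (u x)\<^sup>2) + (g1 + K * w * g) * (u x * s)"
  proof -
    define T where "T = D - q * (u x)\<^sup>2"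
    have a: "a1 E u Du x = s\<^sup>2 - (1 - 1 / t\<^sup>2) / 2 * T"
      "a2 E u Du x = (D - s\<^sup>2) / t - (d - 1 + 1 / t\<^sup>2) / t / 2 * T + Vsr x * (u x * s) - w0 t * (u x)\<^sup>2 / 2"
      "a3 E u Du x = T + Vsr x * (u x)\<^sup>2" "a4 u Du x = u x * s"
      unfolding a1_def a2_def a3_def a4_def T_def d_def defs by simp_all
    \<comment> \<open>The two summands of g T cancel, respectively, the multiple of T with f1 h from
      \<open>a1\<close> and the multiple with (d - 1) F/t from \<open>a2\<close>. This is what
      dictates the form of \<open>g\<close>.\<close>
    have gT: "g * T = f1 * h * T / 2 + (d - 1) * (F / t * T) / 2" unfolding g_def F_def t_def by (simp add: algebra_simps add_divide_distrib)
    have c: "(d - 1 + 1 / t\<^sup>2) / t / 2 * T = (d - 1) * (1 / t * T) / 2 + 1 / t^3 * T / 2"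
      using t by (simp add: field_simps power2_eq_square power3_eq_cube)
    have gen: "(p + r + A) * (s2 - (1 - j) / 2 * T) + F * ((D - s2) * i - ((d - 1) * (i * T) / 2 + k * T / 2) + v - w' / 2)
        + (p * T / 2 + (d - 1) * ((F * i) * T) / 2 + gV) + R
      = p * s2 + (A * (s2 - T / 2) + F * i * (D - s2)) + r * (s2 - T / 2)
        + ((p + r) * j / 2 + A * j / 2 - F * k / 2) * T + (F * v - F * w' / 2) + gV + R"
      for p r A s2 j i k v w' gV R :: real
      by (simp add: field_simps)
    have g3: "g * (T + Vsr x * (u x)\<^sup>2) = f1 * h * T / 2 + (d - 1) * (F / t * T) / 2 + g * (Vsr x * (u x)\<^sup>2)"
      by (simp add: distrib_left gT)
    show ?thesis unfolding a c g3 T_def[symmetric] w_def[symmetric] t_def[symmetric] F1_def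
      using gen[of "f1 * h" "f * h1" "K * w * F" "s\<^sup>2" "1 / t\<^sup>2" "1 / t" "1 / t^3" "Vsr x * (u x * s)" "w0 t * (u x)\<^sup>2"
          "g * (Vsr x * (u x)\<^sup>2)" "(g1 + K * w * g) * (u x * s)"]
      by (simp add: mult.assoc)
  qed
  also have "\<dots> \<ge> (K * c0 / 2) * Fw - P * Hz - (P * (m + 2) * Fw) - P * Hz - Fw - (m + d) * Fw
       - (m * (m + 3) + d * (m + 1) + m + d) * Fw - (m + d) * Hz"
  proof -
    have "a + b + c + e + i + j + k \<ge> b' - c' - e' - e'' - i' - j' - k' - k''"
      if "a \<ge> 0" "b \<ge> b'" "c \<ge> - c'" "e \<ge> - e' - e''" "i \<ge> - i'" "j \<ge> - j'" "k \<ge> - k' - k''"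
      for a b c e i j k b' c' e' e'' i' j' k' k'' :: real using that by linarith
    from this[OF R0 L R1 R2 R3 R4 R5] show ?thesis .
  qed
  finally have fin: "(F1 + K * W (rr x) * F) * a1 E u Du x + F * a2 E u Du x + g * a3 E u Du x + (g1 + K * W (rr x) * g) * a4 u Du x
    \<ge> (K * c0 / 2) * Fw - P * Hz - (P * (m + 2) * Fw) - P * Hz - Fw - (m + d) * Fw
       - (m * (m + 3) + d * (m + 1) + m + d) * Fw - (m + d) * Hz" .
  have "(K * c0 / 2) * Fw - P * Hz - (P * (m + 2) * Fw) - P * Hz - Fw - (m + d) * Fw
       - (m * (m + 3) + d * (m + 1) + m + d) * Fw - (m + d) * Hz
     = (K * c0 / 2 - (P * (m + 2) + 1 + (m + d) + (m * (m + 3) + d * (m + 1) + m + d))) * Fw - (2 * P + m + d) * Hz"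
    by (simp add: algebra_simps)
  then show ?thesis using fin unfolding Fw_def Hz_def w_def t_def Z_def by simp
qed

section \<open>Local, far and weighted energy estimates\<close>

lemma rr_le: "rr x \<le> 1 + norm x"
  unfolding rr_def by (rule real_le_lsqrt) (auto simp: power2_eq_square algebra_simps)

lemma rr_ball_sets [measurable]: "{x::'a::euclidean_space. rr x < L} \<in> sets borel"
  by measurable

context potential
begin

lemma Zf_set_integrable:
  assumes e: "esol E u Du" and h: "h \<in> borel_measurable borel" and b: "\<And>x. rr x < L \<Longrightarrow> \<bar>h x\<bar> \<le> M"
    and S: "S \<in> sets borel" "S \<subseteq> {x. rr x < L}"
  shows "integrable lborel (\<lambda>x. indicator S x * (h x * Zf u Du x))"
proof -
  note [measurable] = h S(1)
  have "integrable lborel (\<lambda>x. (indicator S x * h x) * Zf u Du x)"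
  proof (rule Zf_integrable[OF e, of _ L "\<bar>M\<bar>"])
    show "(\<lambda>x. indicator S x * h x) \<in> borel_measurable borel" by measurable
    show "\<bar>indicator S x * h x\<bar> \<le> \<bar>M\<bar>" for x
      using b[of x] S(2) by (cases "x \<in> S") auto
    fix x :: 'a assume "norm x > L"
    then have "x \<notin> S" using norm_le_rr[of x] S(2) by auto
    then show "indicator S x * h x = 0" by simp
  qed
  then show ?thesis by (simp add: mult.assoc)
qed

lemma sq_set_integrable:
  fixes u :: "'a \<Rightarrow> real"
  assumes "l2loc u" shows "integrable lborel (\<lambda>x. indicator {x. rr x < L} x * (u x)\<^sup>2)"
proof (rule l2loc_prod_integrable[OF assms assms, of _ L 1])
  note [measurable] = l2loc_measurable[OF assms]
  show "(\<lambda>x. indicator {x. rr x < L} x * (u x)\<^sup>2) \<in> borel_measurable borel" by measurable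
  fix x :: 'a assume "norm x > L"
  then show "indicator {x. rr x < L} x * (u x)\<^sup>2 = 0" using norm_le_rr[of x] by auto
qed (auto simp: indicator_def power2_eq_square)

lemma Ex_0: "Ex 0 t = 1" by (simp add: Ex_def)

text \<open>A Caccioppoli inequality, obtained from the multiplier inequality with f = 0 and K = 0,
  where only the energy identity survives. The constant depends on the bound \<open>b\<close> for
  the energy but not on the radius.\<close>

lemma local_energy:
  "\<exists>C\<ge>0. \<forall>E u Du \<rho>. \<bar>E\<bar> \<le> b \<longrightarrow> esol E u Du \<longrightarrow> \<rho> \<ge> 1 \<longrightarrow>
     (LBINT x. indicator {x. rr x < \<rho>} x * Zf u Du x) \<le> C * (LBINT x. indicator {x. rr x < 2 * \<rho>} x * (u x)\<^sup>2)"
proof -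
  obtain ct ct' :: "real \<Rightarrow> real" and B where ct: "\<And>t. (ct has_real_derivative ct' t) (at t)" "continuous_on UNIV ct'"
    "\<And>t. 0 \<le> ct t" "\<And>t. ct t \<le> 1" "\<And>t. t \<le> 1 \<Longrightarrow> ct t = 0" "\<And>t. t \<ge> 2 \<Longrightarrow> ct t = 1"
    "\<And>t. \<bar>ct' t\<bar> \<le> B" "\<And>t. t \<le> 1 \<Longrightarrow> ct' t = 0" "\<And>t. t \<ge> 2 \<Longrightarrow> ct' t = 0" "B \<ge> 1"
    using cutoff_exists by metis
  have ctc: "continuous_on UNIV ct" using ct(1) by (auto intro!: DERIV_isCont continuous_at_imp_continuous_on)
  \<comment> \<open>2 B^2 comes from the cutoff gradient after Young's inequality, |b| + 2Q bounds
    the zero-order coefficient. The 1/2 added to \<open>c\<close> later accounts for the part u^2 of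
    the energy density.\<close>
  define c where "c = 2 * B\<^sup>2 + \<bar>b\<bar> + 2 * Q"
  have c0: "c \<ge> 0" using Q_nonneg by (simp add: c_def)
  have "(LBINT x. indicator {x. rr x < \<rho>} x * Zf u Du x) \<le> (2 * c + 1) * (LBINT x. indicator {x. rr x < 2 * \<rho>} x * (u x)\<^sup>2)"
    if E: "\<bar>E\<bar> \<le> b" and sol: "esol E u Du" and rho: "\<rho> \<ge> 1" for E u Du \<rho>
  proof -
    \<comment> \<open>A square, so that its derivative keeps one factor q = 1 - ct(r/\<rho>): the
      mixed term can then be absorbed into half of q^2 times the squared gradient.\<close>
    define g where "g = (\<lambda>t. (1 - ct (t / \<rho>))\<^sup>2)"
    define g' where "g' = (\<lambda>t. - (2 * (1 - ct (t / \<rho>)) * (ct' (t / \<rho>) / \<rho>)))"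
    have cr: "((\<lambda>t. ct (t / \<rho>)) has_real_derivative ct' (t / \<rho>) / \<rho>) (at t)" for t
    proof -
      have "((\<lambda>t. t / \<rho>) has_real_derivative 1 / \<rho>) (at t)" using rho by (auto intro!: derivative_eq_intros)
      from DERIV_chain2[OF ct(1) this] show ?thesis by simp
    qed
    have gd: "(g has_real_derivative g' t) (at t)" for t
      unfolding g_def g'_def using rho by (auto intro!: derivative_eq_intros cr)
    have gc': "continuous_on {0<..} g'"
      unfolding g'_def using rho
      by (intro continuous_intros continuous_on_compose2[OF ctc] continuous_on_compose2[OF ct(2)]) auto
    have z: "g t = 0" "g' t = 0" if "t \<ge> 2 * \<rho>" for t
      using that rho ct(6)[of "t / \<rho>"] by (simp_all add: g_def g'_def le_divide_eq)
    let ?S = "Sf E u Du (\<lambda>t. 0 * Ex 0 t) (\<lambda>t. (0 + 0 * W t * 0) * Ex 0 t) (\<lambda>t. g t * Ex 0 t) (\<lambda>t. (g' t + 0 * W t * g t) * Ex 0 t)"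
    have S: "integrable lborel ?S" "(LBINT x. ?S x) \<le> 0"
      using multiplier_inequality[OF sol, of 0 "\<lambda>_. 0" "\<lambda>_. 0" g g' "2 * \<rho>"] gd gc' z by auto
    let ?i = "\<lambda>x. indicator {x::'a. rr x < \<rho>} x * Zf u Du x" and ?j = "\<lambda>x. indicator {x::'a. rr x < 2 * \<rho>} x * (u x)\<^sup>2"
    have i: "integrable lborel ?i"
      using Zf_set_integrable[OF sol, of "\<lambda>_. 1" \<rho> 1 "{x. rr x < \<rho>}"] by simp
    have j: "integrable lborel ?j" by (rule sq_set_integrable[OF esol_l2loc(1)[OF sol]])
    have pw: "?i x / 2 - (c + 1 / 2) * ?j x \<le> ?S x" for x
    proof -
      define D s q where "D = cD Du x" and "s = cs Du x" and "q = 1 - ct (rr x / \<rho>)"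
      have D: "0 \<le> D" "s\<^sup>2 \<le> D" unfolding D_def s_def by (rule cD_nonneg cs_sq_le)+
      have q: "0 \<le> q" "q \<le> 1" using ct(3,4) by (auto simp: q_def)
      have Sx: "?S x = q\<^sup>2 * (D - (E - Vlr x) * (u x)\<^sup>2 + Vsr x * (u x)\<^sup>2) + g' (rr x) * (u x * s)"
        by (simp add: Sf_def Ex_0 a3_def a4_def g_def D_def s_def q_def)
      show ?thesis
      proof (cases "rr x < 2 * \<rho>")
        case True
        have e1: "q\<^sup>2 * (D - (E - Vlr x) * (u x)\<^sup>2 + Vsr x * (u x)\<^sup>2) \<ge> q\<^sup>2 * D - (\<bar>b\<bar> + 2 * Q) * (u x)\<^sup>2"
        proof -
          have q2: "0 \<le> q\<^sup>2" "q\<^sup>2 \<le> 1" using q by (simp_all add: power_le_one)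
          have "\<bar>- (E - Vlr x) + Vsr x\<bar> \<le> \<bar>b\<bar> + 2 * Q" using E Vlr_Q[of x] Vsr_Q[of x] by linarith
          then have "\<bar>q\<^sup>2 * ((- (E - Vlr x) + Vsr x) * (u x)\<^sup>2)\<bar> \<le> 1 * ((\<bar>b\<bar> + 2 * Q) * (u x)\<^sup>2)"
            unfolding abs_mult using q2 by (intro mult_mono) auto
          from abs_le_ge[OF this] show ?thesis by (simp add: algebra_simps)
        qed
        have e2: "g' (rr x) * (u x * s) \<ge> - (q\<^sup>2 * D / 2 + 2 * B\<^sup>2 * (u x)\<^sup>2)"
        proof -
          have "\<bar>ct' (rr x / \<rho>) / \<rho>\<bar> \<le> B"
          proof -
            have "\<bar>ct' (rr x / \<rho>)\<bar> / \<rho> \<le> B / 1" using ct(7) ct(10) rho by (intro frac_le) auto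
            then show ?thesis using rho by simp
          qed
          then have "\<bar>(ct' (rr x / \<rho>) / \<rho>) * u x\<bar> \<le> B * \<bar>u x\<bar>" unfolding abs_mult by (intro mult_right_mono) auto
          from power_mono[OF this abs_ge_zero, of 2]
          have 1: "((ct' (rr x / \<rho>) / \<rho>) * u x)\<^sup>2 \<le> (B * \<bar>u x\<bar>)\<^sup>2" unfolding power2_abs .
          have "2 * A * y \<le> A\<^sup>2 / 2 + 2 * y\<^sup>2" for A y :: real
            using sum_squares_bound[of A "2 * y"] by (simp add: power2_eq_square)
          from this[of "q * s" "(ct' (rr x / \<rho>) / \<rho>) * u x"]
          have "2 * (q * s) * ((ct' (rr x / \<rho>) / \<rho>) * u x) \<le> (q * s)\<^sup>2 / 2 + 2 * ((ct' (rr x / \<rho>) / \<rho>) * u x)\<^sup>2" .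
          also have "\<dots> \<le> q\<^sup>2 * D / 2 + 2 * (B * \<bar>u x\<bar>)\<^sup>2"
            using 1 D mult_left_mono[OF D(2), of "q\<^sup>2"] by (intro add_mono) (auto simp: power_mult_distrib)
          finally show ?thesis by (simp add: g'_def q_def power_mult_distrib mult_ac)
        qed
        have e3: "indicator {x::'a. rr x < \<rho>} x * D \<le> q\<^sup>2 * D"
        proof (cases "rr x < \<rho>")
          case T: True
          then have "q = 1" using ct(5)[of "rr x / \<rho>"] rho by (simp add: q_def divide_le_eq)
          then show ?thesis using T by simp
        qed (use D in simp)
        have e4: "indicator {x::'a. rr x < \<rho>} x * (u x)\<^sup>2 \<le> (u x)\<^sup>2" by (simp add: indicator_def)
        have "a * D' / 2 + a * U / 2 - (2 * B' + Q' + 1 / 2) * U \<le> s1 + s2"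
          if "s1 \<ge> q' - Q' * U" "s2 \<ge> - (q' / 2 + 2 * B' * U)" "a * D' \<le> q'" "a * U \<le> U" for a D' U B' Q' s1 s2 q' :: real
          using that by (simp add: algebra_simps)
        from this[OF e1 e2 e3 e4]
        show ?thesis unfolding Sx using True by (simp add: Zf_def D_def c_def algebra_simps add_divide_distrib)
      next
        case False
        then have "\<not> rr x < \<rho>" using rho by linarith
        moreover have "q = 0" "g' (rr x) = 0" using False z[of "rr x"] rho ct(6)[of "rr x / \<rho>"] by (simp_all add: q_def le_divide_eq)
        ultimately show ?thesis unfolding Sx using False by simp
      qed
    qed
    have "(LBINT x. ?i x / 2 - (c + 1 / 2) * ?j x) \<le> (LBINT x. ?S x)"
      by (rule integral_mono) (use i j S pw in auto)
    then have "(LBINT x. ?i x) / 2 - (c + 1 / 2) * (LBINT x. ?j x) \<le> 0" using i j S by simp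
    then show ?thesis by (simp add: algebra_simps)
  qed
  then show ?thesis using c0 by (intro exI[of _ "2 * c + 1"]) auto
qed

text \<open>Smallness of averages over whole dyadic balls instead of single shells. It is the form
  in which the condition at infinity meets the outer cutoff error.\<close>

definition decays :: "('a \<Rightarrow> real) \<Rightarrow> bool" where
  "decays u \<longleftrightarrow> (\<lambda>k::nat. (LBINT x. indicator {x. rr x < 2 ^ k} x * (u x)\<^sup>2) / 2 ^ k) \<longlonglongrightarrow> 0"

lemma Ex_bounds:
  assumes K: "K \<ge> 0" and t: "t \<ge> 1"
  shows "exp (- K) \<le> Ex K t" "Ex K t \<le> exp (K * (LBINT s. w0 s))"
proof -
  have 0: "0 \<le> Jw t" unfolding Jw_def by (intro Bochner_Integration.integral_nonneg) (simp add: w0_nonneg)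
  have 1: "Jw t \<le> (LBINT s. w0 s)" unfolding Jw_def
    by (intro integral_mono Bochner_Integration.integrable_bound[OF w0_int]) (auto simp: indicator_def w0_nonneg w0_int)
  have it: "0 \<le> 1 / t" "1 / t \<le> 1" using t by simp_all
  have "K * (- 1) \<le> K * (Jw t - 1 / t)" using 0 it K by (intro mult_left_mono) linarith+
  then show "exp (- K) \<le> Ex K t" by (simp add: Ex_def)
  have "K * (Jw t - 1 / t) \<le> K * (LBINT s. w0 s)" using 1 it K by (intro mult_left_mono) linarith+
  then show "Ex K t \<le> exp (K * (LBINT s. w0 s))" by (simp add: Ex_def)
qed

text \<open>Since t \<open>w0\<close> t tends to 0, K W t \<le> 1 holds far out for any prescribed
  K, and there the long-range part is at most a/2, leaving E - \<open>Vlr\<close> \<ge> a/2 for all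
  energies at least a.\<close>

lemma far_region:
  assumes a: "a > 0" shows "\<exists>r0\<ge>1. \<forall>t\<ge>r0. K * W t * t \<le> 1 \<and> (\<forall>x. rr x \<ge> r0 \<longrightarrow> \<bar>Vlr x\<bar> \<le> a / 2)"
proof -
  have "((\<lambda>t. K * (t * w0 t + 1 / t)) \<longlongrightarrow> K * (0 + 0)) at_top"
    by (intro tendsto_intros w0_lim tendsto_divide_0[OF tendsto_const filterlim_at_top_imp_at_infinity[OF filterlim_ident]])
  then have "eventually (\<lambda>t. K * (t * w0 t + 1 / t) < 1) at_top" by (intro order_tendstoD(2)) auto
  then obtain r1 where r1: "\<And>t. t \<ge> r1 \<Longrightarrow> K * (t * w0 t + 1 / t) < 1" by (auto simp: eventually_at_top_linorder)
  have "eventually (\<lambda>x. dist (Vlr x) 0 < a / 2) at_infinity" using Vlr_lim a by (intro tendstoD) auto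
  then obtain r2 where r2: "\<And>x. norm x \<ge> r2 \<Longrightarrow> \<bar>Vlr x\<bar> < a / 2" by (auto simp: eventually_at_infinity)
  let ?r = "max 1 (max r1 (r2 + 1))"
  show ?thesis
  proof (intro exI[of _ ?r] conjI allI impI)
    fix t :: real assume t: "t \<ge> ?r"
    have "W t * t = t * w0 t + 1 / t" using t by (simp add: W_def field_simps power2_eq_square)
    then have e: "K * W t * t = K * (t * w0 t + 1 / t)" by (simp add: mult.assoc)
    show "K * W t * t \<le> 1" unfolding e using r1[of t] t by simp
    fix x :: 'a assume "rr x \<ge> ?r"
    then show "\<bar>Vlr x\<bar> \<le> a / 2" using rr_le[of x] r2[of x] by (simp add: less_imp_le)
  qed simp
qed

text \<open>The absorption bound is integrated against the multiplier inequality. What remains on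
  the right are two cutoff errors: one near r0, harmless as a local quantity, and one near \<rho>
  carrying L^m/\<rho>. The constants are fixed before the energy, the solution, L and
  \<rho>.\<close>

lemma far_estimate:
  fixes m :: nat
  assumes a: "0 < a" "a \<le> b"
  shows "\<exists>C r0. C \<ge> 0 \<and> r0 \<ge> 1 \<and> (\<forall>E u Du L \<rho>. a \<le> E \<longrightarrow> E \<le> b \<longrightarrow> esol E u Du \<longrightarrow> 1 \<le> L \<longrightarrow> L \<le> \<rho> \<longrightarrow>
     (LBINT x. indicator {x. 2 * r0 \<le> rr x \<and> rr x < L} x * (rr x ^ m / (rr x)\<^sup>2 * Zf u Du x))
     \<le> C * ((LBINT x. indicator {x. rr x < 2 * r0} x * Zf u Du x) + L ^ m / \<rho> * (LBINT x. indicator {x. rr x < 2 * \<rho>} x * Zf u Du x)))"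
proof -
  obtain ct ct' :: "real \<Rightarrow> real" and B where ct: "\<And>t. (ct has_real_derivative ct' t) (at t)" "continuous_on UNIV ct'"
    "\<And>t. 0 \<le> ct t" "\<And>t. ct t \<le> 1" "\<And>t. t \<le> 1 \<Longrightarrow> ct t = 0" "\<And>t. t \<ge> 2 \<Longrightarrow> ct t = 1"
    "\<And>t. \<bar>ct' t\<bar> \<le> B" "\<And>t. t \<le> 1 \<Longrightarrow> ct' t = 0" "\<And>t. t \<ge> 2 \<Longrightarrow> ct' t = 0" "B \<ge> 1"
    using cutoff_exists by metis
  have ctc: "continuous_on UNIV ct" using ct(1) by (auto intro!: DERIV_isCont continuous_at_imp_continuous_on)
  define d where "d = real DIM('a)"
  have d1: "d \<ge> 1" unfolding d_def using DIM_positive[where 'a='a] by (simp add: Suc_leI)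
  define M where "M = real m"
  define P where "P = b + Q + 1"
  define Ca where "Ca = P * (M + 2) + 1 + (M + d) + (M * (M + 3) + d * (M + 1) + M + d)"
  define Cb where "Cb = 2 * P + M + d"
  \<comment> \<open>Lower bound for E - \<open>Vlr\<close> in the far region, capped at 1 so that it
    also bounds the coefficient of the squared gradient.\<close>
  define c0 where "c0 = min 1 (a / 2)"
  \<comment> \<open>Makes K c0/2 exceed the error coefficient \<open>Ca\<close> by exactly 1. The
    order of choice matters: \<open>Ca\<close> is free of K, so K is fixed from a, b and m, and r0
    is taken afterwards so that K W t \<le> 1 beyond it.\<close>
  define K where "K = 2 * (Ca + 1) / c0"
  have P0: "P \<ge> 1" using a Q_nonneg by (simp add: P_def)
  have M0: "M \<ge> 0" by (simp add: M_def)
  have Ca0: "Ca \<ge> 0" and Cb0: "Cb \<ge> 0" unfolding Ca_def Cb_def using P0 M0 d1 by (auto intro!: add_nonneg_nonneg mult_nonneg_nonneg)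
  have c0: "0 < c0" "c0 \<le> 1" "c0 \<le> a / 2" using a by (auto simp: c0_def)
  have K0: "K \<ge> 0" using Ca0 c0 by (simp add: K_def)
  have Kc: "K * c0 / 2 = Ca + 1" using c0 by (simp add: K_def)
  obtain r0 where r0: "r0 \<ge> 1" "\<And>t. t \<ge> r0 \<Longrightarrow> K * W t * t \<le> 1" "\<And>x. rr x \<ge> r0 \<Longrightarrow> \<bar>Vlr x\<bar> \<le> a / 2"
    using far_region[OF a(1), of K] by (metis order_refl)
  define e1 where "e1 = exp (- K)"
  define e2 where "e2 = exp (K * (LBINT s. w0 s))"
  have e: "e1 > 0" "e2 > 0" "\<And>t. t \<ge> 1 \<Longrightarrow> e1 \<le> Ex K t" "\<And>t. t \<ge> 1 \<Longrightarrow> Ex K t \<le> e2"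
    using Ex_bounds[OF K0] by (auto simp: e1_def e2_def)
  \<comment> \<open>e2/e1 compares the extreme values of the exponential, 2^m pays for the lower
    bound y \<ge> t/2, and (2 r0)^m bounds the weight where the inner cutoff varies.\<close>
  define C where "C = Cb * e2 * B * (2 * r0) ^ m * 2 ^ m / e1"
  have r0m: "(2 * r0) ^ m \<ge> 1" using r0(1) by (intro one_le_power) simp
  have "(LBINT x. indicator {x. 2 * r0 \<le> rr x \<and> rr x < L} x * (rr x ^ m / (rr x)\<^sup>2 * Zf u Du x))
     \<le> C * ((LBINT x. indicator {x. rr x < 2 * r0} x * Zf u Du x) + L ^ m / \<rho> * (LBINT x. indicator {x. rr x < 2 * \<rho>} x * Zf u Du x))"
    if E: "a \<le> E" "E \<le> b" and sol: "esol E u Du" and L: "1 \<le> L" "L \<le> \<rho>" for E u Du L \<rho>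
  proof -
    \<comment> \<open>A smooth truncation of the radius, between t/2 and t as long as t \<le> L and
      always at most L. Its logarithmic derivative \<open>v\<close> lies between 0 and 1/t, so the
      derivative bounds required of f = y^m have constants independent of L.\<close>
    define y where "y = (\<lambda>t::real. t * L / (t + L))"
    define f where "f = (\<lambda>t. y t ^ m)"
    define v where "v = (\<lambda>t. L / (t * (t + L)))"
    define f1 where "f1 = (\<lambda>t. M * f t * v t)"
    define v' where "v' = (\<lambda>t. - (L * (2 * t + L) / (t * (t + L))\<^sup>2))"
    define f2 where "f2 = (\<lambda>t. M * (f1 t * v t + f t * v' t))"
    \<comment> \<open>Switches on between r0 and 2 r0, where the far-region bounds hold, and off
      between \<rho> and 2 \<rho>, so that the multiplier has bounded support.\<close>
    define h where "h = (\<lambda>t. ct (t / r0) * (1 - ct (t / \<rho>)))"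
    define h1 where "h1 = (\<lambda>t. ct' (t / r0) / r0 * (1 - ct (t / \<rho>)) - ct (t / r0) * (ct' (t / \<rho>) / \<rho>))"
    have rho: "\<rho> \<ge> 1" using L by linarith
    have fd: "(f has_real_derivative f1 t) (at t)" if t: "t > 0" for t
    proof -
      have yd: "(y has_real_derivative L\<^sup>2 / (t + L)\<^sup>2) (at t)"
        unfolding y_def using t L by (auto intro!: derivative_eq_intros simp: power2_eq_square field_simps)
      have "((\<lambda>t. y t ^ m) has_real_derivative M * y t ^ (m - 1) * (L\<^sup>2 / (t + L)\<^sup>2)) (at t)"
        unfolding M_def by (rule derivative_eq_intros yd refl)+ simp
      moreover have "M * y t ^ (m - 1) * (L\<^sup>2 / (t + L)\<^sup>2) = f1 t"
      proof (cases m)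
        case (Suc k)
        have "t * L / s * (L / (t * s)) = L\<^sup>2 / s\<^sup>2" if "s > 0" for s using that t by (simp add: field_simps power2_eq_square)
        from this[of "t + L"] have "y t * v t = L\<^sup>2 / (t + L)\<^sup>2" unfolding y_def v_def using t L by simp
        then have "M * y t ^ (m - 1) * (L\<^sup>2 / (t + L)\<^sup>2) = M * y t ^ k * (y t * v t)" by (simp only: Suc diff_Suc_1)
        then show ?thesis by (simp add: f1_def f_def Suc mult_ac)
      qed (simp add: f1_def M_def)
      ultimately show ?thesis unfolding f_def by simp
    qed
    have vd: "(v has_real_derivative v' t) (at t)" if t: "t > 0" for t
    proof -
      have p: "t * (t + L) > 0" using t L by simp
      have "((\<lambda>t. t * (t + L)) has_real_derivative 2 * t + L) (at t)" by (auto intro!: derivative_eq_intros)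
      moreover have "t \<noteq> 0 \<and> t + L \<noteq> 0" using t L by simp
      ultimately show ?thesis
        using DERIV_divide[OF DERIV_const, of "\<lambda>t. t * (t + L)" "2 * t + L" t UNIV L]
        unfolding v_def v'_def power2_eq_square by simp
    qed
    have f1d: "(f1 has_real_derivative f2 t) (at t)" if t: "t > 0" for t
      unfolding f1_def f2_def using DERIV_cmult[OF DERIV_mult[OF fd[OF t] vd[OF t]], of M] by (simp add: f1_def algebra_simps)
    have cr: "((\<lambda>t. ct (t / s)) has_real_derivative ct' (t / s) / s) (at t)" if "s \<ge> 1" for t s
    proof -
      have "((\<lambda>t. t / s) has_real_derivative 1 / s) (at t)" using that by (auto intro!: derivative_eq_intros)
      from DERIV_chain2[OF ct(1) this] show ?thesis by simp
    qed
    have hd: "(h has_real_derivative h1 t) (at t)" for t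
      unfolding h_def h1_def by (auto intro!: derivative_eq_intros cr r0 rho)
    define F where "F = (\<lambda>t. f t * h t)"
    define F1 where "F1 = (\<lambda>t. f1 t * h t + f t * h1 t)"
    define g where "g = (\<lambda>t. (f1 t * h t + (d - 1) * (f t * h t) / t) / 2)"
    define g1 where "g1 = (\<lambda>t. (f2 t * h t + f1 t * h1 t + (d - 1) * (f1 t * h t / t + f t * h1 t / t - f t * h t / t\<^sup>2)) / 2)"
    have Fd: "(F has_real_derivative F1 t) (at t)" if "t > 0" for t
      unfolding F_def F1_def using DERIV_mult[OF fd[OF that] hd] by (simp add: algebra_simps)
    have gd: "(g has_real_derivative g1 t) (at t)" if t: "t > 0" for t
      unfolding g_def g1_def using t
      by (auto intro!: derivative_eq_intros fd f1d hd simp: field_simps power2_eq_square)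
    have ccont: "continuous_on {0<..} (\<lambda>t. ct (t / s))" "continuous_on {0<..} (\<lambda>t. ct' (t / s))" if "s \<ge> 1" for s
      using that by (auto intro!: continuous_intros continuous_on_compose2[OF ctc] continuous_on_compose2[OF ct(2)])
    have hc: "continuous_on {0<..} h" "continuous_on {0<..} h1"
      unfolding h_def h1_def using r0(1) rho by (auto intro!: continuous_intros ccont)
    have fc: "continuous_on {0<..} f" "continuous_on {0<..} f1"
      using fd f1d by (auto intro!: DERIV_isCont continuous_at_imp_continuous_on)
    have vc: "continuous_on {0<..} v" "continuous_on {0<..} v'"
      unfolding v_def v'_def using L by (auto intro!: continuous_intros)
    have f2c: "continuous_on {0<..} f2" unfolding f2_def by (intro continuous_intros fc vc)
    have F1c: "continuous_on {0<..} F1" unfolding F1_def by (intro continuous_intros fc hc)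
    have g1c: "continuous_on {0<..} g1" unfolding g1_def by (intro continuous_intros fc hc f2c) auto
    have yb: "0 \<le> y t" "y t \<le> t" "y t \<le> L" "t \<le> L \<Longrightarrow> t / 2 \<le> y t" if "t > 0" for t
      unfolding y_def using that L by (auto simp: field_simps)
    have fb: "0 \<le> f t" "f t \<le> t ^ m" "f t \<le> L ^ m" "t \<le> L \<Longrightarrow> (t / 2) ^ m \<le> f t" if "t > 0" for t
      unfolding f_def using yb[OF that] that by (auto intro!: power_mono)
    have hb: "0 \<le> h t" "h t \<le> 1" for t
      unfolding h_def using ct(3,4) by (auto intro!: mult_le_one)
    have zz: "h t = 0" "h1 t = 0" if "t \<ge> 2 * \<rho>" for t
      using that rho ct(6)[of "t / \<rho>"] ct(9)[of "t / \<rho>"] by (simp_all add: h_def h1_def le_divide_eq)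
    have zi: "h t = 0" "h1 t = 0" if "t \<le> r0" for t
      using that r0(1) ct(5)[of "t / r0"] ct(8)[of "t / r0"] by (simp_all add: h_def h1_def divide_le_eq)
    have vb: "0 \<le> v t" "v t \<le> 1 / t" "\<bar>v' t\<bar> \<le> 1 / t\<^sup>2" if t: "t > 0" for t
    proof -
      have p: "t * (t + L) > 0" using t L by simp
      show "0 \<le> v t" unfolding v_def using p L by simp
      have "L / (t + L) / t \<le> 1 / t" using t L by (intro divide_right_mono) auto
      then show "v t \<le> 1 / t" unfolding v_def by (simp add: mult.commute)
      have "L * (2 * t + L) \<le> (t + L)\<^sup>2" by (simp add: power2_eq_square algebra_simps)
      then have "L * (2 * t + L) / (t * (t + L))\<^sup>2 \<le> (t + L)\<^sup>2 / (t * (t + L))\<^sup>2" by (intro divide_right_mono) auto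
      also have "\<dots> = 1 / t\<^sup>2" using t L by (simp add: power_mult_distrib)
      finally show "\<bar>v' t\<bar> \<le> 1 / t\<^sup>2" unfolding v'_def using t L by simp
    qed
    have f1b: "0 \<le> f1 t" "f1 t \<le> M * f t / t" "\<bar>f2 t\<bar> \<le> M * (M + 3) * f t / t\<^sup>2" if t: "t > 0" for t
    proof -
      have Mf: "0 \<le> M * f t" using M0 fb(1)[OF t] by simp
      show 1: "0 \<le> f1 t" unfolding f1_def using Mf vb(1)[OF t] by (rule mult_nonneg_nonneg)
      show 2: "f1 t \<le> M * f t / t" unfolding f1_def using mult_left_mono[OF vb(2)[OF t] Mf] by simp
      have "f1 t * v t \<le> M * f t / t * (1 / t)" by (intro mult_mono 2 vb t) (use Mf t vb(1)[OF t] in auto)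
      then have 3: "\<bar>f1 t * v t\<bar> \<le> M * (f t / t\<^sup>2)" using 1 vb(1)[OF t] by (simp add: power2_eq_square)
      have "\<bar>f t * v' t\<bar> \<le> f t * (1 / t\<^sup>2)" unfolding abs_mult using fb(1)[OF t] by (intro mult_mono vb t) auto
      then have 4: "\<bar>f t * v' t\<bar> \<le> f t / t\<^sup>2" by simp
      have n: "0 \<le> f t / t\<^sup>2" using fb(1)[OF t] by simp
      have "\<bar>f1 t * v t + f t * v' t\<bar> \<le> (M + 3) * (f t / t\<^sup>2)"
      proof -
        have "\<bar>p + q\<bar> \<le> (M + 3) * w" if "\<bar>p\<bar> \<le> M * w" "\<bar>q\<bar> \<le> w" "0 \<le> w" for p q w :: real
          using that by (simp add: distrib_right abs_le_iff)
        from this[OF 3 4 n] show ?thesis .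
      qed
      then have "\<bar>f2 t\<bar> \<le> M * ((M + 3) * (f t / t\<^sup>2))"
        unfolding f2_def abs_mult[of M] using M0 by (intro mult_mono) auto
      then show "\<bar>f2 t\<bar> \<le> M * (M + 3) * f t / t\<^sup>2" by simp
    qed
    have h1b: "f t * \<bar>h1 t\<bar> \<le> B * (2 * r0) ^ m * of_bool (t < 2 * r0) + B * (L ^ m / \<rho>) * of_bool (t < 2 * \<rho>)" if t: "t > 0" for t
    proof -
      have A: "\<bar>ct' (t / r0) / r0 * (1 - ct (t / \<rho>))\<bar> \<le> B * of_bool (t < 2 * r0)"
      proof (cases "t < 2 * r0")
        case True
        have "\<bar>ct' (t / r0)\<bar> / r0 \<le> B / 1" using ct(7,10) r0(1) by (intro frac_le) auto
        then have "\<bar>ct' (t / r0) / r0\<bar> \<le> B" using r0(1) by simp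
        then have "\<bar>ct' (t / r0) / r0 * (1 - ct (t / \<rho>))\<bar> \<le> B * 1"
          unfolding abs_mult[of _ "1 - ct (t / \<rho>)"] using ct(3,4)[of "t / \<rho>"] ct(10) by (intro mult_mono) auto
        then show ?thesis using True by simp
      qed (use ct(9)[of "t / r0"] r0(1) in \<open>simp add: le_divide_eq\<close>)
      have A': "\<bar>ct (t / r0) * (ct' (t / \<rho>) / \<rho>)\<bar> \<le> B / \<rho> * of_bool (t < 2 * \<rho>)"
      proof (cases "t < 2 * \<rho>")
        case True
        have "\<bar>ct' (t / \<rho>) / \<rho>\<bar> \<le> B / \<rho>" using ct(7) rho by (simp add: divide_right_mono)
        then have "\<bar>ct (t / r0) * (ct' (t / \<rho>) / \<rho>)\<bar> \<le> 1 * (B / \<rho>)"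
          unfolding abs_mult[of "ct (t / r0)"] using ct(3,4)[of "t / r0"] by (intro mult_mono) auto
        then show ?thesis using True by simp
      qed (use ct(9)[of "t / \<rho>"] rho in \<open>simp add: le_divide_eq\<close>)
      have "f t * \<bar>h1 t\<bar> \<le> f t * (B * of_bool (t < 2 * r0) + B / \<rho> * of_bool (t < 2 * \<rho>))"
        unfolding h1_def by (intro mult_left_mono order_trans[OF abs_triangle_ineq4] add_mono A A' fb t)
      also have "\<dots> = f t * (B * of_bool (t < 2 * r0)) + f t * (B / \<rho> * of_bool (t < 2 * \<rho>))" by (simp add: distrib_left)
      also have "\<dots> \<le> (2 * r0) ^ m * (B * of_bool (t < 2 * r0)) + L ^ m * (B / \<rho> * of_bool (t < 2 * \<rho>))"
      proof (intro add_mono)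
        show "f t * (B * of_bool (t < 2 * r0)) \<le> (2 * r0) ^ m * (B * of_bool (t < 2 * r0))"
        proof (cases "t < 2 * r0")
          case True
          then have "f t \<le> (2 * r0) ^ m" using fb(2)[OF t] power_mono[of t "2 * r0" m] t by linarith
          then show ?thesis using ct(10) by (intro mult_right_mono) auto
        qed simp
        show "f t * (B / \<rho> * of_bool (t < 2 * \<rho>)) \<le> L ^ m * (B / \<rho> * of_bool (t < 2 * \<rho>))"
          using ct(10) rho by (intro mult_right_mono fb t) auto
      qed
      finally show ?thesis by (simp add: mult_ac)
    qed
    let ?S = "Sf E u Du (\<lambda>t. F t * Ex K t) (\<lambda>t. (F1 t + K * W t * F t) * Ex K t) (\<lambda>t. g t * Ex K t) (\<lambda>t. (g1 t + K * W t * g t) * Ex K t)"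
    have S: "integrable lborel ?S" "(LBINT x. ?S x) \<le> 0"
      using multiplier_inequality[OF sol K0 Fd F1c _ gd g1c, of "2 * \<rho>"] fb hb zz
      by (auto simp: F_def F1_def g_def g1_def)
    let ?i = "\<lambda>x. indicator {x::'a. 2 * r0 \<le> rr x \<and> rr x < L} x * (rr x ^ m / (rr x)\<^sup>2 * Zf u Du x)"
    let ?j = "\<lambda>x. indicator {x::'a. rr x < 2 * r0} x * Zf u Du x" and ?k = "\<lambda>x. indicator {x::'a. rr x < 2 * \<rho>} x * Zf u Du x"
    have i: "integrable lborel ?i"
    proof (rule Zf_set_integrable[OF sol, of _ L "L ^ m"])
      fix x :: 'a assume "rr x < L"
      then have "rr x ^ m \<le> L ^ m" using rr_pos[of x] by (intro power_mono) auto
      moreover have "rr x ^ m / (rr x)\<^sup>2 \<le> rr x ^ m / 1" using rr_ge_1[of x] by (intro divide_left_mono) (auto simp: one_le_power)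
      ultimately show "\<bar>rr x ^ m / (rr x)\<^sup>2\<bar> \<le> L ^ m" using rr_pos[of x] by simp
    qed auto
    have j: "integrable lborel ?j" and k: "integrable lborel ?k"
      using Zf_set_integrable[OF sol, of "\<lambda>_. 1" "2 * r0" 1 "{x. rr x < 2 * r0}"] Zf_set_integrable[OF sol, of "\<lambda>_. 1" "2 * \<rho>" 1 "{x. rr x < 2 * \<rho>}"] by simp_all
    define c1 where "c1 = Cb * e2 * B * (2 * r0) ^ m"
    define c2 where "c2 = Cb * e2 * B * (L ^ m / \<rho>)"
    have pw: "e1 / 2 ^ m * ?i x - c1 * ?j x - c2 * ?k x \<le> ?S x" for x
    proof -
      define t where "t = rr x"
      have t: "t > 0" "t \<ge> 1" unfolding t_def using rr_pos[of x] rr_ge_1[of x] by auto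
      have Z: "0 \<le> Zf u Du x" by (rule Zf_nonneg)
      define A where "A = (F1 t + K * W t * F t) * a1 E u Du x + F t * a2 E u Du x + g t * a3 E u Du x + (g1 t + K * W t * g t) * a4 u Du x"
      have SA: "?S x = Ex K t * A" by (simp add: Sf_def A_def t_def algebra_simps)
      \<comment> \<open>Of the gain, only the inverse square part of W is kept; hence the division
        by r^2 on the left-hand side of the estimate.\<close>
      have Wt: "1 / t\<^sup>2 \<le> W t" using w0_nonneg[of t] by (simp add: W_def)
      have Ft: "0 \<le> F t" using fb[OF t(1)] hb by (simp add: F_def)
      have A: "A \<ge> W t * F t * Zf u Du x - Cb * (f t * \<bar>h1 t\<bar> * Zf u Du x)"
      proof (cases "t \<ge> r0")
        case True
        have "(K * c0 / 2 - ((\<bar>E\<bar> + Q + 1) * (M + 2) + 1 + (M + d) + (M * (M + 3) + d * (M + 1) + M + d))) * (W t * F t * Zf u Du x)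
           - (2 * (\<bar>E\<bar> + Q + 1) + M + d) * (f t * \<bar>h1 t\<bar> * Zf u Du x) \<le> A"
          unfolding A_def F_def F1_def g_def g1_def t_def d_def
          by (rule absorption) (use f1b fb hb M0 K0 r0(2)[OF True] c0 E r0(3)[of x] True t in \<open>auto simp: t_def abs_le_iff\<close>)
        moreover have "W t * F t * Zf u Du x \<le> (K * c0 / 2 - ((\<bar>E\<bar> + Q + 1) * (M + 2) + 1 + (M + d) + (M * (M + 3) + d * (M + 1) + M + d))) * (W t * F t * Zf u Du x)"
        proof -
          have "(\<bar>E\<bar> + Q + 1) * (M + 2) \<le> P * (M + 2)" using E a M0 by (intro mult_right_mono) (auto simp: P_def)
          then have one: "1 \<le> K * c0 / 2 - ((\<bar>E\<bar> + Q + 1) * (M + 2) + 1 + (M + d) + (M * (M + 3) + d * (M + 1) + M + d))"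
            unfolding Kc Ca_def by simp
          have "0 \<le> W t * F t * Zf u Du x" using Wt Ft Z t by (intro mult_nonneg_nonneg) (auto intro: order_trans[OF _ Wt])
          from mult_right_mono[OF one this] show ?thesis by (simp only: mult_1)
        qed
        moreover have "(2 * (\<bar>E\<bar> + Q + 1) + M + d) * (f t * \<bar>h1 t\<bar> * Zf u Du x) \<le> Cb * (f t * \<bar>h1 t\<bar> * Zf u Du x)"
          using E a fb(1)[OF t(1)] Z by (intro mult_right_mono) (auto simp: Cb_def P_def)
        ultimately show ?thesis by linarith
      next
        case False
        then have "h t = 0" "h1 t = 0" using zi[of t] by auto
        then show ?thesis unfolding A_def F_def F1_def g_def g1_def by simp
      qed
      have G1: "e1 / 2 ^ m * ?i x \<le> Ex K t * (W t * F t * Zf u Du x)"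
      proof (cases "2 * r0 \<le> t \<and> t < L")
        case True
        have "t / r0 \<ge> 2" "t / \<rho> \<le> 1" using True r0(1) rho L by (simp_all add: le_divide_eq divide_le_eq)
        then have "h t = 1" using ct(6)[of "t / r0"] ct(5)[of "t / \<rho>"] by (simp add: h_def)
        then have "(t / 2) ^ m \<le> F t" using fb(4)[OF t(1)] True by (simp add: F_def)
        then have "1 / t\<^sup>2 * (t / 2) ^ m \<le> W t * F t" using Wt t Ft by (intro mult_mono) (auto intro: order_trans[OF _ Wt])
        then have le: "1 / t\<^sup>2 * (t / 2) ^ m * Zf u Du x \<le> W t * F t * Zf u Du x" using Z by (intro mult_right_mono)
        have "0 \<le> 1 / t\<^sup>2 * (t / 2) ^ m * Zf u Du x" using t Z by simp
        then have "e1 * (1 / t\<^sup>2 * (t / 2) ^ m * Zf u Du x) \<le> Ex K t * (W t * F t * Zf u Du x)"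
          by (intro mult_mono[OF e(3)[OF t(2)] le]) (simp_all add: Ex_def)
        then show ?thesis using True by (simp add: t_def power_divide mult_ac)
      next
        case False
        have "0 \<le> Ex K t * (W t * F t * Zf u Du x)"
          using e(1) e(3)[OF t(2)] Wt Ft Z t by (intro mult_nonneg_nonneg) (auto intro: order_trans[OF _ Wt])
        then show ?thesis using False by (simp add: t_def)
      qed
      have G2: "Ex K t * (Cb * (f t * \<bar>h1 t\<bar> * Zf u Du x)) \<le> c1 * ?j x + c2 * ?k x"
      proof -
        have "Ex K t * (Cb * (f t * \<bar>h1 t\<bar> * Zf u Du x)) \<le> e2 * (Cb * ((B * (2 * r0) ^ m * of_bool (t < 2 * r0) + B * (L ^ m / \<rho>) * of_bool (t < 2 * \<rho>)) * Zf u Du x))"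
        proof (rule mult_mono[OF e(4)[OF t(2)]])
          show "Cb * (f t * \<bar>h1 t\<bar> * Zf u Du x) \<le> Cb * ((B * (2 * r0) ^ m * of_bool (t < 2 * r0) + B * (L ^ m / \<rho>) * of_bool (t < 2 * \<rho>)) * Zf u Du x)"
            by (rule mult_left_mono[OF mult_right_mono[OF h1b[OF t(1)] Z] Cb0])
          show "0 \<le> Cb * (f t * \<bar>h1 t\<bar> * Zf u Du x)"
            using fb(1)[OF t(1)] Z Cb0 by (intro mult_nonneg_nonneg) auto
        qed (use e(2) in simp)
        also have "\<dots> = c1 * ?j x + c2 * ?k x" by (simp add: c1_def c2_def t_def indicator_def algebra_simps)
        finally show ?thesis .
      qed
      have "Ex K t * (W t * F t * Zf u Du x) - Ex K t * (Cb * (f t * \<bar>h1 t\<bar> * Zf u Du x)) \<le> Ex K t * A"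
        using mult_left_mono[OF A, of "Ex K t"] by (simp add: Ex_def right_diff_distrib)
      then show ?thesis unfolding SA using G1 G2 by linarith
    qed
    have lin: "(LBINT x. p * I x - q * J x - r * H x) = p * (LBINT x. I x) - q * (LBINT x. J x) - r * (LBINT x. H x)"
      if "integrable lborel I" "integrable lborel J" "integrable lborel H" for I J H :: "'a \<Rightarrow> real" and p q r :: real
      using that by simp
    have le: "(LBINT x. e1 / 2 ^ m * ?i x - c1 * ?j x - c2 * ?k x) \<le> (LBINT x. ?S x)"
      by (rule integral_mono[OF _ S(1) pw]) (intro Bochner_Integration.integrable_diff integrable_mult_right i j k)
    have main: "e1 / 2 ^ m * (LBINT x. ?i x) - c1 * (LBINT x. ?j x) - c2 * (LBINT x. ?k x) \<le> 0"
      using order_trans[OF le S(2)] unfolding lin[OF i j k] .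
    have kn: "0 \<le> (LBINT x. ?k x)" by (intro Bochner_Integration.integral_nonneg) (simp add: Zf_nonneg)
    \<comment> \<open>Because (2 r0)^m \<ge> 1, the constant of the inner error also serves the
      outer one.\<close>
    have c2: "c2 \<le> c1 * (L ^ m / \<rho>)"
    proof -
      have "Cb * e2 * B * (L ^ m / \<rho>) * 1 \<le> Cb * e2 * B * (L ^ m / \<rho>) * (2 * r0) ^ m"
        using r0m Cb0 e(2) ct(10) L by (intro mult_left_mono mult_nonneg_nonneg) auto
      then show ?thesis by (simp add: c1_def c2_def mult_ac)
    qed
    have comb: "I \<le> q * p' / e1 * (J + s * H)" if "e1 / p' * I - q * J - r * H \<le> 0" "r * H \<le> q * s * H" "p' > 0" for I J H p' q r s :: real
    proof -
      have "e1 / p' * I \<le> q * (J + s * H)" using that by (simp add: algebra_simps)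
      then have "e1 / p' * I * (p' / e1) \<le> q * (J + s * H) * (p' / e1)" using that(3) e(1) by (intro mult_right_mono) auto
      then show ?thesis using that(3) e(1) by (simp add: mult_ac)
    qed
    have "(0::real) < 2 ^ m" by simp
    from comb[OF main mult_right_mono[OF c2 kn] this] show ?thesis unfolding C_def c1_def by simp
  qed
  moreover have "C \<ge> 0" using Cb0 e ct(10) r0(1) by (simp add: C_def)
  ultimately show ?thesis using r0(1) by blast
qed

text \<open>The far estimate is used with exponent m + 2 to offset the lost r^2. For fixed L the
  outer radius runs through powers of 2 and the decay hypothesis removes the outer error; the inner
  energy is reduced to mass by \<open>local_energy\<close>. Neither constant depends on L, which is
  what makes an exhaustion possible.\<close>

lemma weighted_estimate:
  fixes m :: nat
  assumes a: "0 < a" "a \<le> b"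
  shows "\<exists>C R. C \<ge> 0 \<and> (\<forall>E u Du L. a \<le> E \<longrightarrow> E \<le> b \<longrightarrow> esol E u Du \<longrightarrow> decays u \<longrightarrow>
     (LBINT x. indicator {x. rr x < L} x * (rr x ^ m * Zf u Du x)) \<le> C * (LBINT x. indicator {x. rr x < R} x * (u x)\<^sup>2))"
proof -
  obtain C1 where C1: "C1 \<ge> 0" "\<And>E u Du \<rho>. \<bar>E\<bar> \<le> b \<Longrightarrow> esol E u Du \<Longrightarrow> \<rho> \<ge> 1 \<Longrightarrow>
     (LBINT x. indicator {x. rr x < \<rho>} x * Zf u Du x) \<le> C1 * (LBINT x. indicator {x. rr x < 2 * \<rho>} x * (u x)\<^sup>2)"
    using local_energy[of b] by blast
  obtain C r0 where C: "C \<ge> 0" "r0 \<ge> 1" "\<And>E u Du L \<rho>. a \<le> E \<Longrightarrow> E \<le> b \<Longrightarrow> esol E u Du \<Longrightarrow> 1 \<le> L \<Longrightarrow> L \<le> \<rho> \<Longrightarrow>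
     (LBINT x. indicator {x. 2 * r0 \<le> rr x \<and> rr x < L} x * (rr x ^ (m + 2) / (rr x)\<^sup>2 * Zf u Du x))
     \<le> C * ((LBINT x. indicator {x. rr x < 2 * r0} x * Zf u Du x) + L ^ (m + 2) / \<rho> * (LBINT x. indicator {x. rr x < 2 * \<rho>} x * Zf u Du x))"
    using far_estimate[OF a, of "m + 2"] by blast
  have "(LBINT x. indicator {x. rr x < L} x * (rr x ^ m * Zf u Du x)) \<le> ((C + (2 * r0) ^ m) * C1) * (LBINT x. indicator {x. rr x < 4 * r0} x * (u x)\<^sup>2)"
    if E: "a \<le> E" "E \<le> b" and sol: "esol E u Du" and dec: "decays u" for E u Du L
  proof -
    have absE: "\<bar>E\<bar> \<le> b" using E a by simp
    define Z0 where "Z0 = (LBINT x. indicator {x::'a. rr x < 2 * r0} x * Zf u Du x)"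
    let ?N = "max L 1"
    \<comment> \<open>Truncation at max L 1, since the far estimate asks for a truncation radius of
      at least 1.\<close>
    define I where "I = (LBINT x. indicator {x. 2 * r0 \<le> rr x \<and> rr x < ?N} x * (rr x ^ m * Zf u Du x))"
    have I: "I \<le> C * (Z0 + ?N ^ (m + 2) / 2 ^ k * (C1 * (LBINT x. indicator {x. rr x < 2 ^ (k + 2)} x * (u x)\<^sup>2)))" if k: "?N \<le> 2 ^ k" for k :: nat
    proof -
      have "I \<le> C * (Z0 + ?N ^ (m + 2) / 2 ^ k * (LBINT x. indicator {x. rr x < 2 * 2 ^ k} x * Zf u Du x))"
        using C(3)[OF E sol _ k] unfolding I_def Z0_def by (simp add: power_add power2_eq_square)
      also have "\<dots> \<le> C * (Z0 + ?N ^ (m + 2) / 2 ^ k * (C1 * (LBINT x. indicator {x. rr x < 2 * (2 * 2 ^ k)} x * (u x)\<^sup>2)))"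
      proof (intro mult_left_mono add_left_mono C(1))
        have "1 \<le> (2::real) ^ k" by simp
        then have "1 \<le> 2 * (2::real) ^ k" by linarith
        then show "(LBINT x. indicator {x. rr x < 2 * 2 ^ k} x * Zf u Du x) \<le> C1 * (LBINT x. indicator {x. rr x < 2 * (2 * 2 ^ k)} x * (u x)\<^sup>2)"
          by (rule C1(2)[OF absE sol])
      qed simp
      finally show ?thesis by (simp add: power_add mult_ac)
    qed
    \<comment> \<open>The outer cutoff reaches radius 2 * 2^k, and the Caccioppoli step doubles it
      again: the mass is taken over radius 2^(k+2), and the factor 4 restores the matching
      normalisation of the average.\<close>
    have "(\<lambda>k. C * (Z0 + 4 * ?N ^ (m + 2) * C1 * ((LBINT x. indicator {x. rr x < 2 ^ (k + 2)} x * (u x)\<^sup>2) / 2 ^ (k + 2)))) \<longlonglongrightarrow> C * (Z0 + 4 * ?N ^ (m + 2) * C1 * 0)"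
      by (intro tendsto_intros LIMSEQ_ignore_initial_segment[OF dec[unfolded decays_def]])
    moreover obtain k0 :: nat where k0: "?N < 2 ^ k0" using real_arch_pow[of 2 ?N] by auto
    have "\<exists>N. \<forall>n\<ge>N. I \<le> C * (Z0 + 4 * ?N ^ (m + 2) * C1 * ((LBINT x. indicator {x. rr x < 2 ^ (n + 2)} x * (u x)\<^sup>2) / 2 ^ (n + 2)))"
    proof (intro exI[of _ k0] allI impI)
      fix n assume "k0 \<le> n"
      then have "(2::real) ^ k0 \<le> 2 ^ n" by (intro power_increasing) auto
      then have "?N \<le> 2 ^ n" using k0 by linarith
      from I[OF this] show "I \<le> C * (Z0 + 4 * ?N ^ (m + 2) * C1 * ((LBINT x. indicator {x. rr x < 2 ^ (n + 2)} x * (u x)\<^sup>2) / 2 ^ (n + 2)))"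
        by (simp add: power_add mult_ac)
    qed
    ultimately have IZ: "I \<le> C * Z0" by (auto dest: LIMSEQ_le_const)
    have msr: "{x::'a. 2 * r0 \<le> rr x \<and> rr x < ?N} \<in> sets borel" by measurable
    have bnd: "\<bar>rr x ^ m\<bar> \<le> ?N ^ m" if "rr x < ?N" for x :: 'a using that rr_pos[of x] by (simp add: power_mono)
    have rm: "(\<lambda>x::'a. rr x ^ m) \<in> borel_measurable borel" by measurable
    have i1: "integrable lborel (\<lambda>x. indicator {x. 2 * r0 \<le> rr x \<and> rr x < ?N} x * (rr x ^ m * Zf u Du x))"
      by (rule Zf_set_integrable[OF sol rm bnd msr]) auto
    have i2: "integrable lborel (\<lambda>x. indicator {x. rr x < 2 * r0} x * Zf u Du x)"
      using Zf_set_integrable[OF sol, of "\<lambda>_. 1" "2 * r0" 1 "{x. rr x < 2 * r0}"] by simp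
    have i3: "integrable lborel (\<lambda>x. indicator {x. rr x < L} x * (rr x ^ m * Zf u Du x))"
      by (rule Zf_set_integrable[OF sol rm bnd]) auto
    have "(LBINT x. indicator {x. rr x < L} x * (rr x ^ m * Zf u Du x)) \<le> (LBINT x. indicator {x. 2 * r0 \<le> rr x \<and> rr x < ?N} x * (rr x ^ m * Zf u Du x) + (2 * r0) ^ m * (indicator {x. rr x < 2 * r0} x * Zf u Du x))"
    proof (rule integral_mono[OF i3])
      fix x :: 'a
      have "rr x ^ m * Zf u Du x \<le> (2 * r0) ^ m * Zf u Du x" if "rr x < 2 * r0"
        using that rr_pos[of x] Zf_nonneg by (intro mult_right_mono power_mono) auto
      moreover have "0 \<le> rr x ^ m * Zf u Du x" "0 \<le> (2 * r0) ^ m * Zf u Du x" using rr_pos[of x] C(2) Zf_nonneg[of u Du x] by auto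
      ultimately show "indicator {x. rr x < L} x * (rr x ^ m * Zf u Du x) \<le> indicator {x. 2 * r0 \<le> rr x \<and> rr x < ?N} x * (rr x ^ m * Zf u Du x) + (2 * r0) ^ m * (indicator {x. rr x < 2 * r0} x * Zf u Du x)"
        by (cases "rr x < 2 * r0"; cases "rr x < L") (auto simp: indicator_def)
    qed (use i1 i2 in auto)
    also have "\<dots> = I + (2 * r0) ^ m * Z0" unfolding I_def Z0_def using i1 i2 by simp
    also have "\<dots> \<le> (C + (2 * r0) ^ m) * Z0" using IZ by (simp add: distrib_right)
    also have "\<dots> \<le> (C + (2 * r0) ^ m) * (C1 * (LBINT x. indicator {x. rr x < 2 * (2 * r0)} x * (u x)\<^sup>2))"
      unfolding Z0_def using C by (intro mult_left_mono C1(2)[OF absE sol]) auto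
    finally show ?thesis by (simp add: mult.assoc)
  qed
  moreover have "(C + (2 * r0) ^ m) * C1 \<ge> 0" using C C1(1) by simp
  ultimately show ?thesis by blast
qed

end

subsection \<open>Second derivatives\<close>

text \<open>A Caccioppoli inequality one derivative higher. The function w = d_i u formally solves
  Laplace w = d_i F; testing with \<theta>^2 w and moving d_i back onto \<theta>^2 w leaves only F.
  Young's inequality returns half of the left-hand side plus 2 and 5 times the two terms on the
  right, and doubling gives 4 and 10.\<close>

lemma second_derivative_estimate:
  fixes u \<theta> :: "'a::euclidean_space \<Rightarrow> real"
  assumes sol: "wsol u Du F" and i: "i \<in> Basis"
    and Dw: "l2loc Dw" "\<And>j. j \<in> Basis \<Longrightarrow> wd (\<lambda>x. Du x \<bullet> i) j (\<lambda>x. Dw x \<bullet> j)"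
    and th: "\<And>x. (\<theta> has_derivative (\<lambda>h. T x \<bullet> h)) (at x)" "continuous_on UNIV T" and z: "\<And>x. norm x > R \<Longrightarrow> \<theta> x = 0"
  shows "(LBINT x. (\<theta> x)\<^sup>2 * (Dw x \<bullet> Dw x)) \<le> 4 * (LBINT x. (\<theta> x)\<^sup>2 * F x * F x) + 10 * (LBINT x. (T x \<bullet> T x) * (Du x \<bullet> i) * (Du x \<bullet> i))"
proof -
  have l: "l2loc Du" "l2loc F" "l2loc u" using sol by (auto simp: wsol_def)
  have lw: "l2loc (\<lambda>x. Du x \<bullet> i)" by (rule l2loc_inner[OF l(1)])
  note c = l2conv_moll[OF Dw(1)] l2conv_moll[OF l(2)] l2conv_moll[OF lw]
  have thc: "continuous_on UNIV \<theta>" by (rule has_derivative_continuous_on_UNIV[OF th(1)])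
  obtain M1 where M1: "\<And>x. norm x \<le> R \<Longrightarrow> \<bar>(\<theta> x)\<^sup>2\<bar> \<le> M1"
    using continuous_bounded_cball[OF continuous_on_power[OF thc, of 2], of R] by auto
  obtain M2 where M2: "\<And>x. norm x \<le> R \<Longrightarrow> \<bar>T x \<bullet> T x\<bar> \<le> M2"
    using continuous_bounded_cball[OF continuous_on_inner[OF th(2) th(2)], of R] by auto
  have Tz: "T x = 0" if "norm x > R" for x
  proof -
    have "T x \<bullet> T x = 0" using pd_zero_outside[of R \<theta> x "T x"] pd_eq[OF th(1), of "T x" x] z that by simp
    then show ?thesis by simp
  qed
  note [measurable] = borel_measurable_continuous_onI[OF thc] borel_measurable_continuous_onI[OF th(2)]
  have b1: "norm ((\<theta> x)\<^sup>2 * (a \<bullet> c)) \<le> M1 * (norm a * norm c)" if "norm x \<le> R" for x and a c :: 'a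
    unfolding norm_mult by (intro mult_mono) (use M1[OF that] in \<open>auto simp: Cauchy_Schwarz_ineq2 intro: order_trans[OF zero_le_power2]\<close>)
  have b2: "norm ((\<theta> x)\<^sup>2 * a * c) \<le> M1 * (norm a * norm c)" if "norm x \<le> R" for x and a c :: real
    unfolding norm_mult mult.assoc using M1[OF that] by (intro mult_right_mono) auto
  have b3: "norm ((T x \<bullet> T x) * a * c) \<le> M2 * (norm a * norm c)" if "norm x \<le> R" for x and a c :: real
    unfolding norm_mult mult.assoc using M2[OF that] by (intro mult_right_mono) auto
  let ?p = "\<lambda>n. conv (moll n) Dw" and ?f = "\<lambda>n. conv (moll n) F" and ?w = "\<lambda>n. conv (moll n) (\<lambda>x. Du x \<bullet> i)"
  have t1: "(\<lambda>n. \<integral>x. (\<theta> x)\<^sup>2 * (?p n x \<bullet> ?p n x) \<partial>lborel) \<longlonglongrightarrow> (LBINT x. (\<theta> x)\<^sup>2 * (Dw x \<bullet> Dw x))"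
    by (rule l2conv_bilinear[OF c(1) c(1), where B = "\<lambda>x a c. (\<theta> x)\<^sup>2 * (a \<bullet> c)" and R = R and M = M1])
       (use b1 z in \<open>auto intro!: bilinear_via linearI simp: algebra_simps\<close>)
  have t2: "(\<lambda>n. \<integral>x. (\<theta> x)\<^sup>2 * ?f n x * ?f n x \<partial>lborel) \<longlonglongrightarrow> (LBINT x. (\<theta> x)\<^sup>2 * F x * F x)"
    by (rule l2conv_bilinear[OF c(2) c(2), where B = "\<lambda>x a c. (\<theta> x)\<^sup>2 * a * c" and R = R and M = M1])
       (use b2 z in \<open>auto intro!: bilinear_via linearI simp: algebra_simps\<close>)
  have t3: "(\<lambda>n. \<integral>x. (T x \<bullet> T x) * ?w n x * ?w n x \<partial>lborel) \<longlonglongrightarrow> (LBINT x. (T x \<bullet> T x) * (Du x \<bullet> i) * (Du x \<bullet> i))"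
    by (rule l2conv_bilinear[OF c(3) c(3), where B = "\<lambda>x a c. (T x \<bullet> T x) * a * c" and R = R and M = M2])
       (use b3 Tz in \<open>auto intro!: bilinear_via linearI simp: algebra_simps\<close>)
  have le: "(LBINT x. (\<theta> x)\<^sup>2 * (?p n x \<bullet> ?p n x)) \<le> 4 * (LBINT x. (\<theta> x)\<^sup>2 * ?f n x * ?f n x) + 10 * (LBINT x. (T x \<bullet> T x) * ?w n x * ?w n x)" for n
  proof -
    let ?k = "pd i (moll n) :: 'a \<Rightarrow> real"
    note tk = test_fun_pd[OF test_fun_moll[of n, where 'a='a] i]
    have l1: "l1loc Dw" "l1loc F" "l1loc (\<lambda>x. Du x \<bullet> i)" "l1loc Du" "l1loc u"
      using Dw(1) l lw by (auto intro: l2loc_imp_l1loc)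
    define p w f where "p = ?p n" and "w = ?w n" and "f = ?f n"
    have pc: "continuous_on UNIV p" and fc: "continuous_on UNIV f" and wc: "continuous_on UNIV w"
      unfolding p_def f_def w_def by (intro conv_continuous test_fun_moll l1)+
    \<comment> \<open>The gradient of the mollified d_i u equals the i-th derivative of the
      mollified gradient, since both can be written with two derivatives on the kernel. Therefore
      the trace of its Jacobian is the mollified right-hand side differentiated once through the
      kernel.\<close>
    have p_eq: "conv ?k Du = p"
    proof
      fix x
      have "conv ?k Du x \<bullet> j = p x \<bullet> j" if j: "j \<in> Basis" for j
      proof -
        have "conv ?k Du x \<bullet> j = conv (pd j ?k) u x"
          by (rule conv_pd_Du[OF sol test_fun_moll i j])
        also have "\<dots> = conv (pd i (pd j (moll n))) u x" using pd_moll_commute[OF j i, of n] by simp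
        also have "\<dots> = conv (pd j (moll n)) Du x \<bullet> i"
          using conv_pd_Du[OF sol test_fun_moll j i] by simp
        also have "\<dots> = conv (pd j (moll n)) (\<lambda>x. Du x \<bullet> i) x" by (rule conv_inner[OF test_fun_pd[OF test_fun_moll j] l1(4)])
        also have "\<dots> = conv (moll n) (\<lambda>x. Dw x \<bullet> j) x" by (rule conv_pd_wd[OF test_fun_moll Dw(2)[OF j]])
        also have "\<dots> = p x \<bullet> j" unfolding p_def by (rule conv_inner[OF test_fun_moll l1(1), symmetric])
        finally show ?thesis .
      qed
      then show "conv ?k Du x = p x" by (rule euclidean_eqI)
    qed
    have pC: "C1vf p (hess Du ?k)" using C1vf_hess[OF sol tk] unfolding p_eq .
    note pD = pC[unfolded C1vf_def, THEN conjunct1, rule_format]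
    have trp: "tr (hess Du ?k x) = conv ?k F x" for x by (rule tr_hess[OF sol tk])
    have wD: "(w has_derivative (\<lambda>h. p x \<bullet> h)) (at x)" for x
      unfolding w_def p_def by (rule wd_gradient_conv[OF l1(3,1) Dw(2) test_fun_moll])
    have fD: "(f has_derivative (\<lambda>h. \<Sum>j\<in>Basis. (h \<bullet> j) *\<^sub>R conv (pd j (moll n)) F x)) (at x)" for x
      unfolding f_def by (rule conv_has_derivative[OF test_fun_moll l1(2)])
    have fi: "(\<Sum>j\<in>Basis. (i \<bullet> j) *\<^sub>R conv (pd j (moll n)) F x) = conv ?k F x" for x
      using pd_eq[OF fD, of i x] pd_conv[OF test_fun_moll l1(2) i] by (simp add: f_def)
    define v where "v = (\<lambda>x. (\<theta> x * \<theta> x) * w x)"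
    have vD: "(v has_derivative (\<lambda>h. (\<theta> x * \<theta> x) * (p x \<bullet> h) + (\<theta> x * (T x \<bullet> h) + (T x \<bullet> h) * \<theta> x) * w x)) (at x)" for x
      unfolding v_def by (rule has_derivative_mult[OF has_derivative_mult[OF th(1) th(1)] wD])
    have vc: "continuous_on UNIV v" unfolding v_def by (intro continuous_intros thc wc)
    have vz: "v x = 0" if "norm x > R" for x using z[OF that] by (simp add: v_def)
    have fkc: "continuous_on UNIV (conv ?k F)" by (rule conv_continuous[OF tk l1(2)])
    have i1: "integrable lborel (\<lambda>x. v x * conv ?k F x)"
      by (rule continuous_integrable[of _ R]) (auto intro!: continuous_intros vc fkc simp: vz)
    have i2: "integrable lborel (\<lambda>x. (\<theta> x)\<^sup>2 * (p x \<bullet> p x))"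
      by (rule continuous_integrable[of _ R]) (auto intro!: continuous_intros thc pc simp: z)
    have i3: "integrable lborel (\<lambda>x. 2 * \<theta> x * w x * (T x \<bullet> p x))"
      by (rule continuous_integrable[of _ R]) (auto intro!: continuous_intros thc wc pc th(2) simp: z)
    have i4: "integrable lborel (\<lambda>x. f x * ((\<theta> x)\<^sup>2 * (p x \<bullet> i) + 2 * \<theta> x * w x * (T x \<bullet> i)))"
      by (rule continuous_integrable[of _ R]) (auto intro!: continuous_intros fc thc wc pc th(2) simp: z)
    have i5: "integrable lborel (\<lambda>x. (\<theta> x)\<^sup>2 * f x * f x)"
      by (rule continuous_integrable[of _ R]) (auto intro!: continuous_intros thc fc simp: z)
    have i6: "integrable lborel (\<lambda>x. (T x \<bullet> T x) * w x * w x)"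
      by (rule continuous_integrable[of _ R]) (auto intro!: continuous_intros th(2) wc simp: Tz)
    \<comment> \<open>Integrated divergence of v p, where v = \<theta>^2 w and p is the gradient of
      w.\<close>
    have A: "(LBINT x. v x * conv ?k F x) + (LBINT x. (\<theta> x)\<^sup>2 * (p x \<bullet> p x)) + (LBINT x. 2 * \<theta> x * w x * (T x \<bullet> p x)) = 0"
    proof -
      define B where "B = (\<lambda>x h. v x *\<^sub>R hess Du ?k x h + ((\<theta> x * \<theta> x) * (p x \<bullet> h) + (\<theta> x * (T x \<bullet> h) + (T x \<bullet> h) * \<theta> x) * w x) *\<^sub>R p x)"
      have "C1vf (\<lambda>x. v x *\<^sub>R p x) B"
        unfolding C1vf_def
      proof (intro conjI allI)
        show "((\<lambda>x. v x *\<^sub>R p x) has_derivative B x) (at x)" for x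
          unfolding B_def by (rule has_derivative_scaleR[OF vD pD])
        show "continuous_on UNIV (\<lambda>x. B x e)" for e
          unfolding B_def using pC vc pc thc th(2) wc by (auto simp: C1vf_def intro!: continuous_intros)
      qed
      then have "(LBINT x. tr (B x)) = 0" by (rule div_integral_zero[of _ _ R]) (simp add: vz)
      moreover have "tr (B x) = v x * conv ?k F x + (\<theta> x)\<^sup>2 * (p x \<bullet> p x) + 2 * \<theta> x * w x * (T x \<bullet> p x)" for x
      proof -
        have "tr (B x) = v x * tr (hess Du ?k x) + ((\<theta> x * \<theta> x) * (\<Sum>j\<in>Basis. (p x \<bullet> j) * (p x \<bullet> j)) + 2 * \<theta> x * w x * (\<Sum>j\<in>Basis. (T x \<bullet> j) * (p x \<bullet> j)))"
          unfolding tr_def B_def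
          by (simp add: inner_add_left distrib_right distrib_left sum.distrib sum_distrib_left mult_ac)
        then show ?thesis by (simp add: trp euclidean_inner[of "p x" "p x"] euclidean_inner[of "T x" "p x"] power2_eq_square)
      qed
      ultimately show ?thesis using i1 i2 i3 by simp
    qed
    \<comment> \<open>The product v f has bounded support, so its derivative in direction i
      integrates to zero; this shifts the derivative off the right-hand side, about which only
      square integrability is available.\<close>
    have Bq: "(LBINT x. v x * conv ?k F x) = - (LBINT x. f x * ((\<theta> x)\<^sup>2 * (p x \<bullet> i) + 2 * \<theta> x * w x * (T x \<bullet> i)))"
    proof -
      have d: "((\<lambda>x. v x * f x) has_derivative (\<lambda>h. v x * (\<Sum>j\<in>Basis. (h \<bullet> j) *\<^sub>R conv (pd j (moll n)) F x)
           + ((\<theta> x * \<theta> x) * (p x \<bullet> h) + (\<theta> x * (T x \<bullet> h) + (T x \<bullet> h) * \<theta> x) * w x) * f x)) (at x)" for x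
        by (rule has_derivative_mult[OF vD fD])
      have "(LBINT x. v x * conv ?k F x + ((\<theta> x * \<theta> x) * (p x \<bullet> i) + (\<theta> x * (T x \<bullet> i) + (T x \<bullet> i) * \<theta> x) * w x) * f x) = 0"
      proof -
        have c': "continuous_on UNIV (\<lambda>x. v x * (\<Sum>j\<in>Basis. (i \<bullet> j) *\<^sub>R conv (pd j (moll n)) F x) + ((\<theta> x * \<theta> x) * (p x \<bullet> i) + (\<theta> x * (T x \<bullet> i) + (T x \<bullet> i) * \<theta> x) * w x) * f x)"
          unfolding fi by (intro continuous_intros vc fkc thc pc th(2) wc fc)
        show ?thesis
        proof -
          have "(LBINT x. v x * (\<Sum>j\<in>Basis. (i \<bullet> j) *\<^sub>R conv (pd j (moll n)) F x) + ((\<theta> x * \<theta> x) * (p x \<bullet> i) + (\<theta> x * (T x \<bullet> i) + (T x \<bullet> i) * \<theta> x) * w x) * f x) = 0"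
            by (rule integral_directional_derivative_zero[OF d, of i R, OF c']) (simp add: vz)
          then show ?thesis unfolding fi .
        qed
      qed
      also have "(\<lambda>x. v x * conv ?k F x + ((\<theta> x * \<theta> x) * (p x \<bullet> i) + (\<theta> x * (T x \<bullet> i) + (T x \<bullet> i) * \<theta> x) * w x) * f x)
         = (\<lambda>x. v x * conv ?k F x + f x * ((\<theta> x)\<^sup>2 * (p x \<bullet> i) + 2 * \<theta> x * w x * (T x \<bullet> i)))"
        by (simp add: fun_eq_iff power2_eq_square algebra_simps)
      finally show ?thesis using i1 i4 by simp
    qed
    have pw: "f x * ((\<theta> x)\<^sup>2 * (p x \<bullet> i) + 2 * \<theta> x * w x * (T x \<bullet> i)) - 2 * \<theta> x * w x * (T x \<bullet> p x)
       \<le> (\<theta> x)\<^sup>2 * (p x \<bullet> p x) / 2 + 2 * ((\<theta> x)\<^sup>2 * f x * f x) + 5 * ((T x \<bullet> T x) * w x * w x)" for x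
    proof -
      define P Tn where "P = \<theta> x * norm (p x)" and "Tn = norm (T x) * w x"
      have young: "2 * a * b \<le> a\<^sup>2 / c + c * b\<^sup>2" if "c > 0" for a b c :: real
      proof -
        have "0 \<le> (a / sqrt c - sqrt c * b)\<^sup>2" by simp
        also have "\<dots> = a\<^sup>2 / c - 2 * a * b + c * b\<^sup>2" using that by (simp add: power2_diff power_divide power_mult_distrib)
        finally show ?thesis by simp
      qed
      have pi: "\<bar>p x \<bullet> i\<bar> \<le> norm (p x)" "\<bar>T x \<bullet> i\<bar> \<le> norm (T x)" using Basis_le_norm[OF i] by auto
      have e1: "f x * ((\<theta> x)\<^sup>2 * (p x \<bullet> i)) \<le> P\<^sup>2 / 4 + (\<theta> x * f x)\<^sup>2"
      proof -
        have "2 * (\<theta> x * (p x \<bullet> i)) * (\<theta> x * f x) \<le> (\<theta> x * (p x \<bullet> i))\<^sup>2 / 2 + 2 * (\<theta> x * f x)\<^sup>2" by (rule young) simp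
        moreover have "(\<theta> x * (p x \<bullet> i))\<^sup>2 \<le> P\<^sup>2" unfolding P_def power_mult_distrib
          using power_mono[OF pi(1) abs_ge_zero, of 2] by (intro mult_left_mono) auto
        ultimately show ?thesis by (simp add: power2_eq_square algebra_simps)
      qed
      have e2: "f x * (2 * \<theta> x * w x * (T x \<bullet> i)) \<le> (\<theta> x * f x)\<^sup>2 + Tn\<^sup>2"
      proof -
        have "2 * (\<theta> x * f x) * (w x * (T x \<bullet> i)) \<le> (\<theta> x * f x)\<^sup>2 / 1 + 1 * (w x * (T x \<bullet> i))\<^sup>2" by (rule young) simp
        moreover have "(w x * (T x \<bullet> i))\<^sup>2 \<le> Tn\<^sup>2" unfolding Tn_def power_mult_distrib
          using power_mono[OF pi(2) abs_ge_zero, of 2] by (simp add: mult.commute[of "(norm (T x))\<^sup>2"] mult_left_mono)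
        ultimately show ?thesis by (simp add: algebra_simps)
      qed
      have e3: "- (2 * \<theta> x * w x * (T x \<bullet> p x)) \<le> P\<^sup>2 / 4 + 4 * Tn\<^sup>2"
      proof -
        have "\<bar>\<theta> x * w x * (T x \<bullet> p x)\<bar> \<le> \<bar>\<theta> x * w x\<bar> * (norm (T x) * norm (p x))"
          unfolding abs_mult[of _ "T x \<bullet> p x"] by (intro mult_left_mono Cauchy_Schwarz_ineq2) simp
        also have "\<dots> = \<bar>P\<bar> * \<bar>Tn\<bar>" by (simp add: P_def Tn_def abs_mult)
        finally have 1: "\<bar>\<theta> x * w x * (T x \<bullet> p x)\<bar> \<le> \<bar>P\<bar> * \<bar>Tn\<bar>" .
        have 2: "2 * \<bar>P\<bar> * \<bar>Tn\<bar> \<le> \<bar>P\<bar>\<^sup>2 / 4 + 4 * \<bar>Tn\<bar>\<^sup>2" by (rule young) simp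
        have "- (2 * y) \<le> s" if "\<bar>y\<bar> \<le> r" "2 * r \<le> s" for y r s :: real using that by linarith
        from this[OF 1] 2 show ?thesis by (simp add: mult.assoc)
      qed
      have P2: "P\<^sup>2 = (\<theta> x)\<^sup>2 * (p x \<bullet> p x)" "Tn\<^sup>2 = (T x \<bullet> T x) * w x * w x" "(\<theta> x * f x)\<^sup>2 = (\<theta> x)\<^sup>2 * f x * f x"
        by (simp_all add: P_def Tn_def power_mult_distrib dot_square_norm power2_eq_square)
      have "a + b + c \<le> y / 2 + 2 * g + 5 * k" if "a \<le> y / 4 + g" "b \<le> g + k" "c \<le> y / 4 + 4 * k" for a b c y g k :: real
        using that by simp
      from this[OF e1 e2 e3] show ?thesis unfolding P2 by (simp add: algebra_simps)
    qed
    have "(LBINT x. (\<theta> x)\<^sup>2 * (p x \<bullet> p x)) = (LBINT x. f x * ((\<theta> x)\<^sup>2 * (p x \<bullet> i) + 2 * \<theta> x * w x * (T x \<bullet> i)) - 2 * \<theta> x * w x * (T x \<bullet> p x))"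
      using A Bq Bochner_Integration.integral_diff[OF i4 i3] by linarith
    also have "\<dots> \<le> (LBINT x. (\<theta> x)\<^sup>2 * (p x \<bullet> p x) / 2 + 2 * ((\<theta> x)\<^sup>2 * f x * f x) + 5 * ((T x \<bullet> T x) * w x * w x))"
      by (rule integral_mono[OF Bochner_Integration.integrable_diff[OF i4 i3] _ pw])
         (intro Bochner_Integration.integrable_add integrable_mult_right integrable_divide i2 i5 i6)
    also have "\<dots> = (LBINT x. (\<theta> x)\<^sup>2 * (p x \<bullet> p x)) / 2 + 2 * (LBINT x. (\<theta> x)\<^sup>2 * f x * f x) + 5 * (LBINT x. (T x \<bullet> T x) * w x * w x)"
    proof -
      have "(LBINT x. I x / 2 + 2 * J x + 5 * H x) = (LBINT x. I x) / 2 + 2 * (LBINT x. J x) + 5 * (LBINT x. H x)"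
        if "integrable lborel I" "integrable lborel J" "integrable lborel H" for I J H :: "'a \<Rightarrow> real" using that by simp
      from this[OF i2 i5 i6] show ?thesis .
    qed
    finally show ?thesis unfolding p_def f_def w_def by simp
  qed
  show ?thesis
    by (rule LIMSEQ_le[OF t1 tendsto_add[OF tendsto_mult[OF tendsto_const t2] tendsto_mult[OF tendsto_const t3]]]) (use le in auto)
qed

section \<open>Rapid decay in the mean square\<close>

lemma exhaust_integrable:
  fixes h :: "'a::euclidean_space \<Rightarrow> real"
  assumes [measurable]: "h \<in> borel_measurable borel" and h: "\<And>x. h x \<ge> 0"
    and i: "\<And>n::nat. integrable lborel (\<lambda>x. indicator {x. rr x < real n} x * h x)"
    and b: "\<And>n::nat. (LBINT x. indicator {x. rr x < real n} x * h x) \<le> C"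
  shows "integrable lborel h" "(LBINT x. h x) \<le> C"
proof -
  have "(\<lambda>n. \<integral>\<^sup>+x. ennreal (indicator {x. rr x < real n} x * h x) \<partial>lborel) \<longlonglongrightarrow> (\<integral>\<^sup>+x. ennreal (h x) \<partial>lborel)"
  proof (rule nn_integral_LIMSEQ)
    show "incseq (\<lambda>n x. ennreal (indicator {x. rr x < real n} x * h x))"
      by (auto simp: incseq_def le_fun_def indicator_def h intro!: ennreal_leI)
    fix x :: 'a
    obtain N where N: "rr x < real N" using reals_Archimedean2 by blast
    show "(\<lambda>n. ennreal (indicator {x. rr x < real n} x * h x)) \<longlonglongrightarrow> ennreal (h x)"
      by (rule tendsto_eventually, rule eventually_sequentiallyI[of N]) (use N in auto)
  qed measurable
  moreover have "(\<integral>\<^sup>+x. ennreal (indicator {x. rr x < real n} x * h x) \<partial>lborel) \<le> ennreal C" for n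
    using nn_integral_eq_integral[OF i, of n] h b[of n] by (simp add: ennreal_leI)
  ultimately have le: "(\<integral>\<^sup>+x. ennreal (h x) \<partial>lborel) \<le> ennreal C" by (intro LIMSEQ_le_const2) auto
  show 1: "integrable lborel h"
    by (rule integrableI_bounded) (use le h in \<open>auto intro: le_less_trans\<close>)
  \<comment> \<open>The index 0 gives an empty ball, so the assumed bound itself yields C \<ge>
    0.\<close>
  have "{x::'a. rr x < real 0} = {}" by (auto simp: not_less less_imp_le[OF rr_pos])
  then have C0: "C \<ge> 0" using b[of 0] by simp
  have "ennreal (LBINT x. h x) \<le> ennreal C" using nn_integral_eq_integral[OF 1] h le by simp
  then show "(LBINT x. h x) \<le> C" using C0 by simp
qed

text \<open>Square integrability against every power of r. The class is stable under multipliers of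
  polynomial growth, so weighted regularity follows without tracking exponents.\<close>

definition fast :: "('a::euclidean_space \<Rightarrow> 'b::euclidean_space) \<Rightarrow> bool" where
  "fast f \<longleftrightarrow> f \<in> borel_measurable borel \<and> (\<forall>m::nat. integrable lborel (\<lambda>x. rr x ^ m * (norm (f x))\<^sup>2))"

lemma fast_measurable: "fast f \<Longrightarrow> f \<in> borel_measurable borel" by (simp add: fast_def)

lemma fast_bound:
  assumes f: "fast f" and [measurable]: "g \<in> borel_measurable borel" and b: "\<And>x. norm (g x) \<le> C * rr x ^ N * norm (f x)"
  shows "fast g"
  unfolding fast_def
proof (intro conjI allI)
  fix m
  show "integrable lborel (\<lambda>x. rr x ^ m * (norm (g x))\<^sup>2)"
  proof (rule Bochner_Integration.integrable_bound)
    show "integrable lborel (\<lambda>x. C\<^sup>2 * (rr x ^ (m + 2 * N) * (norm (f x))\<^sup>2))" using f by (simp add: fast_def)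
    show "AE x in lborel. norm (rr x ^ m * (norm (g x))\<^sup>2) \<le> norm (C\<^sup>2 * (rr x ^ (m + 2 * N) * (norm (f x))\<^sup>2))"
    proof (intro AE_I2)
      fix x
      have "(norm (g x))\<^sup>2 \<le> (C * rr x ^ N * norm (f x))\<^sup>2" using b[of x] by (intro power_mono) auto
      then have "rr x ^ m * (norm (g x))\<^sup>2 \<le> rr x ^ m * (C * rr x ^ N * norm (f x))\<^sup>2" using rr_pos[of x] by (intro mult_left_mono) auto
      also have "\<dots> = C\<^sup>2 * (rr x ^ (m + 2 * N) * (norm (f x))\<^sup>2)" by (simp add: power_mult_distrib power_add power_mult mult_ac)
      finally show "norm (rr x ^ m * (norm (g x))\<^sup>2) \<le> norm (C\<^sup>2 * (rr x ^ (m + 2 * N) * (norm (f x))\<^sup>2))"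
        using rr_pos[of x] by (simp add: abs_mult)
    qed
  qed measurable
qed fact

lemma fast_add: assumes "fast f" "fast g" shows "fast (\<lambda>x. f x + g x)"
  unfolding fast_def
proof (intro conjI allI)
  note [measurable] = assms[THEN fast_measurable]
  show "(\<lambda>x. f x + g x) \<in> borel_measurable borel" by measurable
  fix m
  show "integrable lborel (\<lambda>x. rr x ^ m * (norm (f x + g x))\<^sup>2)"
  proof (rule Bochner_Integration.integrable_bound)
    show "integrable lborel (\<lambda>x. 2 * (rr x ^ m * (norm (f x))\<^sup>2) + 2 * (rr x ^ m * (norm (g x))\<^sup>2))"
      using assms by (simp add: fast_def)
    show "AE x in lborel. norm (rr x ^ m * (norm (f x + g x))\<^sup>2) \<le> norm (2 * (rr x ^ m * (norm (f x))\<^sup>2) + 2 * (rr x ^ m * (norm (g x))\<^sup>2))"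
    proof (intro AE_I2)
      fix x :: 'a
      have "rr x ^ m * (norm (f x + g x))\<^sup>2 \<le> rr x ^ m * (2 * (norm (f x))\<^sup>2 + 2 * (norm (g x))\<^sup>2)"
        using rr_pos[of x] by (intro mult_left_mono norm_add_sq_le) auto
      then show "norm (rr x ^ m * (norm (f x + g x))\<^sup>2) \<le> norm (2 * (rr x ^ m * (norm (f x))\<^sup>2) + 2 * (rr x ^ m * (norm (g x))\<^sup>2))"
        using rr_pos[of x] by (simp add: algebra_simps)
    qed
  qed measurable
qed

context potential
begin

text \<open>For the solution and its gradient, bounds on all balls uniform in the radius are
  exhausted by monotone convergence. Second derivatives use the local estimate with \<theta> = r^m
  (1 - ct(r/\<rho>)): its right-hand side is controlled by moments already known to be finite,
  uniformly in \<rho>.\<close>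

lemma fast_solution:
  assumes sol: "esol E u Du" and E: "E > 0" and dec: "decays u"
  shows "fast u" "fast Du"
    and "\<And>i Dw. i \<in> Basis \<Longrightarrow> l2loc Dw \<Longrightarrow> (\<And>j. j \<in> Basis \<Longrightarrow> wd (\<lambda>x. Du x \<bullet> i) j (\<lambda>x. Dw x \<bullet> j)) \<Longrightarrow> fast Dw"
proof -
  note l = esol_l2loc[OF sol]
  note [measurable] = l[THEN l2loc_measurable] Zf_measurable[OF sol]
  have ball: "integrable lborel (\<lambda>x. indicator {x. rr x < L} x * (rr x ^ m * Zf u Du x))" for L m
  proof (rule Zf_set_integrable[OF sol, of _ L "L ^ m"])
    show "\<bar>rr x ^ m\<bar> \<le> L ^ m" if "rr x < L" for x :: 'a using that rr_pos[of x] by (simp add: power_mono)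
  qed auto
  have bnd: "\<exists>C. \<forall>L. (LBINT x. indicator {x. rr x < L} x * (rr x ^ m * Zf u Du x)) \<le> C" for m
    using weighted_estimate[OF E order_refl, of m] sol dec by blast
  have nn: "0 \<le> rr x ^ m * Zf u Du x" for x m by (simp add: Zf_nonneg less_imp_le[OF rr_pos])
  have Zint: "integrable lborel (\<lambda>x. rr x ^ m * Zf u Du x)" for m
  proof -
    obtain C where C: "\<And>L. (LBINT x. indicator {x. rr x < L} x * (rr x ^ m * Zf u Du x)) \<le> C" using bnd by blast
    show ?thesis
      by (rule exhaust_integrable(1)[where C = C]) (use nn ball C in auto)
  qed
  show "fast u"
    unfolding fast_def
  proof (intro conjI allI)
    fix m show "integrable lborel (\<lambda>x. rr x ^ m * (norm (u x))\<^sup>2)"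
      by (rule Bochner_Integration.integrable_bound[OF Zint[of m]])
         (use rr_pos cD_nonneg in \<open>auto simp: Zf_def abs_mult less_imp_le intro!: mult_left_mono\<close>)
  qed measurable
  show "fast Du"
    unfolding fast_def
  proof (intro conjI allI)
    fix m show "integrable lborel (\<lambda>x. rr x ^ m * (norm (Du x))\<^sup>2)"
      by (rule Bochner_Integration.integrable_bound[OF Zint[of m]])
         (use rr_pos cD_nonneg in \<open>auto simp: Zf_def abs_mult less_imp_le cD_def dot_square_norm intro!: mult_left_mono\<close>)
  qed measurable
  fix i Dw assume i: "i \<in> Basis" and Dw: "l2loc Dw" "\<And>j. j \<in> Basis \<Longrightarrow> wd (\<lambda>x. Du x \<bullet> i) j (\<lambda>x. Dw x \<bullet> j)"
  note [measurable] = l2loc_measurable[OF Dw(1)]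
  obtain ct ct' :: "real \<Rightarrow> real" and B where ct: "\<And>t. (ct has_real_derivative ct' t) (at t)" "continuous_on UNIV ct'"
    "\<And>t. 0 \<le> ct t" "\<And>t. ct t \<le> 1" "\<And>t. t \<le> 1 \<Longrightarrow> ct t = 0" "\<And>t. t \<ge> 2 \<Longrightarrow> ct t = 1"
    "\<And>t. \<bar>ct' t\<bar> \<le> B" "\<And>t. t \<le> 1 \<Longrightarrow> ct' t = 0" "\<And>t. t \<ge> 2 \<Longrightarrow> ct' t = 0" "B \<ge> 1"
    using cutoff_exists by metis
  have ctc: "continuous_on UNIV ct" using ct(1) by (auto intro!: DERIV_isCont continuous_at_imp_continuous_on)
  show "fast Dw"
    unfolding fast_def
  proof (intro conjI allI)
    fix m :: nat
    \<comment> \<open>2Q + E bounds |V - E|, and (m + B) r^m bounds the gradient of the weight,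
      uniformly in \<rho> \<ge> 1.\<close>
    define Cf where "Cf = 4 * (2 * Q + E)\<^sup>2 + 10 * (real m + B)\<^sup>2"
    have est: "(LBINT x. indicator {x. rr x < \<rho>} x * (rr x ^ (2 * m) * (Dw x \<bullet> Dw x))) \<le> Cf * (LBINT x. rr x ^ (2 * m) * Zf u Du x)"
      if rho: "\<rho> \<ge> 1" for \<rho>
    proof -
      define g where "g = (\<lambda>t. t ^ m * (1 - ct (t / \<rho>)))"
      define g' where "g' = (\<lambda>t. real m * t ^ (m - 1) * (1 - ct (t / \<rho>)) - t ^ m * (ct' (t / \<rho>) / \<rho>))"
      have cr: "((\<lambda>t. ct (t / \<rho>)) has_real_derivative ct' (t / \<rho>) / \<rho>) (at t)" for t
      proof -
        have "((\<lambda>t. t / \<rho>) has_real_derivative 1 / \<rho>) (at t)" using rho by (auto intro!: derivative_eq_intros)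
        from DERIV_chain2[OF ct(1) this] show ?thesis by simp
      qed
      have gd: "(g has_real_derivative g' t) (at t)" for t
        unfolding g_def g'_def by (rule derivative_eq_intros cr refl)+ simp
      have gc': "continuous_on {0<..} g'"
        unfolding g'_def using rho
        by (intro continuous_intros continuous_on_compose2[OF ctc] continuous_on_compose2[OF ct(2)]) auto
      have gz: "g t = 0" "g' t = 0" if "t \<ge> 2 * \<rho>" for t
        using that rho ct(6)[of "t / \<rho>"] ct(9)[of "t / \<rho>"] by (simp_all add: g_def g'_def le_divide_eq)
      have gb: "\<bar>g t\<bar> \<le> t ^ m" "\<bar>g' t\<bar> \<le> (real m + B) * t ^ m" if t: "t \<ge> 1" for t
      proof -
        have q: "0 \<le> 1 - ct (t / \<rho>)" "1 - ct (t / \<rho>) \<le> 1" using ct(3,4)[of "t / \<rho>"] by auto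
        have tm: "0 \<le> t ^ m" "t ^ (m - 1) \<le> t ^ m" "0 \<le> t ^ (m - 1)" using t by (auto intro: power_increasing)
        show "\<bar>g t\<bar> \<le> t ^ m" unfolding g_def abs_mult using q tm by (simp add: mult_left_le)
        have 1: "\<bar>real m * t ^ (m - 1) * (1 - ct (t / \<rho>))\<bar> \<le> real m * t ^ m"
        proof -
          have "\<bar>real m * t ^ (m - 1)\<bar> * \<bar>1 - ct (t / \<rho>)\<bar> \<le> (real m * t ^ m) * 1"
            using q tm by (intro mult_mono) (auto intro: mult_left_mono)
          then show ?thesis by (simp add: abs_mult)
        qed
        have "\<bar>ct' (t / \<rho>)\<bar> / \<rho> \<le> B / 1" using ct(7,10) rho by (intro frac_le) auto
        then have "\<bar>t ^ m * (ct' (t / \<rho>) / \<rho>)\<bar> \<le> t ^ m * B" unfolding abs_mult[of "t ^ m"] using tm rho by (intro mult_mono) auto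
        moreover have "\<bar>p - q\<bar> \<le> (real m + B) * w" if "\<bar>p\<bar> \<le> real m * w" "\<bar>q\<bar> \<le> w * B" for p q w :: real
          using that by (simp add: algebra_simps abs_le_iff)
        ultimately show "\<bar>g' t\<bar> \<le> (real m + B) * t ^ m" unfolding g'_def using 1 by blast
      qed
      define T where "T = (\<lambda>x::'a. (g' (rr x) / rr x) *\<^sub>R x)"
      have thd: "((\<lambda>x. g (rr x)) has_derivative (\<lambda>h. T x \<bullet> h)) (at x)" for x :: 'a
        using radial_has_derivative[OF gd, of x] by (simp add: T_def)
      have Tc: "continuous_on UNIV T"
        unfolding T_def by (intro continuous_intros radial_continuous gc' rr_continuous) simp
      have zo: "g (rr x) = 0" "T x = 0" if "norm x > 2 * \<rho>" for x :: 'a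
        using gz[of "rr x"] that norm_le_rr[of x] by (simp_all add: T_def)
      have TT: "T x \<bullet> T x \<le> ((real m + B) * rr x ^ m)\<^sup>2" for x
      proof -
        have "norm (T x) \<le> \<bar>g' (rr x)\<bar>"
          using norm_le_rr[of x] rr_pos[of x] by (simp add: T_def divide_le_eq mult_left_mono)
        also have "\<dots> \<le> (real m + B) * rr x ^ m" by (rule gb(2)[OF rr_ge_1])
        finally show ?thesis by (simp add: dot_square_norm power_mono)
      qed
      have "(LBINT x. (g (rr x))\<^sup>2 * (Dw x \<bullet> Dw x)) \<le> 4 * (LBINT x. (g (rr x))\<^sup>2 * ((V x - E) * u x) * ((V x - E) * u x)) + 10 * (LBINT x. (T x \<bullet> T x) * (Du x \<bullet> i) * (Du x \<bullet> i))"
        by (rule second_derivative_estimate[OF sol[unfolded esol_def] i Dw thd Tc zo(1)])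
      moreover have "(LBINT x. (g (rr x))\<^sup>2 * ((V x - E) * u x) * ((V x - E) * u x)) \<le> (LBINT x. (2 * Q + E)\<^sup>2 * (rr x ^ (2 * m) * Zf u Du x))"
      proof (rule integral_mono_AE')
        show "integrable lborel (\<lambda>x. (2 * Q + E)\<^sup>2 * (rr x ^ (2 * m) * Zf u Du x))" using Zint by simp
        show "AE x in lborel. (g (rr x))\<^sup>2 * ((V x - E) * u x) * ((V x - E) * u x) \<le> (2 * Q + E)\<^sup>2 * (rr x ^ (2 * m) * Zf u Du x)"
        proof (intro AE_I2)
          fix x
          have "\<bar>V x - E\<bar> \<le> 2 * Q + E" using Vlr_Q[of x] Vsr_Q[of x] V_eq[of x] E by linarith
          from power_mono[OF this abs_ge_zero, of 2] have 1: "(V x - E)\<^sup>2 \<le> (2 * Q + E)\<^sup>2" unfolding power2_abs .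
          from power_mono[OF gb(1)[OF rr_ge_1] abs_ge_zero, of x 2] have 2: "(g (rr x))\<^sup>2 \<le> rr x ^ (2 * m)" unfolding power2_abs by (simp add: power_mult mult.commute)
          have "(V x - E)\<^sup>2 * ((g (rr x))\<^sup>2 * (u x)\<^sup>2) \<le> (2 * Q + E)\<^sup>2 * (rr x ^ (2 * m) * Zf u Du x)"
            using 1 2 cD_nonneg[of Du x] rr_pos[of x] by (intro mult_mono) (auto simp: Zf_def)
          then show "(g (rr x))\<^sup>2 * ((V x - E) * u x) * ((V x - E) * u x) \<le> (2 * Q + E)\<^sup>2 * (rr x ^ (2 * m) * Zf u Du x)"
            by (simp add: power2_eq_square mult_ac)
        qed
        show "AE x in lborel. 0 \<le> (2 * Q + E)\<^sup>2 * (rr x ^ (2 * m) * Zf u Du x)"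
          using rr_pos Zf_nonneg by (auto simp: less_imp_le)
      qed
      moreover have "(LBINT x. (T x \<bullet> T x) * (Du x \<bullet> i) * (Du x \<bullet> i)) \<le> (LBINT x. (real m + B)\<^sup>2 * (rr x ^ (2 * m) * Zf u Du x))"
      proof (rule integral_mono_AE')
        show "integrable lborel (\<lambda>x. (real m + B)\<^sup>2 * (rr x ^ (2 * m) * Zf u Du x))" using Zint by simp
        show "AE x in lborel. (T x \<bullet> T x) * (Du x \<bullet> i) * (Du x \<bullet> i) \<le> (real m + B)\<^sup>2 * (rr x ^ (2 * m) * Zf u Du x)"
        proof (intro AE_I2)
          fix x
          have "\<bar>Du x \<bullet> i\<bar> \<le> norm (Du x)" by (rule Basis_le_norm[OF i])
          from power_mono[OF this abs_ge_zero, of 2] have "(Du x \<bullet> i)\<^sup>2 \<le> Zf u Du x"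
            unfolding power2_abs Zf_def cD_def dot_square_norm using zero_le_power2[of "u x"] by linarith
          then have "(T x \<bullet> T x) * (Du x \<bullet> i)\<^sup>2 \<le> ((real m + B) * rr x ^ m)\<^sup>2 * Zf u Du x" using TT[of x] by (intro mult_mono) auto
          then show "(T x \<bullet> T x) * (Du x \<bullet> i) * (Du x \<bullet> i) \<le> (real m + B)\<^sup>2 * (rr x ^ (2 * m) * Zf u Du x)"
            by (simp add: power2_eq_square power_mult_distrib power_mult mult_ac)
        qed
        show "AE x in lborel. 0 \<le> (real m + B)\<^sup>2 * (rr x ^ (2 * m) * Zf u Du x)"
          using rr_pos Zf_nonneg by (auto simp: less_imp_le)
      qed
      moreover have "(LBINT x. indicator {x. rr x < \<rho>} x * (rr x ^ (2 * m) * (Dw x \<bullet> Dw x))) \<le> (LBINT x. (g (rr x))\<^sup>2 * (Dw x \<bullet> Dw x))"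
      proof (rule integral_mono_AE')
        show "integrable lborel (\<lambda>x. (g (rr x))\<^sup>2 * (Dw x \<bullet> Dw x))"
        proof (rule l2loc_prod_integrable[OF Dw(1) Dw(1), of _ "2 * \<rho>" "((1 + 2 * \<rho>) ^ m)\<^sup>2"])
          have [measurable]: "(\<lambda>x::'a. g (rr x)) \<in> borel_measurable borel"
            by (rule borel_measurable_continuous_onI[OF has_derivative_continuous_on_UNIV[OF thd]])
          show "(\<lambda>x. (g (rr x))\<^sup>2 * (Dw x \<bullet> Dw x)) \<in> borel_measurable borel" by measurable
          fix x :: 'a assume x: "norm x \<le> 2 * \<rho>"
          have "\<bar>g (rr x)\<bar> \<le> (1 + 2 * \<rho>) ^ m"
            using gb(1)[OF rr_ge_1, of x] power_mono[of "rr x" "1 + 2 * \<rho>" m] rr_le[of x] rr_pos[of x] x by linarith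
          from power_mono[OF this abs_ge_zero, of 2] have "(g (rr x))\<^sup>2 \<le> ((1 + 2 * \<rho>) ^ m)\<^sup>2" unfolding power2_abs .
          then show "norm ((g (rr x))\<^sup>2 * (Dw x \<bullet> Dw x)) \<le> ((1 + 2 * \<rho>) ^ m)\<^sup>2 * (norm (Dw x) * norm (Dw x))"
            by (simp add: abs_mult dot_square_norm power2_eq_square[of "norm (Dw x)"] mult_right_mono)
        qed (simp add: zo)
        show "AE x in lborel. indicator {x. rr x < \<rho>} x * (rr x ^ (2 * m) * (Dw x \<bullet> Dw x)) \<le> (g (rr x))\<^sup>2 * (Dw x \<bullet> Dw x)"
        proof (intro AE_I2)
          fix x :: 'a
          show "indicator {x. rr x < \<rho>} x * (rr x ^ (2 * m) * (Dw x \<bullet> Dw x)) \<le> (g (rr x))\<^sup>2 * (Dw x \<bullet> Dw x)"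
          proof (cases "rr x < \<rho>")
            case True
            then have "ct (rr x / \<rho>) = 0" using rho by (intro ct(5)) (simp add: divide_le_eq)
            then show ?thesis using True by (simp add: g_def power_mult mult.commute)
          qed simp
        qed
      qed simp
      ultimately show ?thesis unfolding Cf_def by (simp add: distrib_right)
    qed
    have int: "integrable lborel (\<lambda>x. rr x ^ (2 * m) * (Dw x \<bullet> Dw x))"
    proof (rule exhaust_integrable(1)[where C = "Cf * (LBINT x. rr x ^ (2 * m) * Zf u Du x)"])
      fix n :: nat
      show "integrable lborel (\<lambda>x. indicator {x. rr x < real n} x * (rr x ^ (2 * m) * (Dw x \<bullet> Dw x)))"
      proof (rule l2loc_prod_integrable[OF Dw(1) Dw(1), of _ "real n" "(1 + real n) ^ (2 * m)"])
        fix x :: 'a assume x: "norm x \<le> real n"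
        have "rr x ^ (2 * m) \<le> (1 + real n) ^ (2 * m)" using rr_le[of x] rr_pos[of x] x by (intro power_mono) auto
        then have "rr x ^ (2 * m) * (Dw x \<bullet> Dw x) \<le> (1 + real n) ^ (2 * m) * (Dw x \<bullet> Dw x)" by (intro mult_right_mono) auto
        then show "norm (indicator {x. rr x < real n} x * (rr x ^ (2 * m) * (Dw x \<bullet> Dw x))) \<le> (1 + real n) ^ (2 * m) * (norm (Dw x) * norm (Dw x))"
          using rr_pos[of x] by (auto simp: indicator_def dot_square_norm power2_eq_square)
      next
        fix x :: 'a assume "norm x > real n"
        then show "indicator {x. rr x < real n} x * (rr x ^ (2 * m) * (Dw x \<bullet> Dw x)) = 0" using norm_le_rr[of x] by simp
      qed measurable
      have Z0: "0 \<le> (LBINT x. rr x ^ (2 * m) * Zf u Du x)"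
        using rr_pos Zf_nonneg by (intro Bochner_Integration.integral_nonneg) (auto simp: less_imp_le)
      show "(LBINT x. indicator {x. rr x < real n} x * (rr x ^ (2 * m) * (Dw x \<bullet> Dw x))) \<le> Cf * (LBINT x. rr x ^ (2 * m) * Zf u Du x)"
      proof (cases "n = 0")
        case True
        have "indicator {x::'a. rr x < real n} x = (0::real)" for x :: 'a using True rr_pos[of x] by simp
        then show ?thesis using Z0 by (simp add: Cf_def)
      qed (use est[of "real n"] in auto)
    qed (auto simp: rr_pos less_imp_le)
    show "integrable lborel (\<lambda>x. rr x ^ m * (norm (Dw x))\<^sup>2)"
    \<comment> \<open>The squared cutoff weight produced the even power r^(2m), which dominates r^m
      because r \<ge> 1.\<close>
    proof (rule Bochner_Integration.integrable_bound[OF int])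
      show "AE x in lborel. norm (rr x ^ m * (norm (Dw x))\<^sup>2) \<le> norm (rr x ^ (2 * m) * (Dw x \<bullet> Dw x))"
      proof (intro AE_I2)
        fix x
        have "rr x ^ m * (norm (Dw x))\<^sup>2 \<le> rr x ^ (2 * m) * (norm (Dw x))\<^sup>2"
          using rr_ge_1[of x] by (intro mult_right_mono power_increasing) auto
        then show "norm (rr x ^ m * (norm (Dw x))\<^sup>2) \<le> norm (rr x ^ (2 * m) * (Dw x \<bullet> Dw x))"
          by (simp add: dot_square_norm abs_mult abs_of_pos[OF rr_pos] power_abs)
      qed
    qed measurable
  qed measurable
qed

end

subsection \<open>Complex eigenfunctions and weighted Sobolev regularity\<close>

lemma weak_deriv_iff: "weak_deriv f i g \<longleftrightarrow> wd f i g"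
  unfolding weak_deriv_def wd_def scaleR_conv_of_real by (simp add: mult.commute)

lemma L2loc_imp_l2loc:
  assumes "L2loc f" shows "l2loc f"
  unfolding l2loc_def set_integrable_def
proof (intro conjI allI)
  show [measurable]: "f \<in> borel_measurable borel" using assms by (simp add: L2loc_def)
  fix R
  have "(\<integral>\<^sup>+x\<in>cball 0 R. ennreal ((cmod (f x))\<^sup>2) \<partial>lborel) < \<infinity>" using assms compact_cball unfolding L2loc_def by blast
  also have "(\<integral>\<^sup>+x\<in>cball 0 R. ennreal ((cmod (f x))\<^sup>2) \<partial>lborel) = (\<integral>\<^sup>+x. ennreal (norm (indicator (cball 0 R) x *\<^sub>R (norm (f x))\<^sup>2)) \<partial>lborel)"
    by (intro nn_integral_cong) (simp add: indicator_def)
  finally show "integrable lborel (\<lambda>x. indicator (cball 0 R) x *\<^sub>R (norm (f x))\<^sup>2)" by (intro integrableI_bounded) auto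
qed

lemma l2loc_scaleR_const: "l2loc (u :: _ \<Rightarrow> real) \<Longrightarrow> l2loc (\<lambda>x. u x *\<^sub>R e)"
  by (rule l2loc_bound[of u]) (auto intro!: exI[of _ "norm e"] dest: l2loc_measurable)

lemma l2loc_sum:
  assumes "finite I" "\<And>i. i \<in> I \<Longrightarrow> l2loc (f i)" shows "l2loc (\<lambda>x. \<Sum>i\<in>I. f i x)"
  using assms by (induction rule: finite_induct) (auto intro: l2loc_add l2loc_const)

lemma wd_inner:
  fixes f g :: "'a::euclidean_space \<Rightarrow> 'b::euclidean_space"
  assumes f: "l1loc f" "l1loc g" and w: "wd f i g" and i: "i \<in> Basis"
  shows "wd (\<lambda>x. f x \<bullet> e) i (\<lambda>x. g x \<bullet> e)"
  unfolding wd_def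
proof (intro allI impI)
  fix k :: "'a \<Rightarrow> real" assume k: "test_fun k"
  have int: "integrable lborel (\<lambda>x. k x *\<^sub>R f x)" if k: "test_fun k" and f: "l1loc f" for k :: "'a \<Rightarrow> real" and f :: "'a \<Rightarrow> 'b"
  proof -
    obtain R where R: "\<And>x. norm x > R \<Longrightarrow> k x = 0" using test_fun_support[OF k] by metis
    obtain C where C: "\<And>x. \<bar>k x\<bar> \<le> C" using test_fun_bounded[OF k] by metis
    note [measurable] = test_fun_measurable[OF k] l1loc_measurable[OF f]
    show ?thesis by (rule integrable_l1[OF f, of _ R C]) (auto simp: R intro: mult_right_mono[OF C])
  qed
  have "(LBINT x. pd i k x *\<^sub>R f x) \<bullet> e = - (LBINT x. k x *\<^sub>R g x) \<bullet> e" using w k by (simp add: wd_def)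
  then show "(LBINT x. pd i k x *\<^sub>R (f x \<bullet> e)) = - (LBINT x. k x *\<^sub>R (g x \<bullet> e))"
    using int[OF test_fun_pd[OF k i] f(1)] int[OF k f(2)] by (simp flip: integral_inner_left)
qed

text \<open>The factor \<open>P\<close> is absorbed into the test function. The product k P is only
  C^1 with bounded support, which is exactly what \<open>wd_C1\<close> accepts.\<close>

lemma wd_product:
  fixes f g :: "'a::euclidean_space \<Rightarrow> 'b::euclidean_space"
  assumes f: "l1loc f" "l1loc g" and w: "wd f i g" and i: "i \<in> Basis"
    and P: "\<And>x. (P has_derivative (\<lambda>h. Pd x \<bullet> h)) (at x)" "continuous_on UNIV Pd"
  shows "wd (\<lambda>x. (P x :: real) *\<^sub>R f x) i (\<lambda>x. P x *\<^sub>R g x + (Pd x \<bullet> i) *\<^sub>R f x)"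
  unfolding wd_def
proof (intro allI impI)
  fix k :: "'a \<Rightarrow> real" assume k: "test_fun k"
  obtain R where R: "\<And>x. norm x > R \<Longrightarrow> k x = 0" using test_fun_support[OF k] by metis
  note tp = test_fun_pd[OF k i]
  have Pc: "continuous_on UNIV P" by (rule has_derivative_continuous_on_UNIV[OF P(1)])
  have kd: "(\<Sum>j\<in>Basis. (i \<bullet> j) * pd j k x) = pd i k x" for x
    using pd_eq[OF test_fun_has_derivative[OF k], of i x] by simp
  have d: "((\<lambda>x. k x * P x) has_derivative (\<lambda>h. k x * (Pd x \<bullet> h) + (\<Sum>j\<in>Basis. (h \<bullet> j) * pd j k x) * P x)) (at x)" for x
    by (rule has_derivative_mult[OF test_fun_has_derivative[OF k] P(1)])
  have c: "continuous_on UNIV (\<lambda>x. k x * (Pd x \<bullet> i) + (\<Sum>j\<in>Basis. (i \<bullet> j) * pd j k x) * P x)"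
    unfolding kd by (intro continuous_intros test_fun_continuous k tp Pc P(2))
  have eq: "(LBINT x. (k x * (Pd x \<bullet> i) + (\<Sum>j\<in>Basis. (i \<bullet> j) * pd j k x) * P x) *\<^sub>R f x) = - (LBINT x. (k x * P x) *\<^sub>R g x)"
    by (rule wd_C1[OF f w i d c, of R]) (simp add: R)
  have int: "integrable lborel (\<lambda>x. k x *\<^sub>R f x)" if k: "continuous_on UNIV k" "\<And>x. norm x > R \<Longrightarrow> k x = 0" and f: "l1loc f" for k :: "'a \<Rightarrow> real" and f :: "'a \<Rightarrow> 'b"
  proof -
    obtain C where C: "\<And>x. \<bar>k x\<bar> \<le> C" using continuous_bounded_support[OF k] by metis
    note [measurable] = borel_measurable_continuous_onI[OF k(1)] l1loc_measurable[OF f]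
    show ?thesis by (rule integrable_l1[OF f, of _ R C]) (auto simp: k intro: mult_right_mono[OF C])
  qed
  have i1: "integrable lborel (\<lambda>x. (k x * (Pd x \<bullet> i)) *\<^sub>R f x)"
    by (rule int[OF _ _ f(1)]) (auto simp: R intro!: continuous_intros test_fun_continuous[OF k] P(2))
  have i2: "integrable lborel (\<lambda>x. (pd i k x * P x) *\<^sub>R f x)"
    by (rule int[OF _ _ f(1)]) (auto simp: pd_zero_outside[OF R] intro!: continuous_intros test_fun_continuous[OF tp] Pc)
  have i3: "integrable lborel (\<lambda>x. (k x * P x) *\<^sub>R g x)"
    by (rule int[OF _ _ f(2)]) (auto simp: R intro!: continuous_intros test_fun_continuous[OF k] Pc)
  have "(LBINT x. (k x * (Pd x \<bullet> i)) *\<^sub>R f x) + (LBINT x. (pd i k x * P x) *\<^sub>R f x) = - (LBINT x. (k x * P x) *\<^sub>R g x)"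
    using eq i1 i2 unfolding kd by (simp add: scaleR_add_left)
  then show "(LBINT x. pd i k x *\<^sub>R P x *\<^sub>R f x) = - (LBINT x. k x *\<^sub>R (P x *\<^sub>R g x + (Pd x \<bullet> i) *\<^sub>R f x))"
    using i1 i3 by (simp add: scaleR_add_right algebra_simps eq_neg_iff_add_eq_0)
qed

lemma wd_add:
  fixes f g f' g' :: "'a::euclidean_space \<Rightarrow> 'b::euclidean_space"
  assumes f: "l1loc f" "l1loc g" "wd f i g" and f': "l1loc f'" "l1loc g'" "wd f' i g'" and i: "i \<in> Basis"
  shows "wd (\<lambda>x. f x + f' x) i (\<lambda>x. g x + g' x)"
  unfolding wd_def
proof (intro allI impI)
  fix k :: "'a \<Rightarrow> real" assume k: "test_fun k"
  have int: "integrable lborel (\<lambda>x. k x *\<^sub>R f x)" if k: "test_fun k" and f: "l1loc f" for k :: "'a \<Rightarrow> real" and f :: "'a \<Rightarrow> 'b"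
  proof -
    obtain R where R: "\<And>x. norm x > R \<Longrightarrow> k x = 0" using test_fun_support[OF k] by metis
    obtain C where C: "\<And>x. \<bar>k x\<bar> \<le> C" using test_fun_bounded[OF k] by metis
    note [measurable] = test_fun_measurable[OF k] l1loc_measurable[OF f]
    show ?thesis by (rule integrable_l1[OF f, of _ R C]) (auto simp: R intro: mult_right_mono[OF C])
  qed
  show "(LBINT x. pd i k x *\<^sub>R (f x + f' x)) = - (LBINT x. k x *\<^sub>R (g x + g' x))"
    using f(3) f'(3) k int[OF test_fun_pd[OF k i] f(1)] int[OF test_fun_pd[OF k i] f'(1)] int[OF k f(2)] int[OF k f'(2)]
    by (simp add: scaleR_add_right wd_def)
qed

lemma fast_imp_L2: assumes "fast f" shows "L2 f"
proof -
  have "integrable lborel (\<lambda>x. rr x ^ 0 * (norm (f x))\<^sup>2)" using assms unfolding fast_def by blast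
  then have i: "integrable lborel (\<lambda>x. (norm (f x))\<^sup>2)" by simp
  then have "l2sq f = ennreal (LBINT x. (norm (f x))\<^sup>2)" unfolding l2sq_def by (intro nn_integral_eq_integral) auto
  then show ?thesis using fast_measurable[OF assms] by (simp add: L2_def)
qed

lemma fast_imp_l1loc: assumes "fast f" shows "l1loc f"
proof (rule l2loc_imp_l1loc)
  note [measurable] = fast_measurable[OF assms]
  have i: "integrable lborel (\<lambda>x. rr x ^ 0 * (norm (f x))\<^sup>2)" using assms unfolding fast_def by blast
  show "l2loc f" unfolding l2loc_def set_integrable_def
  proof (intro conjI allI)
    fix R show "integrable lborel (\<lambda>x. indicator (cball 0 R) x *\<^sub>R (norm (f x))\<^sup>2)"
      using i by (intro integrable_mult_indicator) auto
  qed measurable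
qed

lemma fast_zero: "fast (\<lambda>x. 0)" by (simp add: fast_def)

lemma fast_sum: "finite I \<Longrightarrow> (\<And>i. i \<in> I \<Longrightarrow> fast (f i)) \<Longrightarrow> fast (\<lambda>x. \<Sum>i\<in>I. f i x)"
  by (induction rule: finite_induct) (auto intro: fast_add fast_zero)

lemma fast_components:
  fixes f :: "'a::euclidean_space \<Rightarrow> 'b::euclidean_space"
  assumes "\<And>e. e \<in> Basis \<Longrightarrow> fast (\<lambda>x. f x \<bullet> e)" shows "fast f"
proof -
  have "fast (\<lambda>x. \<Sum>e\<in>Basis. (f x \<bullet> e) *\<^sub>R e)"
  proof (intro fast_sum finite_Basis)
    fix e :: 'b assume e: "e \<in> Basis"
    note [measurable] = fast_measurable[OF assms[OF e]]
    show "fast (\<lambda>x. (f x \<bullet> e) *\<^sub>R e)" by (rule fast_bound[OF assms[OF e], of _ 1 0]) (auto simp: e)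
  qed
  then show ?thesis by (simp add: euclidean_representation)
qed

lemma fast_inner: assumes "fast f" shows "fast (\<lambda>x. f x \<bullet> e)"
proof -
  note [measurable] = fast_measurable[OF assms]
  show ?thesis by (rule fast_bound[OF assms, of _ "norm e" 0]) (auto simp: abs_inner_le)
qed

lemma fast_scaleR:
  assumes f: "fast f" and P: "continuous_on UNIV P" and b: "\<And>x. \<bar>P x :: real\<bar> \<le> C * rr x ^ N"
  shows "fast (\<lambda>x. P x *\<^sub>R f x)"
proof -
  note [measurable] = fast_measurable[OF f] borel_measurable_continuous_onI[OF P]
  show ?thesis by (rule fast_bound[OF f, of _ C N]) (auto intro: mult_right_mono[OF b])
qed

lemma rr_powr_continuous: "continuous_on UNIV (\<lambda>x::'a::euclidean_space. rr x powr s)"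
  by (intro continuous_intros rr_continuous) simp

lemma rr_powr_has_derivative:
  "((\<lambda>x. rr x powr s) has_derivative (\<lambda>h. ((s * rr x powr (s - 2)) *\<^sub>R x) \<bullet> h)) (at (x :: 'a::euclidean_space))"
proof -
  have "((\<lambda>t. t powr s) has_real_derivative s * t powr (s - 1)) (at t)" if "t > 0" for t :: real
    using that by (rule has_real_derivative_powr)
  from radial_has_derivative[OF this, of x]
  have "((\<lambda>x. rr x powr s) has_derivative (\<lambda>h. s * rr x powr (s - 1) * ((x \<bullet> h) / rr x))) (at x)" by simp
  moreover have "rr x powr (s - 1) = rr x powr (s - 2) * rr x"
    using powr_add[of "rr x" "s - 2" 1] rr_pos[of x] by simp
  ultimately show ?thesis by (simp add: mult_ac)
qed

lemma rr_powr_le: "s \<le> real N \<Longrightarrow> rr x powr s \<le> rr x ^ N"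
  using powr_mono[of s "real N" "rr x"] rr_ge_1[of x] rr_pos[of x] by (simp add: powr_realpow)

text \<open>The product rule twice: the gradient of r^s is s r^(s-2) x, so every term of the
  weighted derivatives is a fast function times a factor of polynomial growth. Rapid decay of all
  derivatives up to order two therefore covers every real exponent at once.\<close>

lemma H2_weighted:
  fixes \<phi> :: "'a::euclidean_space \<Rightarrow> complex"
  assumes phi: "fast \<phi>" and g: "\<And>i. i \<in> Basis \<Longrightarrow> fast (g i)" "\<And>i. i \<in> Basis \<Longrightarrow> wd \<phi> i (g i)"
    and h: "\<And>i j. i \<in> Basis \<Longrightarrow> j \<in> Basis \<Longrightarrow> fast (h i j)" "\<And>i j. i \<in> Basis \<Longrightarrow> j \<in> Basis \<Longrightarrow> wd (g i) j (h i j)"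
  shows "H2 (\<lambda>x. complex_of_real (rr x powr s) * \<phi> x)"
proof -
  define P where "P = (\<lambda>x::'a. rr x powr s)"
  define q where "q = (\<lambda>x::'a. s * rr x powr (s - 2))"
  define r where "r = (\<lambda>x::'a. s * (s - 2) * rr x powr (s - 4))"
  \<comment> \<open>An integer power dominating r^s, r^(s-2) and r^(s-4); the exponent N + 2 used
    below leaves room for two coordinate factors, each at most r.\<close>
  define N where "N = nat \<lceil>\<bar>s\<bar>\<rceil>"
  have N: "s \<le> real N" "s - 2 \<le> real N" "s - 4 \<le> real N" unfolding N_def by linarith+
  have Pc: "continuous_on UNIV P" and qc: "continuous_on UNIV q" and rc: "continuous_on UNIV r"
    unfolding P_def q_def r_def by (intro continuous_intros rr_powr_continuous)+
  have Pd: "(P has_derivative (\<lambda>h. (q x *\<^sub>R x) \<bullet> h)) (at x)" for x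
    unfolding P_def q_def by (rule rr_powr_has_derivative)
  have qd: "((\<lambda>x. q x * (x \<bullet> i)) has_derivative (\<lambda>h. ((r x * (x \<bullet> i)) *\<^sub>R x + q x *\<^sub>R i) \<bullet> h)) (at x)" for i x
  proof -
    have "(q has_derivative (\<lambda>h. (r x *\<^sub>R x) \<bullet> h)) (at x)"
      using has_derivative_mult_right[OF rr_powr_has_derivative[of "s - 2" x], of s]
      unfolding q_def r_def by (simp add: mult_ac)
    moreover have "((\<lambda>x. x \<bullet> i) has_derivative (\<lambda>h. h \<bullet> i)) (at x)" by (auto intro!: derivative_eq_intros)
    ultimately have "((\<lambda>x. q x * (x \<bullet> i)) has_derivative (\<lambda>h. q x * (h \<bullet> i) + ((r x *\<^sub>R x) \<bullet> h) * (x \<bullet> i))) (at x)"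
      by (rule has_derivative_mult)
    moreover have "(\<lambda>h. q x * (h \<bullet> i) + ((r x *\<^sub>R x) \<bullet> h) * (x \<bullet> i)) = (\<lambda>h. ((r x * (x \<bullet> i)) *\<^sub>R x + q x *\<^sub>R i) \<bullet> h)"
      by (simp add: fun_eq_iff inner_add_left inner_commute[of i] mult_ac)
    ultimately show ?thesis by simp
  qed
  have Pb: "\<bar>P x\<bar> \<le> 1 * rr x ^ (N + 2)" for x
  proof -
    have "rr x powr s \<le> rr x ^ (N + 2)" using N by (intro rr_powr_le) simp
    then show ?thesis by (simp add: P_def)
  qed
  have xi: "\<bar>x \<bullet> i\<bar> \<le> rr x" if "i \<in> Basis" for x i :: 'a using Basis_le_norm[OF that, of x] norm_le_rr[of x] by linarith
  have qb0: "\<bar>q x\<bar> \<le> \<bar>s\<bar> * rr x ^ N" for x using N rr_powr_le[of "s - 2" N x] by (simp add: q_def abs_mult mult_left_mono)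
  have qb: "\<bar>q x * (x \<bullet> i)\<bar> \<le> \<bar>s\<bar> * rr x ^ (N + 2)" if "i \<in> Basis" for x i
  proof -
    have "\<bar>q x\<bar> * \<bar>x \<bullet> i\<bar> \<le> (\<bar>s\<bar> * rr x ^ N) * rr x" using qb0[of x] xi[OF that, of x] rr_pos[of x] by (intro mult_mono) auto
    also have "\<dots> \<le> \<bar>s\<bar> * rr x ^ (N + 2)" using power_increasing[of "N + 1" "N + 2" "rr x"] rr_ge_1[of x] by (simp add: mult.assoc mult_left_mono mult.commute)
    finally show ?thesis by (simp add: abs_mult)
  qed
  have rb: "\<bar>r x * (x \<bullet> i) * (x \<bullet> j) + q x * (i \<bullet> j)\<bar> \<le> (\<bar>s * (s - 2)\<bar> + \<bar>s\<bar>) * rr x ^ (N + 2)" if ij: "i \<in> Basis" "j \<in> Basis" for x i j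
  proof -
    have "\<bar>r x\<bar> \<le> \<bar>s * (s - 2)\<bar> * rr x ^ N" using N rr_powr_le[of "s - 4" N x] by (simp add: r_def abs_mult mult_left_mono)
    then have "\<bar>r x\<bar> * \<bar>x \<bullet> i\<bar> * \<bar>x \<bullet> j\<bar> \<le> \<bar>s * (s - 2)\<bar> * rr x ^ N * rr x * rr x"
      using xi[OF ij(1), of x] xi[OF ij(2), of x] rr_pos[of x] by (intro mult_mono) auto
    then have 1: "\<bar>r x * (x \<bullet> i) * (x \<bullet> j)\<bar> \<le> \<bar>s * (s - 2)\<bar> * rr x ^ (N + 2)" by (simp add: abs_mult power_add power2_eq_square mult_ac)
    have "\<bar>i \<bullet> j\<bar> \<le> 1" using ij by (simp add: inner_Basis)
    then have "\<bar>q x * (i \<bullet> j)\<bar> \<le> (\<bar>s\<bar> * rr x ^ N) * 1" unfolding abs_mult using qb0[of x] by (intro mult_mono) auto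
    also have "\<dots> \<le> \<bar>s\<bar> * rr x ^ (N + 2)" using power_increasing[of N "N + 2" "rr x"] rr_ge_1[of x] by (simp add: mult_left_mono)
    finally have 2: "\<bar>q x * (i \<bullet> j)\<bar> \<le> \<bar>s\<bar> * rr x ^ (N + 2)" .
    have "\<bar>a + b\<bar> \<le> (A + B) * c" if "\<bar>a\<bar> \<le> A * c" "\<bar>b\<bar> \<le> B * c" for a b A B c :: real
      using that by (simp add: distrib_right abs_le_iff)
    from this[OF 1 2] show ?thesis .
  qed
  have cq: "continuous_on UNIV (\<lambda>x. q x * (x \<bullet> i))" for i by (intro continuous_intros qc)
  have cr: "continuous_on UNIV (\<lambda>x. r x * (x \<bullet> i) * (x \<bullet> j) + q x * (i \<bullet> j))" for i j by (intro continuous_intros qc rc)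
  define f0 where "f0 = (\<lambda>x. P x *\<^sub>R \<phi> x)"
  define G where "G = (\<lambda>i x. P x *\<^sub>R g i x + (q x * (x \<bullet> i)) *\<^sub>R \<phi> x)"
  define H where "H = (\<lambda>i j x. (P x *\<^sub>R h i j x + (q x * (x \<bullet> j)) *\<^sub>R g i x) + ((q x * (x \<bullet> i)) *\<^sub>R g j x + (r x * (x \<bullet> i) * (x \<bullet> j) + q x * (i \<bullet> j)) *\<^sub>R \<phi> x))"
  have f0f: "fast f0" unfolding f0_def by (rule fast_scaleR[OF phi Pc Pb])
  have Gf: "fast (G i)" if i: "i \<in> Basis" for i
    unfolding G_def by (intro fast_add fast_scaleR[OF g(1)[OF i] Pc Pb] fast_scaleR[OF phi cq qb[OF i]])
  have Hf: "fast (H i j)" if ij: "i \<in> Basis" "j \<in> Basis" for i j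
    unfolding H_def by (intro fast_add fast_scaleR[OF h(1)[OF ij] Pc Pb] fast_scaleR[OF g(1)[OF ij(1)] cq qb[OF ij(2)]]
        fast_scaleR[OF g(1)[OF ij(2)] cq qb[OF ij(1)]] fast_scaleR[OF phi cr rb[OF ij]])
  have Pdc: "continuous_on UNIV (\<lambda>x. q x *\<^sub>R x)" by (intro continuous_intros qc)
  have qdc: "continuous_on UNIV (\<lambda>x. (r x * (x \<bullet> i)) *\<^sub>R x + q x *\<^sub>R i)" for i by (intro continuous_intros qc rc)
  have wG: "wd f0 i (G i)" if i: "i \<in> Basis" for i
    using wd_product[OF fast_imp_l1loc[OF phi] fast_imp_l1loc[OF g(1)[OF i]] g(2)[OF i] i Pd Pdc]
    by (simp add: f0_def G_def)
  have wH: "wd (G i) j (H i j)" if ij: "i \<in> Basis" "j \<in> Basis" for i j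
  proof -
    have 1: "wd (\<lambda>x. P x *\<^sub>R g i x) j (\<lambda>x. P x *\<^sub>R h i j x + (q x * (x \<bullet> j)) *\<^sub>R g i x)"
      using wd_product[OF fast_imp_l1loc[OF g(1)[OF ij(1)]] fast_imp_l1loc[OF h(1)[OF ij]] h(2)[OF ij] ij(2) Pd Pdc] by simp
    have 2: "wd (\<lambda>x. (q x * (x \<bullet> i)) *\<^sub>R \<phi> x) j (\<lambda>x. (q x * (x \<bullet> i)) *\<^sub>R g j x + (r x * (x \<bullet> i) * (x \<bullet> j) + q x * (i \<bullet> j)) *\<^sub>R \<phi> x)"
      using wd_product[OF fast_imp_l1loc[OF phi] fast_imp_l1loc[OF g(1)[OF ij(2)]] g(2)[OF ij(2)] ij(2) qd[of i] qdc[of i]]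
      by (simp add: inner_add_left)
    show ?thesis unfolding G_def H_def
      by (rule wd_add[OF _ _ 1 _ _ 2 ij(2)])
         (intro fast_imp_l1loc fast_add fast_scaleR[OF h(1)[OF ij] Pc Pb] fast_scaleR[OF g(1)[OF ij(1)] cq qb[OF ij(2)]] fast_scaleR[OF g(1)[OF ij(1)] Pc Pb]
          fast_scaleR[OF g(1)[OF ij(2)] cq qb[OF ij(1)]] fast_scaleR[OF phi cr rb[OF ij]] fast_scaleR[OF phi cq qb[OF ij(1)]])+
  qed
  have "H2 f0" unfolding H2_def weak_deriv_iff
  proof (intro conjI ballI fast_imp_L2[OF f0f])
    fix i :: 'a assume i: "i \<in> Basis"
    show "\<exists>g. L2 g \<and> wd f0 i g \<and> (\<forall>j\<in>Basis. \<exists>h. L2 h \<and> wd g j h)"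
    proof (rule exI[of _ "G i"], intro conjI ballI fast_imp_L2[OF Gf[OF i]] wG[OF i])
      fix j :: 'a assume j: "j \<in> Basis"
      show "\<exists>h. L2 h \<and> wd (G i) j h" using fast_imp_L2[OF Hf[OF i j]] wH[OF i j] by blast
    qed
  qed
  then show ?thesis by (simp add: f0_def P_def scaleR_conv_of_real)
qed

section \<open>From dyadic shells to ball averages\<close>

lemma halving_tendsto_0:
  fixes b c :: "nat \<Rightarrow> real"
  assumes b: "\<And>k. b (Suc k) = b k / 2 + c k" and c: "c \<longlonglongrightarrow> 0"
  shows "b \<longlonglongrightarrow> 0"
proof (rule LIMSEQ_I)
  fix e :: real assume e: "e > 0"
  obtain N where N: "\<And>k. k \<ge> N \<Longrightarrow> \<bar>c k\<bar> < e / 4" using LIMSEQ_D[OF c, of "e / 4"] e by auto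
  \<comment> \<open>Past N each step adds at most e/4 while halving what has accumulated, so the
    accumulated error never exceeds e/2; the initial value decays geometrically.\<close>
  have bd: "\<bar>b (N + j)\<bar> \<le> \<bar>b N\<bar> / 2 ^ j + e / 2" for j
  proof (induction j)
    case (Suc j)
    have "\<bar>p / 2 + q\<bar> \<le> B / 2 + e / 4 + c" if "\<bar>p\<bar> \<le> B + e / 2" "\<bar>q\<bar> \<le> c" for p q B c :: real
      using that by (simp add: abs_le_iff)
    from this[OF Suc less_imp_le[OF N[of "N + j"]]] show ?case by (simp add: b mult.commute)
  qed (use e in simp)
  have "(\<lambda>j. \<bar>b N\<bar> / 2 ^ j) \<longlonglongrightarrow> 0" by (rule LIMSEQ_divide_realpow_zero) simp
  from LIMSEQ_D[OF this, of "e / 2"] e obtain J where J: "\<And>j. j \<ge> J \<Longrightarrow> \<bar>b N\<bar> / 2 ^ j < e / 2" by auto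
  have "norm (b n - 0) < e" if "n \<ge> N + J" for n
  proof -
    have "\<bar>b n\<bar> \<le> \<bar>b N\<bar> / 2 ^ (n - N) + e / 2" using bd[of "n - N"] that by simp
    moreover have "J \<le> n - N" using that by linarith
    from J[OF this] have "\<bar>b N\<bar> / 2 ^ (n - N) < e / 2" .
    ultimately show ?thesis by (metis (no_types, lifting) add_less_cancel_right diff_zero field_sum_of_halves order_le_less_trans real_norm_def)
  qed
  then show "\<exists>no. \<forall>n\<ge>no. norm (b n - 0) < e" by blast
qed

lemma ball_sq_integrable:
  fixes \<phi> :: "'a::euclidean_space \<Rightarrow> 'b::euclidean_space"
  assumes "l2loc \<phi>" "S \<in> sets borel" "S \<subseteq> {x. rr x < L}"
  shows "integrable lborel (\<lambda>x. indicator S x * (norm (\<phi> x))\<^sup>2)"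
proof (rule l2loc_prod_integrable[OF assms(1) assms(1), of _ L 1])
  note [measurable] = l2loc_measurable[OF assms(1)] assms(2)
  show "(\<lambda>x. indicator S x * (norm (\<phi> x))\<^sup>2) \<in> borel_measurable borel" by measurable
  fix x :: 'a assume "norm x > L"
  then have "x \<notin> S" using norm_le_rr[of x] assms(3) by auto
  then show "indicator S x * (norm (\<phi> x))\<^sup>2 = 0" by simp
qed (auto simp: indicator_def power2_eq_square)

text \<open>The ball of radius 2^(k+1) is the ball of radius 2^k together with shell k + 1. After
  dividing by 2^(k+1) the ball averages satisfy a halving recursion driven by the shell terms, which
  tend to zero by assumption.\<close>

lemma Bstar0_imp_mean:
  fixes \<phi> :: "'a::euclidean_space \<Rightarrow> complex"
  assumes "Bstar0 \<phi>"
  shows "(\<lambda>k::nat. (LBINT x. indicator {x. rr x < 2 ^ k} x * (norm (\<phi> x))\<^sup>2) / 2 ^ k) \<longlonglongrightarrow> 0"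
proof -
  have l: "l2loc \<phi>" using assms by (auto simp: Bstar0_def intro: L2loc_imp_l2loc)
  have sh: "(shell k :: 'a set) = {x. 2 powr (real k - 1) \<le> rr x \<and> rr x < 2 ^ k}" for k
    unfolding shell_def by (simp add: powr_realpow)
  have shm: "(shell k :: 'a set) \<in> sets borel" for k unfolding sh by measurable
  have shi: "integrable lborel (\<lambda>x. indicator (shell k) x * (norm (\<phi> x))\<^sup>2)" for k
    by (rule ball_sq_integrable[OF l shm, of _ "2 ^ k"]) (auto simp: sh)
  define c where "c = (\<lambda>k. (LBINT x. indicator (shell k) x * (norm (\<phi> x))\<^sup>2) / 2 ^ k)"
  have "ennreal (2 powr - real k) * (\<integral>\<^sup>+x\<in>shell k. ennreal ((cmod (\<phi> x))\<^sup>2) \<partial>lborel) = ennreal (c k)" for k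
  proof -
    have "(\<integral>\<^sup>+x\<in>shell k. ennreal ((cmod (\<phi> x))\<^sup>2) \<partial>lborel) = (\<integral>\<^sup>+x. ennreal (indicator (shell k) x * (norm (\<phi> x))\<^sup>2) \<partial>lborel)"
      by (intro nn_integral_cong) (simp add: indicator_def)
    also have "\<dots> = ennreal (LBINT x. indicator (shell k) x * (norm (\<phi> x))\<^sup>2)" by (rule nn_integral_eq_integral[OF shi]) simp
    finally have "ennreal (2 powr - real k) * (\<integral>\<^sup>+x\<in>shell k. ennreal ((cmod (\<phi> x))\<^sup>2) \<partial>lborel) = ennreal (2 powr - real k * (LBINT x. indicator (shell k) x * (norm (\<phi> x))\<^sup>2))"
      by (simp add: ennreal_mult')
    then show ?thesis by (simp add: c_def powr_minus powr_realpow divide_inverse mult.commute)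
  qed
  then have "(\<lambda>k. ennreal (c k)) \<longlonglongrightarrow> ennreal 0" using assms by (simp add: Bstar0_def)
  then have "c \<longlonglongrightarrow> 0" by (rule tendsto_ennrealD) (auto simp: c_def intro!: Bochner_Integration.integral_nonneg divide_nonneg_nonneg)
  then have c: "(\<lambda>k. c (Suc k)) \<longlonglongrightarrow> 0" by (rule LIMSEQ_Suc)
  show ?thesis
  proof (rule halving_tendsto_0[OF _ c])
    fix k
    have p: "(2::real) powr (real (Suc k) - 1) = 2 ^ k" by (simp add: powr_realpow)
    have "indicator {x::'a. rr x < 2 ^ Suc k} x = (indicator {x. rr x < 2 ^ k} x + indicator (shell (Suc k)) x :: real)" for x
    proof -
      have le: "(2::real) ^ k \<le> 2 ^ Suc k" by simp
      have "rr x < 2 ^ k \<Longrightarrow> rr x < 2 ^ Suc k" by (rule order_less_le_trans[OF _ le])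
      then show ?thesis unfolding sh p by (cases "rr x < 2 ^ k") (auto simp: indicator_def not_less)
    qed
    then have "(LBINT x. indicator {x::'a. rr x < 2 ^ Suc k} x * (norm (\<phi> x))\<^sup>2) = (LBINT x. indicator {x. rr x < 2 ^ k} x * (norm (\<phi> x))\<^sup>2) + (LBINT x. indicator (shell (Suc k)) x * (norm (\<phi> x))\<^sup>2)"
      using ball_sq_integrable[OF l, of "{x. rr x < 2 ^ k}" "2 ^ k"] shi by (simp add: distrib_right)
    then show "(LBINT x. indicator {x::'a. rr x < 2 ^ Suc k} x * (norm (\<phi> x))\<^sup>2) / 2 ^ Suc k = (LBINT x. indicator {x. rr x < 2 ^ k} x * (norm (\<phi> x))\<^sup>2) / 2 ^ k / 2 + c (Suc k)"
      by (simp add: c_def add_divide_distrib)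
  qed
qed

text \<open>The total mass is divided by 2^k. This gives eigenfunctions in the operator domain the
  same decay property, so that they enter the theory without a separate hypothesis on
  shells.\<close>

lemma L2_imp_mean:
  fixes \<phi> :: "'a::euclidean_space \<Rightarrow> complex"
  assumes "L2 \<phi>"
  shows "(\<lambda>k::nat. (LBINT x. indicator {x. rr x < 2 ^ k} x * (norm (\<phi> x))\<^sup>2) / 2 ^ k) \<longlonglongrightarrow> 0"
proof -
  have [measurable]: "\<phi> \<in> borel_measurable borel" using assms by (simp add: L2_def)
  have i: "integrable lborel (\<lambda>x. (norm (\<phi> x))\<^sup>2)"
    using assms by (intro integrableI_bounded) (auto simp: L2_def l2sq_def)
  have nb: "norm ((LBINT x. indicator {x. rr x < 2 ^ k} x * (norm (\<phi> x))\<^sup>2) / 2 ^ k) \<le> (LBINT x. (norm (\<phi> x))\<^sup>2) / 2 ^ k" for k :: nat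
  proof -
    have "0 \<le> (LBINT x. indicator {x. rr x < 2 ^ k} x * (norm (\<phi> x))\<^sup>2)" by (intro Bochner_Integration.integral_nonneg) auto
    moreover have "(LBINT x. indicator {x. rr x < 2 ^ k} x * (norm (\<phi> x))\<^sup>2) \<le> (LBINT x. (norm (\<phi> x))\<^sup>2)"
      by (rule integral_mono_AE'[OF i]) (auto simp: indicator_def)
    ultimately show ?thesis by (simp add: divide_right_mono)
  qed
  have "(\<lambda>k. (LBINT x. (norm (\<phi> x))\<^sup>2) / 2 ^ k) \<longlonglongrightarrow> 0" by (rule LIMSEQ_divide_realpow_zero) simp
  from Lim_null_comparison[OF always_eventually[OF allI[OF nb]] this] show ?thesis .
qed

section \<open>Passage from real solutions to complex eigenfunctions\<close>

context potential
begin

lemma decays_part: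
  fixes \<phi> :: "'a \<Rightarrow> complex"
  assumes l: "l2loc \<phi>" and e: "norm e \<le> 1"
    and m: "(\<lambda>k::nat. (LBINT x. indicator {x. rr x < 2 ^ k} x * (norm (\<phi> x))\<^sup>2) / 2 ^ k) \<longlonglongrightarrow> 0"
  shows "decays (\<lambda>x. \<phi> x \<bullet> e)"
  unfolding decays_def
proof (rule Lim_null_comparison[OF _ m], rule always_eventually, rule allI)
  fix k :: nat
  have "0 \<le> (LBINT x. indicator {x. rr x < 2 ^ k} x * (\<phi> x \<bullet> e)\<^sup>2)" by (intro Bochner_Integration.integral_nonneg) auto
  moreover have "(LBINT x. indicator {x. rr x < 2 ^ k} x * (\<phi> x \<bullet> e)\<^sup>2) \<le> (LBINT x. indicator {x. rr x < 2 ^ k} x * (norm (\<phi> x))\<^sup>2)"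
  proof (rule integral_mono_AE')
    show "integrable lborel (\<lambda>x. indicator {x. rr x < 2 ^ k} x * (norm (\<phi> x))\<^sup>2)"
      by (rule ball_sq_integrable[OF l]) auto
    show "AE x in lborel. indicator {x. rr x < 2 ^ k} x * (\<phi> x \<bullet> e)\<^sup>2 \<le> indicator {x. rr x < 2 ^ k} x * (norm (\<phi> x))\<^sup>2"
    proof (intro AE_I2 mult_left_mono)
      fix x :: 'a
      have "\<bar>\<phi> x \<bullet> e\<bar> \<le> norm (\<phi> x)"
        using Cauchy_Schwarz_ineq2[of "\<phi> x" e] mult_left_mono[OF e, of "norm (\<phi> x)"] by simp
      from power_mono[OF this abs_ge_zero, of 2] show "(\<phi> x \<bullet> e)\<^sup>2 \<le> (norm (\<phi> x))\<^sup>2" unfolding power2_abs .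
    qed simp
  qed (auto simp: indicator_def)
  ultimately show "norm ((LBINT x. indicator {x. rr x < 2 ^ k} x * (\<phi> x \<bullet> e)\<^sup>2) / 2 ^ k) \<le> (LBINT x. indicator {x. rr x < 2 ^ k} x * (norm (\<phi> x))\<^sup>2) / 2 ^ k"
    by (simp add: divide_right_mono)
qed

lemma V_measurable [measurable]: "V \<in> borel_measurable borel"
  unfolding V_eq by measurable

text \<open>V and E are real, so pairing with a fixed complex number \<open>e\<close> commutes with
  the equation; e = 1 and e = \<i> give the real and imaginary parts.\<close>

lemma esol_of_gen_eigenfun:
  fixes \<phi> :: "'a \<Rightarrow> complex"
  assumes gen: "gen_eigenfun V E \<phi>"
    and g: "\<And>i. i \<in> Basis \<Longrightarrow> l2loc (g i)" "\<And>i. i \<in> Basis \<Longrightarrow> wd \<phi> i (g i)"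
  shows "esol E (\<lambda>x. \<phi> x \<bullet> e) (\<lambda>x. \<Sum>i\<in>Basis. (g i x \<bullet> e) *\<^sub>R i)"
  unfolding esol_def wsol_def
proof (intro conjI ballI allI impI)
  have l: "l2loc \<phi>" using gen by (auto simp: gen_eigenfun_def H2loc_def intro: L2loc_imp_l2loc)
  note [measurable] = l2loc_measurable[OF l]
  have Vb: "\<bar>V x - E\<bar> \<le> 2 * Q + \<bar>E\<bar>" for x using Vlr_Q[of x] Vsr_Q[of x] V_eq[of x] by linarith
  show lu: "l2loc (\<lambda>x. \<phi> x \<bullet> e)" by (rule l2loc_inner[OF l])
  show "l2loc (\<lambda>x. \<Sum>i\<in>Basis. (g i x \<bullet> e) *\<^sub>R i)"
    by (intro l2loc_sum finite_Basis l2loc_scaleR_const l2loc_inner g)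
  show lF: "l2loc (\<lambda>x. (V x - E) * (\<phi> x \<bullet> e))"
    by (rule l2loc_bound[OF lu]) (use Vb in \<open>auto simp: abs_mult intro!: exI[of _ "2 * Q + \<bar>E\<bar>"] mult_right_mono\<close>)
  show "wd (\<lambda>x. \<phi> x \<bullet> e) i (\<lambda>x. (\<Sum>i\<in>Basis. (g i x \<bullet> e) *\<^sub>R i) \<bullet> i)" if i: "i \<in> Basis" for i
    using wd_inner[OF l2loc_imp_l1loc[OF l] l2loc_imp_l1loc[OF g(1)[OF i]] g(2)[OF i] i, of e] i by simp
  fix k :: "'a \<Rightarrow> real" assume k: "test_fun k"
  obtain R where R: "\<And>x. norm x > R \<Longrightarrow> k x = 0" using test_fun_support[OF k] by metis
  have lc: "continuous_on UNIV (laplacian k)" unfolding laplacian_def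
    by (intro continuous_on_sum test_fun_continuous test_fun_pd k)
  have lz: "laplacian k x = 0" if "norm x > R" for x
  proof -
    have "pd i k y = 0" if "norm y > R" for i y by (rule pd_zero_outside[OF R that])
    then have "pd i (pd i k) x = 0" for i by (rule pd_zero_outside[OF _ that])
    then show ?thesis by (simp add: laplacian_def)
  qed
  have int: "integrable lborel (\<lambda>x. a x *\<^sub>R f x)" if a: "continuous_on UNIV a" "\<And>x. norm x > R \<Longrightarrow> a x = 0" and f: "l2loc f" for a and f :: "'a \<Rightarrow> complex"
  proof -
    obtain C where C: "\<And>x. \<bar>a x\<bar> \<le> C" using continuous_bounded_support[OF a] by metis
    note [measurable] = borel_measurable_continuous_onI[OF a(1)] l2loc_measurable[OF f]
    show ?thesis by (rule integrable_l1[OF l2loc_imp_l1loc[OF f], of _ R C]) (auto simp: a intro: mult_right_mono[OF C])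
  qed
  have lVf: "l2loc (\<lambda>x. (V x - E) *\<^sub>R \<phi> x)"
    by (rule l2loc_bound[OF l]) (use Vb in \<open>auto intro!: exI[of _ "2 * Q + \<bar>E\<bar>"] mult_right_mono\<close>)
  have i1: "integrable lborel (\<lambda>x. laplacian k x *\<^sub>R \<phi> x)" by (rule int[OF lc lz l])
  have i2: "integrable lborel (\<lambda>x. k x *\<^sub>R ((V x - E) *\<^sub>R \<phi> x))" by (rule int[OF test_fun_continuous[OF k] R lVf])
  have "(\<lambda>x. \<phi> x * complex_of_real (- laplacian k x) + complex_of_real (V x - E) * \<phi> x * complex_of_real (k x))
    = (\<lambda>x. k x *\<^sub>R ((V x - E) *\<^sub>R \<phi> x) - laplacian k x *\<^sub>R \<phi> x)"
    by (simp add: fun_eq_iff scaleR_conv_of_real algebra_simps)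
  moreover have "(LBINT x. \<phi> x * complex_of_real (- laplacian k x) + complex_of_real (V x - E) * \<phi> x * complex_of_real (k x)) = 0"
    using gen k unfolding gen_eigenfun_def by blast
  ultimately have "(LBINT x. k x *\<^sub>R ((V x - E) *\<^sub>R \<phi> x) - laplacian k x *\<^sub>R \<phi> x) = 0" by simp
  then have "(LBINT x. laplacian k x *\<^sub>R \<phi> x) = (LBINT x. k x *\<^sub>R ((V x - E) *\<^sub>R \<phi> x))"
    using i1 i2 by simp
  then have "(LBINT x. laplacian k x *\<^sub>R \<phi> x) \<bullet> e = (LBINT x. k x *\<^sub>R ((V x - E) *\<^sub>R \<phi> x)) \<bullet> e" by simp
  then show "(LBINT x. (\<phi> x \<bullet> e) * laplacian k x) = (LBINT x. (V x - E) * (\<phi> x \<bullet> e) * k x)"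
    using i1 i2 by (simp add: mult_ac flip: integral_inner_left)
qed

text \<open>One choice of weak derivatives \<open>g\<close> serves all \<open>e\<close>
  simultaneously, so decay proved for the real and imaginary parts applies to the same complex
  gradient.\<close>

lemma gen_eigenfun_parts:
  fixes \<phi> :: "'a \<Rightarrow> complex"
  assumes gen: "gen_eigenfun V E \<phi>"
  shows "\<exists>g. (\<forall>i\<in>Basis. l2loc (g i) \<and> wd \<phi> i (g i) \<and> (\<forall>j\<in>Basis. \<exists>h. l2loc h \<and> wd (g i) j h)) \<and>
    (\<forall>e. esol E (\<lambda>x. \<phi> x \<bullet> e) (\<lambda>x. \<Sum>i\<in>Basis. (g i x \<bullet> e) *\<^sub>R i))"
proof -
  have "\<forall>i\<in>Basis. \<exists>g. l2loc g \<and> wd \<phi> i g \<and> (\<forall>j\<in>Basis. \<exists>h. l2loc h \<and> wd g j h)"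
    using gen unfolding gen_eigenfun_def H2loc_def weak_deriv_iff by (meson L2loc_imp_l2loc)
  then obtain g where g: "\<forall>i\<in>Basis. l2loc (g i) \<and> wd \<phi> i (g i) \<and> (\<forall>j\<in>Basis. \<exists>h. l2loc h \<and> wd (g i) j h)"
    using bchoice[of Basis "\<lambda>i g. l2loc g \<and> wd \<phi> i g \<and> (\<forall>j\<in>Basis. \<exists>h. l2loc h \<and> wd g j h)"] by blast
  have "esol E (\<lambda>x. \<phi> x \<bullet> e) (\<lambda>x. \<Sum>i\<in>Basis. (g i x \<bullet> e) *\<^sub>R i)" for e
    by (rule esol_of_gen_eigenfun[OF gen]) (use g in auto)
  then show ?thesis using g by (intro exI[of _ g]) simp
qed

lemma complex_Basis_norm: "e \<in> Basis \<Longrightarrow> norm (e :: complex) \<le> 1" by simp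

lemma H2_of_gen_eigenfun:
  fixes \<phi> :: "'a \<Rightarrow> complex"
  assumes gen: "gen_eigenfun V E \<phi>" and E: "E > 0" and dec: "\<And>e. e \<in> Basis \<Longrightarrow> decays (\<lambda>x. \<phi> x \<bullet> e)"
  shows "H2 (\<lambda>x. complex_of_real (rr x powr s) * \<phi> x)" "fast \<phi>"
proof -
  obtain g where "(\<forall>i\<in>Basis. l2loc (g i) \<and> wd \<phi> i (g i) \<and> (\<forall>j\<in>Basis. \<exists>h. l2loc h \<and> wd (g i) j h)) \<and>
      (\<forall>e. esol E (\<lambda>x. \<phi> x \<bullet> e) (\<lambda>x. \<Sum>i\<in>Basis. (g i x \<bullet> e) *\<^sub>R i))"
    using gen_eigenfun_parts[OF gen] ..
  then have g: "\<And>i. i \<in> Basis \<Longrightarrow> l2loc (g i)" "\<And>i. i \<in> Basis \<Longrightarrow> wd \<phi> i (g i)"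
    "\<And>i. i \<in> Basis \<Longrightarrow> \<forall>j\<in>Basis. \<exists>h. l2loc h \<and> wd (g i) j h" "\<And>e. esol E (\<lambda>x. \<phi> x \<bullet> e) (\<lambda>x. \<Sum>i\<in>Basis. (g i x \<bullet> e) *\<^sub>R i)"
    by blast+
  have "\<forall>i\<in>Basis. \<forall>j\<in>Basis. \<exists>h. l2loc h \<and> wd (g i) j h" using g(3) by blast
  then obtain h where h: "\<And>i j. i \<in> Basis \<Longrightarrow> j \<in> Basis \<Longrightarrow> l2loc (h i j) \<and> wd (g i) j (h i j)" by metis
  show phi: "fast \<phi>" by (rule fast_components) (rule fast_solution(1)[OF g(4) E dec])
  have gf: "fast (g i)" if i: "i \<in> Basis" for i
  proof (rule fast_components)
    fix e :: complex assume e: "e \<in> Basis"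
    from fast_inner[OF fast_solution(2)[OF g(4) E dec[OF e]], of i] show "fast (\<lambda>x. g i x \<bullet> e)" using i by simp
  qed
  have hf: "fast (h i j)" if ij: "i \<in> Basis" "j \<in> Basis" for i j
  proof (rule fast_components)
    fix e :: complex assume e: "e \<in> Basis"
    have "fast (\<lambda>x. \<Sum>j\<in>Basis. (h i j x \<bullet> e) *\<^sub>R j)"
    proof (rule fast_solution(3)[OF g(4) E dec[OF e] ij(1)])
      show "l2loc (\<lambda>x. \<Sum>j\<in>Basis. (h i j x \<bullet> e) *\<^sub>R j)"
        by (intro l2loc_sum finite_Basis l2loc_scaleR_const l2loc_inner) (use h ij in blast)
      fix j' :: 'a assume j': "j' \<in> Basis"
      have "wd (\<lambda>x. g i x \<bullet> e) j' (\<lambda>x. h i j' x \<bullet> e)"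
        using h[OF ij(1) j'] g(1)[OF ij(1)] j' by (intro wd_inner) (auto intro: l2loc_imp_l1loc)
      then show "wd (\<lambda>x. (\<Sum>i\<in>Basis. (g i x \<bullet> e) *\<^sub>R i) \<bullet> i) j' (\<lambda>x. (\<Sum>j\<in>Basis. (h i j x \<bullet> e) *\<^sub>R j) \<bullet> j')"
        using ij j' by simp
    qed
    from fast_inner[OF this, of j] show "fast (\<lambda>x. h i j x \<bullet> e)" using ij by simp
  qed
  show "H2 (\<lambda>x. complex_of_real (rr x powr s) * \<phi> x)"
    by (rule H2_weighted[where g = g and h = h]) (use phi gf g(2) hf h in auto)
qed

text \<open>The local mass on the right of \<open>weighted_estimate\<close> is bounded by the
  negatively weighted norm, since a negative power of r is bounded below on a ball. Extended
  integrals are used because that norm is not known to be finite beforehand.\<close>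

lemma weighted_bound_complex:
  fixes m :: nat
  assumes a: "0 < a" "a \<le> b"
  shows "\<exists>C\<ge>0. \<forall>E \<phi>. a \<le> E \<longrightarrow> E \<le> b \<longrightarrow> gen_eigenfun V E \<phi> \<longrightarrow> (\<forall>e\<in>Basis. decays (\<lambda>x. \<phi> x \<bullet> e)) \<longrightarrow>
    (\<integral>\<^sup>+x. ennreal (rr x ^ m * (norm (\<phi> x))\<^sup>2) \<partial>lborel) \<le> ennreal C * (\<integral>\<^sup>+x. ennreal ((rr x powr (- 3 / 4))\<^sup>2 * (norm (\<phi> x))\<^sup>2) \<partial>lborel)"
proof -
  obtain C R where C: "C \<ge> 0" "\<And>E u Du L. a \<le> E \<Longrightarrow> E \<le> b \<Longrightarrow> esol E u Du \<Longrightarrow> decays u \<Longrightarrow>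
     (LBINT x. indicator {x. rr x < L} x * (rr x ^ m * Zf u Du x)) \<le> C * (LBINT x. indicator {x. rr x < R} x * (u x)\<^sup>2)"
    using weighted_estimate[OF a, of m] by blast
  \<comment> \<open>The weight r^(-3/4) enters squared, and for r < R this K satisfies K r^(-3/2)
    \<ge> 1.\<close>
  define K where "K = (\<bar>R\<bar> + 1) powr (3 / 2)"
  have "(\<integral>\<^sup>+x. ennreal (rr x ^ m * (norm (\<phi> x))\<^sup>2) \<partial>lborel) \<le> ennreal (C * K) * (\<integral>\<^sup>+x. ennreal ((rr x powr (- 3 / 4))\<^sup>2 * (norm (\<phi> x))\<^sup>2) \<partial>lborel)"
    if E: "a \<le> E" "E \<le> b" and gen: "gen_eigenfun V E \<phi>" and dec: "\<forall>e\<in>Basis. decays (\<lambda>x. \<phi> x \<bullet> e)" for E \<phi>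
  proof -
    obtain g where "(\<forall>i\<in>Basis. l2loc (g i) \<and> wd \<phi> i (g i) \<and> (\<forall>j\<in>Basis. \<exists>h. l2loc h \<and> wd (g i) j h)) \<and>
        (\<forall>e. esol E (\<lambda>x. \<phi> x \<bullet> e) (\<lambda>x. \<Sum>i\<in>Basis. (g i x \<bullet> e) *\<^sub>R i))"
      using gen_eigenfun_parts[OF gen] ..
    then have g: "\<And>e. esol E (\<lambda>x. \<phi> x \<bullet> e) (\<lambda>x. \<Sum>i\<in>Basis. (g i x \<bullet> e) *\<^sub>R i)" by blast
    have l: "l2loc \<phi>" using gen by (auto simp: gen_eigenfun_def H2loc_def intro: L2loc_imp_l2loc)
    note [measurable] = l2loc_measurable[OF l]
    have nsum: "(norm (\<phi> x))\<^sup>2 = (\<Sum>e\<in>Basis. (\<phi> x \<bullet> e)\<^sup>2)" for x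
      unfolding power2_norm_eq_inner euclidean_inner[of "\<phi> x" "\<phi> x"] by (simp only: power2_eq_square)
    have bi: "integrable lborel (\<lambda>x. indicator {x. rr x < L} x * (norm (\<phi> x))\<^sup>2)" for L by (rule ball_sq_integrable[OF l]) auto
    have ei: "integrable lborel (\<lambda>x. indicator {x. rr x < L} x * (\<phi> x \<bullet> e)\<^sup>2)" for L e
      by (rule sq_set_integrable[OF l2loc_inner[OF l]])
    have mi: "integrable lborel (\<lambda>x. indicator {x. rr x < L} x * (rr x ^ m * (\<phi> x \<bullet> e)\<^sup>2))" for L e
    proof (rule Bochner_Integration.integrable_bound[OF integrable_mult_right[OF ei[of L e], of "\<bar>L\<bar> ^ m"]])
      show "AE x in lborel. norm (indicator {x. rr x < L} x * (rr x ^ m * (\<phi> x \<bullet> e)\<^sup>2)) \<le> norm (\<bar>L\<bar> ^ m * (indicator {x. rr x < L} x * (\<phi> x \<bullet> e)\<^sup>2))"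
      proof (intro AE_I2)
        fix x :: 'a
        have "rr x ^ m \<le> \<bar>L\<bar> ^ m" if "rr x < L" using that rr_pos[of x] by (intro power_mono) auto
        then show "norm (indicator {x. rr x < L} x * (rr x ^ m * (\<phi> x \<bullet> e)\<^sup>2)) \<le> norm (\<bar>L\<bar> ^ m * (indicator {x. rr x < L} x * (\<phi> x \<bullet> e)\<^sup>2))"
          using rr_pos[of x] by (auto simp: indicator_def abs_mult intro!: mult_right_mono)
      qed
    qed measurable
    have ball: "(LBINT x. indicator {x. rr x < L} x * (rr x ^ m * (norm (\<phi> x))\<^sup>2)) \<le> C * (LBINT x. indicator {x. rr x < R} x * (norm (\<phi> x))\<^sup>2)" for L
    proof -
      have "(LBINT x. indicator {x. rr x < L} x * (rr x ^ m * (norm (\<phi> x))\<^sup>2)) = (\<Sum>e\<in>Basis. \<integral>x. indicator {x. rr x < L} x * (rr x ^ m * (\<phi> x \<bullet> e)\<^sup>2) \<partial>lborel)"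
        unfolding nsum sum_distrib_left by (rule Bochner_Integration.integral_sum[OF mi])
      also have "\<dots> \<le> (\<Sum>e\<in>Basis. C * (LBINT x. indicator {x. rr x < R} x * (\<phi> x \<bullet> e)\<^sup>2))"
      proof (rule sum_mono)
        fix e :: complex assume e: "e \<in> Basis"
        let ?D = "\<lambda>x. \<Sum>i\<in>Basis. (g i x \<bullet> e) *\<^sub>R i"
        have "(LBINT x. indicator {x. rr x < L} x * (rr x ^ m * (\<phi> x \<bullet> e)\<^sup>2)) \<le> (LBINT x. indicator {x. rr x < L} x * (rr x ^ m * Zf (\<lambda>x. \<phi> x \<bullet> e) ?D x))"
        proof (rule integral_mono[OF mi])
          show "integrable lborel (\<lambda>x. indicator {x. rr x < L} x * (rr x ^ m * Zf (\<lambda>x. \<phi> x \<bullet> e) ?D x))"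
          proof (rule Zf_set_integrable[OF g, of _ L "L ^ m"])
            show "\<bar>rr x ^ m\<bar> \<le> L ^ m" if "rr x < L" for x :: 'a using that rr_pos[of x] by (simp add: power_mono)
          qed auto
          show "indicator {x. rr x < L} x * (rr x ^ m * (\<phi> x \<bullet> e)\<^sup>2) \<le> indicator {x. rr x < L} x * (rr x ^ m * Zf (\<lambda>x. \<phi> x \<bullet> e) ?D x)" for x
            using rr_pos[of x] cD_nonneg[of ?D x] by (intro mult_left_mono) (auto simp: Zf_def)
        qed
        also have "\<dots> \<le> C * (LBINT x. indicator {x. rr x < R} x * (\<phi> x \<bullet> e)\<^sup>2)"
          by (rule C(2)[OF E g]) (use dec e in blast)
        finally show "(LBINT x. indicator {x. rr x < L} x * (rr x ^ m * (\<phi> x \<bullet> e)\<^sup>2)) \<le> C * (LBINT x. indicator {x. rr x < R} x * (\<phi> x \<bullet> e)\<^sup>2)" .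
      qed
      also have "\<dots> = C * (LBINT x. indicator {x. rr x < R} x * (norm (\<phi> x))\<^sup>2)"
        unfolding nsum sum_distrib_left[of "indicator _ _"] Bochner_Integration.integral_sum[OF ei] by (rule sum_distrib_left[symmetric])
      finally show ?thesis .
    qed
    have mb: "integrable lborel (\<lambda>x. indicator {x. rr x < L} x * (rr x ^ m * (norm (\<phi> x))\<^sup>2))" for L
      unfolding nsum sum_distrib_left by (intro Bochner_Integration.integrable_sum mi)
    have ex: "integrable lborel (\<lambda>x. rr x ^ m * (norm (\<phi> x))\<^sup>2)" "(LBINT x. rr x ^ m * (norm (\<phi> x))\<^sup>2) \<le> C * (LBINT x. indicator {x. rr x < R} x * (norm (\<phi> x))\<^sup>2)"
      by (rule exhaust_integrable[OF _ _ mb ball], measurable, simp add: less_imp_le[OF rr_pos])+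
    have "(\<integral>\<^sup>+x. ennreal (rr x ^ m * (norm (\<phi> x))\<^sup>2) \<partial>lborel) = ennreal (LBINT x. rr x ^ m * (norm (\<phi> x))\<^sup>2)"
      by (rule nn_integral_eq_integral[OF ex(1)]) (simp add: less_imp_le[OF rr_pos])
    also have "\<dots> \<le> ennreal (C * (LBINT x. indicator {x. rr x < R} x * (norm (\<phi> x))\<^sup>2))" by (rule ennreal_leI[OF ex(2)])
    also have "\<dots> = ennreal C * ennreal (LBINT x. indicator {x. rr x < R} x * (norm (\<phi> x))\<^sup>2)" using C(1) by (simp add: ennreal_mult')
    also have "ennreal (LBINT x. indicator {x. rr x < R} x * (norm (\<phi> x))\<^sup>2) = (\<integral>\<^sup>+x. ennreal (indicator {x. rr x < R} x * (norm (\<phi> x))\<^sup>2) \<partial>lborel)"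
      by (rule nn_integral_eq_integral[OF bi, symmetric]) simp
    also have "\<dots> \<le> (\<integral>\<^sup>+x. ennreal K * ennreal ((rr x powr (- 3 / 4))\<^sup>2 * (norm (\<phi> x))\<^sup>2) \<partial>lborel)"
    proof (intro nn_integral_mono)
      fix x :: 'a
      have "indicator {x. rr x < R} x * (norm (\<phi> x))\<^sup>2 \<le> K * ((rr x powr (- 3 / 4))\<^sup>2 * (norm (\<phi> x))\<^sup>2)"
      proof (cases "rr x < R")
        case True
        have "(rr x powr (- 3 / 4))\<^sup>2 = rr x powr (- 3 / 2)" by (simp add: power2_eq_square flip: powr_add)
        moreover have "1 \<le> K * rr x powr (- 3 / 2)"
        proof -
          have "rr x powr (3 / 2) \<le> K" unfolding K_def using True rr_pos[of x] by (intro powr_mono2) auto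
          then show ?thesis using rr_pos[of x] by (simp add: powr_minus divide_inverse[symmetric] le_divide_eq)
        qed
        ultimately have "1 * (norm (\<phi> x))\<^sup>2 \<le> (K * (rr x powr (- 3 / 4))\<^sup>2) * (norm (\<phi> x))\<^sup>2" by (intro mult_right_mono) auto
        then show ?thesis using True by (simp add: mult.assoc)
      qed (simp add: K_def)
      then show "ennreal (indicator {x. rr x < R} x * (norm (\<phi> x))\<^sup>2) \<le> ennreal K * ennreal ((rr x powr (- 3 / 4))\<^sup>2 * (norm (\<phi> x))\<^sup>2)"
        by (simp add: K_def ennreal_mult'[symmetric] ennreal_leI)
    qed
    also have "\<dots> = ennreal K * (\<integral>\<^sup>+x. ennreal ((rr x powr (- 3 / 4))\<^sup>2 * (norm (\<phi> x))\<^sup>2) \<partial>lborel)"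
      by (rule nn_integral_cmult) measurable
    finally show ?thesis using C(1) by (simp add: ennreal_mult K_def mult.assoc mult_left_mono)
  qed
  then show ?thesis using C(1) by (intro exI[of _ "C * K"]) (auto simp: K_def)
qed

end

subsection \<open>Finiteness of the spectrum\<close>

lemma fast_square_integrable: "fast u \<Longrightarrow> integrable lborel (\<lambda>x. (norm (u x))\<^sup>2)"
  unfolding fast_def by (auto dest: spec[of _ 0])

lemma fast_prod_integrable:
  fixes u v :: "'a::euclidean_space \<Rightarrow> real"
  assumes "fast u" "fast v" shows "integrable lborel (\<lambda>x. u x * v x)"
proof (rule Bochner_Integration.integrable_bound)
  show "integrable lborel (\<lambda>x. (norm (u x))\<^sup>2 + (norm (v x))\<^sup>2)"
    using assms[THEN fast_square_integrable] by (rule Bochner_Integration.integrable_add)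
  note [measurable] = assms[THEN fast_measurable]
  show "(\<lambda>x. u x * v x) \<in> borel_measurable lborel" by measurable
  show "AE x in lborel. norm (u x * v x) \<le> norm ((norm (u x))\<^sup>2 + (norm (v x))\<^sup>2)"
  proof (intro AE_I2)
    fix x :: 'a
    have "\<bar>u x * v x\<bar> \<le> ((u x)\<^sup>2 + (v x)\<^sup>2) / 2" by (rule abs_mult_le_sum_sq)
    also have "\<dots> \<le> (u x)\<^sup>2 + (v x)\<^sup>2" by simp
    finally show "norm (u x * v x) \<le> norm ((norm (u x))\<^sup>2 + (norm (v x))\<^sup>2)" by simp
  qed
qed

lemma fast_scale: "fast u \<Longrightarrow> fast (\<lambda>x. c * (u x :: real))"
  using fast_scaleR[of u "\<lambda>_. c" "\<bar>c\<bar>" 0] by simp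

text \<open>A translation by y changes v by an integral of p along the segment, so in L^2 by at most
  |y| times the norm of p. Jensen averages this over the kernel, whose support restricts |y| to
  1/(n+1).\<close>

lemma N2_moll_smooth:
  fixes v :: "'a::euclidean_space \<Rightarrow> real"
  assumes v: "\<And>x. (v has_derivative (\<lambda>h. p x \<bullet> h)) (at x)" and p: "continuous_on UNIV p"
  shows "N2 (\<lambda>x. conv (moll n) v x - v x) \<le> ennreal ((1 / (real n + 1))\<^sup>2) * N2 p"
proof -
  have vc: "continuous_on UNIV v" by (rule has_derivative_continuous_on_UNIV[OF v])
  have v1: "l1loc v" by (intro l2loc_imp_l1loc l2loc_continuous vc)
  note [measurable] = borel_measurable_continuous_onI[OF vc] borel_measurable_continuous_onI[OF p]
    test_fun_measurable[OF test_fun_moll[of n, where 'a='a]]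
  let ?I = "\<lambda>t. indicator {0..1::real} t :: real"
  have inner: "(\<integral>\<^sup>+x. ennreal ((v (x - y) - v x)\<^sup>2) \<partial>lborel) \<le> ennreal ((norm y)\<^sup>2) * N2 p" for y
  proof -
    have pt: "ennreal ((v (x - y) - v x)\<^sup>2) \<le> ennreal ((norm y)\<^sup>2) * (\<integral>\<^sup>+t. ennreal (?I t * (norm (p (x - t *\<^sub>R y)))\<^sup>2) \<partial>lborel)" for x
    proof -
      define g where "g = (\<lambda>t. p (x - t *\<^sub>R y) \<bullet> (- y))"
      have pc: "continuous_on S (\<lambda>t. p (x - t *\<^sub>R y))" for S :: "real set"
        by (rule continuous_on_compose2[OF p]) (auto intro!: continuous_intros)
      have gc: "continuous_on S g" for S unfolding g_def by (intro continuous_intros pc)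
      have "(LBINT t. indicator {0..1} t *\<^sub>R g t) = v (x - 1 *\<^sub>R y) - v (x - 0 *\<^sub>R y)"
      proof (rule integral_FTC_atLeastAtMost)
        fix t :: real
        have "((\<lambda>t. x - t *\<^sub>R y) has_derivative (\<lambda>s. - (s *\<^sub>R y))) (at t)" by (auto intro!: derivative_eq_intros)
        from has_derivative_compose[OF this v]
        have "((\<lambda>t. v (x - t *\<^sub>R y)) has_derivative (\<lambda>s. s *\<^sub>R g t)) (at t)" by (simp add: g_def)
        then show "((\<lambda>t. v (x - t *\<^sub>R y)) has_vector_derivative g t) (at t within {0..1})"
          by (simp add: has_vector_derivative_def has_derivative_at_withinI)
      qed (auto intro: gc)
      \<comment> \<open>Cauchy-Schwarz is applied with the indicator of [0,1] as one of the two
        functions; its square integrates to 1, so no constant appears.\<close>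
      moreover have sqI: "(?I t * s)\<^sup>2 = ?I t * s\<^sup>2" "(?I t)\<^sup>2 = ?I t" "?I t * (?I t * s) = ?I t * s" for t s by (auto simp: indicator_def)
      ultimately have eq: "v (x - y) - v x = (LBINT t. ?I t * (?I t * g t))" unfolding sqI by simp
      have ic: "integrable lborel (\<lambda>t. ?I t * h t)" if "continuous_on UNIV h" for h :: "real \<Rightarrow> real"
        using borel_integrable_atLeastAtMost'[of 0 1 h] continuous_on_subset[OF that] by (simp add: set_integrable_def)
      have i0: "integrable lborel (\<lambda>t. (?I t)\<^sup>2)" using ic[of "\<lambda>_. 1"] unfolding sqI by simp
      have i1: "integrable lborel (\<lambda>t. (?I t * g t)\<^sup>2)" unfolding sqI by (intro ic continuous_intros gc)
      have i2: "integrable lborel (\<lambda>t. ?I t * (?I t * g t))" unfolding sqI by (intro ic gc)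
      have one: "(LBINT t. (?I t)\<^sup>2) = 1" unfolding sqI by simp
      have "\<bar>v (x - y) - v x\<bar> \<le> sqrt (LBINT t. (?I t * g t)\<^sup>2)"
        unfolding eq using integral_cauchy_schwarz[OF i0 i1 i2] unfolding one by simp
      from power_mono[OF this abs_ge_zero, of 2]
      have "(v (x - y) - v x)\<^sup>2 \<le> (LBINT t. (?I t * g t)\<^sup>2)" by simp
      also have "\<dots> \<le> (LBINT t. (norm y)\<^sup>2 * (?I t * (norm (p (x - t *\<^sub>R y)))\<^sup>2))"
      proof (rule integral_mono[OF i1])
        show "integrable lborel (\<lambda>t. (norm y)\<^sup>2 * (?I t * (norm (p (x - t *\<^sub>R y)))\<^sup>2))"
          by (intro integrable_mult_right ic continuous_intros pc)
        fix t
        have "\<bar>g t\<bar> \<le> norm (p (x - t *\<^sub>R y)) * norm y" unfolding g_def using Cauchy_Schwarz_ineq2[of "p (x - t *\<^sub>R y)" "- y"] by simp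
        from power_mono[OF this abs_ge_zero, of 2] have "(g t)\<^sup>2 \<le> (norm y)\<^sup>2 * (norm (p (x - t *\<^sub>R y)))\<^sup>2"
          by (simp add: power_mult_distrib mult.commute)
        then have "?I t * (g t)\<^sup>2 \<le> ?I t * ((norm y)\<^sup>2 * (norm (p (x - t *\<^sub>R y)))\<^sup>2)" by (intro mult_left_mono) auto
        then show "(?I t * g t)\<^sup>2 \<le> (norm y)\<^sup>2 * (?I t * (norm (p (x - t *\<^sub>R y)))\<^sup>2)" unfolding sqI by (simp add: mult_ac)
      qed
      also have "\<dots> = (norm y)\<^sup>2 * (LBINT t. ?I t * (norm (p (x - t *\<^sub>R y)))\<^sup>2)" by simp
      finally have "ennreal ((v (x - y) - v x)\<^sup>2) \<le> ennreal ((norm y)\<^sup>2 * (LBINT t. ?I t * (norm (p (x - t *\<^sub>R y)))\<^sup>2))" by (rule ennreal_leI)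
      also have "\<dots> = ennreal ((norm y)\<^sup>2) * ennreal (LBINT t. ?I t * (norm (p (x - t *\<^sub>R y)))\<^sup>2)" by (simp add: ennreal_mult')
      also have "ennreal (LBINT t. ?I t * (norm (p (x - t *\<^sub>R y)))\<^sup>2) = (\<integral>\<^sup>+t. ennreal (?I t * (norm (p (x - t *\<^sub>R y)))\<^sup>2) \<partial>lborel)"
        by (rule nn_integral_eq_integral[symmetric]) (auto intro!: ic continuous_intros pc)
      finally show ?thesis .
    qed
    have "(\<integral>\<^sup>+x. ennreal ((v (x - y) - v x)\<^sup>2) \<partial>lborel) \<le> (\<integral>\<^sup>+x. ennreal ((norm y)\<^sup>2) * (\<integral>\<^sup>+t. ennreal (?I t * (norm (p (x - t *\<^sub>R y)))\<^sup>2) \<partial>lborel) \<partial>lborel)"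
      by (intro nn_integral_mono pt)
    also have "\<dots> = ennreal ((norm y)\<^sup>2) * (\<integral>\<^sup>+x. (\<integral>\<^sup>+t. ennreal (?I t * (norm (p (x - t *\<^sub>R y)))\<^sup>2) \<partial>lborel) \<partial>lborel)"
      by (rule nn_integral_cmult) measurable
    also have "(\<integral>\<^sup>+x. (\<integral>\<^sup>+t. ennreal (?I t * (norm (p (x - t *\<^sub>R y)))\<^sup>2) \<partial>lborel) \<partial>lborel) = (\<integral>\<^sup>+t. (\<integral>\<^sup>+x. ennreal (?I t * (norm (p (x - t *\<^sub>R y)))\<^sup>2) \<partial>lborel) \<partial>lborel)"
      by (rule lborel_pair.Fubini') measurable
    also have "\<dots> = (\<integral>\<^sup>+t. ennreal (?I t) * N2 p \<partial>lborel)"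
    proof (intro nn_integral_cong)
      fix t :: real
      have "(\<integral>\<^sup>+x. ennreal (?I t * (norm (p (x - t *\<^sub>R y)))\<^sup>2) \<partial>lborel) = ennreal (?I t) * (\<integral>\<^sup>+x. ennreal ((norm (p (x - t *\<^sub>R y)))\<^sup>2) \<partial>lborel)"
        by (subst nn_integral_cmult[symmetric]) (auto simp: ennreal_mult')
      then show "(\<integral>\<^sup>+x. ennreal (?I t * (norm (p (x - t *\<^sub>R y)))\<^sup>2) \<partial>lborel) = ennreal (?I t) * N2 p"
        unfolding N2_def by (simp add: nn_integral_translate[of "\<lambda>x. ennreal ((norm (p x))\<^sup>2)"])
    qed
    also have "\<dots> = N2 p" by (simp add: nn_integral_multc ennreal_indicator)
    finally show ?thesis .
  qed
  have i1: "integrable lborel (\<lambda>y. moll n y *\<^sub>R v (x - y))" for x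
  proof -
    have "integrable (distr lborel borel (\<lambda>y. x - y)) (\<lambda>y. moll n (x - y) *\<^sub>R v y)"
      using conv_integrable[OF test_fun_moll v1, of n x] by (simp add: distr_reflect)
    then show ?thesis by (subst (asm) integrable_distr_eq) auto
  qed
  have eq: "conv (moll n) v x - v x = (LBINT y. moll n y *\<^sub>R (v (x - y) - v x))" for x
    using i1[of x] test_fun_integrable[OF test_fun_moll[of n, where 'a='a]]
    by (simp add: conv_alt[OF test_fun_moll v1] right_diff_distrib moll_integral)
  have "N2 (\<lambda>x. conv (moll n) v x - v x) \<le> (\<integral>\<^sup>+x. (\<integral>\<^sup>+y. ennreal (moll n y) * ennreal ((norm (v (x - y) - v x))\<^sup>2) \<partial>lborel) \<partial>lborel)"
    unfolding N2_def eq by (intro nn_integral_mono moll_jensen) measurable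
  also have "\<dots> = (\<integral>\<^sup>+y. (\<integral>\<^sup>+x. ennreal (moll n y) * ennreal ((norm (v (x - y) - v x))\<^sup>2) \<partial>lborel) \<partial>lborel)"
    by (rule lborel_pair.Fubini') measurable
  also have "\<dots> = (\<integral>\<^sup>+y. ennreal (moll n y) * (\<integral>\<^sup>+x. ennreal ((norm (v (x - y) - v x))\<^sup>2) \<partial>lborel) \<partial>lborel)"
    by (intro nn_integral_cong nn_integral_cmult) measurable
  also have "\<dots> \<le> (\<integral>\<^sup>+y. ennreal (moll n y) * (ennreal ((1 / (real n + 1))\<^sup>2) * N2 p) \<partial>(lborel :: 'a measure))"
  proof (intro nn_integral_mono)
    fix y :: 'a
    show "ennreal (moll n y) * (\<integral>\<^sup>+x. ennreal ((norm (v (x - y) - v x))\<^sup>2) \<partial>lborel) \<le> ennreal (moll n y) * (ennreal ((1 / (real n + 1))\<^sup>2) * N2 p)"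
    proof (cases "norm y \<le> 1 / (real n + 1)")
      case True
      then have "(norm y)\<^sup>2 \<le> (1 / (real n + 1))\<^sup>2" by (intro power_mono) auto
      have "(\<integral>\<^sup>+x. ennreal ((norm (v (x - y) - v x))\<^sup>2) \<partial>lborel) \<le> ennreal ((norm y)\<^sup>2) * N2 p" using inner[of y] by simp
      also have "\<dots> \<le> ennreal ((1 / (real n + 1))\<^sup>2) * N2 p" by (rule mult_right_mono[OF ennreal_leI[OF \<open>(norm y)\<^sup>2 \<le> _\<close>]]) simp
      finally show ?thesis by (rule mult_left_mono) simp
    qed (simp add: moll_zero)
  qed
  also have "\<dots> = ennreal ((1 / (real n + 1))\<^sup>2) * N2 p"
    by (simp add: nn_integral_multc nn_integral_eq_integral[OF test_fun_integrable[OF test_fun_moll]] moll_nonneg moll_integral)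
  finally show ?thesis .
qed

text \<open>The smooth case is applied to mollifications v m of w, whose gradients have norm at most
  that of \<open>Dw\<close> by contractivity. Three-term splitting costs 6 times the distance of v m
  to w plus 4 times the rate; the former vanishes as m grows.\<close>

lemma N2_moll_rate:
  fixes w :: "'a::euclidean_space \<Rightarrow> real"
  assumes w: "l2loc w" "l2loc Dw" "\<And>i. i \<in> Basis \<Longrightarrow> wd w i (\<lambda>x. Dw x \<bullet> i)" and fin: "N2 w < \<infinity>"
  shows "N2 (\<lambda>x. conv (moll n) w x - w x) \<le> 4 * (ennreal ((1 / (real n + 1))\<^sup>2) * N2 Dw)"
proof -
  note l1 = w(1,2)[THEN l2loc_imp_l1loc]
  define v where "v = (\<lambda>m. conv (moll m) w)"
  have v1: "l1loc (v m)" for m unfolding v_def by (intro l2loc_imp_l1loc conv_l2loc test_fun_moll l1)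
  note [measurable] = l1loc_measurable[OF l1(1)] l1loc_measurable[OF v1] conv_measurable[OF test_fun_moll l1(1)] conv_measurable[OF test_fun_moll v1]
  have a: "(\<lambda>m. N2 (\<lambda>x. v m x - w x)) \<longlonglongrightarrow> 0" unfolding v_def by (rule moll_conv_N2[OF _ fin]) measurable
  let ?c = "ennreal ((1 / (real n + 1))\<^sup>2) * N2 Dw"
  have le: "N2 (\<lambda>x. conv (moll n) w x - w x) \<le> 6 * N2 (\<lambda>x. v m x - w x) + 4 * ?c" for m
  proof -
    have sw: "N2 (\<lambda>x. w x - v m x) = N2 (\<lambda>x. v m x - w x)" by (simp add: N2_def power2_commute)
    have wv1: "l1loc (\<lambda>x. w x - v m x)"
      using l2loc_imp_l1loc[OF l2loc_diff[OF w(1), of "v m"]] conv_l2loc[OF test_fun_moll l1(1)] by (simp add: v_def)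
    have "N2 (\<lambda>x. conv (moll n) w x - w x) = N2 (\<lambda>x. conv (moll n) (\<lambda>x. w x - v m x) x + ((conv (moll n) (v m) x - v m x) + (v m x - w x)))"
      by (simp add: conv_diff[OF test_fun_moll l1(1) v1])
    also have "\<dots> \<le> 2 * N2 (conv (moll n) (\<lambda>x. w x - v m x)) + 2 * N2 (\<lambda>x. (conv (moll n) (v m) x - v m x) + (v m x - w x))"
      by (rule N2_add_le) (auto intro: conv_measurable test_fun_moll wv1)
    also have "\<dots> \<le> 2 * N2 (\<lambda>x. w x - v m x) + 2 * (2 * N2 (\<lambda>x. conv (moll n) (v m) x - v m x) + 2 * N2 (\<lambda>x. v m x - w x))"
      by (intro add_mono mult_left_mono N2_conv_le wv1 N2_add_le) auto
    also have "N2 (\<lambda>x. conv (moll n) (v m) x - v m x) \<le> ?c"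
    proof -
      have "N2 (\<lambda>x. conv (moll n) (v m) x - v m x) \<le> ennreal ((1 / (real n + 1))\<^sup>2) * N2 (conv (moll m) Dw)"
        unfolding v_def by (rule N2_moll_smooth[OF wd_gradient_conv[OF l1 w(3) test_fun_moll] conv_continuous[OF test_fun_moll l1(2)]])
      also have "\<dots> \<le> ?c" by (intro mult_left_mono N2_conv_le l1) auto
      finally show ?thesis .
    qed
    finally have "N2 (\<lambda>x. conv (moll n) w x - w x) \<le> 2 * N2 (\<lambda>x. v m x - w x) + 2 * (2 * ?c + 2 * N2 (\<lambda>x. v m x - w x))"
      unfolding sw by (simp add: add_mono mult_left_mono)
    also have "\<dots> = 6 * N2 (\<lambda>x. v m x - w x) + 4 * ?c"
    proof -
      have "2 * a + 2 * (2 * c + 2 * a) = 6 * a + 4 * c" for a c :: ennreal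
      proof -
        have "2 * a + 2 * (2 * c + 2 * a) = (2 * a + 4 * a) + 4 * c" by (simp add: distrib_left mult.assoc[symmetric] add_ac)
        also have "2 * a + 4 * a = 6 * a" by (simp add: distrib_right[symmetric])
        finally show ?thesis .
      qed
      then show ?thesis .
    qed
    finally show ?thesis .
  qed
  have "(\<lambda>m. 6 * N2 (\<lambda>x. v m x - w x) + 4 * ?c) \<longlonglongrightarrow> 6 * 0 + 4 * ?c"
    by (intro tendsto_add tendsto_const ennreal_tendsto_cmult a) simp
  then show ?thesis by (intro LIMSEQ_le_const[of _ "4 * ?c"]) (use le in auto)
qed

text \<open>The squared distance from \<open>f\<close> to its projection onto the span is
  nonnegative; expanding it leaves the squared norm of \<open>f\<close> minus the sum of squared
  coefficients.\<close>

lemma bessel_inequality: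
  fixes f :: "'a::euclidean_space \<Rightarrow> real" and u :: "nat \<Rightarrow> 'a \<Rightarrow> real"
  assumes f: "integrable lborel (\<lambda>x. (f x)\<^sup>2)" and fu: "\<And>n. n < N \<Longrightarrow> integrable lborel (\<lambda>x. f x * u n x)"
    and uu: "\<And>m n. m < N \<Longrightarrow> n < N \<Longrightarrow> integrable lborel (\<lambda>x. u m x * u n x)"
    and on: "\<And>m n. m < N \<Longrightarrow> n < N \<Longrightarrow> (LBINT x. u m x * u n x) = (if m = n then 1 else 0)"
  shows "(\<Sum>n<N. (LBINT x. f x * u n x)\<^sup>2) \<le> (LBINT x. (f x)\<^sup>2)"
proof -
  define c where "c = (\<lambda>n. \<integral>x. f x * u n x \<partial>lborel)"
  have i1: "integrable lborel (\<lambda>x. \<Sum>n<N. c n * (f x * u n x))" by (intro Bochner_Integration.integrable_sum integrable_mult_right fu) simp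
  have i2: "integrable lborel (\<lambda>x. \<Sum>m<N. \<Sum>n<N. c m * c n * (u m x * u n x))"
    by (intro Bochner_Integration.integrable_sum integrable_mult_right uu) simp_all
  have "0 \<le> (LBINT x. (f x - (\<Sum>n<N. c n * u n x))\<^sup>2)" by simp
  also have "(\<lambda>x. (f x - (\<Sum>n<N. c n * u n x))\<^sup>2) = (\<lambda>x. (f x)\<^sup>2 - 2 * (\<Sum>n<N. c n * (f x * u n x)) + (\<Sum>m<N. \<Sum>n<N. c m * c n * (u m x * u n x)))"
  proof
    fix x
    have "(\<Sum>n<N. c n * u n x) * (\<Sum>n<N. c n * u n x) = (\<Sum>m<N. \<Sum>n<N. c m * c n * (u m x * u n x))"
      unfolding sum_product by (intro sum.cong refl) (simp add: mult_ac)
    moreover have "f x * (\<Sum>n<N. c n * u n x) = (\<Sum>n<N. c n * (f x * u n x))"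
      unfolding sum_distrib_left by (intro sum.cong refl) (simp add: mult_ac)
    ultimately show "(f x - (\<Sum>n<N. c n * u n x))\<^sup>2 = (f x)\<^sup>2 - 2 * (\<Sum>n<N. c n * (f x * u n x)) + (\<Sum>m<N. \<Sum>n<N. c m * c n * (u m x * u n x))"
      by (simp add: power2_diff power2_eq_square[of "sum _ _"])
  qed
  also have "(LBINT x. (f x)\<^sup>2 - 2 * (\<Sum>n<N. c n * (f x * u n x)) + (\<Sum>m<N. \<Sum>n<N. c m * c n * (u m x * u n x)))
     = (LBINT x. (f x)\<^sup>2) - 2 * (LBINT x. (\<Sum>n<N. c n * (f x * u n x))) + (LBINT x. (\<Sum>m<N. \<Sum>n<N. c m * c n * (u m x * u n x)))"
    using f i1 i2 by simp
  also have "(LBINT x. (\<Sum>n<N. c n * (f x * u n x))) = (\<Sum>n<N. (c n)\<^sup>2)"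
    using fu by (subst Bochner_Integration.integral_sum) (auto simp: c_def power2_eq_square)
  also have "(LBINT x. (\<Sum>m<N. \<Sum>n<N. c m * c n * (u m x * u n x))) = (\<Sum>m<N. \<Sum>n<N. c m * c n * (if m = n then 1 else 0))"
  proof -
    have e: "(LBINT x. (\<Sum>n<N. c m * c n * (u m x * u n x))) = (\<Sum>n<N. c m * c n * (if m = n then 1 else 0))" if "m < N" for m
      by (subst Bochner_Integration.integral_sum) (auto simp: uu on that intro!: sum.cong)
    show ?thesis
      by (subst Bochner_Integration.integral_sum) (auto intro!: Bochner_Integration.integrable_sum integrable_mult_right uu sum.cong[OF refl e])
  qed
  also have "\<dots> = (\<Sum>n<N. (c n)\<^sup>2)" by (intro sum.cong refl) (simp add: power2_eq_square if_distrib cong: if_cong)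
  finally show ?thesis by (simp add: c_def)
qed

section \<open>Real eigenspaces, orthogonality and the count\<close>

context potential
begin

text \<open>The real eigenspace at energy E, with rapid decay built in so that all inner products
  converge. The weak gradient is existential, which makes this a property of the function alone and
  a real vector space by \<open>rE_linear\<close>.\<close>

definition rE :: "real \<Rightarrow> ('a \<Rightarrow> real) \<Rightarrow> bool" where
  "rE E u \<longleftrightarrow> fast u \<and> (\<exists>Du. esol E u Du)"

lemma fast_imp_decays: assumes "fast u" shows "decays u"
  unfolding decays_def
proof -
  note i = fast_square_integrable[OF assms]
  note [measurable] = fast_measurable[OF assms]
  have nb: "norm ((LBINT x. indicator {x. rr x < 2 ^ k} x * (u x)\<^sup>2) / 2 ^ k) \<le> (LBINT x. (norm (u x))\<^sup>2) / 2 ^ k" for k :: nat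
  proof -
    have "0 \<le> (LBINT x. indicator {x. rr x < 2 ^ k} x * (u x)\<^sup>2)" by (intro Bochner_Integration.integral_nonneg) auto
    moreover have "(LBINT x. indicator {x. rr x < 2 ^ k} x * (u x)\<^sup>2) \<le> (LBINT x. (norm (u x))\<^sup>2)"
      by (rule integral_mono_AE'[OF i]) (auto simp: indicator_def)
    ultimately show ?thesis by (simp add: divide_right_mono)
  qed
  have "(\<lambda>k. (LBINT x. (norm (u x))\<^sup>2) / 2 ^ k) \<longlonglongrightarrow> 0" by (rule LIMSEQ_divide_realpow_zero) simp
  from Lim_null_comparison[OF always_eventually[OF allI[OF nb]] this]
  show "(\<lambda>k. (LBINT x. indicator {x. rr x < 2 ^ k} x * (u x)\<^sup>2) / 2 ^ k) \<longlonglongrightarrow> 0" .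
qed

lemma esol_linear:
  assumes u: "esol E u Du" and v: "esol E v Dv"
  shows "esol E (\<lambda>x. u x + c * v x) (\<lambda>x. Du x + c *\<^sub>R Dv x)"
  unfolding esol_def wsol_def
proof (intro conjI ballI allI impI)
  have l: "l2loc u" "l2loc Du" "l2loc v" "l2loc Dv" "l2loc (\<lambda>x. (V x - E) * u x)" "l2loc (\<lambda>x. (V x - E) * v x)"
    using u v by (auto simp: esol_def wsol_def)
  have cDv: "l2loc (\<lambda>x. c *\<^sub>R Dv x)" by (rule l2loc_bound[OF l(4)]) (use l2loc_measurable[OF l(4)] in \<open>auto intro!: exI[of _ "\<bar>c\<bar>"]\<close>)
  show "l2loc (\<lambda>x. u x + c * v x)" by (intro l2loc_add l2loc_cmult l)
  show "l2loc (\<lambda>x. Du x + c *\<^sub>R Dv x)" by (intro l2loc_add l cDv)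
  show "l2loc (\<lambda>x. (V x - E) * (u x + c * v x))"
    using l2loc_add[OF l(5) l2loc_cmult[OF l(6), of c]] by (simp add: algebra_simps)
  fix i :: 'a assume i: "i \<in> Basis"
  have wu: "wd u i (\<lambda>x. Du x \<bullet> i)" and wv: "wd v i (\<lambda>x. Dv x \<bullet> i)" using u v i by (auto simp: esol_def wsol_def)
  have wcv: "wd (\<lambda>x. c * v x) i (\<lambda>x. c * (Dv x \<bullet> i))" using wv unfolding wd_def by (simp add: mult.left_commute)
  have "wd (\<lambda>x. u x + c * v x) i (\<lambda>x. Du x \<bullet> i + c * (Dv x \<bullet> i))"
    by (rule wd_add[OF _ _ wu _ _ wcv i]) (intro l2loc_imp_l1loc l2loc_cmult l2loc_inner l)+
  then show "wd (\<lambda>x. u x + c * v x) i (\<lambda>x. (Du x + c *\<^sub>R Dv x) \<bullet> i)" by (simp add: inner_add_left)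
next
  fix k :: "'a \<Rightarrow> real" assume k: "test_fun k"
  have l: "l2loc u" "l2loc v" "l2loc (\<lambda>x. (V x - E) * u x)" "l2loc (\<lambda>x. (V x - E) * v x)"
    using u v by (auto simp: esol_def wsol_def)
  obtain R where R: "\<And>x. norm x > R \<Longrightarrow> k x = 0" using test_fun_support[OF k] by metis
  have lc: "continuous_on UNIV (laplacian k)" unfolding laplacian_def
    by (intro continuous_on_sum test_fun_continuous test_fun_pd k)
  have lz: "laplacian k x = 0" if "norm x > R" for x
  proof -
    have "pd i k y = 0" if "norm y > R" for i y by (rule pd_zero_outside[OF R that])
    then have "pd i (pd i k) x = 0" for i by (rule pd_zero_outside[OF _ that])
    then show ?thesis by (simp add: laplacian_def)
  qed
  have int: "integrable lborel (\<lambda>x. f x * a x)" if a: "continuous_on UNIV a" "\<And>x. norm x > R \<Longrightarrow> a x = 0" and f: "l2loc f" for a f :: "'a \<Rightarrow> real"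
  proof -
    obtain C where C: "\<And>x. \<bar>a x\<bar> \<le> C" using continuous_bounded_support[OF a] by metis
    note [measurable] = borel_measurable_continuous_onI[OF a(1)] l2loc_measurable[OF f]
    show ?thesis by (rule integrable_l1[OF l2loc_imp_l1loc[OF f], of _ R C]) (auto simp: a abs_mult mult.commute intro: mult_right_mono[OF C])
  qed
  have e: "(LBINT x. u x * laplacian k x) = (LBINT x. (V x - E) * u x * k x)"
    "(LBINT x. v x * laplacian k x) = (LBINT x. (V x - E) * v x * k x)"
    using u v k by (auto simp: esol_def wsol_def)
  have "(LBINT x. (u x + c * v x) * laplacian k x) = (LBINT x. u x * laplacian k x + c * (v x * laplacian k x))"
    by (intro Bochner_Integration.integral_cong refl) (simp add: algebra_simps)
  also have "\<dots> = (LBINT x. u x * laplacian k x) + c * (LBINT x. v x * laplacian k x)"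
    using int[OF lc lz l(1)] int[OF lc lz l(2)] by simp
  also have "\<dots> = (LBINT x. (V x - E) * u x * k x + c * ((V x - E) * v x * k x))"
    unfolding e using int[OF test_fun_continuous[OF k] R l(3)] int[OF test_fun_continuous[OF k] R l(4)] by simp
  also have "\<dots> = (LBINT x. (V x - E) * (u x + c * v x) * k x)"
    by (intro Bochner_Integration.integral_cong refl) (simp add: algebra_simps)
  finally show "(LBINT x. (u x + c * v x) * laplacian k x) = (LBINT x. (V x - E) * (u x + c * v x) * k x)" .
qed

lemma rE_linear: "rE E u \<Longrightarrow> rE E v \<Longrightarrow> rE E (\<lambda>x. u x + c * v x)"
  unfolding rE_def by (elim conjE exE, intro conjI exI, intro fast_add fast_scale, assumption+, erule esol_linear, assumption)

lemma rE_scale: assumes "rE E u" shows "rE E (\<lambda>x. c * u x)"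
  using rE_linear[OF assms assms, of "c - 1"] by (simp add: algebra_simps)

text \<open>Subtracting a projection stays inside the eigenspace, as one Gram-Schmidt step
  requires.\<close>

lemma rE_diff_sum: "rE E v \<Longrightarrow> (\<And>n. n < N \<Longrightarrow> rE E (u n)) \<Longrightarrow> rE E (\<lambda>x. v x - (\<Sum>n<(N::nat). c n * u n x))"
proof (induction N)
  case (Suc N)
  have "rE E (\<lambda>x. (v x - (\<Sum>n<N. c n * u n x)) + (- c N) * u N x)" by (intro rE_linear Suc) simp_all
  then show ?case by (simp add: algebra_simps)
qed simp

text \<open>Square integrability alone gives small ball averages, and the weighted estimate upgrades
  these to rapid decay.\<close>

lemma eigenfun_rE:
  assumes "eigenfun V E \<phi>" "E > 0" shows "rE E (\<lambda>x. \<phi> x \<bullet> e)"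
proof -
  have gen: "gen_eigenfun V E \<phi>" and "L2 \<phi>" using assms by (auto simp: eigenfun_def H2_def)
  have l: "l2loc \<phi>" using gen by (auto simp: gen_eigenfun_def H2loc_def intro: L2loc_imp_l2loc)
  have "decays (\<lambda>x. \<phi> x \<bullet> e)" if "e \<in> Basis" for e
    by (rule decays_part[OF l _ L2_imp_mean[OF \<open>L2 \<phi>\<close>]]) (simp add: that)
  then have "fast \<phi>" using H2_of_gen_eigenfun(2)[OF gen assms(2)] by blast
  then show ?thesis unfolding rE_def using gen_eigenfun_parts[OF gen] fast_inner by blast
qed

text \<open>Green's formula with a cutoff: the two energy identities, each tested with the other
  solution, share the gradient term, so their difference isolates (E' - E) times the inner product.
  The cutoff gradient is O(1/\<rho>) and multiplies integrable quantities, so the boundary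
  contribution disappears.\<close>

lemma rE_orthogonal:
  assumes u: "rE E u" and v: "rE E' v" and E: "E > 0" "E' > 0" "E \<noteq> E'"
  shows "(LBINT x. u x * v x) = 0"
proof -
  obtain Du Dv where s: "esol E u Du" "esol E' v Dv" using u v by (auto simp: rE_def)
  have f: "fast u" "fast v" using u v by (auto simp: rE_def)
  have fD: "fast Du" "fast Dv" using fast_solution(2)[OF s(1) E(1) fast_imp_decays[OF f(1)]] fast_solution(2)[OF s(2) E(2) fast_imp_decays[OF f(2)]] .
  note l = esol_l2loc[OF s(1)] esol_l2loc[OF s(2)]
  note [measurable] = l[THEN l2loc_measurable]
  have wu: "i \<in> Basis \<Longrightarrow> wd u i (\<lambda>x. Du x \<bullet> i)" and wv: "i \<in> Basis \<Longrightarrow> wd v i (\<lambda>x. Dv x \<bullet> i)" for i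
    using s by (auto simp: esol_def wsol_def)
  obtain ct ct' :: "real \<Rightarrow> real" and B where ct: "\<And>t. (ct has_real_derivative ct' t) (at t)" "continuous_on UNIV ct'"
    "\<And>t. 0 \<le> ct t" "\<And>t. ct t \<le> 1" "\<And>t. t \<le> 1 \<Longrightarrow> ct t = 0" "\<And>t. t \<ge> 2 \<Longrightarrow> ct t = 1"
    "\<And>t. \<bar>ct' t\<bar> \<le> B" "\<And>t. t \<le> 1 \<Longrightarrow> ct' t = 0" "\<And>t. t \<ge> 2 \<Longrightarrow> ct' t = 0" "B \<ge> 1"
    using cutoff_exists by metis
  define \<rho> where "\<rho> = (\<lambda>n::nat. real n + 1)"
  have rho: "\<rho> n \<ge> 1" for n by (simp add: \<rho>_def)
  define \<theta> where "\<theta> = (\<lambda>n (x::'a). 1 - ct (rr x / \<rho> n))"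
  have thb: "0 \<le> \<theta> n x" "\<theta> n x \<le> 1" for n x using ct(3,4) by (simp_all add: \<theta>_def)
  \<comment> \<open>Dominates both boundary integrals for every cutoff radius; finite because
    solutions and gradients decay fast.\<close>
  define J where "J = (LBINT x. (norm (v x))\<^sup>2 + (norm (Du x))\<^sup>2) + (LBINT x. (norm (u x))\<^sup>2 + (norm (Dv x))\<^sup>2)"
  have bound: "\<bar>(E' - E) * (LBINT x. \<theta> n x * (u x * v x))\<bar> \<le> B / \<rho> n * J" for n
  proof -
    define g' where "g' = (\<lambda>t. - (ct' (t / \<rho> n) / \<rho> n))"
    have cr: "((\<lambda>t. 1 - ct (t / \<rho> n)) has_real_derivative g' t) (at t)" for t
    proof -
      have "((\<lambda>t. t / \<rho> n) has_real_derivative 1 / \<rho> n) (at t)" using rho[of n] by (auto intro!: derivative_eq_intros)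
      from DERIV_diff[OF DERIV_const DERIV_chain2[OF ct(1) this]] show ?thesis by (simp add: g'_def)
    qed
    have gc': "continuous_on {0<..} g'"
      unfolding g'_def using rho[of n] by (intro continuous_intros continuous_on_compose2[OF ct(2)]) auto
    define T where "T = (\<lambda>x::'a. (g' (rr x) / rr x) *\<^sub>R x)"
    have thd: "(\<theta> n has_derivative (\<lambda>h. T x \<bullet> h)) (at x)" for x
      using radial_has_derivative[OF cr, of x] by (simp add: T_def \<theta>_def)
    have Tc: "continuous_on UNIV T" unfolding T_def by (intro continuous_intros radial_continuous gc' rr_continuous) simp
    note [measurable] = borel_measurable_continuous_onI[OF Tc] borel_measurable_continuous_onI[OF has_derivative_continuous_on_UNIV[OF thd]]
    have zo: "\<theta> n x = 0" if "norm x > 2 * \<rho> n" for x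
      using that norm_le_rr[of x] rho[of n] ct(6)[of "rr x / \<rho> n"] by (simp add: \<theta>_def le_divide_eq)
    have Tb: "norm (T x) \<le> B / \<rho> n" for x
    proof -
      have "norm (T x) \<le> \<bar>g' (rr x)\<bar>" using norm_le_rr[of x] rr_pos[of x] by (simp add: T_def divide_le_eq mult_left_mono)
      also have "\<dots> \<le> B / \<rho> n" using ct(7) rho[of n] by (simp add: g'_def divide_right_mono)
      finally show ?thesis .
    qed
    have small: "\<bar>\<integral>x. w x * (T x \<bullet> D x) \<partial>lborel\<bar> \<le> B / \<rho> n * (LBINT x. (norm (w x))\<^sup>2 + (norm (D x))\<^sup>2)"
      if w: "fast w" and D: "fast D" for w :: "'a \<Rightarrow> real" and D :: "'a \<Rightarrow> 'a"
    proof -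
      note [measurable] = fast_measurable[OF w] fast_measurable[OF D]
      have i: "integrable lborel (\<lambda>x. B / \<rho> n * ((norm (w x))\<^sup>2 + (norm (D x))\<^sup>2))"
        by (intro integrable_mult_right Bochner_Integration.integrable_add fast_square_integrable w D)
      have b: "\<bar>w x * (T x \<bullet> D x)\<bar> \<le> B / \<rho> n * ((norm (w x))\<^sup>2 + (norm (D x))\<^sup>2)" for x
      proof -
        have "\<bar>T x \<bullet> D x\<bar> \<le> norm (T x) * norm (D x)" by (rule Cauchy_Schwarz_ineq2)
        also have "\<dots> \<le> B / \<rho> n * norm (D x)" by (intro mult_right_mono Tb) simp
        finally have "\<bar>w x\<bar> * \<bar>T x \<bullet> D x\<bar> \<le> \<bar>w x\<bar> * (B / \<rho> n * norm (D x))" by (intro mult_left_mono) auto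
        also have "\<dots> = B / \<rho> n * (\<bar>w x\<bar> * norm (D x))" by simp
        also have "\<dots> \<le> B / \<rho> n * ((norm (w x))\<^sup>2 + (norm (D x))\<^sup>2)"
        proof (intro mult_left_mono)
          have 1: "\<bar>\<bar>w x\<bar> * norm (D x)\<bar> \<le> (\<bar>w x\<bar>\<^sup>2 + (norm (D x))\<^sup>2) / 2" by (rule abs_mult_le_sum_sq)
          have "s \<le> t" if "\<bar>s\<bar> \<le> t / 2" for s t :: real using that by linarith
          from this[OF 1] show "\<bar>w x\<bar> * norm (D x) \<le> (norm (w x))\<^sup>2 + (norm (D x))\<^sup>2" by simp
        qed (use ct(10) rho[of n] in simp)
        finally show ?thesis by (simp add: abs_mult)
      qed
      have i': "integrable lborel (\<lambda>x. w x * (T x \<bullet> D x))"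
      proof (rule Bochner_Integration.integrable_bound[OF i])
        show "(\<lambda>x. w x * (T x \<bullet> D x)) \<in> borel_measurable lborel" by measurable
        show "AE x in lborel. norm (w x * (T x \<bullet> D x)) \<le> norm (B / \<rho> n * ((norm (w x))\<^sup>2 + (norm (D x))\<^sup>2))"
          using order_trans[OF b abs_ge_self] by (intro AE_I2) (simp only: real_norm_def)
      qed
      have "\<bar>\<integral>x. w x * (T x \<bullet> D x) \<partial>lborel\<bar> \<le> (LBINT x. B / \<rho> n * ((norm (w x))\<^sup>2 + (norm (D x))\<^sup>2))"
        by (rule order_trans[OF integral_abs_bound integral_mono[OF integrable_abs[OF i'] i b]])
      then show ?thesis by simp
    qed
    have i: "integrable lborel (\<lambda>x. \<theta> n x * w x * ((V x - c) * z x))" if w: "fast w" and z: "fast z" for w z :: "'a \<Rightarrow> real" and c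
    proof (rule Bochner_Integration.integrable_bound)
      show "integrable lborel (\<lambda>x. (2 * Q + \<bar>c\<bar>) * (w x * z x))" by (intro integrable_mult_right fast_prod_integrable w z)
      note [measurable] = fast_measurable[OF w] fast_measurable[OF z]
      show "(\<lambda>x. \<theta> n x * w x * ((V x - c) * z x)) \<in> borel_measurable lborel" by measurable
      show "AE x in lborel. norm (\<theta> n x * w x * ((V x - c) * z x)) \<le> norm ((2 * Q + \<bar>c\<bar>) * (w x * z x))"
      proof (intro AE_I2)
        fix x
        have "\<bar>V x - c\<bar> \<le> 2 * Q + \<bar>c\<bar>" using Vlr_Q[of x] Vsr_Q[of x] V_eq[of x] by linarith
        then have "\<bar>\<theta> n x\<bar> * \<bar>V x - c\<bar> \<le> 1 * (2 * Q + \<bar>c\<bar>)" using thb[of n x] by (intro mult_mono) auto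
        then have "(\<bar>\<theta> n x\<bar> * \<bar>V x - c\<bar>) * \<bar>w x * z x\<bar> \<le> (2 * Q + \<bar>c\<bar>) * \<bar>w x * z x\<bar>" by (intro mult_right_mono) auto
        then show "norm (\<theta> n x * w x * ((V x - c) * z x)) \<le> norm ((2 * Q + \<bar>c\<bar>) * (w x * z x))"
          using Q_nonneg by (simp add: abs_mult mult_ac)
      qed
    qed
    have e1: "(LBINT x. \<theta> n x * (Du x \<bullet> Dv x)) + (LBINT x. v x * (T x \<bullet> Du x)) + (LBINT x. \<theta> n x * v x * ((V x - E) * u x)) = 0"
      by (rule energy_identity[OF s(1)[unfolded esol_def] l(3,4) wv thd Tc zo])
    have e2: "(LBINT x. \<theta> n x * (Dv x \<bullet> Du x)) + (LBINT x. u x * (T x \<bullet> Dv x)) + (LBINT x. \<theta> n x * u x * ((V x - E') * v x)) = 0"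
      by (rule energy_identity[OF s(2)[unfolded esol_def] l(1,2) wu thd Tc zo])
    have "(LBINT x. \<theta> n x * v x * ((V x - E) * u x)) - (LBINT x. \<theta> n x * u x * ((V x - E') * v x)) = (LBINT x. (E' - E) * (\<theta> n x * (u x * v x)))"
      by (subst Bochner_Integration.integral_diff[symmetric, OF i[OF f(2,1)] i[OF f]]) (simp add: algebra_simps)
    then have "(E' - E) * (LBINT x. \<theta> n x * (u x * v x)) = (LBINT x. u x * (T x \<bullet> Dv x)) - (LBINT x. v x * (T x \<bullet> Du x))"
      using e1 e2 by (simp add: inner_commute[of "Dv _"])
    then show ?thesis using small[OF f(1) fD(2)] small[OF f(2) fD(1)] unfolding J_def distrib_left by linarith
  qed
  have lim1: "(\<lambda>n. (E' - E) * (LBINT x. \<theta> n x * (u x * v x))) \<longlonglongrightarrow> (E' - E) * (LBINT x. u x * v x)"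
  proof (intro tendsto_mult tendsto_const integral_dominated_convergence[where w = "\<lambda>x. \<bar>u x * v x\<bar>"])
    show "integrable lborel (\<lambda>x. \<bar>u x * v x\<bar>)" using fast_prod_integrable[OF f] by simp
    have "continuous_on UNIV ct" using ct(1) by (auto intro!: DERIV_isCont continuous_at_imp_continuous_on)
    note [measurable] = borel_measurable_continuous_onI[OF this]
    show "(\<lambda>x. \<theta> n x * (u x * v x)) \<in> borel_measurable lborel" for n unfolding \<theta>_def by measurable
    show "AE x in lborel. norm (\<theta> n x * (u x * v x)) \<le> \<bar>u x * v x\<bar>" for n
      using thb by (intro AE_I2) (simp add: abs_mult mult_left_le_one_le)
    show "AE x in lborel. (\<lambda>n. \<theta> n x * (u x * v x)) \<longlonglongrightarrow> u x * v x"
    proof (intro AE_I2 tendsto_eventually)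
      fix x :: 'a
      obtain N where N: "rr x < real N" using reals_Archimedean2 by blast
      have "\<theta> n x = 1" if "n \<ge> N" for n
      proof -
        have "rr x / \<rho> n \<le> 1" using N that rho[of n] by (simp add: divide_le_eq \<rho>_def)
        then show ?thesis using ct(5) by (simp add: \<theta>_def)
      qed
      then show "\<forall>\<^sub>F n in sequentially. \<theta> n x * (u x * v x) = u x * v x" by (intro eventually_sequentiallyI[of N]) simp
    qed
  qed measurable
  have lim2: "(\<lambda>n. B / \<rho> n * J) \<longlonglongrightarrow> 0"
  proof -
    have "(\<lambda>n. B * J * inverse (real (Suc n))) \<longlonglongrightarrow> B * J * 0" by (intro tendsto_intros LIMSEQ_inverse_real_of_nat)
    then show ?thesis by (simp add: \<rho>_def divide_inverse mult_ac add.commute)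
  qed
  have "(\<lambda>n. (E' - E) * (LBINT x. \<theta> n x * (u x * v x))) \<longlonglongrightarrow> 0"
    by (rule Lim_null_comparison[OF always_eventually lim2]) (use bound in auto)
  from LIMSEQ_unique[OF lim1 this] show ?thesis using E(3) by simp
qed

text \<open>A Hilbert-Schmidt count in place of a compactness argument: for a normalised eigenfunction \<open>u\<close> the
  mollification \<open>k * u\<close> keeps a quarter of the mass on a fixed ball, whereas Bessel's inequality for the
  functions \<open>k (x - \<sqdot>)\<close> bounds the sum of these masses over an orthonormal family.\<close>

lemma orthonormal_bound:
  assumes a: "0 < a" "a \<le> b"
  shows "\<exists>N0. \<forall>N (E :: nat \<Rightarrow> real) u. (\<forall>n<N. a \<le> E n \<and> E n \<le> b \<and> rE (E n) (u n)) \<longrightarrow>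
    (\<forall>m<N. \<forall>n<N. (LBINT x. u m x * u n x) = (if m = n then 1 else 0)) \<longrightarrow> N \<le> (N0 :: nat)"
proof -
  obtain C R where C: "C \<ge> 0" "\<And>E u Du L. a \<le> E \<Longrightarrow> E \<le> b \<Longrightarrow> esol E u Du \<Longrightarrow> decays u \<Longrightarrow>
     (LBINT x. indicator {x. rr x < L} x * (rr x ^ 2 * Zf u Du x)) \<le> C * (LBINT x. indicator {x. rr x < R} x * (u x)\<^sup>2)"
    using weighted_estimate[OF a, of 2] by blast
  \<comment> \<open>By the weighted bound with m = 2, the mass of a normalised eigenfunction outside
    R0 is at most C/R0^2, hence at most a quarter.\<close>
  obtain R0 where R0: "R0 > 0" "C / R0\<^sup>2 \<le> 1 / 4"
  proof (rule that[of "2 * (C + 1)"])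
    have "C * 4 \<le> (2 * (C + 1))\<^sup>2" using C(1) by (simp add: power2_eq_square algebra_simps)
    then show "C / (2 * (C + 1))\<^sup>2 \<le> 1 / 4" using C(1) by (simp add: divide_le_eq)
  qed (use C in simp)
  \<comment> \<open>Together with the mollification rate and the gradient bound C, this makes the
    squared mollification error at most 1/8. Then 1 \<le> 1/4 + 2/8 + 2X, where X is the mollified
    mass inside R0, forces X \<ge> 1/4.\<close>
  obtain n0 :: nat where n0: "8 * C * (1 / (real n0 + 1))\<^sup>2 \<le> 1 / 4"
  proof -
    obtain n :: nat where n: "32 * C < real n" using reals_Archimedean2 by blast
    have "32 * C \<le> (real n + 1) * 1" using n by simp
    also have "\<dots> \<le> (real n + 1) * (real n + 1)" by (intro mult_left_mono) auto
    finally have "8 * C * (1 / (real n + 1))\<^sup>2 \<le> 1 / 4" by (simp add: power_divide power2_eq_square divide_le_eq)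
    then show ?thesis by (rule that)
  qed
  let ?k = "moll n0 :: 'a \<Rightarrow> real"
  \<comment> \<open>The volume of the ball times the squared norm of the kernel: the squared
    Hilbert-Schmidt norm of mollification followed by restriction to the ball.\<close>
  define Bm where "Bm = (LBINT x. indicator {x::'a. rr x < R0} x) * (LBINT y. (?k y)\<^sup>2)"
  have kc: "continuous_on UNIV ?k" by (rule test_fun_continuous[OF test_fun_moll])
  obtain Kb where Kb: "\<And>x. \<bar>?k x\<bar> \<le> Kb" using test_fun_bounded[OF test_fun_moll[of n0, where 'a='a]] by metis
  note [measurable] = borel_measurable_continuous_onI[OF kc]
  have "real N \<le> 4 * Bm"
    if ev: "\<forall>n<N. a \<le> E n \<and> E n \<le> b \<and> rE (E n) (u n)" and on: "\<forall>m<N. \<forall>n<N. (LBINT x. u m x * u n x) = (if m = n then 1 else 0)"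
    for N and E :: "nat \<Rightarrow> real" and u
  proof -
    have fu: "fast (u n)" if "n < N" for n using ev that by (auto simp: rE_def)
    have lu: "l1loc (u n)" if "n < N" for n by (rule fast_imp_l1loc[OF fu[OF that]])
    have ci: "integrable lborel (\<lambda>x. indicator {x. rr x < R0} x * (conv ?k (u n) x)\<^sup>2)" if "n < N" for n
      by (rule sq_set_integrable[OF conv_l2loc[OF test_fun_moll lu[OF that]]])
    have one: "1 / 4 \<le> (LBINT x. indicator {x. rr x < R0} x * (conv ?k (u n) x)\<^sup>2)" if n: "n < N" for n
    proof -
      obtain D where D: "esol (E n) (u n) D" using ev n by (auto simp: rE_def)
      have En: "a \<le> E n" "E n \<le> b" using ev n by auto
      have dec: "decays (u n)" by (rule fast_imp_decays[OF fu[OF n]])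
      have fD: "fast D" by (rule fast_solution(2)[OF D _ dec]) (use En a in linarith)
      note l = esol_l2loc[OF D]
      have usq: "integrable lborel (\<lambda>x. (u n x)\<^sup>2)" using fast_square_integrable[OF fu[OF n]] by simp
      have u1: "(LBINT x. (u n x)\<^sup>2) = 1" using on n by (simp add: power2_eq_square)
      note [measurable] = l[THEN l2loc_measurable] Zf_measurable[OF D] conv_measurable[OF test_fun_moll lu[OF n]]
      have CR: "C * (LBINT x. indicator {x. rr x < R} x * (u n x)\<^sup>2) \<le> C"
      proof -
        have "(LBINT x. indicator {x. rr x < R} x * (u n x)\<^sup>2) \<le> (LBINT x. (u n x)\<^sup>2)"
          by (rule integral_mono_AE'[OF usq]) (auto simp: indicator_def)
        then have "(LBINT x. indicator {x. rr x < R} x * (u n x)\<^sup>2) \<le> 1" using u1 by simp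
        from mult_left_mono[OF this C(1)] show ?thesis by simp
      qed
      have ball: "integrable lborel (\<lambda>x. indicator {x. rr x < real k} x * (rr x ^ 2 * Zf (u n) D x))" for k
      proof (rule Zf_set_integrable[OF D, of _ "real k" "(real k) ^ 2"])
        show "\<bar>rr x ^ 2\<bar> \<le> (real k) ^ 2" if "rr x < real k" for x :: 'a using that rr_pos[of x] by (simp add: power_mono)
      qed auto
      have Z: "integrable lborel (\<lambda>x. rr x ^ 2 * Zf (u n) D x)" "(LBINT x. rr x ^ 2 * Zf (u n) D x) \<le> C"
        by (rule exhaust_integrable[OF _ _ ball order_trans[OF C(2)[OF En D dec] CR]], measurable, simp add: Zf_nonneg)+
      have rr2: "1 \<le> rr x ^ 2" for x :: 'a using rr_ge_1[of x] by (rule one_le_power)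
      have Dsq: "integrable lborel (\<lambda>x. (norm (D x))\<^sup>2)" by (rule fast_square_integrable[OF fD])
      have DC: "(LBINT x. (norm (D x))\<^sup>2) \<le> C"
      proof (rule order_trans[OF integral_mono[OF Dsq Z(1)] Z(2)])
        fix x
        have "1 * (norm (D x))\<^sup>2 \<le> rr x ^ 2 * Zf (u n) D x"
          using rr2[of x] by (intro mult_mono) (auto simp: Zf_def cD_def dot_square_norm)
        then show "(norm (D x))\<^sup>2 \<le> rr x ^ 2 * Zf (u n) D x" by simp
      qed
      have far: "(LBINT x. indicator {x. \<not> rr x < R0} x * (u n x)\<^sup>2) \<le> 1 / 4"
      proof -
        have "(LBINT x. indicator {x. \<not> rr x < R0} x * (u n x)\<^sup>2) \<le> (LBINT x. (1 / R0\<^sup>2) * (rr x ^ 2 * Zf (u n) D x))"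
        proof (rule integral_mono_AE')
          show "integrable lborel (\<lambda>x. (1 / R0\<^sup>2) * (rr x ^ 2 * Zf (u n) D x))" using Z(1) by simp
          show "AE x in lborel. indicator {x. \<not> rr x < R0} x * (u n x)\<^sup>2 \<le> (1 / R0\<^sup>2) * (rr x ^ 2 * Zf (u n) D x)"
          proof (intro AE_I2)
            fix x :: 'a
            show "indicator {x. \<not> rr x < R0} x * (u n x)\<^sup>2 \<le> (1 / R0\<^sup>2) * (rr x ^ 2 * Zf (u n) D x)"
            proof (cases "rr x < R0")
              case False
              then have "R0\<^sup>2 \<le> rr x ^ 2" using R0 by (intro power_mono) auto
              then have "R0\<^sup>2 * (u n x)\<^sup>2 \<le> rr x ^ 2 * Zf (u n) D x" using cD_nonneg[of D x] by (intro mult_mono) (auto simp: Zf_def)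
              then show ?thesis using False R0 by (simp add: le_divide_eq mult.commute)
            qed (simp add: Zf_nonneg)
          qed
          show "AE x in lborel. 0 \<le> (1 / R0\<^sup>2) * (rr x ^ 2 * Zf (u n) D x)" by (simp add: Zf_nonneg)
        qed
        also have "\<dots> = (LBINT x. rr x ^ 2 * Zf (u n) D x) / R0\<^sup>2" by simp
        also have "\<dots> \<le> C / R0\<^sup>2" using Z(2) by (intro divide_right_mono) auto
        finally show ?thesis using R0(2) by linarith
      qed
      have near: "integrable lborel (\<lambda>x. (conv ?k (u n) x - u n x)\<^sup>2)" "(LBINT x. (conv ?k (u n) x - u n x)\<^sup>2) \<le> 1 / 8"
      proof -
        have fin: "N2 (u n) = 1" unfolding N2_def using nn_integral_eq_integral[OF usq] u1 by simp
        have ND: "N2 D \<le> ennreal C" unfolding N2_def using nn_integral_eq_integral[OF Dsq] DC by (simp add: ennreal_leI)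
        have "N2 (\<lambda>x. conv ?k (u n) x - u n x) \<le> 4 * (ennreal ((1 / (real n0 + 1))\<^sup>2) * N2 D)"
          by (rule N2_moll_rate[OF l]) (use D fin in \<open>auto simp: esol_def wsol_def\<close>)
        also have "\<dots> \<le> 4 * (ennreal ((1 / (real n0 + 1))\<^sup>2) * ennreal C)" by (intro mult_left_mono ND) auto
        also have "\<dots> = ennreal (4 * ((1 / (real n0 + 1))\<^sup>2 * C))" using C(1) by (simp add: ennreal_mult)
        also have "\<dots> \<le> ennreal (1 / 8)" using n0 by (intro ennreal_leI) (simp add: mult_ac)
        finally have le: "(\<integral>\<^sup>+x. ennreal ((conv ?k (u n) x - u n x)\<^sup>2) \<partial>lborel) \<le> ennreal (1 / 8)" by (simp add: N2_def)
        show 1: "integrable lborel (\<lambda>x. (conv ?k (u n) x - u n x)\<^sup>2)"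
          by (rule integrableI_bounded) (use le in \<open>auto intro: le_less_trans\<close>)
        show "(LBINT x. (conv ?k (u n) x - u n x)\<^sup>2) \<le> 1 / 8"
          using le nn_integral_eq_integral[OF 1] by simp
      qed
      have fi: "integrable lborel (\<lambda>x. indicator {x. \<not> rr x < R0} x * (u n x)\<^sup>2)"
        using integrable_mult_indicator[OF _ usq, of "{x. \<not> rr x < R0}"] by simp
      have "1 = (LBINT x. (u n x)\<^sup>2)" by (simp add: u1)
      also have "\<dots> \<le> (LBINT x. indicator {x. \<not> rr x < R0} x * (u n x)\<^sup>2 + (2 * (conv ?k (u n) x - u n x)\<^sup>2 + 2 * (indicator {x. rr x < R0} x * (conv ?k (u n) x)\<^sup>2)))"
      proof (rule integral_mono[OF usq])
        fix x
        have "(u n x)\<^sup>2 \<le> 2 * (conv ?k (u n) x - u n x)\<^sup>2 + 2 * (conv ?k (u n) x)\<^sup>2"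
          using norm_add_sq_le[of "u n x - conv ?k (u n) x" "conv ?k (u n) x"] by (simp add: power2_commute)
        then show "(u n x)\<^sup>2 \<le> indicator {x. \<not> rr x < R0} x * (u n x)\<^sup>2 + (2 * (conv ?k (u n) x - u n x)\<^sup>2 + 2 * (indicator {x. rr x < R0} x * (conv ?k (u n) x)\<^sup>2))"
          by (cases "rr x < R0") auto
      qed (intro Bochner_Integration.integrable_add integrable_mult_right fi near ci n)
      also have "\<dots> = (LBINT x. indicator {x. \<not> rr x < R0} x * (u n x)\<^sup>2) + (2 * (LBINT x. (conv ?k (u n) x - u n x)\<^sup>2) + 2 * (LBINT x. indicator {x. rr x < R0} x * (conv ?k (u n) x)\<^sup>2))"
        using fi near(1) ci[OF n] by simp
      finally show ?thesis using far near(2) by linarith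
    qed
    \<comment> \<open>At a fixed x the mollified values are the Fourier coefficients of the
      reflected kernel y -> k(x - y) against the orthonormal family; the norm of that kernel does
      not depend on x.\<close>
    have bes: "(\<Sum>n<N. (conv ?k (u n) x)\<^sup>2) \<le> (LBINT y. (?k y)\<^sup>2)" for x
    proof -
      have "(\<lambda>y. (?k y)\<^sup>2) \<in> borel_measurable borel" by measurable
      from integral_reflect[OF this, of x] have r: "(LBINT y. (?k (x - y))\<^sup>2) = (LBINT y. (?k y)\<^sup>2)" .
      have "integrable lborel (\<lambda>y. (?k (x - y))\<^sup>2)"
        by (rule continuous_integrable[of _ "norm x + 1"])
           (use norm_triangle_ineq2[of _ x] in \<open>auto intro!: continuous_intros continuous_on_compose2[OF kc] moll_support simp: norm_minus_commute algebra_simps, smt (verit) norm_minus_commute norm_triangle_ineq2\<close>)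
      then have "(\<Sum>n<N. (LBINT y. ?k (x - y) * u n y)\<^sup>2) \<le> (LBINT y. (?k (x - y))\<^sup>2)"
        by (rule bessel_inequality) (use conv_integrable[OF test_fun_moll lu] fast_prod_integrable[OF fu fu] on in auto)
      then show ?thesis unfolding r by (simp add: conv_def)
    qed
    have ii: "integrable lborel (\<lambda>x::'a. indicator {x. rr x < R0} x :: real)"
      using ball_sq_integrable[of "\<lambda>_::'a. 1::real" "{x. rr x < R0}" R0] by (simp add: l2loc_const)
    have "(\<Sum>n<N. 1 / 4) \<le> (\<Sum>n<N. (LBINT x. indicator {x. rr x < R0} x * (conv ?k (u n) x)\<^sup>2))" by (intro sum_mono one) simp
    also have "\<dots> = (LBINT x. (\<Sum>n<N. indicator {x. rr x < R0} x * (conv ?k (u n) x)\<^sup>2))"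
      by (rule Bochner_Integration.integral_sum[symmetric]) (simp add: ci)
    also have "\<dots> \<le> (LBINT x. indicator {x::'a. rr x < R0} x * (LBINT y. (?k y)\<^sup>2))"
    proof (rule integral_mono)
      show "integrable lborel (\<lambda>x. \<Sum>n<N. indicator {x. rr x < R0} x * (conv ?k (u n) x)\<^sup>2)" by (intro Bochner_Integration.integrable_sum ci) simp
      show "integrable lborel (\<lambda>x. indicator {x::'a. rr x < R0} x * (LBINT y. (?k y)\<^sup>2))" by (intro integrable_mult_left ii)
      show "(\<Sum>n<N. indicator {x. rr x < R0} x * (conv ?k (u n) x)\<^sup>2) \<le> indicator {x. rr x < R0} x * (LBINT y. (?k y)\<^sup>2)" for x
        unfolding sum_distrib_left[symmetric] by (intro mult_left_mono bes) simp
    qed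
    also have "\<dots> = Bm" by (simp add: Bm_def)
    finally show ?thesis by simp
  qed
  then have "N \<le> nat \<lceil>4 * Bm\<rceil>"
    if "\<forall>n<N. a \<le> E n \<and> E n \<le> b \<and> rE (E n) (u n)" "\<forall>m<N. \<forall>n<N. (LBINT x. u m x * u n x) = (if m = n then 1 else 0)"
    for N and E :: "nat \<Rightarrow> real" and u
    using of_nat_le_iff[THEN iffD1, OF order_trans[OF _ real_nat_ceiling_ge]] that by blast
  then show ?thesis by blast
qed

end

section \<open>Condition 1 in working form and the conclusions\<close>

lemma L1loc_real_imp_l1loc:
  assumes "L1loc_real f" shows "l1loc f"
  unfolding l1loc_def set_integrable_def
proof (intro conjI allI)
  show [measurable]: "f \<in> borel_measurable borel" using assms by (simp add: L1loc_real_def)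
  fix R
  have "(\<integral>\<^sup>+x\<in>cball 0 R. ennreal \<bar>f x\<bar> \<partial>lborel) < \<infinity>" using assms compact_cball unfolding L1loc_real_def by blast
  also have "(\<integral>\<^sup>+x\<in>cball 0 R. ennreal \<bar>f x\<bar> \<partial>lborel) = (\<integral>\<^sup>+x. ennreal (norm (indicator (cball 0 R) x *\<^sub>R f x)) \<partial>lborel)"
    by (intro nn_integral_cong) (simp add: indicator_def)
  finally show "integrable lborel (\<lambda>x. indicator (cball 0 R) x *\<^sub>R f x)" by (intro integrableI_bounded) auto
qed

lemma wd_of_real: "wd (\<lambda>x. complex_of_real (f x)) i (\<lambda>x. complex_of_real (g x)) \<Longrightarrow> wd f i g"
  unfolding wd_def scaleR_conv_of_real of_real_mult[symmetric] integral_complex_of_real of_real_minus[symmetric] of_real_eq_iff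
  by simp

text \<open>The condition restricts the bounding function only for arguments at least 1. Since r
  \<ge> 1 everywhere, replacing it by 0 below 1 affects none of the pointwise bounds and gives
  global nonnegativity and integrability.\<close>

lemma condition1_imp_potential:
  fixes V :: "'a::euclidean_space \<Rightarrow> real"
  assumes "condition1 V" shows "\<exists>Vsr Vlr G w0 Q. potential V Vsr Vlr G w0 Q"
proof -
  obtain w0 Vsr Vlr G where c: "\<forall>t\<ge>1. 0 \<le> w0 t" "((\<lambda>t. t * w0 t) \<longlongrightarrow> 0) at_top" "\<forall>b. bounded (w0 ` {1..b})"
    "set_integrable lborel {1..} w0" "Vsr \<in> borel_measurable lborel" "bounded (range Vsr)"
    "Vlr \<in> borel_measurable lborel" "bounded (range Vlr)" "\<forall>x. V x = Vsr x + Vlr x"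
    "\<forall>i\<in>Basis. L1loc_real (G i) \<and> weak_deriv (\<lambda>x. complex_of_real (Vlr x)) i (\<lambda>x. complex_of_real (G i x))"
    "(Vlr \<longlongrightarrow> 0) at_infinity" "AE x::'a in lborel. (\<Sum>i\<in>Basis. (x \<bullet> i / rr x) * G i x) \<le> w0 (rr x)" "\<forall>x. \<bar>Vsr x\<bar> \<le> w0 (rr x)"
    using assms unfolding condition1_def by auto
  define w where "w = (\<lambda>t. indicator {1..} t *\<^sub>R w0 t)"
  have w1: "w t = w0 t" if "t \<ge> 1" for t using that by (simp add: w_def)
  define g where "g = (\<lambda>x. \<Sum>i\<in>Basis. G i x *\<^sub>R i)"
  have g: "g x \<bullet> i = G i x" if "i \<in> Basis" for i x using that by (simp add: g_def)
  obtain B1 B2 where B: "\<forall>x. \<bar>Vsr x\<bar> \<le> B1" "\<forall>x. \<bar>Vlr x\<bar> \<le> B2" using c(6,8) by (auto simp: bounded_iff)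
  have iw: "integrable lborel w" using c(4) by (simp add: w_def set_integrable_def)
  have Gl: "l1loc (G i)" if "i \<in> Basis" for i using c(10) that by (auto intro: L1loc_real_imp_l1loc)
  have "potential V Vsr Vlr g w (max B1 B2)"
  proof
    show "w \<in> borel_measurable borel" using borel_measurable_integrable[OF iw] by simp
    show "0 \<le> w t" for t using c(1) by (simp add: w_def indicator_def)
    show "((\<lambda>t. t * w t) \<longlongrightarrow> 0) at_top"
      by (rule Lim_transform_eventually[OF c(2)]) (auto intro: eventually_at_top_linorderI[of 1] simp: w1)
    show "\<exists>B. \<forall>t\<le>b. w t \<le> B" for b
    proof -
      obtain B where "\<forall>x\<in>{1..b}. \<bar>w0 x\<bar> \<le> B" using c(3) by (auto simp: bounded_iff)
      then have "w t \<le> max 0 B" if "t \<le> b" for t using that by (force simp: w_def indicator_def abs_le_iff)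
      then show ?thesis by blast
    qed
    show "integrable lborel w" by (rule iw)
    show "Vsr \<in> borel_measurable borel" "Vlr \<in> borel_measurable borel" using c by auto
    show "\<bar>Vsr x\<bar> \<le> max B1 B2" "\<bar>Vlr x\<bar> \<le> max B1 B2" "V x = Vsr x + Vlr x" "\<bar>Vsr x\<bar> \<le> w (rr x)" for x
      using B c(9,13) by (auto simp: w1 rr_ge_1 le_max_iff_disj)
    show "l1loc g" unfolding l1loc_def set_integrable_def
    proof (intro conjI allI)
      show "g \<in> borel_measurable borel" unfolding g_def
        by (intro borel_measurable_sum borel_measurable_scaleR borel_measurable_const l1loc_measurable Gl)
      have "integrable lborel (\<lambda>x. \<Sum>i\<in>Basis. (indicator (cball 0 R) x *\<^sub>R G i x) *\<^sub>R i)" for R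
        using Gl unfolding l1loc_def set_integrable_def by (intro Bochner_Integration.integrable_sum integrable_scaleR_left) auto
      then show "integrable lborel (\<lambda>x. indicator (cball 0 R) x *\<^sub>R g x)" for R
        by (simp add: g_def scaleR_right.sum)
    qed
    show "wd Vlr i (\<lambda>x. g x \<bullet> i)" if "i \<in> Basis" for i
      using c(10) that unfolding g[OF that] by (auto simp: weak_deriv_iff intro: wd_of_real)
    show "(Vlr \<longlongrightarrow> 0) at_infinity" by (rule c(11))
    have "(x \<bullet> g x) / rr x = (\<Sum>i\<in>Basis. (x \<bullet> i / rr x) * G i x)" for x
      by (simp add: g_def inner_sum_right sum_divide_distrib mult.commute)
    then show "AE x in lborel. (x \<bullet> g x) / rr x \<le> w (rr x)" using c(12) by (simp add: w1 rr_ge_1)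
  qed
  then show ?thesis by blast
qed

context potential
begin

lemma Bstar0_imp_decays:
  assumes "gen_eigenfun V E \<phi>" "Bstar0 \<phi>" "e \<in> Basis" shows "decays (\<lambda>x. \<phi> x \<bullet> e)"
  using decays_part[OF L2loc_imp_l2loc complex_Basis_norm Bstar0_imp_mean] assms by (simp add: Bstar0_def)

text \<open>Only the extreme energies of the compact set enter: its minimum is attained and
  therefore positive, and the estimate is uniform on the interval between the extremes.\<close>

lemma weighted_l2sq_bound:
  assumes I: "compact I" "I \<subseteq> {0<..}"
  shows "\<exists>C>0. \<forall>E \<phi>. E \<in> I \<and> gen_eigenfun V E \<phi> \<and> Bstar0 \<phi> \<longrightarrow>
    l2sq (\<lambda>x. complex_of_real (rr x powr \<alpha>) * \<phi> x) \<le> ennreal (C\<^sup>2) * l2sq (\<lambda>x. complex_of_real (rr x powr (-3/4)) * \<phi> x)"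
proof (cases "I = {}")
  case False
  obtain a where a: "a \<in> I" "\<And>x. x \<in> I \<Longrightarrow> a \<le> x" using compact_attains_inf[OF I(1) False] by auto
  obtain b where b: "b \<in> I" "\<And>x. x \<in> I \<Longrightarrow> x \<le> b" using compact_attains_sup[OF I(1) False] by auto
  \<comment> \<open>An integer exponent with (r^\<alpha>)^2 \<le> r^m; for negative \<alpha> the
    conversion to a natural number gives 0, still sufficient because r \<ge> 1.\<close>
  define m where "m = nat \<lceil>2 * \<alpha>\<rceil>"
  obtain C where C: "C \<ge> 0" "\<And>E \<phi>. a \<le> E \<Longrightarrow> E \<le> b \<Longrightarrow> gen_eigenfun V E \<phi> \<Longrightarrow> (\<forall>e\<in>Basis. decays (\<lambda>x. \<phi> x \<bullet> e)) \<Longrightarrow>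
    (\<integral>\<^sup>+x. ennreal (rr x ^ m * (norm (\<phi> x))\<^sup>2) \<partial>lborel) \<le> ennreal C * (\<integral>\<^sup>+x. ennreal ((rr x powr (- 3 / 4))\<^sup>2 * (norm (\<phi> x))\<^sup>2) \<partial>lborel)"
    using weighted_bound_complex[of a b m] a b I(2) by (auto simp: subset_iff)
  \<comment> \<open>The square of sqrt C + 1 dominates C, and the added 1 keeps the constant
    positive when C = 0.\<close>
  have "l2sq (\<lambda>x. complex_of_real (rr x powr \<alpha>) * \<phi> x) \<le> ennreal ((sqrt C + 1)\<^sup>2) * l2sq (\<lambda>x. complex_of_real (rr x powr (-3/4)) * \<phi> x)"
    if E: "E \<in> I" and gen: "gen_eigenfun V E \<phi>" and B: "Bstar0 \<phi>" for E \<phi>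
  proof -
    have "(rr x powr \<alpha>)\<^sup>2 \<le> rr x ^ m" for x :: 'a
      using rr_powr_le[of "2 * \<alpha>" m x] real_nat_ceiling_ge[of "2 * \<alpha>"] by (simp add: power2_eq_square m_def flip: powr_add)
    then have "l2sq (\<lambda>x. complex_of_real (rr x powr \<alpha>) * \<phi> x) \<le> (\<integral>\<^sup>+x. ennreal (rr x ^ m * (norm (\<phi> x))\<^sup>2) \<partial>lborel)"
      unfolding l2sq_def by (intro nn_integral_mono ennreal_leI) (auto simp: norm_mult power_mult_distrib intro: mult_right_mono)
    also have "\<dots> \<le> ennreal C * (\<integral>\<^sup>+x. ennreal ((rr x powr (- 3 / 4))\<^sup>2 * (norm (\<phi> x))\<^sup>2) \<partial>lborel)"
      using C(2)[OF a(2)[OF E] b(2)[OF E] gen] Bstar0_imp_decays[OF gen B] by blast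
    also have "\<dots> \<le> ennreal ((sqrt C + 1)\<^sup>2) * (\<integral>\<^sup>+x. ennreal ((rr x powr (- 3 / 4))\<^sup>2 * (norm (\<phi> x))\<^sup>2) \<partial>lborel)"
      using C(1) by (intro mult_right_mono ennreal_leI) (auto simp: power2_sum)
    also have "(\<integral>\<^sup>+x. ennreal ((rr x powr (- 3 / 4))\<^sup>2 * (norm (\<phi> x))\<^sup>2) \<partial>lborel) = l2sq (\<lambda>x. complex_of_real (rr x powr (-3/4)) * \<phi> x)"
      by (simp add: l2sq_def norm_mult power_mult_distrib)
    finally show ?thesis .
  qed
  then show ?thesis using C(1) by (intro exI[of _ "sqrt C + 1"]) (auto intro: add_nonneg_pos)
qed (auto intro: exI[of _ 1])

lemma rE_normalise:
  assumes u: "rE E u" and nz: "\<not> (AE x in lborel. u x = 0)"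
  shows "\<exists>c. (LBINT x. (c * u x) * (c * u x)) = 1"
proof -
  have f: "fast u" using u by (simp add: rE_def)
  have "(LBINT x. u x * u x) \<noteq> 0" using nz integral_nonneg_eq_0_iff_AE[OF fast_prod_integrable[OF f f]] by simp
  moreover have "(LBINT x. u x * u x) \<ge> 0" by simp
  ultimately have "(LBINT x. u x * u x) > 0" by linarith
  then show ?thesis by (intro exI[of _ "1 / sqrt (LBINT x. u x * u x)"]) (simp flip: real_sqrt_mult)
qed

text \<open>A nonzero eigenfunction has a nonzero real or imaginary part, and either part is a real
  solution that can be normalised.\<close>

lemma pos_eigenvalue_rE:
  assumes "E \<in> pos_eigenvalues V"
  shows "\<exists>u. rE E u \<and> (LBINT x. u x * u x) = 1"
proof -
  obtain \<phi> where \<phi>: "E > 0" "eigenfun V E \<phi>" "\<not> (AE x in lborel. \<phi> x = 0)" using assms by (auto simp: pos_eigenvalues_def)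
  have "\<exists>e\<in>Basis. \<not> (AE x in lborel. \<phi> x \<bullet> e = 0)"
  proof (rule ccontr)
    assume "\<not> ?thesis"
    then have "AE x in lborel. \<forall>e\<in>Basis. \<phi> x \<bullet> e = 0" by (intro AE_finite_allI) auto
    then have "AE x in lborel. \<phi> x = 0" by eventually_elim (auto intro: euclidean_eqI)
    then show False using \<phi>(3) by simp
  qed
  then obtain e where "\<not> (AE x in lborel. \<phi> x \<bullet> e = 0)" by blast
  from rE_normalise[OF eigenfun_rE[OF \<phi>(2,1)] this] rE_scale[OF eigenfun_rE[OF \<phi>(2,1)]] show ?thesis by blast
qed

text \<open>Too many eigenvalues in [a,b] would give, with one normalised real eigenfunction for
  each, an orthonormal family larger than \<open>orthonormal_bound\<close> allows; orthogonality
  comes from the eigenvalues being distinct.\<close>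

lemma finite_pos_eigenvalues:
  assumes "0 < a" shows "finite (pos_eigenvalues V \<inter> {a..b})"
proof (rule ccontr)
  let ?S = "pos_eigenvalues V \<inter> {a..b}"
  assume inf: "infinite ?S"
  then have "a \<le> b" by (rule contrapos_np) simp
  from orthonormal_bound[OF assms this] obtain N0 :: nat where N0:
    "\<And>N (E :: nat \<Rightarrow> real) u. (\<forall>n<N. a \<le> E n \<and> E n \<le> b \<and> rE (E n) (u n)) \<Longrightarrow>
      (\<forall>m<N. \<forall>n<N. (LBINT x. u m x * u n x) = (if m = n then 1 else 0)) \<Longrightarrow> N \<le> N0" by blast
  obtain B where B: "finite B" "card B = Suc N0" "B \<subseteq> ?S" using infinite_arbitrarily_large[OF inf] by blast
  obtain E where E: "bij_betw E {0..<Suc N0} B" using ex_bij_betw_nat_finite[OF B(1)] B(2) by auto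
  have ES: "E n \<in> ?S" if "n < Suc N0" for n
  proof -
    have "E n \<in> B" using bij_betwE[OF E] that by auto
    then show ?thesis using B(3) by blast
  qed
  have "\<forall>n. \<exists>u. n < Suc N0 \<longrightarrow> rE (E n) u \<and> (LBINT x. u x * u x) = 1"
    using ES pos_eigenvalue_rE by blast
  from choice[OF this] obtain u where u: "\<And>n. n < Suc N0 \<Longrightarrow> rE (E n) (u n)" "\<And>n. n < Suc N0 \<Longrightarrow> (LBINT x. u n x * u n x) = 1" by blast
  have "Suc N0 \<le> N0"
  proof (rule N0)
    show "\<forall>n<Suc N0. a \<le> E n \<and> E n \<le> b \<and> rE (E n) (u n)" using ES u(1) by simp
    show "\<forall>m<Suc N0. \<forall>n<Suc N0. (LBINT x. u m x * u n x) = (if m = n then 1 else 0)"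
    proof (intro allI impI)
      fix m n assume mn: "m < Suc N0" "n < Suc N0"
      have "E m \<noteq> E n" if "m \<noteq> n" using E mn that by (auto simp: bij_betw_def inj_on_def)
      moreover have "E m > 0" "E n > 0" using ES[OF mn(1)] ES[OF mn(2)] by (auto simp: pos_eigenvalues_def)
      ultimately show "(LBINT x. u m x * u n x) = (if m = n then 1 else 0)"
        using rE_orthogonal[OF u(1)[OF mn(1)] u(1)[OF mn(2)]] u(2)[OF mn(1)] u(2)[OF mn(2)] by simp
    qed
  qed
  then show False by simp
qed

text \<open>An orthonormal family of maximal size exists because sizes are bounded. A solution not
  in its span almost everywhere would leave a nonzero remainder after projection, whose
  normalisation extends the family.\<close>

lemma rE_finite_dimensional:
  assumes E: "E > 0"
  shows "\<exists>(N::nat) u. \<forall>v. rE E v \<longrightarrow> (\<exists>c. AE x in lborel. v x = (\<Sum>n<N. c n * u n x))"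
proof -
  define P where "P = (\<lambda>N::nat. \<exists>u. (\<forall>n<N. rE E (u n)) \<and> (\<forall>m<N. \<forall>n<N. (LBINT x. u m x * u n x) = (if m = n then 1 else 0)))"
  obtain N0 where N0': "\<forall>N (E' :: nat \<Rightarrow> real) u. (\<forall>n<N. E \<le> E' n \<and> E' n \<le> E \<and> rE (E' n) (u n)) \<longrightarrow>
    (\<forall>m<N. \<forall>n<N. (LBINT x. u m x * u n x) = (if m = n then 1 else 0)) \<longrightarrow> N \<le> N0"
    using exE[OF orthonormal_bound[OF E order_refl]] .
  have N0: "N \<le> N0" if PN: "P N" for N
  proof -
    obtain u where u: "\<forall>n<N. rE E (u n)" "\<forall>m<N. \<forall>n<N. (LBINT x. u m x * u n x) = (if m = n then 1 else 0)"
      using PN unfolding P_def by (elim exE conjE)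
    show ?thesis by (rule mp[OF mp[OF N0'[THEN spec, THEN spec[of _ "\<lambda>_. E"], THEN spec[of _ u]]]]) (use u in simp_all)
  qed
  have P0: "P 0" by (simp add: P_def)
  define N where "N = (GREATEST N. P N)"
  have PN: "P N" unfolding N_def by (rule GreatestI_nat[of P, OF P0 N0])
  obtain u where "\<forall>n<N. rE E (u n)" "\<forall>m<N. \<forall>n<N. (LBINT x. u m x * u n x) = (if m = n then 1 else 0)"
    using PN unfolding P_def by (elim exE conjE)
  then have u: "\<And>n. n < N \<Longrightarrow> rE E (u n)"
    "\<And>m n. m < N \<Longrightarrow> n < N \<Longrightarrow> (LBINT x. u m x * u n x) = (if m = n then 1 else 0)" by simp_all
  have notP: "\<not> P (Suc N)" using Greatest_le_nat[of P "Suc N" N0] N0 by (auto simp: N_def)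
  have "AE x in lborel. v x = (\<Sum>n<N. (LBINT x. v x * u n x) * u n x)" if v: "rE E v" for v
  proof (rule ccontr)
    define c where "c = (\<lambda>n. \<integral>x. v x * u n x \<partial>lborel)"
    define w where "w = (\<lambda>x. v x - (\<Sum>n<N. c n * u n x))"
    assume "\<not> (AE x in lborel. v x = (\<Sum>n<N. (LBINT x. v x * u n x) * u n x))"
    then have nz: "\<not> (AE x in lborel. w x = 0)" by (simp add: w_def c_def)
    have w: "rE E w" unfolding w_def by (rule rE_diff_sum[OF v u(1)])
    have f: "rE E f \<Longrightarrow> rE E g \<Longrightarrow> integrable lborel (\<lambda>x. f x * g x)" for f g by (auto simp: rE_def intro: fast_prod_integrable)
    have orth: "(LBINT x. w x * u m x) = 0" if m: "m < N" for m
    proof -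
      have "(LBINT x. w x * u m x) = (LBINT x. v x * u m x - (\<Sum>n<N. c n * (u n x * u m x)))"
        by (simp add: w_def left_diff_distrib sum_distrib_right mult.assoc)
      also have "\<dots> = (LBINT x. v x * u m x) - (LBINT x. (\<Sum>n<N. c n * (u n x * u m x)))"
        using f[OF v u(1)[OF m]] f[OF u(1) u(1)[OF m]]
        by (intro Bochner_Integration.integral_diff Bochner_Integration.integrable_sum integrable_mult_right) auto
      also have "(LBINT x. (\<Sum>n<N. c n * (u n x * u m x))) = (\<Sum>n<N. c n * (LBINT x. u n x * u m x))"
        using f[OF u(1) u(1)[OF m]] by (subst Bochner_Integration.integral_sum) auto
      also have "(\<Sum>n<N. c n * (LBINT x. u n x * u m x)) = (\<Sum>n<N. if n = m then c n else 0)"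
        using u(2) m by (intro sum.cong) auto
      finally show ?thesis using m by (simp add: c_def)
    qed
    obtain d where d: "(LBINT x. (d * w x) * (d * w x)) = 1" using rE_normalise[OF w nz] by blast
    \<comment> \<open>The family of maximal size extended at index N by the normalised remainder,
      which contradicts the choice of N.\<close>
    define u' where "u' = (\<lambda>n x. if n < N then u n x else d * w x)"
    have orth': "(LBINT x. d * w x * u m x) = 0" "(LBINT x. u m x * (d * w x)) = 0" if "m < N" for m
      using orth[OF that] by (simp_all add: mult.assoc mult.left_commute mult.commute[of "u m _"])
    have "P (Suc N)" unfolding P_def
    proof (intro exI[of _ u'] conjI allI impI)
      show "rE E (u' n)" if "n < Suc N" for n using u(1) rE_scale[OF w] by (cases "n < N") (simp_all add: u'_def)
      show "(LBINT x. u' m x * u' n x) = (if m = n then 1 else 0)" if "m < Suc N" "n < Suc N" for m n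
        using that u(2) orth' d by (cases "m < N"; cases "n < N") (auto simp: u'_def less_Suc_eq)
    qed
    with notP show False by simp
  qed
  then have "\<forall>v. rE E v \<longrightarrow> (\<exists>c. AE x in lborel. v x = (\<Sum>n<N. c n * u n x))" using exI by fast
  then show ?thesis by (intro exI[of _ N] exI[of _ u])
qed

text \<open>A real spanning family also spans over the complex numbers: the coefficients of the real
  and imaginary parts combine into complex ones.\<close>

lemma eigenspace_finite_dimensional:
  assumes E: "E > 0"
  shows "\<exists>(n::nat) (e::nat \<Rightarrow> 'a \<Rightarrow> complex). \<forall>\<phi>. eigenfun V E \<phi> \<longrightarrow> (\<exists>c. AE x in lborel. \<phi> x = (\<Sum>k<n. c k * e k x))"
proof -
  obtain N :: nat and u where u: "\<And>v. rE E v \<Longrightarrow> \<exists>c. AE x in lborel. v x = (\<Sum>n<N. c n * u n x)"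
    using rE_finite_dimensional[OF E] by blast
  have "\<exists>c. AE x in lborel. \<phi> x = (\<Sum>k<N. c k * complex_of_real (u k x))" if \<phi>: "eigenfun V E \<phi>" for \<phi>
  proof -
    obtain c1 where c1: "AE x in lborel. \<phi> x \<bullet> 1 = (\<Sum>n<N. c1 n * u n x)" using u[OF eigenfun_rE[OF \<phi> E]] by blast
    obtain c2 where c2: "AE x in lborel. \<phi> x \<bullet> \<i> = (\<Sum>n<N. c2 n * u n x)" using u[OF eigenfun_rE[OF \<phi> E]] by blast
    have "AE x in lborel. \<phi> x = (\<Sum>k<N. Complex (c1 k) (c2 k) * complex_of_real (u k x))"
      using c1 c2 by eventually_elim (simp add: complex_eq_iff)
    then show ?thesis by (intro exI[of _ "\<lambda>k. Complex (c1 k) (c2 k)"])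
  qed
  then show ?thesis by (intro exI[of _ N] exI[of _ "\<lambda>k x. complex_of_real (u k x)"]) simp
qed

end

text \<open>The norm inequality is squared and stated for extended values, so it presupposes no
  finiteness of either side. Discreteness in the open half-line is finiteness on every interval
  [a,b] with a > 0. Finite multiplicity is expressed by finitely many functions spanning the
  eigenspace up to null sets; the spanning functions themselves are not asked to be
  eigenfunctions.\<close>

theorem mainTheorem1:
  fixes V :: "'a::euclidean_space \<Rightarrow> real"
  assumes "condition1 V"
  shows "(\<forall>I \<alpha>0. compact I \<and> I \<subseteq> {0<..} \<longrightarrow>
            (\<exists>C>0. \<forall>E \<phi>. E \<in> I \<and> gen_eigenfun V E \<phi> \<and> Bstar0 \<phi> \<longrightarrow>
               l2sq (\<lambda>x. complex_of_real (rr x powr \<alpha>0) * \<phi> x)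
                 \<le> ennreal (C\<^sup>2) * l2sq (\<lambda>x. complex_of_real (rr x powr (-3/4)) * \<phi> x)))
       \<and> (\<forall>E \<phi>. 0 < E \<and> gen_eigenfun V E \<phi> \<and> Bstar0 \<phi> \<longrightarrow>
            L2 \<phi> \<and> eigenfun V E \<phi> \<and> (\<forall>s::real. H2 (\<lambda>x. complex_of_real (rr x powr s) * \<phi> x)))
       \<and> (\<forall>a b. 0 < a \<longrightarrow> finite (pos_eigenvalues V \<inter> {a..b}))
       \<and> (\<forall>E\<in>pos_eigenvalues V. \<exists>(n::nat) (e::nat \<Rightarrow> 'a \<Rightarrow> complex).
            (\<forall>\<phi>. eigenfun V E \<phi> \<longrightarrow>
               (\<exists>c::nat \<Rightarrow> complex. AE x in lborel. \<phi> x = (\<Sum>k<n. c k * e k x))))"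
proof -
  obtain Vsr Vlr G w0 Q where "potential V Vsr Vlr G w0 Q" using condition1_imp_potential[OF assms] by blast
  then interpret potential V Vsr Vlr G w0 Q .
  have H: "H2 (\<lambda>x. complex_of_real (rr x powr s) * \<phi> x)" if "0 < E" "gen_eigenfun V E \<phi>" "Bstar0 \<phi>" for E \<phi> s
    by (rule H2_of_gen_eigenfun(1)[OF that(2,1) Bstar0_imp_decays[OF that(2,3)]])
  \<comment> \<open>The weight exponent s = 0 gives the unweighted statement, since r is never 0 and
    its zeroth power is 1.\<close>
  have H0: "H2 \<phi>" if "0 < E" "gen_eigenfun V E \<phi>" "Bstar0 \<phi>" for E \<phi>
    using H[OF that, of 0] by simp
  show ?thesis
  proof (intro conjI)
    show "\<forall>E \<phi>. 0 < E \<and> gen_eigenfun V E \<phi> \<and> Bstar0 \<phi> \<longrightarrow>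
      L2 \<phi> \<and> eigenfun V E \<phi> \<and> (\<forall>s::real. H2 (\<lambda>x. complex_of_real (rr x powr s) * \<phi> x))"
    proof (intro allI impI, elim conjE, intro conjI allI)
      fix E \<phi> s assume g: "0 < E" "gen_eigenfun V E \<phi>" "Bstar0 \<phi>"
      show "L2 \<phi>" using H0[OF g] unfolding H2_def by (rule conjunct1)
      show "eigenfun V E \<phi>" using H0[OF g] g(2) unfolding eigenfun_def by (rule conjI)
      show "H2 (\<lambda>x. complex_of_real (rr x powr s) * \<phi> x)" by (rule H[OF g])
    qed
    show "\<forall>E\<in>pos_eigenvalues V. \<exists>(n::nat) (e::nat \<Rightarrow> 'a \<Rightarrow> complex).
      (\<forall>\<phi>. eigenfun V E \<phi> \<longrightarrow> (\<exists>c::nat \<Rightarrow> complex. AE x in lborel. \<phi> x = (\<Sum>k<n. c k * e k x)))"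
      using eigenspace_finite_dimensional by (simp add: pos_eigenvalues_def)
  qed (use weighted_l2sq_bound finite_pos_eigenvalues in simp_all)
qed

end
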